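(* Let $d\geq1$ and work over $K=\mathbb{C}[u^{\pm1},v^{\pm1}]$. For each socle $\overline{\mu}\in\operatorname{Soc}_d$ and each $a\in\{1,\dots,d\}$ with $\overline{\mu}_a\neq0$, choose a Markov trace $\{\tau^{\overline{\mu},a}_n\}_{n\geq1}$ on $\{\widehat{H}_n\}_{n\geq1}$; by convention, all maps $\tau_0^{\overline{\mu},a}$ are the identity of $\widehat{H}_0=K$. Then the maps $$\Bigl(\sum_{\mu}(\tau^{\overline{\mu},1}_{\mu_1}\otimes\dots\otimes\tau^{\overline{\mu},d}_{\mu_d})\circ\operatorname{Tr}_{\operatorname{Mat}_{m_{\mu}}}\Bigr)\circ\Psi_{d,n}\ :\ \widehat{Y}_{d,n}\to K\ ,\qquad n\geq1,$$ where the sum is over the $d$-compositions $\mu$ of $n$, $\overline{\mu}$ is the socle of $\mu$, and the summand indexed by $\mu$ acts on the component $\operatorname{Mat}_{m_{\mu}}(\widehat{H}^{\mu})$, form a Markov trace on $\{\widehat{Y}_{d,n}\}_{n\geq1}$.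
   Context: Let $u,v$ be indeterminates, $K=\mathbb{C}[u^{\pm1},v^{\pm1}]$, $s_i=(i,i+1)\in\mathfrak{S}_n$, $\ell$ the length function. Affine Yokonuma--Hecke algebra: $\widehat{Y}_{d,n}$ is the unital associative $K$-algebra generated by $g_1,\dots,g_{n-1},X_1^{\pm1},t_1,\dots,t_n$ with relations: $g_ig_j=g_jg_i$ for $|i-j|>1$; $g_ig_{i+1}g_i=g_{i+1}g_ig_{i+1}$; $X_1g_1X_1g_1=g_1X_1g_1X_1$; $X_1g_i=g_iX_1$ for $i\geq2$; $t_it_j=t_jt_i$; $g_it_j=t_{s_i(j)}g_i$; $t_j^d=1$; $X_1t_j=t_jX_1$; $g_i^2=u^2+v\,e_ig_i$, where $e_i=\frac1d\sum_{s=1}^{d}t_i^st_{i+1}^{-s}$. For $w$ with reduced expression $s_{i_1}\cdots s_{i_r}$, $g_w=g_{i_1}\cdots g_{i_r}$; $X_{i+1}=u^{-2}g_iX_ig_i$ (the $X_i$ commute with each other and with the $t_j$); $X^{\lambda}=X_1^{\lambda_1}\cdots X_n^{\lambda_n}$. $\widehat{Y}_{d,n}$ is regarded as a subalgebra of $\widehat{Y}_{d,n+1}$ via the generators with the same names. The affine Hecke algebra is $\widehat{H}_n=\widehat{Y}_{1,n}$ ($t_j=1$, $e_i=1$), with generators $\overline{g}_i,\overline{X}_1^{\pm1}$ and elements $\overline{X}_i,\overline{g}_w,\overline{X}^{\lambda}$ defined likewise; $\widehat{H}_0=K$. Markov traces: a Markov trace on $\{\widehat{Y}_{d,n}\}_{n\geq1}$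 is a family of $K$-linear maps $\rho_{d,n}:\widehat{Y}_{d,n}\to K$ such that $\rho_{d,n}(xy)=\rho_{d,n}(yx)$ for all $n\geq1$, $x,y\in\widehat{Y}_{d,n}$, and $\rho_{d,n+1}(xg_n)=\rho_{d,n+1}(xg_n^{-1})=\rho_{d,n}(x)$ for all $n\geq1$, $x\in\widehat{Y}_{d,n}$. A Markov trace on $\{\widehat{H}_n\}_{n\geq1}$ is the same notion with $d=1$ (with $\overline{g}_n$ in place of $g_n$). Compositions: a $d$-composition of $n$ is $\mu\in\mathbb{Z}_{\geq0}^d$ with $\sum_a\mu_a=n$. Its socle $\overline{\mu}$ is defined by $\overline{\mu}_a=1$ if $\mu_a\geq1$ and $\overline{\mu}_a=0$ if $\mu_a=0$. $\operatorname{Soc}_d$ is the set of socles of $d$-compositions (non-zero vectors in $\{0,1\}^d$). $\mathfrak{S}^{\mu}\subset\mathfrak{S}_n$ is the Young subgroup permuting the consecutive blocks of sizes $\mu_1,\dots,\mu_d$; $m_{\mu}=\frac{n!}{\mu_1!\cdots\mu_d!}$; $\widehat{H}^{\mu}=\widehat{H}_{\mu_1}\otimes\dots\otimes\widehat{H}_{\mu_d}$, identified with the subalgebra of $\widehat{H}_n$ generated by $\overline{X}_1^{\pm1},\dots,\overline{X}_n^{\pm1}$ and the $\overline{g}_i$ with $s_i\in\mathfrak{S}^{\mu}$. Isomorphism: let $\xi_1,\dots,\xi_d$ be the $d$-th roots of unity, $\mathcal{T}_{d,n}=\langle t_1,\dots,t_n\rangle$ (the group algebra of $(\mathbb{Z}/d\mathbb{Z})^n$),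 $\operatorname{Irr}(\mathcal{T}_{d,n})$ its set of characters ($\chi(t_j)\in\{\xi_1,\dots,\xi_d\}$), $E_{\chi}$ the primitive idempotent of $\chi$, and $\operatorname{Comp}(\chi)=\mu$ with $\mu_a=\#\{j:\chi(t_j)=\xi_a\}$. $\mathfrak{S}_n$ acts by $w(\chi)(t_i)=\chi(t_{w^{-1}(i)})$. $\chi_0^{\mu}$ takes the value $\xi_1$ on the first $\mu_1$ of the $t_j$, $\xi_2$ on the next $\mu_2$, etc.; $\pi_{\chi}$ is the element of minimal length with $\pi_{\chi}(\chi_0^{\mu})=\chi$, where $\mu=\operatorname{Comp}(\chi)$. Matrices in $\operatorname{Mat}_{m_{\mu}}(\widehat{H}^{\mu})$ have rows and columns indexed by the characters $\chi$ with $\operatorname{Comp}(\chi)=\mu$; $\boldsymbol{1}_{\chi,\chi'}$ are the matrix units. $\Psi_{d,n}:\widehat{Y}_{d,n}\to\bigoplus_{\mu}\operatorname{Mat}_{m_{\mu}}(\widehat{H}^{\mu})$ is the algebra isomorphism given on the basis elements $E_{\chi}X^{\lambda}g_{w^{-1}}$ by $$E_{\chi}X^{\lambda}g_{w^{-1}}\mapsto u^{\ell(w^{-1})-\ell(\pi_{\chi}^{-1}w^{-1}\pi_{w(\chi)})}\boldsymbol{1}_{\chi,w(\chi)}\Bigl(\prod_j\overline{X}_{\pi_{\chi}^{-1}(j)}^{\lambda_j}\Bigr)\overline{g}_{\pi_{\chi}^{-1}w^{-1}\pi_{w(\chi)}}.$$ $\operatorname{Tr}_{\operatorname{Mat}_{m_{\mu}}}$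 is the usual trace (sum of the diagonal entries), with values in $\widehat{H}^{\mu}$. *)

theory Defs
  imports
    "HOL-Algebra.Algebra"
    "HOL-Library.Poly_Mapping"
    "HOL-Library.Product_Plus"
    "HOL-Combinatorics.Permutations"
begin

section \<open>The ground ring\<close>

text \<open>Laurent polynomials in two variables over the complex numbers, as the monoid algebra of
  \<open>\<int> \<times> \<int>\<close>: the monomial \<open>u\<^sup>i v\<^sup>j\<close> is \<open>single (i, j) 1\<close>.\<close>

type_synonym laurent = "(int \<times> int) \<Rightarrow>\<^sub>0 complex"

definition K_const :: "complex \<Rightarrow> laurent" where
  "K_const c = Poly_Mapping.single 0 c"

definition u_pow :: "int \<Rightarrow> laurent" where
  "u_pow k = Poly_Mapping.single (k, 0) 1"

definition v_var :: laurent where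
  "v_var = Poly_Mapping.single (0, 1) 1"

section \<open>Algebras over the ground ring\<close>

text \<open>An associative algebra is carried by the record \<^typ>\<open>('k, 'a) module\<close>, that is, a ring
  together with a scalar multiplication.  (The library locale \<^locale>\<open>algebra\<close> is about
  commutative algebras only.)\<close>

type_synonym 'a K_algebra = "(laurent, 'a) module"

definition K_linear :: "'a K_algebra \<Rightarrow> ('a \<Rightarrow> laurent) \<Rightarrow> bool" where
  "K_linear A f \<longleftrightarrow>
     (\<forall>x\<in>carrier A. \<forall>y\<in>carrier A. f (x \<oplus>\<^bsub>A\<^esub> y) = f x + f y) \<and>
     (\<forall>c. \<forall>x\<in>carrier A. f (c \<odot>\<^bsub>A\<^esub> x) = c * f x)"

definition K_algebra_hom :: "'a K_algebra \<Rightarrow> 'b K_algebra \<Rightarrow> ('a \<Rightarrow> 'b) set" where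
  "K_algebra_hom A B =
     {f \<in> ring_hom A B. \<forall>c. \<forall>x\<in>carrier A. f (c \<odot>\<^bsub>A\<^esub> x) = c \<odot>\<^bsub>B\<^esub> f x}"

definition mprod :: "('a, 'b) monoid_scheme \<Rightarrow> 'a list \<Rightarrow> 'a" where
  "mprod M xs = foldr (monoid.mult M) xs \<one>\<^bsub>M\<^esub>"

definition monoid_algebra :: "('m, 'b) monoid_scheme \<Rightarrow> ('m \<Rightarrow>\<^sub>0 laurent) K_algebra" where
  "monoid_algebra M =
     \<lparr>carrier = {p. Poly_Mapping.keys p \<subseteq> carrier M},
      monoid.mult = (\<lambda>p q. \<Sum>x\<in>Poly_Mapping.keys p. \<Sum>y\<in>Poly_Mapping.keys q.
        Poly_Mapping.single (x \<otimes>\<^bsub>M\<^esub> y) (Poly_Mapping.lookup p x * Poly_Mapping.lookup q y)),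
      one = Poly_Mapping.single \<one>\<^bsub>M\<^esub> 1,
      ring.zero = 0,
      add = (+),
      smult = (\<lambda>c p. Poly_Mapping.map ((*) c) p)\<rparr>"

text \<open>The quotient of an algebra by the two-sided ideal generated by a set \<open>R\<close>.\<close>

definition algebra_class :: "'a K_algebra \<Rightarrow> 'a set \<Rightarrow> 'a \<Rightarrow> 'a set" where
  "algebra_class A R x = Idl\<^bsub>A\<^esub> R +>\<^bsub>A\<^esub> x"

definition algebra_quot :: "'a K_algebra \<Rightarrow> 'a set \<Rightarrow> 'a set K_algebra" where
  "algebra_quot A R =
     (let Q = A Quot (Idl\<^bsub>A\<^esub> R) in
      \<lparr>carrier = carrier Q, monoid.mult = monoid.mult Q, one = monoid.one Q,
       ring.zero = ring.zero Q, add = ring.add Q,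
       smult = (\<lambda>c C. \<Union>x\<in>C. algebra_class A R (c \<odot>\<^bsub>A\<^esub> x))\<rparr>)"

definition free_monoid :: "'g set \<Rightarrow> 'g list monoid" where
  "free_monoid S = \<lparr>carrier = lists S, monoid.mult = (@), one = []\<rparr>"

subsection \<open>Tensor products\<close>

text \<open>The tensor product of a family of algebras over a non-empty finite index set, as the free
  module on the families of elements modulo the multilinearity relations. The span of these
  relations is stable under componentwise multiplication by families, so it coincides with the
  two-sided ideal they generate in the monoid algebra of the product monoid.\<close>

definition multilinear_rels ::
  "'i set \<Rightarrow> ('i \<Rightarrow> 'a K_algebra) \<Rightarrow> (('i \<Rightarrow> 'a) \<Rightarrow>\<^sub>0 laurent) set" where
  "multilinear_rels I A =
     {Poly_Mapping.single (h(a := x \<oplus>\<^bsub>A a\<^esub> y)) 1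
        - Poly_Mapping.single (h(a := x)) 1 - Poly_Mapping.single (h(a := y)) 1 | h a x y.
        h \<in> (\<Pi>\<^sub>E i\<in>I. carrier (A i)) \<and> a \<in> I \<and> x \<in> carrier (A a) \<and> y \<in> carrier (A a)} \<union>
     {Poly_Mapping.single (h(a := c \<odot>\<^bsub>A a\<^esub> x)) 1 - Poly_Mapping.single (h(a := x)) c | h a c x.
        h \<in> (\<Pi>\<^sub>E i\<in>I. carrier (A i)) \<and> a \<in> I \<and> x \<in> carrier (A a)}"

definition tensor :: "'i set \<Rightarrow> ('i \<Rightarrow> 'a K_algebra) \<Rightarrow> (('i \<Rightarrow> 'a) \<Rightarrow>\<^sub>0 laurent) set K_algebra" where
  "tensor I A = algebra_quot (monoid_algebra (product_group I A)) (multilinear_rels I A)"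

definition pure_tensor ::
  "'i set \<Rightarrow> ('i \<Rightarrow> 'a K_algebra) \<Rightarrow> ('i \<Rightarrow> 'a) \<Rightarrow> (('i \<Rightarrow> 'a) \<Rightarrow>\<^sub>0 laurent) set" where
  "pure_tensor I A h =
     algebra_class (monoid_algebra (product_group I A)) (multilinear_rels I A)
       (Poly_Mapping.single (restrict h I) 1)"

text \<open>The linear form \<open>\<Otimes>\<^sub>a f\<^sub>a\<close>, sending \<open>\<Sum> c\<^sub>h (\<otimes>\<^sub>a h\<^sub>a)\<close> to \<open>\<Sum> c\<^sub>h (\<Prod>\<^sub>a f\<^sub>a(h\<^sub>a))\<close>; for linear
  \<open>f\<^sub>a\<close> the value does not depend on the chosen representative.\<close>

definition tensor_form ::
  "'i set \<Rightarrow> ('i \<Rightarrow> 'a \<Rightarrow> laurent) \<Rightarrow> (('i \<Rightarrow> 'a) \<Rightarrow>\<^sub>0 laurent) set \<Rightarrow> laurent" where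
  "tensor_form I f C =
     (let p = (SOME p. p \<in> C) in
      \<Sum>h\<in>Poly_Mapping.keys p. Poly_Mapping.lookup p h * (\<Prod>a\<in>I. f a (h a)))"

subsection \<open>Matrix algebras and direct sums\<close>

definition mat_algebra :: "'i set \<Rightarrow> 'a K_algebra \<Rightarrow> ('i \<Rightarrow> 'i \<Rightarrow> 'a) K_algebra" where
  "mat_algebra I A =
     \<lparr>carrier = (\<Pi>\<^sub>E i\<in>I. \<Pi>\<^sub>E j\<in>I. carrier A),
      monoid.mult = (\<lambda>M N. \<lambda>i\<in>I. \<lambda>j\<in>I. \<Oplus>\<^bsub>A\<^esub>k\<in>I. M i k \<otimes>\<^bsub>A\<^esub> N k j),
      one = (\<lambda>i\<in>I. \<lambda>j\<in>I. if i = j then \<one>\<^bsub>A\<^esub> else \<zero>\<^bsub>A\<^esub>),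
      ring.zero = (\<lambda>i\<in>I. \<lambda>j\<in>I. \<zero>\<^bsub>A\<^esub>),
      add = (\<lambda>M N. \<lambda>i\<in>I. \<lambda>j\<in>I. M i j \<oplus>\<^bsub>A\<^esub> N i j),
      smult = (\<lambda>c M. \<lambda>i\<in>I. \<lambda>j\<in>I. c \<odot>\<^bsub>A\<^esub> M i j)\<rparr>"

definition mat_trace :: "'i set \<Rightarrow> 'a K_algebra \<Rightarrow> ('i \<Rightarrow> 'i \<Rightarrow> 'a) \<Rightarrow> 'a" where
  "mat_trace I A M = (\<Oplus>\<^bsub>A\<^esub>i\<in>I. M i i)"

definition direct_sum :: "'j set \<Rightarrow> ('j \<Rightarrow> 'a K_algebra) \<Rightarrow> ('j \<Rightarrow> 'a) K_algebra" where
  "direct_sum J B =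
     \<lparr>carrier = (\<Pi>\<^sub>E j\<in>J. carrier (B j)),
      monoid.mult = (\<lambda>x y. \<lambda>j\<in>J. x j \<otimes>\<^bsub>B j\<^esub> y j),
      one = (\<lambda>j\<in>J. \<one>\<^bsub>B j\<^esub>),
      ring.zero = (\<lambda>j\<in>J. \<zero>\<^bsub>B j\<^esub>),
      add = (\<lambda>x y. \<lambda>j\<in>J. x j \<oplus>\<^bsub>B j\<^esub> y j),
      smult = (\<lambda>c x. \<lambda>j\<in>J. c \<odot>\<^bsub>B j\<^esub> x j)\<rparr>"

section \<open>The symmetric group\<close>

text \<open>Elements of the symmetric group are the functions \<open>w\<close> with \<open>w permutes {1..n}\<close>, and the
  product is composition.\<close>

definition word_perm :: "nat list \<Rightarrow> nat \<Rightarrow> nat" where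
  "word_perm is = foldr (\<lambda>i w. transpose i (Suc i) \<circ> w) is id"

definition perm_length :: "nat \<Rightarrow> (nat \<Rightarrow> nat) \<Rightarrow> nat" where
  "perm_length n w = (LEAST r. \<exists>is. set is \<subseteq> {1..<n} \<and> word_perm is = w \<and> length is = r)"

definition reduced_word :: "nat \<Rightarrow> (nat \<Rightarrow> nat) \<Rightarrow> nat list" where
  "reduced_word n w =
     (SOME is. set is \<subseteq> {1..<n} \<and> word_perm is = w \<and> length is = perm_length n w)"

section \<open>The affine Yokonuma--Hecke algebras\<close>

datatype gen = G nat | X1 | X1inv | T nat

type_synonym yh = "(gen list \<Rightarrow>\<^sub>0 laurent) set"

text \<open>For \<open>n = 0\<close> there are neither generators nor relations, so that the algebra presented below
  is the ground ring, which is the convention for \<open>n = 0\<close>.\<close>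

definition yh_gens :: "nat \<Rightarrow> gen set" where
  "yh_gens n = (if n = 0 then {} else G ` {1..<n} \<union> {X1, X1inv} \<union> T ` {1..n})"

abbreviation mon :: "gen list \<Rightarrow> gen list \<Rightarrow>\<^sub>0 laurent" where
  "mon w \<equiv> Poly_Mapping.single w 1"

text \<open>Each relation \<open>p = q\<close> is given by the element \<open>p - q\<close> of the free algebra. In the quadratic
  relation \<open>g\<^sub>i\<^sup>2 = u\<^sup>2 + v e\<^sub>i g\<^sub>i\<close> with \<open>e\<^sub>i = d\<^sup>-\<^sup>1 \<Sum>\<^sub>s t\<^sub>i\<^sup>s t\<^sub>i\<^sub>+\<^sub>1\<^sup>-\<^sup>s\<close>, the power \<open>t\<^sub>i\<^sub>+\<^sub>1\<^sup>-\<^sup>s\<close> is written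
  \<open>t\<^sub>i\<^sub>+\<^sub>1\<^sup>d\<^sup>-\<^sup>s\<close>, which is the same by \<open>t\<^sub>i\<^sub>+\<^sub>1\<^sup>d = 1\<close>.\<close>

definition yh_rels :: "nat \<Rightarrow> nat \<Rightarrow> (gen list \<Rightarrow>\<^sub>0 laurent) set" where
  "yh_rels d n =
     (if n \<ge> 1 then {mon [X1, X1inv] - mon [], mon [X1inv, X1] - mon []} else {}) \<union>
     {mon [G i, G j] - mon [G j, G i] | i j.
        i \<in> {1..<n} \<and> j \<in> {1..<n} \<and> \<bar>int i - int j\<bar> > 1} \<union>
     {mon [G i, G (Suc i), G i] - mon [G (Suc i), G i, G (Suc i)] | i.
        i \<in> {1..<n} \<and> Suc i \<in> {1..<n}} \<union>
     (if n \<ge> 2 then {mon [X1, G 1, X1, G 1] - mon [G 1, X1, G 1, X1]} else {}) \<union>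
     {mon [X1, G i] - mon [G i, X1] | i. i \<in> {2..<n}} \<union>
     {mon [T i, T j] - mon [T j, T i] | i j. i \<in> {1..n} \<and> j \<in> {1..n}} \<union>
     {mon [G i, T j] - mon [T (transpose i (Suc i) j), G i] | i j. i \<in> {1..<n} \<and> j \<in> {1..n}} \<union>
     {mon (replicate d (T j)) - mon [] | j. j \<in> {1..n}} \<union>
     {mon [X1, T j] - mon [T j, X1] | j. j \<in> {1..n}} \<union>
     {mon [G i, G i] - (Poly_Mapping.single [] (u_pow 2) +
        (\<Sum>s\<in>{1..d}. Poly_Mapping.single
          (replicate s (T i) @ replicate (d - s) (T (Suc i)) @ [G i]) (K_const (1 / of_nat d) * v_var))) | i.
        i \<in> {1..<n}}"

definition YH :: "nat \<Rightarrow> nat \<Rightarrow> yh K_algebra" where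
  "YH d n = algebra_quot (monoid_algebra (free_monoid (yh_gens n))) (yh_rels d n)"

definition yh_gen :: "nat \<Rightarrow> nat \<Rightarrow> gen \<Rightarrow> yh" where
  "yh_gen d n x = algebra_class (monoid_algebra (free_monoid (yh_gens n))) (yh_rels d n) (mon [x])"

definition yh_g :: "nat \<Rightarrow> nat \<Rightarrow> nat \<Rightarrow> yh" where
  "yh_g d n i = yh_gen d n (G i)"

definition yh_t :: "nat \<Rightarrow> nat \<Rightarrow> nat \<Rightarrow> yh" where
  "yh_t d n j = yh_gen d n (T j)"

text \<open>Only used for indices \<open>\<ge> 1\<close>; the value at \<open>0\<close> is irrelevant.\<close>

fun yh_X :: "nat \<Rightarrow> nat \<Rightarrow> nat \<Rightarrow> yh" where
  "yh_X d n 0 = \<one>\<^bsub>YH d n\<^esub>"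
| "yh_X d n (Suc 0) = yh_gen d n X1"
| "yh_X d n (Suc (Suc i)) =
     u_pow (-2) \<odot>\<^bsub>YH d n\<^esub> (yh_g d n (Suc i) \<otimes>\<^bsub>YH d n\<^esub> yh_X d n (Suc i) \<otimes>\<^bsub>YH d n\<^esub> yh_g d n (Suc i))"

definition yh_gw :: "nat \<Rightarrow> nat \<Rightarrow> (nat \<Rightarrow> nat) \<Rightarrow> yh" where
  "yh_gw d n w = mprod (YH d n) (map (yh_g d n) (reduced_word n w))"

definition yh_Xpow :: "nat \<Rightarrow> nat \<Rightarrow> (nat \<Rightarrow> int) \<Rightarrow> yh" where
  "yh_Xpow d n lam = mprod (YH d n) (map (\<lambda>j. yh_X d n j [^]\<^bsub>YH d n\<^esub> lam j) [1..<Suc n])"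

text \<open>The map from the algebra for \<open>n\<close> to the one for \<open>n + 1\<close> which preserves the names of the
  generators: a class modulo the smaller ideal lies in a single class modulo the larger one.\<close>

definition yh_incl :: "nat \<Rightarrow> nat \<Rightarrow> yh \<Rightarrow> yh" where
  "yh_incl d n C = (\<Union>p\<in>C.
     algebra_class (monoid_algebra (free_monoid (yh_gens (Suc n)))) (yh_rels d (Suc n)) p)"

definition markov_trace :: "nat \<Rightarrow> (nat \<Rightarrow> yh \<Rightarrow> laurent) \<Rightarrow> bool" where
  "markov_trace d \<rho> \<longleftrightarrow>
     (\<forall>n\<ge>1. K_linear (YH d n) (\<rho> n)) \<and>
     (\<forall>n\<ge>1. \<forall>x\<in>carrier (YH d n). \<forall>y\<in>carrier (YH d n).
        \<rho> n (x \<otimes>\<^bsub>YH d n\<^esub> y) = \<rho> n (y \<otimes>\<^bsub>YH d n\<^esub> x)) \<and>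
     (\<forall>n\<ge>1. \<forall>x\<in>carrier (YH d n).
        \<rho> (Suc n) (yh_incl d n x \<otimes>\<^bsub>YH d (Suc n)\<^esub> yh_g d (Suc n) n) = \<rho> n x \<and>
        \<rho> (Suc n) (yh_incl d n x \<otimes>\<^bsub>YH d (Suc n)\<^esub> inv\<^bsub>YH d (Suc n)\<^esub> yh_g d (Suc n) n) = \<rho> n x)"

section \<open>Compositions and characters\<close>

definition compositions :: "nat \<Rightarrow> nat \<Rightarrow> (nat \<Rightarrow> nat) set" where
  "compositions d n = {\<mu>. (\<forall>a. a \<notin> {1..d} \<longrightarrow> \<mu> a = 0) \<and> (\<Sum>a\<in>{1..d}. \<mu> a) = n}"

definition socle :: "(nat \<Rightarrow> nat) \<Rightarrow> nat \<Rightarrow> nat" where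
  "socle \<mu> = (\<lambda>a. if \<mu> a \<ge> 1 then 1 else 0)"

definition Soc :: "nat \<Rightarrow> (nat \<Rightarrow> nat) set" where
  "Soc d = (\<Union>n\<in>{1..}. socle ` compositions d n)"

definition offset :: "(nat \<Rightarrow> nat) \<Rightarrow> nat \<Rightarrow> nat" where
  "offset \<mu> a = (\<Sum>b\<in>{1..<a}. \<mu> b)"

definition block :: "(nat \<Rightarrow> nat) \<Rightarrow> nat \<Rightarrow> nat" where
  "block \<mu> j = (THE a. a \<ge> 1 \<and> offset \<mu> a < j \<and> j \<le> offset \<mu> a + \<mu> a)"

text \<open>A character \<open>\<chi>\<close> of the group algebra of \<open>(\<int>/d\<int>)\<^sup>n\<close> is represented by the family of its values
  \<open>\<chi>(t\<^sub>1), \<dots>, \<chi>(t\<^sub>n)\<close>. The parameter \<open>\<xi>\<close> is an enumeration \<open>\<xi>\<^sub>1, \<dots>, \<xi>\<^sub>d\<close> of the \<open>d\<close>-th roots of unity.\<close>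

definition chars :: "nat \<Rightarrow> nat \<Rightarrow> (nat \<Rightarrow> complex) set" where
  "chars d n = (\<Pi>\<^sub>E j\<in>{1..n}. {z. z ^ d = 1})"

definition char_act :: "(nat \<Rightarrow> nat) \<Rightarrow> (nat \<Rightarrow> complex) \<Rightarrow> nat \<Rightarrow> complex" where
  "char_act w \<chi> = \<chi> \<circ> inv_into UNIV w"

definition Comp :: "nat \<Rightarrow> (nat \<Rightarrow> complex) \<Rightarrow> nat \<Rightarrow> (nat \<Rightarrow> complex) \<Rightarrow> nat \<Rightarrow> nat" where
  "Comp d \<xi> n \<chi> = (\<lambda>a. if a \<in> {1..d} then card {j \<in> {1..n}. \<chi> j = \<xi> a} else 0)"

definition chars_of :: "nat \<Rightarrow> (nat \<Rightarrow> complex) \<Rightarrow> nat \<Rightarrow> (nat \<Rightarrow> nat) \<Rightarrow> (nat \<Rightarrow> complex) set" where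
  "chars_of d \<xi> n \<mu> = {\<chi> \<in> chars d n. Comp d \<xi> n \<chi> = \<mu>}"

definition char0 :: "(nat \<Rightarrow> complex) \<Rightarrow> nat \<Rightarrow> (nat \<Rightarrow> nat) \<Rightarrow> nat \<Rightarrow> complex" where
  "char0 \<xi> n \<mu> = (\<lambda>j\<in>{1..n}. \<xi> (block \<mu> j))"

definition char_perm :: "nat \<Rightarrow> (nat \<Rightarrow> complex) \<Rightarrow> nat \<Rightarrow> (nat \<Rightarrow> complex) \<Rightarrow> nat \<Rightarrow> nat" where
  "char_perm d \<xi> n \<chi> =
     (ARG_MIN (perm_length n) w. w permutes {1..n} \<and> char_act w (char0 \<xi> n (Comp d \<xi> n \<chi>)) = \<chi>)"

text \<open>The primitive idempotent \<open>E\<^sub>\<chi> = \<Prod>\<^sub>j (d\<^sup>-\<^sup>1 \<Sum>\<^sub>s \<chi>(t\<^sub>j)\<^sup>s t\<^sub>j\<^sup>-\<^sup>s)\<close>, that is,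
  \<open>d\<^sup>-\<^sup>n \<Sum>\<^sub>t \<chi>(t) t\<^sup>-\<^sup>1\<close> with \<open>t\<close> ranging over \<open>(\<int>/d\<int>)\<^sup>n\<close>.\<close>

definition idem :: "nat \<Rightarrow> nat \<Rightarrow> (nat \<Rightarrow> complex) \<Rightarrow> yh" where
  "idem d n \<chi> = mprod (YH d n) (map (\<lambda>j.
     K_const (1 / of_nat d) \<odot>\<^bsub>YH d n\<^esub>
       (\<Oplus>\<^bsub>YH d n\<^esub>s\<in>{0..<d}. K_const (\<chi> j ^ s) \<odot>\<^bsub>YH d n\<^esub> (yh_t d n j [^]\<^bsub>YH d n\<^esub> (- int s)))) [1..<Suc n])"

section \<open>Tensor products of affine Hecke algebras\<close>

type_synonym hmu = "((nat \<Rightarrow> yh) \<Rightarrow>\<^sub>0 laurent) set"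

abbreviation hecke :: "nat \<Rightarrow> yh K_algebra" where
  "hecke \<equiv> YH 1"

definition Hmu :: "nat \<Rightarrow> (nat \<Rightarrow> nat) \<Rightarrow> hmu K_algebra" where
  "Hmu d \<mu> = tensor {1..d} (\<lambda>a. hecke (\<mu> a))"

definition in_factor :: "nat \<Rightarrow> (nat \<Rightarrow> nat) \<Rightarrow> nat \<Rightarrow> yh \<Rightarrow> hmu" where
  "in_factor d \<mu> a x =
     pure_tensor {1..d} (\<lambda>a. hecke (\<mu> a)) ((\<lambda>b. \<one>\<^bsub>hecke (\<mu> b)\<^esub>)(a := x))"

text \<open>The identification of the tensor product with a subalgebra of the affine Hecke algebra
  for \<open>n\<close>, read in the tensor product: for \<open>j\<close> in the \<open>a\<close>-th block, the element with index \<open>j\<close> is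
  the element with index \<open>j - offset \<mu> a\<close> of the \<open>a\<close>-th factor. Here \<open>hmu_g d \<mu> i\<close> is meant for \<open>i\<close>
  and \<open>i + 1\<close> in the same block, and \<open>hmu_gw d \<mu> n w\<close> for \<open>w\<close> in the Young subgroup of \<open>\<mu>\<close>, whose
  reduced words only involve such \<open>i\<close>.\<close>

definition hmu_X :: "nat \<Rightarrow> (nat \<Rightarrow> nat) \<Rightarrow> nat \<Rightarrow> hmu" where
  "hmu_X d \<mu> j =
     (let a = block \<mu> j in in_factor d \<mu> a (yh_X 1 (\<mu> a) (j - offset \<mu> a)))"

definition hmu_g :: "nat \<Rightarrow> (nat \<Rightarrow> nat) \<Rightarrow> nat \<Rightarrow> hmu" where
  "hmu_g d \<mu> i =
     (let a = block \<mu> i in in_factor d \<mu> a (yh_g 1 (\<mu> a) (i - offset \<mu> a)))"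

definition hmu_gw :: "nat \<Rightarrow> (nat \<Rightarrow> nat) \<Rightarrow> nat \<Rightarrow> (nat \<Rightarrow> nat) \<Rightarrow> hmu" where
  "hmu_gw d \<mu> n w = mprod (Hmu d \<mu>) (map (hmu_g d \<mu>) (reduced_word n w))"

section \<open>The isomorphism\<close>

type_synonym mats = "(nat \<Rightarrow> nat) \<Rightarrow> (nat \<Rightarrow> complex) \<Rightarrow> (nat \<Rightarrow> complex) \<Rightarrow> hmu"

definition Mats :: "nat \<Rightarrow> (nat \<Rightarrow> complex) \<Rightarrow> nat \<Rightarrow> mats K_algebra" where
  "Mats d \<xi> n =
     direct_sum (compositions d n) (\<lambda>\<mu>. mat_algebra (chars_of d \<xi> n \<mu>) (Hmu d \<mu>))"

text \<open>The matrix unit \<open>1\<^bsub>\<chi>,\<chi>'\<^esub>\<close> multiplied by \<open>h\<close>, in the component of \<open>\<nu>\<close>.\<close>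

definition mat_unit ::
  "nat \<Rightarrow> (nat \<Rightarrow> complex) \<Rightarrow> nat \<Rightarrow> (nat \<Rightarrow> nat) \<Rightarrow>
   (nat \<Rightarrow> complex) \<Rightarrow> (nat \<Rightarrow> complex) \<Rightarrow> hmu \<Rightarrow> mats" where
  "mat_unit d \<xi> n \<nu> \<chi> \<chi>' h =
     (\<lambda>\<mu>\<in>compositions d n. \<lambda>\<psi>\<in>chars_of d \<xi> n \<mu>. \<lambda>\<psi>'\<in>chars_of d \<xi> n \<mu>.
        if \<mu> = \<nu> \<and> \<psi> = \<chi> \<and> \<psi>' = \<chi>' then h else \<zero>\<^bsub>Hmu d \<mu>\<^esub>)"

definition Psi_value ::
  "nat \<Rightarrow> (nat \<Rightarrow> complex) \<Rightarrow> nat \<Rightarrow> (nat \<Rightarrow> complex) \<Rightarrow> (nat \<Rightarrow> int) \<Rightarrow> (nat \<Rightarrow> nat) \<Rightarrow> mats" where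
  "Psi_value d \<xi> n \<chi> lam w =
     (let \<mu> = Comp d \<xi> n \<chi>;
          w\<chi> = char_act w \<chi>;
          \<pi>inv = inv_into UNIV (char_perm d \<xi> n \<chi>);
          winv = inv_into UNIV w;
          x = \<pi>inv \<circ> winv \<circ> char_perm d \<xi> n w\<chi>
      in u_pow (int (perm_length n winv) - int (perm_length n x)) \<odot>\<^bsub>Mats d \<xi> n\<^esub>
           mat_unit d \<xi> n \<mu> \<chi> w\<chi>
             (mprod (Hmu d \<mu>) (map (\<lambda>j. hmu_X d \<mu> (\<pi>inv j) [^]\<^bsub>Hmu d \<mu>\<^esub> lam j) [1..<Suc n])
                \<otimes>\<^bsub>Hmu d \<mu>\<^esub> hmu_gw d \<mu> n x))"

text \<open>The elements \<open>E\<^sub>\<chi> X\<^sup>\<lambda> g\<^sub>w\<close> form a basis, so the prescribed values determine \<open>Psi d \<xi> n\<close> on the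
  carrier; that it is bijective is then a property of this homomorphism.\<close>

definition Psi :: "nat \<Rightarrow> (nat \<Rightarrow> complex) \<Rightarrow> nat \<Rightarrow> yh \<Rightarrow> mats" where
  "Psi d \<xi> n = (SOME f. f \<in> K_algebra_hom (YH d n) (Mats d \<xi> n) \<and>
     (\<forall>\<chi>\<in>chars d n. \<forall>lam. \<forall>w. w permutes {1..n} \<longrightarrow>
        f (idem d n \<chi> \<otimes>\<^bsub>YH d n\<^esub> yh_Xpow d n lam \<otimes>\<^bsub>YH d n\<^esub> yh_gw d n (inv_into UNIV w))
          = Psi_value d \<xi> n \<chi> lam w))"

section \<open>The traces\<close>

text \<open>The identity of the affine Hecke algebra for \<open>n = 0\<close>, which is the ground ring.\<close>

definition trace0 :: "yh \<Rightarrow> laurent" where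
  "trace0 C = (THE c. C = c \<odot>\<^bsub>hecke 0\<^esub> \<one>\<^bsub>hecke 0\<^esub>)"

definition with_trace0 :: "(nat \<Rightarrow> yh \<Rightarrow> laurent) \<Rightarrow> nat \<Rightarrow> yh \<Rightarrow> laurent" where
  "with_trace0 \<tau> n = (if n = 0 then trace0 else \<tau> n)"

definition combined_trace ::
  "nat \<Rightarrow> (nat \<Rightarrow> complex) \<Rightarrow> ((nat \<Rightarrow> nat) \<Rightarrow> nat \<Rightarrow> nat \<Rightarrow> yh \<Rightarrow> laurent) \<Rightarrow> nat \<Rightarrow> yh \<Rightarrow> laurent" where
  "combined_trace d \<xi> \<tau> n y =
     (\<Sum>\<mu>\<in>compositions d n.
        tensor_form {1..d} (\<lambda>a. with_trace0 (\<tau> (socle \<mu>) a) (\<mu> a))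
          (mat_trace (chars_of d \<xi> n \<mu>) (Hmu d \<mu>) (Psi d \<xi> n y \<mu>)))"

end

(* The isomorphism Psi sends each generator to a monomial matrix, with one entry in each row chi.
   These matrices satisfy the defining relations, and the resulting homomorphism has the prescribed
   values on the elements E_chi X^lambda g_w: deleting from a reduced word of w the letters which
   exchange two different values of chi leaves a reduced word of pi_chi^-1 w pi_{w(chi)}, and two
   reduced words give the same product by Matsumoto's theorem. Since the E_chi add up to 1, these
   values determine a homomorphism on the generators, so Psi is the one just described.

   The trace property is that of a matrix trace whose entries are evaluated by a trace. For x from
   n strands, the row chi of Psi(x g_n) contributes to the matrix trace only if
   chi(t_n) = chi(t_{n+1}). Such chi correspond to the characters for n strands, the composition
   changes from mu to mu + (1 in a single part a) with mu_a >= 1, so that the socle is the same, and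
   the diagonal entry is the one of Psi(x) multiplied by the last generator of the a-th tensor
   factor. There the Markov property of the trace in the a-th factor applies. *)
theory Submission
  imports Defs
begin

section \<open>Algebras\<close>

text \<open>\<open>Psi\<close> and \<open>tensor_form\<close> are choice terms, and this shapes the
  proof. For \<open>Psi\<close> a witness has to be built from the presentation, and every other
  homomorphism with the prescribed values has to be compared with it on words. For
  \<open>tensor_form\<close> the value has to vanish on a whole two-sided ideal, although the form
  is not multiplicative. Characters are treated as colourings of {1..n} by {1..d}. A strand carries
  its colour a and its rank among the strands of colour a. If i and i+1 have the same colour, the
  entry of g_i is the generator of the a-th factor whose index is the rank of i; the pair of colour
  and rank is unchanged when strands of different colours cross, so the relations can be followed
  strand by strand. If the colours differ, e_i acts as 0, the square of g_i has to be u^2, and the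
  entry is u. As every row has a single entry that can be nonzero, a product of such matrices is
  computed along a path of rows, and the relations turn into identities in one tensor product, with
  no sum over columns left.\<close>

locale K_alg = ring A for A :: "'a K_algebra" (structure) +
  assumes smult_closed [simp, intro]: "x \<in> carrier A \<Longrightarrow> c \<odot> x \<in> carrier A"
    and smult_l_distr: "x \<in> carrier A \<Longrightarrow> (c + c') \<odot> x = c \<odot> x \<oplus> c' \<odot> x"
    and smult_r_distr: "x \<in> carrier A \<Longrightarrow> y \<in> carrier A \<Longrightarrow> c \<odot> (x \<oplus> y) = c \<odot> x \<oplus> c \<odot> y"
    and smult_smult: "x \<in> carrier A \<Longrightarrow> c \<odot> (c' \<odot> x) = (c * c') \<odot> x"
    and smult_one [simp]: "x \<in> carrier A \<Longrightarrow> 1 \<odot> x = x"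
    and smult_mult_l: "x \<in> carrier A \<Longrightarrow> y \<in> carrier A \<Longrightarrow> (c \<odot> x) \<otimes> y = c \<odot> (x \<otimes> y)"
    and smult_mult_r: "x \<in> carrier A \<Longrightarrow> y \<in> carrier A \<Longrightarrow> x \<otimes> (c \<odot> y) = c \<odot> (x \<otimes> y)"
begin

lemma smult_zero_left [simp]:
  assumes "x \<in> carrier A" shows "0 \<odot> x = \<zero>"
proof -
  have "0 \<odot> x = 0 \<odot> x \<oplus> 0 \<odot> x"
    using smult_l_distr[of x 0 0] assms by simp
  then show ?thesis
    using assms by (metis add.l_cancel_one' smult_closed)
qed

lemma smult_zero_right [simp]: "c \<odot> \<zero> = \<zero>"
proof -
  have "c \<odot> \<zero> = c \<odot> \<zero> \<oplus> c \<odot> \<zero>"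
    using smult_r_distr[of \<zero> \<zero> c] by simp
  then show ?thesis
    by (metis add.l_cancel_one' smult_closed zero_closed)
qed

lemma smult_minus:
  assumes "x \<in> carrier A" shows "(- c) \<odot> x = \<ominus> (c \<odot> x)"
proof -
  have "(- c) \<odot> x \<oplus> c \<odot> x = \<zero>"
    using smult_l_distr[of x "- c" c] assms by simp
  then show ?thesis
    using assms by (simp add: minus_equality)
qed

lemma smult_finsum:
  "f \<in> S \<rightarrow> carrier A \<Longrightarrow> c \<odot> (\<Oplus>i\<in>S. f i) = (\<Oplus>i\<in>S. c \<odot> f i)"
proof (induction S rule: infinite_finite_induct)
  case (insert x F)
  then have "f x \<in> carrier A" "f \<in> F \<rightarrow> carrier A" "(\<lambda>i. c \<odot> f i) \<in> F \<rightarrow> carrier A"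
    by auto
  with insert show ?case
    by (simp add: smult_r_distr finsum_insert)
qed auto

lemma smult_swap:
  assumes "x \<in> carrier A" "y \<in> carrier A"
  shows "(c \<odot> x) \<otimes> (c' \<odot> y) = (c * c') \<odot> (x \<otimes> y)"
  using assms by (simp add: smult_mult_l smult_mult_r smult_smult mult.commute)

text \<open>Applied to the factor u^-2 in the recursion for \<open>yh_X\<close>: a rescaled unit
  stays a unit when the scalar is invertible.\<close>

lemma smult_Units:
  assumes x: "x \<in> Units A" and c: "c * c' = 1"
  shows "c \<odot> x \<in> Units A" and "inv (c \<odot> x) = c' \<odot> inv x"
proof -
  have i: "inv x \<in> carrier A" "x \<in> carrier A"
    using x by auto
  have c': "c' * c = 1"
    using c by (simp add: mult.commute)
  have 1: "(c \<odot> x) \<otimes> (c' \<odot> inv x) = \<one>" "(c' \<odot> inv x) \<otimes> (c \<odot> x) = \<one>"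
    using i x c c' by (simp_all add: smult_swap Units_l_inv Units_r_inv)
  then show "c \<odot> x \<in> Units A"
    using i unfolding Units_def by blast
  show "inv (c \<odot> x) = c' \<odot> inv x"
    using 1 i by (intro inv_char) auto
qed

end

section \<open>Products of lists in a monoid\<close>

lemma mprod_Nil [simp]: "mprod M [] = \<one>\<^bsub>M\<^esub>"
  by (simp add: mprod_def)

lemma mprod_Cons [simp]: "mprod M (x # xs) = x \<otimes>\<^bsub>M\<^esub> mprod M xs"
  by (simp add: mprod_def)

context monoid
begin

lemma mprod_closed [simp, intro]: "set xs \<subseteq> carrier G \<Longrightarrow> mprod G xs \<in> carrier G"
  by (induction xs) auto

lemma mprod_append:
  "set xs \<subseteq> carrier G \<Longrightarrow> set ys \<subseteq> carrier G \<Longrightarrow> mprod G (xs @ ys) = mprod G xs \<otimes> mprod G ys"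
  by (induction xs) (auto simp: m_assoc)

lemma mprod_replicate: "x \<in> carrier G \<Longrightarrow> mprod G (replicate k x) = x [^] k"
  proof (induction k)
  case (Suc k)
  then show ?case
    using nat_pow_Suc2[of x k] by simp
qed simp

lemma int_pow_Units:
  assumes "x \<in> Units G" shows "x [^] (k::int) \<in> Units G"
  using Units_pow_closed[OF assms]
  by (cases "k < 0") (simp_all only: int_pow_def2 Units_inv_Units if_True if_False)

text \<open>Multiply \<open>x \<otimes> y = y \<otimes> x\<close> by the inverse of \<open>x\<close>
  from both sides. This is what handles the negative powers of the t_i in
  \<open>idem\<close>.\<close>

lemma inv_unit_comm:
  assumes "x \<in> Units G" "y \<in> carrier G" "x \<otimes> y = y \<otimes> x"
  shows "inv x \<otimes> y = y \<otimes> inv x"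
proof -
  have x: "x \<in> carrier G" "inv x \<in> carrier G"
    using assms by auto
  have "inv x \<otimes> y = inv x \<otimes> (y \<otimes> x) \<otimes> inv x"
    using x assms by (simp add: m_assoc)
  also have "\<dots> = (inv x \<otimes> x) \<otimes> (y \<otimes> inv x)"
    using x assms(1,2) by (simp only: assms(3)[symmetric] m_assoc m_closed)
  also have "\<dots> = y \<otimes> inv x"
    using x assms(1,2) by (subst Units_l_inv) auto
  finally show ?thesis .
qed

end

section \<open>Homomorphisms of algebras\<close>

locale K_hom = A: K_alg A + B: K_alg B
  for A :: "'a K_algebra" (structure) and B :: "'b K_algebra" (structure) +
  fixes f :: "'a \<Rightarrow> 'b"
  assumes f: "f \<in> K_algebra_hom A B"
begin

lemma hom_closed [simp, intro]: "x \<in> carrier A \<Longrightarrow> f x \<in> carrier B"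
  and hom_add [simp]: "x \<in> carrier A \<Longrightarrow> y \<in> carrier A \<Longrightarrow> f (x \<oplus>\<^bsub>A\<^esub> y) = f x \<oplus>\<^bsub>B\<^esub> f y"
  and hom_mult [simp]: "x \<in> carrier A \<Longrightarrow> y \<in> carrier A \<Longrightarrow> f (x \<otimes>\<^bsub>A\<^esub> y) = f x \<otimes>\<^bsub>B\<^esub> f y"
  and hom_one [simp]: "f \<one>\<^bsub>A\<^esub> = \<one>\<^bsub>B\<^esub>"
  and hom_smult [simp]: "x \<in> carrier A \<Longrightarrow> f (c \<odot>\<^bsub>A\<^esub> x) = c \<odot>\<^bsub>B\<^esub> f x"
  using f by (auto simp: K_algebra_hom_def ring_hom_def)

lemma hom_zero [simp]: "f \<zero>\<^bsub>A\<^esub> = \<zero>\<^bsub>B\<^esub>"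
  using hom_smult[of "\<zero>\<^bsub>A\<^esub>" 0] by simp

lemma hom_uminus [simp]: "x \<in> carrier A \<Longrightarrow> f (\<ominus>\<^bsub>A\<^esub> x) = \<ominus>\<^bsub>B\<^esub> f x"
  using hom_smult[of x "- 1"] by (simp add: A.smult_minus B.smult_minus)

lemma hom_finsum: "g \<in> S \<rightarrow> carrier A \<Longrightarrow> f (\<Oplus>\<^bsub>A\<^esub>i\<in>S. g i) = (\<Oplus>\<^bsub>B\<^esub>i\<in>S. f (g i))"
proof (induction S rule: infinite_finite_induct)
  case (insert x F)
  then have "g x \<in> carrier A" "g \<in> F \<rightarrow> carrier A" "(\<lambda>i. f (g i)) \<in> F \<rightarrow> carrier B"
    by auto
  with insert show ?case
    by simp
qed auto

lemma hom_mprod: "set xs \<subseteq> carrier A \<Longrightarrow> f (mprod A xs) = mprod B (map f xs)"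
  by (induction xs) auto

lemma hom_nat_pow: "x \<in> carrier A \<Longrightarrow> f (x [^]\<^bsub>A\<^esub> (k::nat)) = f x [^]\<^bsub>B\<^esub> k"
  by (induction k) auto

lemma hom_Units: "x \<in> Units A \<Longrightarrow> f x \<in> Units B"
  and hom_inv: "x \<in> Units A \<Longrightarrow> f (inv\<^bsub>A\<^esub> x) = inv\<^bsub>B\<^esub> f x"
proof -
  have *: "f x \<in> Units B \<and> f (inv\<^bsub>A\<^esub> x) = inv\<^bsub>B\<^esub> f x" if x: "x \<in> Units A" for x
  proof -
    have i: "inv\<^bsub>A\<^esub> x \<in> carrier A" "x \<in> carrier A"
      using x by auto
    have 1: "f x \<otimes>\<^bsub>B\<^esub> f (inv\<^bsub>A\<^esub> x) = \<one>\<^bsub>B\<^esub>" "f (inv\<^bsub>A\<^esub> x) \<otimes>\<^bsub>B\<^esub> f x = \<one>\<^bsub>B\<^esub>"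
      using i x by (simp_all flip: hom_mult)
    then have "f x \<in> Units B"
      using i unfolding Units_def by blast
    then show ?thesis
      using 1 i by (metis B.inv_char hom_closed)
  qed
  show "x \<in> Units A \<Longrightarrow> f x \<in> Units B" "x \<in> Units A \<Longrightarrow> f (inv\<^bsub>A\<^esub> x) = inv\<^bsub>B\<^esub> f x"
    using * by auto
qed

lemma hom_int_pow: "x \<in> Units A \<Longrightarrow> f (x [^]\<^bsub>A\<^esub> (k::int)) = f x [^]\<^bsub>B\<^esub> k"
  using A.Units_pow_closed[of x] A.Units_closed[of x]
  by (cases "k < 0") (simp_all only: int_pow_def2 hom_nat_pow hom_inv if_True if_False)

end

subsection \<open>Monoid algebras\<close>

lemma poly_mapping_sum_single:
  fixes p :: "'m \<Rightarrow>\<^sub>0 'b::comm_monoid_add"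
  shows "p = (\<Sum>x\<in>Poly_Mapping.keys p. Poly_Mapping.single x (Poly_Mapping.lookup p x))"
  by (rule poly_mapping_eqI)
    (auto simp: lookup_sum lookup_single when_def in_keys_iff)

lemma monoid_algebra_simps [simp]:
  "carrier (monoid_algebra M) = {p. Poly_Mapping.keys p \<subseteq> carrier M}"
  "\<one>\<^bsub>monoid_algebra M\<^esub> = Poly_Mapping.single \<one>\<^bsub>M\<^esub> 1"
  "\<zero>\<^bsub>monoid_algebra M\<^esub> = 0"
  "p \<oplus>\<^bsub>monoid_algebra M\<^esub> q = p + q"
  "c \<odot>\<^bsub>monoid_algebra M\<^esub> p = Poly_Mapping.map ((*) c) p"
  by (simp_all add: monoid_algebra_def)

lemma lookup_map_mult [simp]:
  "Poly_Mapping.lookup (Poly_Mapping.map ((*) (c::'c::mult_zero)) p) x = c * Poly_Mapping.lookup p x"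
  by (simp add: map.rep_eq when_def)

lemma monoid_algebra_mult_single [simp]:
  "Poly_Mapping.single x a \<otimes>\<^bsub>monoid_algebra M\<^esub> Poly_Mapping.single y b
    = Poly_Mapping.single (x \<otimes>\<^bsub>M\<^esub> y) (a * b)"
  by (simp add: monoid_algebra_def)

lemma monoid_algebra_mult_zero [simp]:
  "0 \<otimes>\<^bsub>monoid_algebra M\<^esub> q = 0" "p \<otimes>\<^bsub>monoid_algebra M\<^esub> 0 = 0"
  by (simp_all add: monoid_algebra_def)

lemma monoid_algebra_mult_distl:
  "(p + p') \<otimes>\<^bsub>monoid_algebra M\<^esub> q = p \<otimes>\<^bsub>monoid_algebra M\<^esub> q + p' \<otimes>\<^bsub>monoid_algebra M\<^esub> q"
  unfolding monoid_algebra_def monoid.select_convs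
  by (rule setsum_keys_plus_distrib
      [where f = "\<lambda>x a. \<Sum>y\<in>Poly_Mapping.keys q. Poly_Mapping.single (x \<otimes>\<^bsub>M\<^esub> y) (a * Poly_Mapping.lookup q y)"])
    (simp_all add: distrib_right single_add sum.distrib)

lemma monoid_algebra_mult_distr:
  "p \<otimes>\<^bsub>monoid_algebra M\<^esub> (q + q') = p \<otimes>\<^bsub>monoid_algebra M\<^esub> q + p \<otimes>\<^bsub>monoid_algebra M\<^esub> q'"
proof -
  have "(\<Sum>y\<in>Poly_Mapping.keys (q + q'). Poly_Mapping.single (x \<otimes>\<^bsub>M\<^esub> y) (a * Poly_Mapping.lookup (q + q') y))
    = (\<Sum>y\<in>Poly_Mapping.keys q. Poly_Mapping.single (x \<otimes>\<^bsub>M\<^esub> y) (a * Poly_Mapping.lookup q y))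
      + (\<Sum>y\<in>Poly_Mapping.keys q'. Poly_Mapping.single (x \<otimes>\<^bsub>M\<^esub> y) (a * Poly_Mapping.lookup q' y))" for x a
    by (rule setsum_keys_plus_distrib[where f = "\<lambda>y b. Poly_Mapping.single (x \<otimes>\<^bsub>M\<^esub> y) (a * b)"])
      (simp_all add: distrib_left single_add)
  then show ?thesis
    unfolding monoid_algebra_def monoid.select_convs by (simp add: sum.distrib)
qed

lemma map_mult_add:
  "Poly_Mapping.map ((*) (c::'c::semiring_0)) (p + q) = Poly_Mapping.map ((*) c) p + Poly_Mapping.map ((*) c) q"
  by (rule poly_mapping_eqI) (simp add: lookup_add distrib_left)

lemma map_mult_single [simp]:
  "Poly_Mapping.map ((*) (c::'c::mult_zero)) (Poly_Mapping.single x a) = Poly_Mapping.single x (c * a)"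
  by (rule poly_mapping_eqI) (simp add: lookup_single when_def)

lemma map_mult_zero [simp]: "Poly_Mapping.map ((*) (c::'c::mult_zero)) 0 = 0"
  by (rule poly_mapping_eqI) simp

lemma single_in_monoid_algebra [simp]:
  "x \<in> carrier M \<Longrightarrow> Poly_Mapping.single x c \<in> carrier (monoid_algebra M)"
  by simp

lemma monoid_algebra_add_closed [intro]:
  "p \<in> carrier (monoid_algebra M) \<Longrightarrow> q \<in> carrier (monoid_algebra M) \<Longrightarrow> p + q \<in> carrier (monoid_algebra M)"
  using keys_add[of p q] by auto

text \<open>The identities proved with this rule are additive in each argument, so they reduce to
  monomials, and the double sums over supports in the definition of the product need not be
  manipulated.\<close>

lemma monoid_algebra_induct [consumes 1, case_names zero single add]:
  assumes p: "p \<in> carrier (monoid_algebra M)"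
    and "P 0" and "\<And>x c. x \<in> carrier M \<Longrightarrow> P (Poly_Mapping.single x c)"
    and "\<And>p q. p \<in> carrier (monoid_algebra M) \<Longrightarrow> q \<in> carrier (monoid_algebra M) \<Longrightarrow> P p \<Longrightarrow> P q \<Longrightarrow> P (p + q)"
  shows "P p"
proof -
  have "P (\<Sum>x\<in>S. Poly_Mapping.single x (Poly_Mapping.lookup p x)) \<and>
      (\<Sum>x\<in>S. Poly_Mapping.single x (Poly_Mapping.lookup p x)) \<in> carrier (monoid_algebra M)"
    if "finite S" "S \<subseteq> carrier M" for S
    using that
  proof (induction S rule: finite_induct)
    case (insert x F)
    then have "Poly_Mapping.single x (Poly_Mapping.lookup p x) \<in> carrier (monoid_algebra M)"
      by simp
    moreover from this insert have "Poly_Mapping.single x (Poly_Mapping.lookup p x)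
      + (\<Sum>x\<in>F. Poly_Mapping.single x (Poly_Mapping.lookup p x)) \<in> carrier (monoid_algebra M)"
      by (intro monoid_algebra_add_closed) auto
    ultimately show ?case
      using insert assms by simp
  qed (simp add: assms)
  then have "P (\<Sum>x\<in>Poly_Mapping.keys p. Poly_Mapping.single x (Poly_Mapping.lookup p x))"
    using p by simp
  then show ?thesis
    by (simp flip: poly_mapping_sum_single)
qed

text \<open>Every axiom is additive in each of its arguments; one induction per argument reduces it
  to the corresponding monoid axiom.\<close>

lemma K_alg_monoid_algebra:
  assumes "monoid M"
  shows "K_alg (monoid_algebra M)"
proof -
  interpret M: monoid M by fact
  let ?A = "monoid_algebra M"
  note dist = monoid_algebra_mult_distl monoid_algebra_mult_distr map_mult_add
  \<comment> \<open>Membership in the carrier stays folded, so that goals keep the shape which the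
    induction rule consumes.\<close>
  note [simp del] = monoid_algebra_simps(1)
  note [simp] = M.m_assoc mult.assoc
  have closed: "p \<otimes>\<^bsub>?A\<^esub> q \<in> carrier ?A" if "p \<in> carrier ?A" "q \<in> carrier ?A" for p q
    using that
  proof (induction p rule: monoid_algebra_induct)
    case (single x c)
    from single(2) show ?case
    proof (induction q rule: monoid_algebra_induct)
      case (add p q) then show ?case by (simp add: dist monoid_algebra_add_closed)
    qed (use single in \<open>simp_all add: monoid_algebra_simps(1)\<close>)
  next
    case (add p q) then show ?case by (simp add: dist monoid_algebra_add_closed)
  qed (simp add: monoid_algebra_simps(1))
  have assoc: "p \<otimes>\<^bsub>?A\<^esub> q \<otimes>\<^bsub>?A\<^esub> r = p \<otimes>\<^bsub>?A\<^esub> (q \<otimes>\<^bsub>?A\<^esub> r)"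
    if "p \<in> carrier ?A" "q \<in> carrier ?A" "r \<in> carrier ?A" for p q r
    using that
  proof (induction p rule: monoid_algebra_induct)
    case p: (single x c)
    from p(2-) show ?case
    proof (induction q rule: monoid_algebra_induct)
      case q: (single y c)
      from q(2-) show ?case
        by (induction r rule: monoid_algebra_induct) (use p q in \<open>simp_all add: dist\<close>)
    qed (simp_all add: dist)
  qed (simp_all add: dist)
  have onel: "\<one>\<^bsub>?A\<^esub> \<otimes>\<^bsub>?A\<^esub> p = p" and oner: "p \<otimes>\<^bsub>?A\<^esub> \<one>\<^bsub>?A\<^esub> = p" if "p \<in> carrier ?A" for p
    using that by (induction p rule: monoid_algebra_induct) (simp_all add: dist)
  have sl: "(c \<odot>\<^bsub>?A\<^esub> p) \<otimes>\<^bsub>?A\<^esub> q = c \<odot>\<^bsub>?A\<^esub> (p \<otimes>\<^bsub>?A\<^esub> q)"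
    and sr: "p \<otimes>\<^bsub>?A\<^esub> (c \<odot>\<^bsub>?A\<^esub> q) = c \<odot>\<^bsub>?A\<^esub> (p \<otimes>\<^bsub>?A\<^esub> q)"
    if "p \<in> carrier ?A" "q \<in> carrier ?A" for c p q
    using that
  proof (induction p rule: monoid_algebra_induct)
    case p: (single x a)
    { case 1
      from 1 show ?case
        by (induction q rule: monoid_algebra_induct) (use p in \<open>simp_all add: dist\<close>)
    next
      case 2
      from 2 show ?case
        by (induction q rule: monoid_algebra_induct) (use p in \<open>simp_all add: dist mult.left_commute\<close>) }
  qed (simp_all add: dist)
  have "ring ?A"
  proof (intro ringI abelian_groupI monoidI)
    fix p assume "p \<in> carrier ?A"
    then show "\<exists>q\<in>carrier ?A. q \<oplus>\<^bsub>?A\<^esub> p = \<zero>\<^bsub>?A\<^esub>"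
      by (intro bexI[of _ "- p"]) (simp_all add: monoid_algebra_simps(1))
  next
    show "\<one>\<^bsub>?A\<^esub> \<in> carrier ?A" "\<zero>\<^bsub>?A\<^esub> \<in> carrier ?A"
      by (simp_all add: monoid_algebra_simps(1))
  next
    fix p q r
    assume pqr: "p \<in> carrier ?A" "q \<in> carrier ?A" "r \<in> carrier ?A"
    show "(p \<oplus>\<^bsub>?A\<^esub> q) \<otimes>\<^bsub>?A\<^esub> r = p \<otimes>\<^bsub>?A\<^esub> r \<oplus>\<^bsub>?A\<^esub> q \<otimes>\<^bsub>?A\<^esub> r"
      "r \<otimes>\<^bsub>?A\<^esub> (p \<oplus>\<^bsub>?A\<^esub> q) = r \<otimes>\<^bsub>?A\<^esub> p \<oplus>\<^bsub>?A\<^esub> r \<otimes>\<^bsub>?A\<^esub> q"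
      "p \<oplus>\<^bsub>?A\<^esub> q \<oplus>\<^bsub>?A\<^esub> r = p \<oplus>\<^bsub>?A\<^esub> (q \<oplus>\<^bsub>?A\<^esub> r)"
      by (simp_all add: dist add.assoc)
    show "p \<otimes>\<^bsub>?A\<^esub> q \<otimes>\<^bsub>?A\<^esub> r = p \<otimes>\<^bsub>?A\<^esub> (q \<otimes>\<^bsub>?A\<^esub> r)"
      using pqr by (rule assoc)
  next
    fix p q
    assume pq: "p \<in> carrier ?A" "q \<in> carrier ?A"
    show "p \<oplus>\<^bsub>?A\<^esub> q = q \<oplus>\<^bsub>?A\<^esub> p" "\<zero>\<^bsub>?A\<^esub> \<oplus>\<^bsub>?A\<^esub> p = p"
      by (simp_all add: add.commute)
    show "p \<oplus>\<^bsub>?A\<^esub> q \<in> carrier ?A" "p \<otimes>\<^bsub>?A\<^esub> q \<in> carrier ?A"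
      using pq closed monoid_algebra_add_closed by auto
    show "\<one>\<^bsub>?A\<^esub> \<otimes>\<^bsub>?A\<^esub> p = p" "p \<otimes>\<^bsub>?A\<^esub> \<one>\<^bsub>?A\<^esub> = p"
      using pq onel oner by auto
  qed
  moreover have "c \<odot>\<^bsub>?A\<^esub> p \<in> carrier ?A" if "p \<in> carrier ?A" for c p
    using that by (auto simp: monoid_algebra_simps(1) in_keys_iff subset_iff dest!: mult_not_zero)
  moreover have "(c + c') \<odot>\<^bsub>?A\<^esub> p = c \<odot>\<^bsub>?A\<^esub> p \<oplus>\<^bsub>?A\<^esub> c' \<odot>\<^bsub>?A\<^esub> p"
    "c \<odot>\<^bsub>?A\<^esub> (c' \<odot>\<^bsub>?A\<^esub> p) = (c * c') \<odot>\<^bsub>?A\<^esub> p" "1 \<odot>\<^bsub>?A\<^esub> p = p" for c c' p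
    by (rule poly_mapping_eqI; simp add: lookup_add distrib_right mult.assoc)+
  ultimately show ?thesis
    by (intro K_alg.intro K_alg_axioms.intro) (use sl sr in \<open>simp_all add: map_mult_add\<close>)
qed

lemma monoid_free_monoid: "monoid (free_monoid S)"
  by (rule monoidI) (auto simp: free_monoid_def)

lemma free_monoid_simps [simp]:
  "carrier (free_monoid S) = lists S" "x \<otimes>\<^bsub>free_monoid S\<^esub> y = x @ y" "\<one>\<^bsub>free_monoid S\<^esub> = []"
  by (simp_all add: free_monoid_def)

lemma monoid_product_group:
  assumes "\<And>i. i \<in> I \<Longrightarrow> monoid (N i)"
  shows "monoid (product_group I N)"
proof (rule monoidI)
  show "x \<otimes>\<^bsub>product_group I N\<^esub> y \<in> carrier (product_group I N)"
    if "x \<in> carrier (product_group I N)" "y \<in> carrier (product_group I N)" for x y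
    using that assms by (auto simp: PiE_iff monoid.m_closed)
qed (use assms in \<open>auto simp: PiE_iff monoid.one_closed monoid.m_assoc monoid.m_closed monoid.l_one monoid.r_one
      intro!: extensionalityI[where A = I]\<close>)

text \<open>The linear extension of a map on monomials. For a multiplicative map it is the
  homomorphism of the universal property, see \<open>ma_extend_hom\<close>.\<close>

definition ma_extend :: "'b K_algebra \<Rightarrow> ('m \<Rightarrow> 'b) \<Rightarrow> ('m \<Rightarrow>\<^sub>0 laurent) \<Rightarrow> 'b" where
  "ma_extend B \<phi> p = (\<Oplus>\<^bsub>B\<^esub>x\<in>Poly_Mapping.keys p. Poly_Mapping.lookup p x \<odot>\<^bsub>B\<^esub> \<phi> x)"

context K_alg
begin

lemma ma_extend_single [simp]:
  "\<phi> x \<in> carrier A \<Longrightarrow> ma_extend A \<phi> (Poly_Mapping.single x c) = c \<odot> \<phi> x"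
  by (simp add: ma_extend_def)

text \<open>Cancellation can make the support of a sum smaller than the union of the supports; over
  a common index set, addition becomes termwise.\<close>

lemma ma_extend_superset:
  assumes "finite S" "Poly_Mapping.keys p \<subseteq> S" "\<phi> \<in> S \<rightarrow> carrier A"
  shows "ma_extend A \<phi> p = (\<Oplus>x\<in>S. Poly_Mapping.lookup p x \<odot> \<phi> x)"
  unfolding ma_extend_def
  by (rule add.finprod_mono_neutral_cong_left) (use assms in \<open>auto simp: in_keys_iff Pi_iff\<close>)

lemma ma_extend_add:
  assumes "\<phi> \<in> C \<rightarrow> carrier A" "Poly_Mapping.keys p \<subseteq> C" "Poly_Mapping.keys q \<subseteq> C"
  shows "ma_extend A \<phi> (p + q) = ma_extend A \<phi> p \<oplus> ma_extend A \<phi> q"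
proof -
  let ?S = "Poly_Mapping.keys p \<union> Poly_Mapping.keys q"
  have S: "\<phi> \<in> ?S \<rightarrow> carrier A"
    using assms by auto
  have c: "(\<lambda>x. Poly_Mapping.lookup p x \<odot> \<phi> x) \<in> ?S \<rightarrow> carrier A"
    "(\<lambda>x. Poly_Mapping.lookup q x \<odot> \<phi> x) \<in> ?S \<rightarrow> carrier A"
    using S by auto
  have "ma_extend A \<phi> (p + q) = (\<Oplus>x\<in>?S. Poly_Mapping.lookup (p + q) x \<odot> \<phi> x)"
    using S keys_add[of p q] by (intro ma_extend_superset) auto
  also have "\<dots> = (\<Oplus>x\<in>?S. Poly_Mapping.lookup p x \<odot> \<phi> x \<oplus> Poly_Mapping.lookup q x \<odot> \<phi> x)"
    using S by (intro add.finprod_cong' ) (auto simp: lookup_add smult_l_distr Pi_iff)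
  also have "\<dots> = (\<Oplus>x\<in>?S. Poly_Mapping.lookup p x \<odot> \<phi> x) \<oplus> (\<Oplus>x\<in>?S. Poly_Mapping.lookup q x \<odot> \<phi> x)"
    using c by (simp add: add.finprod_multf)
  also have "\<dots> = ma_extend A \<phi> p \<oplus> ma_extend A \<phi> q"
    using S by (subst (1 2) ma_extend_superset[of ?S]) auto
  finally show ?thesis .
qed

lemma ma_extend_hom:
  assumes M: "monoid M" and \<phi>: "\<phi> \<in> carrier M \<rightarrow> carrier A" "\<phi> \<one>\<^bsub>M\<^esub> = \<one>"
    "\<And>x y. x \<in> carrier M \<Longrightarrow> y \<in> carrier M \<Longrightarrow> \<phi> (x \<otimes>\<^bsub>M\<^esub> y) = \<phi> x \<otimes> \<phi> y"
  shows "ma_extend A \<phi> \<in> K_algebra_hom (monoid_algebra M) A"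
proof -
  interpret M: monoid M by fact
  interpret B: K_alg "monoid_algebra M" by (rule K_alg_monoid_algebra) fact
  let ?B = "monoid_algebra M" and ?F = "ma_extend A \<phi>"
  note c = monoid_algebra_simps(1)
  have \<phi>c: "\<phi> x \<in> carrier A" if "x \<in> carrier M" for x
    using \<phi> that by auto
  have add: "?F (p + q) = ?F p \<oplus> ?F q" if "p \<in> carrier ?B" "q \<in> carrier ?B" for p q
    using that \<phi> by (intro ma_extend_add[where C = "carrier M"]) auto
  have z: "?F 0 = \<zero>"
    by (simp add: ma_extend_def)
  have closed: "?F p \<in> carrier A" if "p \<in> carrier ?B" for p
    using that by (induction p rule: monoid_algebra_induct) (simp_all add: z add \<phi>c del: c)
  have smult: "?F (c \<odot>\<^bsub>?B\<^esub> p) = c \<odot> ?F p" if "p \<in> carrier ?B" for c p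
    using that
  proof (induction p rule: monoid_algebra_induct)
    case (add p q)
    then have "c \<odot>\<^bsub>?B\<^esub> p \<in> carrier ?B" "c \<odot>\<^bsub>?B\<^esub> q \<in> carrier ?B"
      by blast+
    then show ?case
      using add closed unfolding monoid_algebra_simps(5) map_mult_add
      by (simp add: \<open>\<And>p q. p \<in> carrier ?B \<Longrightarrow> q \<in> carrier ?B \<Longrightarrow> ?F (p + q) = ?F p \<oplus> ?F q\<close> smult_r_distr del: c)
  qed (simp_all add: z \<phi>c smult_smult)
  have mult: "?F (p \<otimes>\<^bsub>?B\<^esub> q) = ?F p \<otimes> ?F q" if "p \<in> carrier ?B" "q \<in> carrier ?B" for p q
    using that
  proof (induction p rule: monoid_algebra_induct)
    case p: (single x a)
    from p(2) show ?case
    proof (induction q rule: monoid_algebra_induct)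
      case (single y b)
      then show ?case using p \<phi> \<phi>c by (simp add: smult_swap)
    next
      case (add q q')
      have "Poly_Mapping.single x a \<in> carrier ?B"
        using p by simp
      then show ?case using add p closed \<phi>c
        by (simp add: monoid_algebra_mult_distr \<open>\<And>p q. p \<in> carrier ?B \<Longrightarrow> q \<in> carrier ?B \<Longrightarrow> ?F (p + q) = ?F p \<oplus> ?F q\<close> r_distr B.m_closed del: c)
    qed (use p \<phi>c in \<open>simp add: z\<close>)
  next
    case (add p p')
    then show ?case using closed
      by (simp add: monoid_algebra_mult_distl \<open>\<And>p q. p \<in> carrier ?B \<Longrightarrow> q \<in> carrier ?B \<Longrightarrow> ?F (p + q) = ?F p \<oplus> ?F q\<close> l_distr B.m_closed del: c)
  qed (simp add: z closed del: c)
  have one: "?F \<one>\<^bsub>?B\<^esub> = \<one>"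
    using \<phi>(2) by simp
  have add': "?F (p \<oplus>\<^bsub>?B\<^esub> q) = ?F p \<oplus> ?F q" if "p \<in> carrier ?B" "q \<in> carrier ?B" for p q
    unfolding monoid_algebra_simps(4) using that by (rule add)
  have "?F \<in> ring_hom ?B A"
    by (rule ring_hom_memI) (fact closed mult add' one)+
  then show ?thesis
    unfolding K_algebra_hom_def using smult by blast
qed

end

subsection \<open>Quotients\<close>

lemma (in K_alg) smult_uminus:
  assumes "x \<in> carrier A" shows "c \<odot> (\<ominus> x) = \<ominus> (c \<odot> x)"
  using assms smult_minus[of x 1] smult_minus[of x c] smult_smult[of x c "- 1"] by simp

locale K_quot = K_alg A for A :: "'a K_algebra" (structure) +
  fixes R :: "'a set"
  assumes R: "R \<subseteq> carrier A"
begin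

abbreviation "I \<equiv> Idl\<^bsub>A\<^esub> R"
abbreviation "Q \<equiv> algebra_quot A R"
abbreviation "cls \<equiv> algebra_class A R"

lemma I: "ideal I A"
  by (rule genideal_ideal) (rule R)

sublocale I: ideal I A
  by (rule I)

lemma cls_eq_iff:
  "x \<in> carrier A \<Longrightarrow> y \<in> carrier A \<Longrightarrow> cls x = cls y \<longleftrightarrow> x \<ominus> y \<in> I"
  unfolding algebra_class_def by (simp add: quotient_eq_iff_same_a_r_cos[OF I])

lemma cls_self: "x \<in> carrier A \<Longrightarrow> x \<in> cls x"
  unfolding algebra_class_def by (rule I.a_rcos_self)

lemma mem_cls:
  assumes "x \<in> carrier A" "y \<in> cls x"
  shows "y \<in> carrier A" "cls y = cls x"
  using assms I.a_repr_independence'[of y x] I.a_elemrcos_carrier[of x y]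
  unfolding algebra_class_def by auto

text \<open>The ideal is only a ring ideal, but c x = (c 1) x makes it stable under scalars.\<close>

lemma I_smult: "x \<in> I \<Longrightarrow> c \<odot> x \<in> I"
proof -
  assume x: "x \<in> I"
  then have "c \<odot> x = (c \<odot> \<one>) \<otimes> x"
    using I.Icarr smult_mult_l by simp
  then show ?thesis
    using x by (simp add: I.I_l_closed)
qed

lemma carrier_quot: "carrier Q = cls ` carrier A"
  by (auto simp: algebra_quot_def Let_def FactRing_def A_RCOSETS_def RCOSETS_def algebra_class_def
      a_r_coset_def)

lemma quotE:
  assumes "C \<in> carrier Q" obtains x where "x \<in> carrier A" "C = cls x"
  using assms by (auto simp: carrier_quot)

lemma quot_ops:
  assumes "x \<in> carrier A" "y \<in> carrier A"
  shows "cls x \<oplus>\<^bsub>Q\<^esub> cls y = cls (x \<oplus> y)" "cls x \<otimes>\<^bsub>Q\<^esub> cls y = cls (x \<otimes> y)"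
  using assms ring_hom_add[OF I.rcos_ring_hom, of x y] ring_hom_mult[OF I.rcos_ring_hom, of x y]
  by (simp_all add: algebra_quot_def Let_def algebra_class_def)

lemma quot_one: "\<one>\<^bsub>Q\<^esub> = cls \<one>"
  by (simp add: algebra_quot_def Let_def FactRing_def algebra_class_def)

lemma quot_zero: "\<zero>\<^bsub>Q\<^esub> = cls \<zero>"
  unfolding algebra_class_def
  by (simp add: algebra_quot_def Let_def FactRing_def I.a_rcos_const)

text \<open>The scalar action on a coset is encoded as a union over all representatives; the union
  collapses because each representative yields the same coset, the ideal being stable under
  scalars.\<close>

lemma quot_smult:
  assumes x: "x \<in> carrier A"
  shows "c \<odot>\<^bsub>Q\<^esub> cls x = cls (c \<odot> x)"
proof -
  have "cls (c \<odot> y) = cls (c \<odot> x)" if y: "y \<in> cls x" for y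
  proof -
    have yc: "y \<in> carrier A" and "y \<ominus> x \<in> I"
      using mem_cls[OF x y] cls_eq_iff x by auto
    then have "c \<odot> (y \<ominus> x) \<in> I"
      by (blast intro: I_smult)
    moreover have "c \<odot> (y \<ominus> x) = c \<odot> y \<ominus> c \<odot> x"
      using x yc by (simp add: a_minus_def smult_r_distr smult_uminus)
    ultimately show ?thesis
      using x yc by (simp add: cls_eq_iff)
  qed
  then have "(\<Union>y\<in>cls x. cls (c \<odot> y)) = cls (c \<odot> x)"
    using cls_self[OF x] by blast
  then show ?thesis
    by (simp add: algebra_quot_def Let_def)
qed

lemma ring_Q: "ring Q"
proof (intro ringI abelian_groupI monoidI)
  fix P assume P: "P \<in> carrier Q"
  then obtain x where x: "x \<in> carrier A" and Xx: "P = cls x"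
    by (rule quotE)
  have "cls (\<ominus> x) \<oplus>\<^bsub>Q\<^esub> P = \<zero>\<^bsub>Q\<^esub>"
    using x by (simp add: Xx quot_ops quot_zero l_neg)
  then show "\<exists>P'\<in>carrier Q. P' \<oplus>\<^bsub>Q\<^esub> P = \<zero>\<^bsub>Q\<^esub>"
    using x by (auto simp: carrier_quot)
  show "\<zero>\<^bsub>Q\<^esub> \<oplus>\<^bsub>Q\<^esub> P = P" "\<one>\<^bsub>Q\<^esub> \<otimes>\<^bsub>Q\<^esub> P = P" "P \<otimes>\<^bsub>Q\<^esub> \<one>\<^bsub>Q\<^esub> = P"
    using x by (simp_all add: Xx quot_ops quot_zero quot_one)
  fix P' assume "P' \<in> carrier Q"
  then obtain y where y: "y \<in> carrier A" and Yy: "P' = cls y"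
    by (rule quotE)
  show "P \<oplus>\<^bsub>Q\<^esub> P' = P' \<oplus>\<^bsub>Q\<^esub> P"
    using x y by (simp add: Xx Yy quot_ops a_comm)
  show "P \<oplus>\<^bsub>Q\<^esub> P' \<in> carrier Q" "P \<otimes>\<^bsub>Q\<^esub> P' \<in> carrier Q"
    using x y by (simp_all add: Xx Yy quot_ops carrier_quot)
  fix P'' assume "P'' \<in> carrier Q"
  then obtain z where z: "z \<in> carrier A" and Zz: "P'' = cls z"
    by (rule quotE)
  show "P \<oplus>\<^bsub>Q\<^esub> P' \<oplus>\<^bsub>Q\<^esub> P'' = P \<oplus>\<^bsub>Q\<^esub> (P' \<oplus>\<^bsub>Q\<^esub> P'')"
    "P \<otimes>\<^bsub>Q\<^esub> P' \<otimes>\<^bsub>Q\<^esub> P'' = P \<otimes>\<^bsub>Q\<^esub> (P' \<otimes>\<^bsub>Q\<^esub> P'')"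
    "(P \<oplus>\<^bsub>Q\<^esub> P') \<otimes>\<^bsub>Q\<^esub> P'' = P \<otimes>\<^bsub>Q\<^esub> P'' \<oplus>\<^bsub>Q\<^esub> P' \<otimes>\<^bsub>Q\<^esub> P''"
    "P'' \<otimes>\<^bsub>Q\<^esub> (P \<oplus>\<^bsub>Q\<^esub> P') = P'' \<otimes>\<^bsub>Q\<^esub> P \<oplus>\<^bsub>Q\<^esub> P'' \<otimes>\<^bsub>Q\<^esub> P'"
    using x y z by (simp_all add: Xx Yy Zz quot_ops a_assoc m_assoc l_distr r_distr)
qed (simp_all add: quot_zero quot_one carrier_quot)

lemma K_alg_Q: "K_alg Q"
proof (intro K_alg.intro K_alg_axioms.intro ring_Q)
  fix P c c' assume P: "P \<in> carrier Q"
  then obtain x where x: "x \<in> carrier A" and Xx: "P = cls x"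
    by (rule quotE)
  show "c \<odot>\<^bsub>Q\<^esub> P \<in> carrier Q" "1 \<odot>\<^bsub>Q\<^esub> P = P" "c \<odot>\<^bsub>Q\<^esub> (c' \<odot>\<^bsub>Q\<^esub> P) = (c * c') \<odot>\<^bsub>Q\<^esub> P"
    "(c + c') \<odot>\<^bsub>Q\<^esub> P = c \<odot>\<^bsub>Q\<^esub> P \<oplus>\<^bsub>Q\<^esub> c' \<odot>\<^bsub>Q\<^esub> P"
    using x by (simp_all add: Xx quot_smult carrier_quot quot_ops smult_smult smult_l_distr)
  fix P' assume "P' \<in> carrier Q"
  then obtain y where y: "y \<in> carrier A" and Yy: "P' = cls y"
    by (rule quotE)
  show "c \<odot>\<^bsub>Q\<^esub> (P \<oplus>\<^bsub>Q\<^esub> P') = c \<odot>\<^bsub>Q\<^esub> P \<oplus>\<^bsub>Q\<^esub> c \<odot>\<^bsub>Q\<^esub> P'"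
    "(c \<odot>\<^bsub>Q\<^esub> P) \<otimes>\<^bsub>Q\<^esub> P' = c \<odot>\<^bsub>Q\<^esub> (P \<otimes>\<^bsub>Q\<^esub> P')"
    "P \<otimes>\<^bsub>Q\<^esub> (c \<odot>\<^bsub>Q\<^esub> P') = c \<odot>\<^bsub>Q\<^esub> (P \<otimes>\<^bsub>Q\<^esub> P')"
    using x y by (simp_all add: Xx Yy quot_ops quot_smult smult_r_distr smult_mult_l smult_mult_r)
qed

sublocale Q: K_alg Q
  by (rule K_alg_Q)

lemma cls_hom: "cls \<in> K_algebra_hom A Q"
  by (auto simp: K_algebra_hom_def ring_hom_def carrier_quot quot_ops quot_one quot_smult)

lemma K_hom_cls: "K_hom A Q cls"
  by (intro K_hom.intro K_hom_axioms.intro K_alg_axioms K_alg_Q cls_hom)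

lemma cls_zero_rel: "r \<in> R \<Longrightarrow> cls r = \<zero>\<^bsub>Q\<^esub>"
proof -
  assume r: "r \<in> R"
  then have "r \<in> I"
    using genideal_self[OF R] by blast
  moreover have "r \<in> carrier A"
    using r R by blast
  moreover from this have "r \<ominus> \<zero> = r"
    by (simp add: a_minus_def)
  ultimately show ?thesis
    by (simp add: quot_zero cls_eq_iff)
qed

text \<open>Minimality of the generated ideal. It is used twice: for the kernel of a homomorphism in
  \<open>hom_lift\<close>, and in \<open>lin_ideal\<close> for a linear form, where the kernel has
  to be replaced by a smaller set that is an ideal.\<close>

lemma I_subset_kernel:
  assumes Z: "subgroup Z (add_monoid A)" "R \<subseteq> Z"
    and mult: "\<And>x z. z \<in> Z \<Longrightarrow> x \<in> carrier A \<Longrightarrow> x \<otimes> z \<in> Z"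
      "\<And>x z. z \<in> Z \<Longrightarrow> x \<in> carrier A \<Longrightarrow> z \<otimes> x \<in> Z"
  shows "I \<subseteq> Z"
  by (rule genideal_minimal, rule idealI) (fact ring_axioms Z mult)+

lemma hom_lift:
  assumes "K_alg B" "f \<in> K_algebra_hom A B" and rel: "\<And>r. r \<in> R \<Longrightarrow> f r = \<zero>\<^bsub>B\<^esub>"
  obtains g where "g \<in> K_algebra_hom Q B" "\<And>x. x \<in> carrier A \<Longrightarrow> g (cls x) = f x"
proof -
  interpret B: K_alg B by fact
  interpret f: K_hom A B f by (intro K_hom.intro K_hom_axioms.intro K_alg_axioms assms)
  define Z where "Z = {x \<in> carrier A. f x = \<zero>\<^bsub>B\<^esub>}"
  have "I \<subseteq> Z"
  proof (rule I_subset_kernel)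
    show "subgroup Z (add_monoid A)"
      by (rule add.subgroupI) (auto simp: Z_def)
    show "R \<subseteq> Z"
      using R rel by (auto simp: Z_def)
  qed (simp_all add: Z_def)
  have eq: "f x = f y" if "x \<in> carrier A" "y \<in> carrier A" "cls x = cls y" for x y
  proof -
    have "x \<ominus> y \<in> Z"
      using that \<open>I \<subseteq> Z\<close> by (auto simp: cls_eq_iff)
    then have "f x \<oplus>\<^bsub>B\<^esub> \<ominus>\<^bsub>B\<^esub> f y = \<zero>\<^bsub>B\<^esub>"
      using that by (simp add: a_minus_def Z_def)
    then show ?thesis
      using that by (simp add: B.add.inv_solve_right')
  qed
  \<comment> \<open>The representative is arbitrary; \<open>eq\<close> turns this into a rule that
    evaluates \<open>g\<close> on every class.\<close>
  define g where "g C = f (SOME x. x \<in> carrier A \<and> cls x = C)" for C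
  have g: "g (cls x) = f x" if "x \<in> carrier A" for x
    unfolding g_def
  proof (rule someI2)
    show "x \<in> carrier A \<and> cls x = cls x"
      using that by simp
  qed (use that eq in blast)
  have "g \<in> ring_hom Q B"
    by (rule ring_hom_memI) (auto simp: carrier_quot quot_ops quot_one g)
  then have "g \<in> K_algebra_hom Q B"
    by (auto simp: K_algebra_hom_def carrier_quot quot_smult g)
  with g show ?thesis
    using that by blast
qed

end

subsection \<open>Matrices and direct sums\<close>

lemma mat_algebra_simps [simp]:
  "carrier (mat_algebra J A) = (\<Pi>\<^sub>E i\<in>J. \<Pi>\<^sub>E j\<in>J. carrier A)"
  "\<one>\<^bsub>mat_algebra J A\<^esub> = (\<lambda>i\<in>J. \<lambda>j\<in>J. if i = j then \<one>\<^bsub>A\<^esub> else \<zero>\<^bsub>A\<^esub>)"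
  "\<zero>\<^bsub>mat_algebra J A\<^esub> = (\<lambda>i\<in>J. \<lambda>j\<in>J. \<zero>\<^bsub>A\<^esub>)"
  "M \<oplus>\<^bsub>mat_algebra J A\<^esub> N = (\<lambda>i\<in>J. \<lambda>j\<in>J. M i j \<oplus>\<^bsub>A\<^esub> N i j)"
  "M \<otimes>\<^bsub>mat_algebra J A\<^esub> N = (\<lambda>i\<in>J. \<lambda>j\<in>J. \<Oplus>\<^bsub>A\<^esub>k\<in>J. M i k \<otimes>\<^bsub>A\<^esub> N k j)"
  "c \<odot>\<^bsub>mat_algebra J A\<^esub> M = (\<lambda>i\<in>J. \<lambda>j\<in>J. c \<odot>\<^bsub>A\<^esub> M i j)"
  by (simp_all add: mat_algebra_def)

lemma direct_sum_simps [simp]: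
  "carrier (direct_sum J B) = (\<Pi>\<^sub>E j\<in>J. carrier (B j))"
  "\<one>\<^bsub>direct_sum J B\<^esub> = (\<lambda>j\<in>J. \<one>\<^bsub>B j\<^esub>)"
  "\<zero>\<^bsub>direct_sum J B\<^esub> = (\<lambda>j\<in>J. \<zero>\<^bsub>B j\<^esub>)"
  "x \<oplus>\<^bsub>direct_sum J B\<^esub> y = (\<lambda>j\<in>J. x j \<oplus>\<^bsub>B j\<^esub> y j)"
  "x \<otimes>\<^bsub>direct_sum J B\<^esub> y = (\<lambda>j\<in>J. x j \<otimes>\<^bsub>B j\<^esub> y j)"
  "c \<odot>\<^bsub>direct_sum J B\<^esub> x = (\<lambda>j\<in>J. c \<odot>\<^bsub>B j\<^esub> x j)"
  by (simp_all add: direct_sum_def)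

lemma (in abelian_monoid) finsum_swap:
  assumes "finite S" "finite U" "\<And>i j. i \<in> S \<Longrightarrow> j \<in> U \<Longrightarrow> f i j \<in> carrier G"
  shows "(\<Oplus>i\<in>S. \<Oplus>j\<in>U. f i j) = (\<Oplus>j\<in>U. \<Oplus>i\<in>S. f i j)"
  using assms(1,3)
proof (induction S rule: finite_induct)
  case (insert x S)
  then have "(\<lambda>j. f x j) \<in> U \<rightarrow> carrier G" "(\<lambda>i. \<Oplus>j\<in>U. f i j) \<in> S \<rightarrow> carrier G"
    "(\<lambda>j. \<Oplus>i\<in>S. f i j) \<in> U \<rightarrow> carrier G"
    by (auto intro!: finsum_closed)
  moreover have "(\<Oplus>j\<in>U. \<Oplus>i\<in>insert x S. f i j) = (\<Oplus>j\<in>U. f x j \<oplus> (\<Oplus>i\<in>S. f i j))"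
    using insert by (intro finsum_cong') (auto intro!: finsum_closed)
  ultimately show ?case
    using insert by (simp add: finsum_addf)
qed simp

lemma (in ring) finsum_single:
  assumes "k \<in> S" "finite S" "x \<in> carrier R"
  shows "(\<Oplus>i\<in>S. if i = k then x else \<zero>) = x"
  using add.finprod_singleton_swap[of k S "\<lambda>_. x"] assms by simp

lemma K_alg_mat_algebra:
  assumes "K_alg A" "finite J"
  shows "K_alg (mat_algebra J A)"
proof -
  interpret K_alg A by fact
  let ?M = "mat_algebra J A"
  have fc: "(\<Oplus>\<^bsub>A\<^esub>k\<in>J. f k) \<in> carrier A" if "\<And>k. k \<in> J \<Longrightarrow> f k \<in> carrier A" for f
    using that by (intro finsum_closed) auto
  have ent: "x i j \<in> carrier A" if "x \<in> carrier ?M" "i \<in> J" "j \<in> J" for x i j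
    using that by (auto simp: PiE_iff)
  have ext: "x = y" if "x \<in> carrier ?M" "y \<in> carrier ?M" "\<And>i j. i \<in> J \<Longrightarrow> j \<in> J \<Longrightarrow> x i j = y i j" for x y
  proof (rule PiE_ext)
    show "x i = y i" if i: "i \<in> J" for i
      by (rule PiE_ext[of "x i" J "\<lambda>_. carrier A"])
        (use i \<open>x \<in> carrier ?M\<close> \<open>y \<in> carrier ?M\<close> \<open>\<And>i j. i \<in> J \<Longrightarrow> j \<in> J \<Longrightarrow> x i j = y i j\<close> in auto)
  qed (use that in simp_all)
  have mc: "x \<otimes>\<^bsub>?M\<^esub> y \<in> carrier ?M" if "x \<in> carrier ?M" "y \<in> carrier ?M" for x y
    using ent[OF that(1)] ent[OF that(2)] by (auto intro!: fc)
  have ac: "x \<oplus>\<^bsub>?M\<^esub> y \<in> carrier ?M" if "x \<in> carrier ?M" "y \<in> carrier ?M" for x y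
    using ent[OF that(1)] ent[OF that(2)] by auto
  have sc: "c \<odot>\<^bsub>?M\<^esub> x \<in> carrier ?M" if "x \<in> carrier ?M" for c x
    using ent[OF that(1)] by auto
  have oc: "\<one>\<^bsub>?M\<^esub> \<in> carrier ?M" "\<zero>\<^bsub>?M\<^esub> \<in> carrier ?M"
    by auto
  have assoc: "(x \<otimes>\<^bsub>?M\<^esub> y) \<otimes>\<^bsub>?M\<^esub> z = x \<otimes>\<^bsub>?M\<^esub> (y \<otimes>\<^bsub>?M\<^esub> z)"
    if xyz: "x \<in> carrier ?M" "y \<in> carrier ?M" "z \<in> carrier ?M" for x y z
  proof (rule ext)
    fix i j assume ij: "i \<in> J" "j \<in> J"
    note e = ent[OF xyz(1)] ent[OF xyz(2)] ent[OF xyz(3)]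
    have "((x \<otimes>\<^bsub>?M\<^esub> y) \<otimes>\<^bsub>?M\<^esub> z) i j
        = (\<Oplus>\<^bsub>A\<^esub>k\<in>J. (\<Oplus>\<^bsub>A\<^esub>l\<in>J. x i l \<otimes>\<^bsub>A\<^esub> y l k \<otimes>\<^bsub>A\<^esub> z k j))"
      using ij e by (auto intro!: finsum_cong' fc simp: finsum_ldistr assms Pi_iff)
    also have "\<dots> = (\<Oplus>\<^bsub>A\<^esub>l\<in>J. (\<Oplus>\<^bsub>A\<^esub>k\<in>J. x i l \<otimes>\<^bsub>A\<^esub> y l k \<otimes>\<^bsub>A\<^esub> z k j))"
      using ij e by (intro finsum_swap) (auto simp: assms)
    also have "\<dots> = (x \<otimes>\<^bsub>?M\<^esub> (y \<otimes>\<^bsub>?M\<^esub> z)) i j"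
      using ij e by (auto intro!: finsum_cong' fc simp: finsum_rdistr assms Pi_iff m_assoc)
    finally show "((x \<otimes>\<^bsub>?M\<^esub> y) \<otimes>\<^bsub>?M\<^esub> z) i j = (x \<otimes>\<^bsub>?M\<^esub> (y \<otimes>\<^bsub>?M\<^esub> z)) i j" .
  qed (intro mc xyz)+
  have one: "\<one>\<^bsub>?M\<^esub> \<otimes>\<^bsub>?M\<^esub> x = x" "x \<otimes>\<^bsub>?M\<^esub> \<one>\<^bsub>?M\<^esub> = x" if x: "x \<in> carrier ?M" for x
  proof -
    show "\<one>\<^bsub>?M\<^esub> \<otimes>\<^bsub>?M\<^esub> x = x"
    proof (rule ext)
      fix i j assume ij: "i \<in> J" "j \<in> J"
      have "(\<one>\<^bsub>?M\<^esub> \<otimes>\<^bsub>?M\<^esub> x) i j = (\<Oplus>\<^bsub>A\<^esub>k\<in>J. if k = i then x i j else \<zero>\<^bsub>A\<^esub>)"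
        using ij ent[OF x] by (auto intro!: finsum_cong')
      then show "(\<one>\<^bsub>?M\<^esub> \<otimes>\<^bsub>?M\<^esub> x) i j = x i j"
        using ij ent[OF x] assms by (simp add: finsum_single)
    qed (intro mc oc x)+
    show "x \<otimes>\<^bsub>?M\<^esub> \<one>\<^bsub>?M\<^esub> = x"
    proof (rule ext)
      fix i j assume ij: "i \<in> J" "j \<in> J"
      have "(x \<otimes>\<^bsub>?M\<^esub> \<one>\<^bsub>?M\<^esub>) i j = (\<Oplus>\<^bsub>A\<^esub>k\<in>J. if k = j then x i j else \<zero>\<^bsub>A\<^esub>)"
        using ij ent[OF x] by (auto intro!: finsum_cong')
      then show "(x \<otimes>\<^bsub>?M\<^esub> \<one>\<^bsub>?M\<^esub>) i j = x i j"
        using ij ent[OF x] assms by (simp add: finsum_single)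
    qed (intro mc oc x)+
  qed
  have dist: "(x \<oplus>\<^bsub>?M\<^esub> y) \<otimes>\<^bsub>?M\<^esub> z = x \<otimes>\<^bsub>?M\<^esub> z \<oplus>\<^bsub>?M\<^esub> y \<otimes>\<^bsub>?M\<^esub> z"
    "z \<otimes>\<^bsub>?M\<^esub> (x \<oplus>\<^bsub>?M\<^esub> y) = z \<otimes>\<^bsub>?M\<^esub> x \<oplus>\<^bsub>?M\<^esub> z \<otimes>\<^bsub>?M\<^esub> y"
    if xyz: "x \<in> carrier ?M" "y \<in> carrier ?M" "z \<in> carrier ?M" for x y z
  proof -
    note e = ent[OF xyz(1)] ent[OF xyz(2)] ent[OF xyz(3)]
    have p: "(\<lambda>k. x i k \<otimes>\<^bsub>A\<^esub> z k j) \<in> J \<rightarrow> carrier A" "(\<lambda>k. y i k \<otimes>\<^bsub>A\<^esub> z k j) \<in> J \<rightarrow> carrier A"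
      "(\<lambda>k. z i k \<otimes>\<^bsub>A\<^esub> x k j) \<in> J \<rightarrow> carrier A" "(\<lambda>k. z i k \<otimes>\<^bsub>A\<^esub> y k j) \<in> J \<rightarrow> carrier A"
      if "i \<in> J" "j \<in> J" for i j
      using that e by auto
    show "(x \<oplus>\<^bsub>?M\<^esub> y) \<otimes>\<^bsub>?M\<^esub> z = x \<otimes>\<^bsub>?M\<^esub> z \<oplus>\<^bsub>?M\<^esub> y \<otimes>\<^bsub>?M\<^esub> z"
    proof (rule ext)
      fix i j assume ij: "i \<in> J" "j \<in> J"
      have "((x \<oplus>\<^bsub>?M\<^esub> y) \<otimes>\<^bsub>?M\<^esub> z) i j = (\<Oplus>\<^bsub>A\<^esub>k\<in>J. (x \<oplus>\<^bsub>?M\<^esub> y) i k \<otimes>\<^bsub>A\<^esub> z k j)"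
        using ij by simp
      also have "\<dots> = (\<Oplus>\<^bsub>A\<^esub>k\<in>J. x i k \<otimes>\<^bsub>A\<^esub> z k j \<oplus>\<^bsub>A\<^esub> y i k \<otimes>\<^bsub>A\<^esub> z k j)"
        by (rule finsum_cong') (use ij e in \<open>auto simp: l_distr\<close>)
      finally show "((x \<oplus>\<^bsub>?M\<^esub> y) \<otimes>\<^bsub>?M\<^esub> z) i j = (x \<otimes>\<^bsub>?M\<^esub> z \<oplus>\<^bsub>?M\<^esub> y \<otimes>\<^bsub>?M\<^esub> z) i j"
        using ij finsum_addf[OF p(1,2)[OF ij]] by simp
    qed (intro mc ac xyz)+
    show "z \<otimes>\<^bsub>?M\<^esub> (x \<oplus>\<^bsub>?M\<^esub> y) = z \<otimes>\<^bsub>?M\<^esub> x \<oplus>\<^bsub>?M\<^esub> z \<otimes>\<^bsub>?M\<^esub> y"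
    proof (rule ext)
      fix i j assume ij: "i \<in> J" "j \<in> J"
      have "(z \<otimes>\<^bsub>?M\<^esub> (x \<oplus>\<^bsub>?M\<^esub> y)) i j = (\<Oplus>\<^bsub>A\<^esub>k\<in>J. z i k \<otimes>\<^bsub>A\<^esub> (x \<oplus>\<^bsub>?M\<^esub> y) k j)"
        using ij by simp
      also have "\<dots> = (\<Oplus>\<^bsub>A\<^esub>k\<in>J. z i k \<otimes>\<^bsub>A\<^esub> x k j \<oplus>\<^bsub>A\<^esub> z i k \<otimes>\<^bsub>A\<^esub> y k j)"
        by (rule finsum_cong') (use ij e in \<open>auto simp: r_distr\<close>)
      finally show "(z \<otimes>\<^bsub>?M\<^esub> (x \<oplus>\<^bsub>?M\<^esub> y)) i j = (z \<otimes>\<^bsub>?M\<^esub> x \<oplus>\<^bsub>?M\<^esub> z \<otimes>\<^bsub>?M\<^esub> y) i j"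
        using ij finsum_addf[OF p(3,4)[OF ij]] by simp
    qed (intro mc ac xyz)+
  qed
  have smult: "(c \<odot>\<^bsub>?M\<^esub> x) \<otimes>\<^bsub>?M\<^esub> y = c \<odot>\<^bsub>?M\<^esub> (x \<otimes>\<^bsub>?M\<^esub> y)"
    "x \<otimes>\<^bsub>?M\<^esub> (c \<odot>\<^bsub>?M\<^esub> y) = c \<odot>\<^bsub>?M\<^esub> (x \<otimes>\<^bsub>?M\<^esub> y)"
    if xy: "x \<in> carrier ?M" "y \<in> carrier ?M" for c x y
  proof -
    note e = ent[OF xy(1)] ent[OF xy(2)]
    have p: "(\<lambda>k. x i k \<otimes>\<^bsub>A\<^esub> y k j) \<in> J \<rightarrow> carrier A" if "i \<in> J" "j \<in> J" for i j
      using that e by auto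
    show "(c \<odot>\<^bsub>?M\<^esub> x) \<otimes>\<^bsub>?M\<^esub> y = c \<odot>\<^bsub>?M\<^esub> (x \<otimes>\<^bsub>?M\<^esub> y)"
    proof (rule ext)
      fix i j assume ij: "i \<in> J" "j \<in> J"
      show "((c \<odot>\<^bsub>?M\<^esub> x) \<otimes>\<^bsub>?M\<^esub> y) i j = (c \<odot>\<^bsub>?M\<^esub> (x \<otimes>\<^bsub>?M\<^esub> y)) i j"
        using ij e by (auto simp: smult_finsum[OF p] smult_mult_l intro!: finsum_cong')
    qed (intro mc sc xy)+
    show "x \<otimes>\<^bsub>?M\<^esub> (c \<odot>\<^bsub>?M\<^esub> y) = c \<odot>\<^bsub>?M\<^esub> (x \<otimes>\<^bsub>?M\<^esub> y)"
    proof (rule ext)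
      fix i j assume ij: "i \<in> J" "j \<in> J"
      show "(x \<otimes>\<^bsub>?M\<^esub> (c \<odot>\<^bsub>?M\<^esub> y)) i j = (c \<odot>\<^bsub>?M\<^esub> (x \<otimes>\<^bsub>?M\<^esub> y)) i j"
        using ij e by (auto simp: smult_finsum[OF p] smult_mult_r intro!: finsum_cong')
    qed (intro mc sc xy)+
  qed
  have "ring ?M"
  proof (intro ringI abelian_groupI monoidI)
    fix x assume x: "x \<in> carrier ?M"
    show "\<exists>y\<in>carrier ?M. y \<oplus>\<^bsub>?M\<^esub> x = \<zero>\<^bsub>?M\<^esub>"
      by (rule bexI[of _ "\<lambda>i\<in>J. \<lambda>j\<in>J. \<ominus>\<^bsub>A\<^esub> x i j"])
        (use ent[OF x] in \<open>auto simp: l_neg intro!: restrict_ext\<close>)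
    show "\<zero>\<^bsub>?M\<^esub> \<oplus>\<^bsub>?M\<^esub> x = x"
      by (rule ext) (use x ent[OF x] in \<open>auto intro!: ac oc\<close>)
    fix y assume y: "y \<in> carrier ?M"
    show "x \<oplus>\<^bsub>?M\<^esub> y = y \<oplus>\<^bsub>?M\<^esub> x"
      using ent[OF x] ent[OF y] by (auto intro!: restrict_ext simp: a_comm)
    fix z assume z: "z \<in> carrier ?M"
    show "x \<oplus>\<^bsub>?M\<^esub> y \<oplus>\<^bsub>?M\<^esub> z = x \<oplus>\<^bsub>?M\<^esub> (y \<oplus>\<^bsub>?M\<^esub> z)"
      using ent[OF x] ent[OF y] ent[OF z] by (auto intro!: restrict_ext simp: a_assoc)
  qed (fact mc ac oc assoc one dist)+
  then show ?thesis
  proof (intro K_alg.intro K_alg_axioms.intro sc smult)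
    fix x c c' assume x: "x \<in> carrier ?M"
    show "1 \<odot>\<^bsub>?M\<^esub> x = x"
      by (rule ext) (use x ent[OF x] in \<open>auto intro!: sc\<close>)
    show "(c + c') \<odot>\<^bsub>?M\<^esub> x = c \<odot>\<^bsub>?M\<^esub> x \<oplus>\<^bsub>?M\<^esub> c' \<odot>\<^bsub>?M\<^esub> x"
      "c \<odot>\<^bsub>?M\<^esub> (c' \<odot>\<^bsub>?M\<^esub> x) = (c * c') \<odot>\<^bsub>?M\<^esub> x"
      using ent[OF x] by (auto intro!: restrict_ext simp: smult_l_distr smult_smult)
    fix y assume y: "y \<in> carrier ?M"
    show "c \<odot>\<^bsub>?M\<^esub> (x \<oplus>\<^bsub>?M\<^esub> y) = c \<odot>\<^bsub>?M\<^esub> x \<oplus>\<^bsub>?M\<^esub> c \<odot>\<^bsub>?M\<^esub> y"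
      using ent[OF x] ent[OF y] by (auto intro!: restrict_ext simp: smult_r_distr)
  qed
qed

lemma K_alg_direct_sum:
  assumes "\<And>j. j \<in> J \<Longrightarrow> K_alg (B j)"
  shows "K_alg (direct_sum J B)"
proof -
  let ?S = "direct_sum J B"
  note r = assms[THEN K_alg.axioms(1)]
  have sr: "semiring (B j)" if "j \<in> J" for j
  proof -
    interpret ring "B j"
      by (rule r) fact
    show ?thesis
      by unfold_locales
  qed
  note am = r[THEN ring.is_abelian_group, THEN abelian_group.axioms(1)]
  note m = r[THEN ring.is_monoid]
  have ext: "x = y" if "x \<in> carrier ?S" "y \<in> carrier ?S" "\<And>j. j \<in> J \<Longrightarrow> x j = y j" for x y
    using that by (auto intro!: PiE_ext[of x J _ y])
  have ent: "x j \<in> carrier (B j)" if "x \<in> carrier ?S" "j \<in> J" for x j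
    using that by (auto simp: PiE_iff)
  have mc: "x \<otimes>\<^bsub>?S\<^esub> y \<in> carrier ?S" if "x \<in> carrier ?S" "y \<in> carrier ?S" for x y
    using ent[OF that(1)] ent[OF that(2)] by (auto simp: monoid.m_closed[OF m])
  have ac: "x \<oplus>\<^bsub>?S\<^esub> y \<in> carrier ?S" if "x \<in> carrier ?S" "y \<in> carrier ?S" for x y
    using ent[OF that(1)] ent[OF that(2)] by (auto simp: abelian_monoid.a_closed[OF am])
  have sc: "c \<odot>\<^bsub>?S\<^esub> x \<in> carrier ?S" if "x \<in> carrier ?S" for c x
    using ent[OF that(1)] by (auto simp: K_alg.smult_closed[OF assms])
  have oc: "\<one>\<^bsub>?S\<^esub> \<in> carrier ?S" "\<zero>\<^bsub>?S\<^esub> \<in> carrier ?S"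
    by (auto simp: monoid.one_closed[OF m] abelian_monoid.zero_closed[OF am])
  have ring: "ring ?S"
  proof (intro ringI abelian_groupI monoidI)
    fix x assume x: "x \<in> carrier ?S"
    show "\<exists>y\<in>carrier ?S. y \<oplus>\<^bsub>?S\<^esub> x = \<zero>\<^bsub>?S\<^esub>"
      by (rule bexI[of _ "\<lambda>j\<in>J. \<ominus>\<^bsub>B j\<^esub> x j"])
        (use ent[OF x] in \<open>auto simp: abelian_group.l_neg[OF ring.is_abelian_group[OF r]]
          abelian_group.a_inv_closed[OF ring.is_abelian_group[OF r]] intro!: restrict_ext\<close>)
    show "\<zero>\<^bsub>?S\<^esub> \<oplus>\<^bsub>?S\<^esub> x = x"
      by (rule ext) (use ent[OF x] x ac oc in \<open>auto simp: abelian_monoid.l_zero[OF am]\<close>)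
    show "\<one>\<^bsub>?S\<^esub> \<otimes>\<^bsub>?S\<^esub> x = x"
      by (rule ext) (use ent[OF x] x mc oc in \<open>auto simp: monoid.l_one[OF m]\<close>)
    show "x \<otimes>\<^bsub>?S\<^esub> \<one>\<^bsub>?S\<^esub> = x"
      by (rule ext) (use ent[OF x] x mc oc in \<open>auto simp: monoid.r_one[OF m]\<close>)
    fix y assume y: "y \<in> carrier ?S"
    show "x \<oplus>\<^bsub>?S\<^esub> y = y \<oplus>\<^bsub>?S\<^esub> x"
      using ent[OF x] ent[OF y] by (auto intro!: restrict_ext simp: abelian_monoid.a_comm[OF am])
    fix z assume z: "z \<in> carrier ?S"
    note e = ent[OF x] ent[OF y] ent[OF z]
    show "x \<oplus>\<^bsub>?S\<^esub> y \<oplus>\<^bsub>?S\<^esub> z = x \<oplus>\<^bsub>?S\<^esub> (y \<oplus>\<^bsub>?S\<^esub> z)"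
      using e by (auto intro!: restrict_ext simp: abelian_monoid.a_assoc[OF am])
    show "x \<otimes>\<^bsub>?S\<^esub> y \<otimes>\<^bsub>?S\<^esub> z = x \<otimes>\<^bsub>?S\<^esub> (y \<otimes>\<^bsub>?S\<^esub> z)"
      using e by (auto intro!: restrict_ext simp: monoid.m_assoc[OF m])
    show "(x \<oplus>\<^bsub>?S\<^esub> y) \<otimes>\<^bsub>?S\<^esub> z = x \<otimes>\<^bsub>?S\<^esub> z \<oplus>\<^bsub>?S\<^esub> y \<otimes>\<^bsub>?S\<^esub> z"
      "z \<otimes>\<^bsub>?S\<^esub> (x \<oplus>\<^bsub>?S\<^esub> y) = z \<otimes>\<^bsub>?S\<^esub> x \<oplus>\<^bsub>?S\<^esub> z \<otimes>\<^bsub>?S\<^esub> y"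
      using e by (auto intro!: restrict_ext simp: semiring.l_distr[OF sr]
          semiring.r_distr[OF sr])
  qed (fact mc ac oc)+
  note K = K_alg.smult_l_distr[OF assms] K_alg.smult_r_distr[OF assms] K_alg.smult_smult[OF assms]
    K_alg.smult_one[OF assms] K_alg.smult_mult_l[OF assms] K_alg.smult_mult_r[OF assms]
  show ?thesis
  proof (intro K_alg.intro K_alg_axioms.intro ring sc)
    fix x c c' assume x: "x \<in> carrier ?S"
    show "1 \<odot>\<^bsub>?S\<^esub> x = x"
      by (rule ext) (use ent[OF x] x sc in \<open>auto simp: K\<close>)
    show "(c + c') \<odot>\<^bsub>?S\<^esub> x = c \<odot>\<^bsub>?S\<^esub> x \<oplus>\<^bsub>?S\<^esub> c' \<odot>\<^bsub>?S\<^esub> x"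
      "c \<odot>\<^bsub>?S\<^esub> (c' \<odot>\<^bsub>?S\<^esub> x) = (c * c') \<odot>\<^bsub>?S\<^esub> x"
      using ent[OF x] by (auto intro!: restrict_ext simp: K)
    fix y assume y: "y \<in> carrier ?S"
    show "c \<odot>\<^bsub>?S\<^esub> (x \<oplus>\<^bsub>?S\<^esub> y) = c \<odot>\<^bsub>?S\<^esub> x \<oplus>\<^bsub>?S\<^esub> c \<odot>\<^bsub>?S\<^esub> y"
      "(c \<odot>\<^bsub>?S\<^esub> x) \<otimes>\<^bsub>?S\<^esub> y = c \<odot>\<^bsub>?S\<^esub> (x \<otimes>\<^bsub>?S\<^esub> y)"
      "x \<otimes>\<^bsub>?S\<^esub> (c \<odot>\<^bsub>?S\<^esub> y) = c \<odot>\<^bsub>?S\<^esub> (x \<otimes>\<^bsub>?S\<^esub> y)"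
      using ent[OF x] ent[OF y] by (auto intro!: restrict_ext simp: K)
  qed
qed

subsection \<open>Tensor products\<close>

lemma monoid_algebra_mult_diff:
  "(p - p') \<otimes>\<^bsub>monoid_algebra M\<^esub> q = p \<otimes>\<^bsub>monoid_algebra M\<^esub> q - p' \<otimes>\<^bsub>monoid_algebra M\<^esub> q"
  "q \<otimes>\<^bsub>monoid_algebra M\<^esub> (p - p') = q \<otimes>\<^bsub>monoid_algebra M\<^esub> p - q \<otimes>\<^bsub>monoid_algebra M\<^esub> p'"
  using monoid_algebra_mult_distl[of M "p - p'" p' q, symmetric]
    monoid_algebra_mult_distr[of M q "p - p'" p', symmetric]
  by (simp_all add: eq_diff_eq)

lemma monoid_algebra_diff_closed [intro]:
  assumes "p \<in> carrier (monoid_algebra M)" "q \<in> carrier (monoid_algebra M)"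
  shows "p - q \<in> carrier (monoid_algebra M)"
proof -
  have "- q \<in> carrier (monoid_algebra M)"
    using assms by (simp add: in_keys_iff subset_iff)
  then show ?thesis
    using monoid_algebra_add_closed[of p M "- q"] assms by simp
qed

text \<open>The linear extension of \<open>F\<close> to formal combinations.
  \<open>tensor_form\<close> is this function, for the product of the given forms, evaluated at a
  chosen representative.\<close>

definition lin :: "('m \<Rightarrow> laurent) \<Rightarrow> ('m \<Rightarrow>\<^sub>0 laurent) \<Rightarrow> laurent" where
  "lin F p = (\<Sum>h\<in>Poly_Mapping.keys p. Poly_Mapping.lookup p h * F h)"

lemma lin_add: "lin F (p + q) = lin F p + lin F q"
  unfolding lin_def
  by (rule setsum_keys_plus_distrib[where f = "\<lambda>h c. c * F h"]) (simp_all add: distrib_right)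

lemma lin_single [simp]: "lin F (Poly_Mapping.single h c) = c * F h"
  by (simp add: lin_def)

lemma lin_zero [simp]: "lin F 0 = 0"
  by (simp add: lin_def)

lemma lin_diff: "lin F (p - q) = lin F p - lin F q"
  using lin_add[of F "p - q" q] by simp

lemma lin_smult: "lin F (Poly_Mapping.map ((*) c) p) = c * lin F p"
proof -
  \<comment> \<open>The multiplication that returns its first argument, on the whole type, puts
    every combination into a carrier, so that the induction rule applies to an arbitrary
    \<open>p\<close>.\<close>
  have "p \<in> carrier (monoid_algebra \<lparr>carrier = UNIV, monoid.mult = (\<lambda>x y. x), one = undefined\<rparr>)"
    by simp
  then show ?thesis
    by (induction p rule: monoid_algebra_induct)
      (simp_all add: lin_add map_mult_add distrib_left mult.assoc)
qed

locale tensor_alg =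
  fixes J :: "'i set" and A :: "'i \<Rightarrow> 'a K_algebra"
  assumes fin: "finite J" and A: "\<And>i. i \<in> J \<Longrightarrow> K_alg (A i)"
begin

abbreviation "PG \<equiv> product_group J A"
abbreviation "MA \<equiv> monoid_algebra PG"
abbreviation "rels \<equiv> multilinear_rels J A"
abbreviation "TT \<equiv> tensor J A"
abbreviation "pure \<equiv> pure_tensor J A"

lemma A_ring: "i \<in> J \<Longrightarrow> ring (A i)"
  using A by (auto dest: K_alg.axioms)

lemma A_monoid: "i \<in> J \<Longrightarrow> monoid (A i)"
  using A_ring ring.is_monoid by blast

lemma monoid_PG: "monoid PG"
  by (rule monoid_product_group) (rule A_monoid)

lemma A_simps:
  assumes "i \<in> J"
  shows "x \<in> carrier (A i) \<Longrightarrow> y \<in> carrier (A i) \<Longrightarrow> x \<otimes>\<^bsub>A i\<^esub> y \<in> carrier (A i)"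
    "x \<in> carrier (A i) \<Longrightarrow> y \<in> carrier (A i) \<Longrightarrow> x \<oplus>\<^bsub>A i\<^esub> y \<in> carrier (A i)"
    "x \<in> carrier (A i) \<Longrightarrow> c \<odot>\<^bsub>A i\<^esub> x \<in> carrier (A i)"
    "\<one>\<^bsub>A i\<^esub> \<in> carrier (A i)"
proof -
  interpret K_alg "A i" by (rule A) fact
  show "x \<in> carrier (A i) \<Longrightarrow> y \<in> carrier (A i) \<Longrightarrow> x \<otimes>\<^bsub>A i\<^esub> y \<in> carrier (A i)"
    "x \<in> carrier (A i) \<Longrightarrow> y \<in> carrier (A i) \<Longrightarrow> x \<oplus>\<^bsub>A i\<^esub> y \<in> carrier (A i)"
    "x \<in> carrier (A i) \<Longrightarrow> c \<odot>\<^bsub>A i\<^esub> x \<in> carrier (A i)"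
    "\<one>\<^bsub>A i\<^esub> \<in> carrier (A i)"
    by auto
qed

lemma rels_closed: "rels \<subseteq> carrier MA"
proof
  fix r assume "r \<in> rels"
  then consider h a x y where "h \<in> (\<Pi>\<^sub>E i\<in>J. carrier (A i))" "a \<in> J" "x \<in> carrier (A a)" "y \<in> carrier (A a)"
      "r = Poly_Mapping.single (h(a := x \<oplus>\<^bsub>A a\<^esub> y)) 1
        - Poly_Mapping.single (h(a := x)) 1 - Poly_Mapping.single (h(a := y)) 1"
    | h a c x where "h \<in> (\<Pi>\<^sub>E i\<in>J. carrier (A i))" "a \<in> J" "x \<in> carrier (A a)"
      "r = Poly_Mapping.single (h(a := c \<odot>\<^bsub>A a\<^esub> x)) 1 - Poly_Mapping.single (h(a := x)) c"
    unfolding multilinear_rels_def by blast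
  then show "r \<in> carrier MA"
  proof cases
    case 1
    then have "h(a := x \<oplus>\<^bsub>A a\<^esub> y) \<in> carrier PG" "h(a := x) \<in> carrier PG" "h(a := y) \<in> carrier PG"
      by (auto simp: PiE_iff A_simps extensional_def)
    then show ?thesis
      unfolding 1 by (intro monoid_algebra_diff_closed single_in_monoid_algebra)
  next
    case 2
    then have "h(a := c \<odot>\<^bsub>A a\<^esub> x) \<in> carrier PG" "h(a := x) \<in> carrier PG"
      by (auto simp: PiE_iff A_simps extensional_def)
    then show ?thesis
      unfolding 2 by (intro monoid_algebra_diff_closed single_in_monoid_algebra)
  qed
qed

lemma relsI:
  assumes "h \<in> (\<Pi>\<^sub>E i\<in>J. carrier (A i))" "a \<in> J" "x \<in> carrier (A a)"
  shows "y \<in> carrier (A a) \<Longrightarrow> Poly_Mapping.single (h(a := x \<oplus>\<^bsub>A a\<^esub> y)) 1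
      - Poly_Mapping.single (h(a := x)) 1 - Poly_Mapping.single (h(a := y)) 1 \<in> rels"
    and "Poly_Mapping.single (h(a := c \<odot>\<^bsub>A a\<^esub> x)) 1 - Poly_Mapping.single (h(a := x)) c \<in> rels"
  unfolding multilinear_rels_def using assms by blast+

sublocale Tq: K_quot MA rels
  by (intro K_quot.intro K_quot_axioms.intro K_alg_monoid_algebra monoid_PG rels_closed)

lemma TT_eq: "TT = algebra_quot MA rels"
  by (simp add: tensor_def)

lemma K_alg_TT: "K_alg TT"
  unfolding TT_eq by (rule Tq.K_alg_Q)

sublocale Tn: K_alg TT
  by (rule K_alg_TT)

lemma restrict_PG: "h \<in> (\<Pi> i\<in>J. carrier (A i)) \<Longrightarrow> restrict h J \<in> carrier PG"
  by auto

lemma pure_cls: "pure h = Tq.cls (Poly_Mapping.single (restrict h J) 1)"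
  by (simp add: pure_tensor_def)

lemma pure_restrict: "pure (restrict h J) = pure h"
  by (simp add: pure_cls)

lemma pure_cong: "(\<And>i. i \<in> J \<Longrightarrow> h i = k i) \<Longrightarrow> pure h = pure k"
  unfolding pure_cls by (metis restrict_ext)

lemma pure_closed: "h \<in> (\<Pi> i\<in>J. carrier (A i)) \<Longrightarrow> pure h \<in> carrier TT"
  unfolding pure_cls TT_eq Tq.carrier_quot
  by (intro imageI single_in_monoid_algebra restrict_PG)

lemma pure_mult:
  assumes "h \<in> (\<Pi> i\<in>J. carrier (A i))" "k \<in> (\<Pi> i\<in>J. carrier (A i))"
  shows "pure h \<otimes>\<^bsub>TT\<^esub> pure k = pure (\<lambda>i. h i \<otimes>\<^bsub>A i\<^esub> k i)"
proof -
  have "(\<lambda>i\<in>J. restrict h J i \<otimes>\<^bsub>A i\<^esub> restrict k J i) = (\<lambda>i\<in>J. h i \<otimes>\<^bsub>A i\<^esub> k i)"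
    by auto
  then show ?thesis
    unfolding pure_cls TT_eq
    using restrict_PG[OF assms(1)] restrict_PG[OF assms(2)]
    by (subst Tq.quot_ops) (simp_all del: monoid_algebra_simps(1))
qed

lemma pure_one: "pure (\<lambda>i. \<one>\<^bsub>A i\<^esub>) = \<one>\<^bsub>TT\<^esub>"
  by (simp add: pure_cls TT_eq Tq.quot_one)

lemma pure_add:
  assumes h: "h \<in> (\<Pi> i\<in>J. carrier (A i))" and a: "a \<in> J" "x \<in> carrier (A a)" "y \<in> carrier (A a)"
  shows "pure (h(a := x \<oplus>\<^bsub>A a\<^esub> y)) = pure (h(a := x)) \<oplus>\<^bsub>TT\<^esub> pure (h(a := y))"
proof -
  let ?h = "restrict h J" and ?s = "\<lambda>h. Poly_Mapping.single h (1::laurent)"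
  have eq: "restrict (h(a := z)) J = ?h(a := z)" for z
    using a by auto
  have "?s (?h(a := x \<oplus>\<^bsub>A a\<^esub> y)) - ?s (?h(a := x)) - ?s (?h(a := y)) \<in> rels"
    using a restrict_PG[OF h] by (intro relsI) simp_all
  from Tq.cls_zero_rel[OF this]
  have 0: "Tq.cls (?s (?h(a := x \<oplus>\<^bsub>A a\<^esub> y)) - ?s (?h(a := x)) - ?s (?h(a := y))) = \<zero>\<^bsub>TT\<^esub>"
    by (simp add: TT_eq)
  have c: "?h(a := z) \<in> carrier PG" if "z \<in> carrier (A a)" for z
    using that h a by (auto simp: PiE_iff extensional_def)
  have sc: "?s (?h(a := z)) \<in> carrier MA" if "z \<in> carrier (A a)" for z
    using c[OF that] by (rule single_in_monoid_algebra)
  let ?P = "?s (?h(a := x \<oplus>\<^bsub>A a\<^esub> y)) - ?s (?h(a := x)) - ?s (?h(a := y))"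
  have P: "?P \<in> carrier MA"
    by (intro monoid_algebra_diff_closed sc a A_simps)
  \<comment> \<open>The monomial is written as the defining relation plus the two expected
    monomials; passing to classes removes the relation.\<close>
  have "?s (?h(a := x \<oplus>\<^bsub>A a\<^esub> y)) = ?P \<oplus>\<^bsub>MA\<^esub> (?s (?h(a := x)) \<oplus>\<^bsub>MA\<^esub> ?s (?h(a := y)))"
    by simp
  then have "pure (h(a := x \<oplus>\<^bsub>A a\<^esub> y)) = Tq.cls (?P \<oplus>\<^bsub>MA\<^esub> (?s (?h(a := x)) \<oplus>\<^bsub>MA\<^esub> ?s (?h(a := y))))"
    unfolding pure_cls eq by (rule arg_cong)
  also have "\<dots> = Tq.cls ?P \<oplus>\<^bsub>TT\<^esub> (pure (h(a := x)) \<oplus>\<^bsub>TT\<^esub> pure (h(a := y)))"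
    unfolding pure_cls eq by (simp only: TT_eq Tq.quot_ops P sc a Tq.add.m_closed)
  finally have "pure (h(a := x \<oplus>\<^bsub>A a\<^esub> y)) = \<zero>\<^bsub>TT\<^esub> \<oplus>\<^bsub>TT\<^esub> (pure (h(a := x)) \<oplus>\<^bsub>TT\<^esub> pure (h(a := y)))"
    unfolding 0 .
  moreover have "pure (h(a := z)) \<in> carrier TT" if "z \<in> carrier (A a)" for z
    using h a that by (intro pure_closed) auto
  ultimately show ?thesis
    using a by simp
qed

lemma pure_smult:
  assumes h: "h \<in> (\<Pi> i\<in>J. carrier (A i))" and a: "a \<in> J" "x \<in> carrier (A a)"
  shows "pure (h(a := c \<odot>\<^bsub>A a\<^esub> x)) = c \<odot>\<^bsub>TT\<^esub> pure (h(a := x))"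
proof -
  let ?h = "restrict h J" and ?s = "\<lambda>h c. Poly_Mapping.single h (c::laurent)"
  have eq: "restrict (h(a := z)) J = ?h(a := z)" for z
    using a by auto
  have "?s (?h(a := c \<odot>\<^bsub>A a\<^esub> x)) 1 - ?s (?h(a := x)) c \<in> rels"
    using a restrict_PG[OF h] by (intro relsI) simp_all
  from Tq.cls_zero_rel[OF this]
  have 0: "Tq.cls (?s (?h(a := c \<odot>\<^bsub>A a\<^esub> x)) 1 - ?s (?h(a := x)) c) = \<zero>\<^bsub>TT\<^esub>"
    by (simp add: TT_eq)
  have c: "?h(a := z) \<in> carrier PG" if "z \<in> carrier (A a)" for z
    using that h a by (auto simp: PiE_iff extensional_def)
  have sc: "?s (?h(a := z)) e \<in> carrier MA" if "z \<in> carrier (A a)" for z e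
    using c[OF that] by (rule single_in_monoid_algebra)
  let ?P = "?s (?h(a := c \<odot>\<^bsub>A a\<^esub> x)) 1 - ?s (?h(a := x)) c"
  have P: "?P \<in> carrier MA"
    by (intro monoid_algebra_diff_closed sc a A_simps)
  have "?s (?h(a := c \<odot>\<^bsub>A a\<^esub> x)) 1 = ?P \<oplus>\<^bsub>MA\<^esub> c \<odot>\<^bsub>MA\<^esub> ?s (?h(a := x)) 1"
    by simp
  then have "pure (h(a := c \<odot>\<^bsub>A a\<^esub> x)) = Tq.cls (?P \<oplus>\<^bsub>MA\<^esub> c \<odot>\<^bsub>MA\<^esub> ?s (?h(a := x)) 1)"
    unfolding pure_cls eq by (rule arg_cong)
  also have "\<dots> = Tq.cls ?P \<oplus>\<^bsub>TT\<^esub> c \<odot>\<^bsub>TT\<^esub> pure (h(a := x))"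
    unfolding pure_cls eq by (simp only: TT_eq Tq.quot_ops Tq.quot_smult P sc a Tq.smult_closed)
  finally have "pure (h(a := c \<odot>\<^bsub>A a\<^esub> x)) = \<zero>\<^bsub>TT\<^esub> \<oplus>\<^bsub>TT\<^esub> c \<odot>\<^bsub>TT\<^esub> pure (h(a := x))"
    unfolding 0 .
  moreover have "pure (h(a := z)) \<in> carrier TT" if "z \<in> carrier (A a)" for z
    using h a that by (intro pure_closed) auto
  ultimately show ?thesis
    using a by simp
qed

text \<open>Pure tensors span the tensor product.\<close>

lemma TT_induct [consumes 1, case_names pure add smult]:
  assumes C: "C \<in> carrier TT"
    and p: "\<And>h. h \<in> (\<Pi> i\<in>J. carrier (A i)) \<Longrightarrow> P (pure h)"
    and a: "\<And>x y. x \<in> carrier TT \<Longrightarrow> y \<in> carrier TT \<Longrightarrow> P x \<Longrightarrow> P y \<Longrightarrow> P (x \<oplus>\<^bsub>TT\<^esub> y)"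
    and s: "\<And>c x. x \<in> carrier TT \<Longrightarrow> P x \<Longrightarrow> P (c \<odot>\<^bsub>TT\<^esub> x)"
  shows "P C"
proof -
  obtain q where q: "q \<in> carrier MA" and C: "C = Tq.cls q"
    using C unfolding TT_eq by (rule Tq.quotE)
  have single: "P (Tq.cls (Poly_Mapping.single h c))" if h: "h \<in> carrier PG" for h c
  proof -
    have "Tq.cls (Poly_Mapping.single h 1) = pure h"
      using h by (auto simp: pure_cls PiE_restrict)
    moreover have h': "h \<in> (\<Pi> i\<in>J. carrier (A i))"
      using h by auto
    ultimately have "P (Tq.cls (Poly_Mapping.single h 1))" and
      "Tq.cls (Poly_Mapping.single h 1) \<in> carrier TT"
      using p pure_closed by simp_all
    then have "P (c \<odot>\<^bsub>TT\<^esub> Tq.cls (Poly_Mapping.single h 1))"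
      using s by blast
    moreover have "c \<odot>\<^bsub>TT\<^esub> Tq.cls (Poly_Mapping.single h 1) = Tq.cls (c \<odot>\<^bsub>MA\<^esub> Poly_Mapping.single h 1)"
      unfolding TT_eq by (rule Tq.quot_smult) (rule single_in_monoid_algebra[OF h])
    ultimately show ?thesis
      by simp
  qed
  have "P (Tq.cls q)"
    using q
  proof (induction q rule: monoid_algebra_induct)
    \<comment> \<open>The rule offers no case for zero, which is reached as 0 times the pure tensor
      of the units.\<close>
    case zero
    have "(\<lambda>i\<in>J. \<one>\<^bsub>A i\<^esub>) \<in> carrier PG"
      by (auto simp: A_simps)
    from single[OF this, of 0] show ?case
      by simp
  next
    case (add x y)
    then have "Tq.cls (x + y) = Tq.cls x \<oplus>\<^bsub>TT\<^esub> Tq.cls y"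
      unfolding TT_eq by (subst Tq.quot_ops) (simp_all del: monoid_algebra_simps(1))
    moreover have "Tq.cls x \<in> carrier TT" "Tq.cls y \<in> carrier TT"
      using add unfolding TT_eq Tq.carrier_quot by blast+
    ultimately show ?case
      using a add by simp
  qed (use single in blast)
  then show ?thesis
    using C by simp
qed

definition ins :: "'i \<Rightarrow> 'a \<Rightarrow> (('i \<Rightarrow> 'a) \<Rightarrow>\<^sub>0 laurent) set" where
  "ins a x = pure ((\<lambda>b. \<one>\<^bsub>A b\<^esub>)(a := x))"

lemma ins_hom:
  assumes a: "a \<in> J"
  shows "ins a \<in> K_algebra_hom (A a) TT"
proof -
  interpret a: K_alg "A a"
    by (rule A) fact
  have 1: "(\<lambda>b. \<one>\<^bsub>A b\<^esub>) \<in> (\<Pi> i\<in>J. carrier (A i))"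
    by (auto simp: A_simps)
  have x: "(\<lambda>b. \<one>\<^bsub>A b\<^esub>)(a := x) \<in> (\<Pi> i\<in>J. carrier (A i))" if "x \<in> carrier (A a)" for x
    using that by (auto simp: A_simps)
  have "ins a \<in> ring_hom (A a) TT"
  proof (rule ring_hom_memI)
    fix x y assume xy: "x \<in> carrier (A a)" "y \<in> carrier (A a)"
    show "ins a (x \<otimes>\<^bsub>A a\<^esub> y) = ins a x \<otimes>\<^bsub>TT\<^esub> ins a y"
      unfolding ins_def using xy x
      by (subst pure_mult) (auto intro!: pure_cong simp: monoid.l_one[OF A_monoid] A_simps)
    show "ins a (x \<oplus>\<^bsub>A a\<^esub> y) = ins a x \<oplus>\<^bsub>TT\<^esub> ins a y"
      unfolding ins_def using xy 1 a by (intro pure_add)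
  next
    show "ins a \<one>\<^bsub>A a\<^esub> = \<one>\<^bsub>TT\<^esub>"
      unfolding ins_def by (subst pure_one[symmetric], rule pure_cong) auto
  qed (use x in \<open>auto simp: ins_def intro: pure_closed\<close>)
  moreover have "ins a (c \<odot>\<^bsub>A a\<^esub> x) = c \<odot>\<^bsub>TT\<^esub> ins a x" if "x \<in> carrier (A a)" for c x
    unfolding ins_def using that 1 a by (intro pure_smult)
  ultimately show ?thesis
    unfolding K_algebra_hom_def by blast
qed

lemma K_hom_ins: "a \<in> J \<Longrightarrow> K_hom (A a) TT (ins a)"
  by (intro K_hom.intro K_hom_axioms.intro A K_alg_TT ins_hom)

text \<open>In every component at most one of the two families differs from 1.\<close>

lemma ins_commute:
  assumes "a \<in> J" "b \<in> J" "a \<noteq> b" "x \<in> carrier (A a)" "y \<in> carrier (A b)"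
  shows "ins a x \<otimes>\<^bsub>TT\<^esub> ins b y = ins b y \<otimes>\<^bsub>TT\<^esub> ins a x"
proof -
  have x: "(\<lambda>b. \<one>\<^bsub>A b\<^esub>)(a := x) \<in> (\<Pi> i\<in>J. carrier (A i))"
    "(\<lambda>a. \<one>\<^bsub>A a\<^esub>)(b := y) \<in> (\<Pi> i\<in>J. carrier (A i))"
    using assms by (auto simp: A_simps)
  show ?thesis
    unfolding ins_def pure_mult[OF x] pure_mult[OF x(2,1)]
    using assms by (intro pure_cong) (auto simp: monoid.l_one[OF A_monoid] monoid.r_one[OF A_monoid] A_simps)
qed

text \<open>The universal property of the tensor product of algebras: multiplicativity gives a
  homomorphism on the monoid algebra of the product monoid, and multilinearity says that it kills
  the generators of the ideal.\<close>

lemma hom_extend: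
  assumes B: "K_alg B" and \<phi>: "\<phi> \<in> (\<Pi>\<^sub>E i\<in>J. carrier (A i)) \<rightarrow> carrier B"
    and one: "\<phi> (\<lambda>i\<in>J. \<one>\<^bsub>A i\<^esub>) = \<one>\<^bsub>B\<^esub>"
    and mult: "\<And>h k. h \<in> (\<Pi>\<^sub>E i\<in>J. carrier (A i)) \<Longrightarrow> k \<in> (\<Pi>\<^sub>E i\<in>J. carrier (A i)) \<Longrightarrow>
      \<phi> (\<lambda>i\<in>J. h i \<otimes>\<^bsub>A i\<^esub> k i) = \<phi> h \<otimes>\<^bsub>B\<^esub> \<phi> k"
    and add: "\<And>h a x y. h \<in> (\<Pi>\<^sub>E i\<in>J. carrier (A i)) \<Longrightarrow> a \<in> J \<Longrightarrow> x \<in> carrier (A a) \<Longrightarrow> y \<in> carrier (A a) \<Longrightarrow>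
      \<phi> (h(a := x \<oplus>\<^bsub>A a\<^esub> y)) = \<phi> (h(a := x)) \<oplus>\<^bsub>B\<^esub> \<phi> (h(a := y))"
    and smult: "\<And>h a c x. h \<in> (\<Pi>\<^sub>E i\<in>J. carrier (A i)) \<Longrightarrow> a \<in> J \<Longrightarrow> x \<in> carrier (A a) \<Longrightarrow>
      \<phi> (h(a := c \<odot>\<^bsub>A a\<^esub> x)) = c \<odot>\<^bsub>B\<^esub> \<phi> (h(a := x))"
  obtains g where "g \<in> K_algebra_hom TT B" "\<And>h. h \<in> (\<Pi>\<^sub>E i\<in>J. carrier (A i)) \<Longrightarrow> g (pure h) = \<phi> h"
proof -
  interpret B: K_alg B by fact
  let ?F = "ma_extend B \<phi>"
  have hom: "?F \<in> K_algebra_hom MA B"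
    by (rule B.ma_extend_hom) (use monoid_PG \<phi> one mult in simp_all)
  then interpret F: K_hom MA B ?F
    by (intro K_hom.intro K_hom_axioms.intro B Tq.K_alg_axioms)
  have Fd: "?F (p - q) = ?F p \<ominus>\<^bsub>B\<^esub> ?F q" if "p \<in> carrier MA" "q \<in> carrier MA" for p q
  proof -
    have d: "p - q \<in> carrier MA"
      using that by blast
    have "?F ((p - q) \<oplus>\<^bsub>MA\<^esub> q) = ?F (p - q) \<oplus>\<^bsub>B\<^esub> ?F q"
      using d that(2) by (rule F.hom_add)
    then have "?F p = ?F (p - q) \<oplus>\<^bsub>B\<^esub> ?F q"
      by simp
    then show ?thesis
      using F.hom_closed[OF d] F.hom_closed[OF that(1)] F.hom_closed[OF that(2)]
      by (simp add: B.minus_eq B.a_assoc B.r_neg)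
  qed
  have \<phi>': "\<phi> h \<in> carrier B" if "h \<in> (\<Pi>\<^sub>E i\<in>J. carrier (A i))" for h
    using \<phi> that by auto
  have c: "h(a := z) \<in> (\<Pi>\<^sub>E i\<in>J. carrier (A i))" if "h \<in> (\<Pi>\<^sub>E i\<in>J. carrier (A i))" "a \<in> J" "z \<in> carrier (A a)" for h a z
    using that by (auto simp: PiE_iff extensional_def)
  have "?F r = \<zero>\<^bsub>B\<^esub>" if "r \<in> rels" for r
    using that
  proof -
    assume "r \<in> rels"
    then consider h a x y where "h \<in> (\<Pi>\<^sub>E i\<in>J. carrier (A i))" "a \<in> J" "x \<in> carrier (A a)" "y \<in> carrier (A a)"
      "r = Poly_Mapping.single (h(a := x \<oplus>\<^bsub>A a\<^esub> y)) 1
        - Poly_Mapping.single (h(a := x)) 1 - Poly_Mapping.single (h(a := y)) 1"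
    | h a c x where "h \<in> (\<Pi>\<^sub>E i\<in>J. carrier (A i))" "a \<in> J" "x \<in> carrier (A a)"
      "r = Poly_Mapping.single (h(a := c \<odot>\<^bsub>A a\<^esub> x)) 1 - Poly_Mapping.single (h(a := x)) c"
      unfolding multilinear_rels_def by blast
    then show ?thesis
    proof cases
      case 1
      note cs = c[OF 1(1,2,3)] c[OF 1(1,2,4)] c[OF 1(1,2) A_simps(2)[OF 1(2-4)]]
      have s: "Poly_Mapping.single (h(a := z)) 1 \<in> carrier MA" if "z \<in> carrier (A a)" for z
        using c[OF 1(1,2) that] by simp
      have cancel: "P \<oplus>\<^bsub>B\<^esub> P' \<ominus>\<^bsub>B\<^esub> P \<ominus>\<^bsub>B\<^esub> P' = \<zero>\<^bsub>B\<^esub>" if P: "P \<in> carrier B" "P' \<in> carrier B" for P P'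
      proof -
        have "P \<oplus>\<^bsub>B\<^esub> P' \<ominus>\<^bsub>B\<^esub> P \<ominus>\<^bsub>B\<^esub> P' = (P \<oplus>\<^bsub>B\<^esub> P') \<oplus>\<^bsub>B\<^esub> \<ominus>\<^bsub>B\<^esub> (P \<oplus>\<^bsub>B\<^esub> P')"
          using P by (simp add: B.minus_eq B.minus_add B.a_assoc)
        then show ?thesis
          using P by (simp add: B.r_neg)
      qed
      show ?thesis
        unfolding 1(5)
        by (subst Fd, (intro monoid_algebra_diff_closed s A_simps 1)+,
            subst Fd, (intro s A_simps 1)+)
          (use cs \<phi>' add[OF 1(1-4)] cancel in simp)
    next
      case 2
      note cs = c[OF 2(1,2,3)] c[OF 2(1,2) A_simps(3)[OF 2(2-3), of c]]
      have s: "Poly_Mapping.single (h(a := z)) c \<in> carrier MA" if "z \<in> carrier (A a)" for z c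
        using c[OF 2(1,2) that] by simp
      show ?thesis
        unfolding 2(4)
        by (subst Fd, (intro s A_simps 2)+)
          (use cs \<phi>' smult[OF 2(1-3)] in \<open>simp add: B.minus_eq B.r_neg\<close>)
    qed
  qed
  from Tq.hom_lift[OF B hom this] obtain g where g: "g \<in> K_algebra_hom TT B"
    "\<And>x. x \<in> carrier MA \<Longrightarrow> g (Tq.cls x) = ?F x"
    unfolding TT_eq by blast
  have "g (pure h) = \<phi> h" if h: "h \<in> (\<Pi>\<^sub>E i\<in>J. carrier (A i))" for h
  proof -
    have "restrict h J = h"
      using h by (rule PiE_restrict)
    then show ?thesis
      unfolding pure_cls using g(2)[of "Poly_Mapping.single h 1"] h \<phi>'[OF h] by simp
  qed
  with g(1) show ?thesis
    using that by blast
qed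

end

text \<open>Functoriality of the tensor product. It is used to add one strand to a single factor
  while the other factors stay as they are.\<close>

lemma tensor_map:
  assumes T: "tensor_alg J A" "tensor_alg J A'"
    and \<phi>: "\<And>i. i \<in> J \<Longrightarrow> \<phi> i \<in> K_algebra_hom (A i) (A' i)"
  obtains g where "g \<in> K_algebra_hom (tensor J A) (tensor J A')"
    "\<And>h. h \<in> (\<Pi> i\<in>J. carrier (A i)) \<Longrightarrow> g (pure_tensor J A h) = pure_tensor J A' (\<lambda>i. \<phi> i (h i))"
proof -
  interpret T: tensor_alg J A by fact
  interpret T': tensor_alg J A' by fact
  let ?p = "\<lambda>h. pure_tensor J A' (\<lambda>i. \<phi> i (h i))"
  have \<phi>c: "\<phi> i x \<in> carrier (A' i)"
    and \<phi>_one: "\<phi> i \<one>\<^bsub>A i\<^esub> = \<one>\<^bsub>A' i\<^esub>"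
    and \<phi>_mult: "\<phi> i (x \<otimes>\<^bsub>A i\<^esub> y) = \<phi> i x \<otimes>\<^bsub>A' i\<^esub> \<phi> i y"
    and \<phi>_add: "\<phi> i (x \<oplus>\<^bsub>A i\<^esub> y) = \<phi> i x \<oplus>\<^bsub>A' i\<^esub> \<phi> i y"
    and \<phi>_smult: "\<phi> i (c \<odot>\<^bsub>A i\<^esub> x) = c \<odot>\<^bsub>A' i\<^esub> \<phi> i x"
    if "i \<in> J" "x \<in> carrier (A i)" "y \<in> carrier (A i)" for i x y c
  proof -
    interpret K_hom "A i" "A' i" "\<phi> i"
      by (intro K_hom.intro K_hom_axioms.intro T.A T'.A \<phi> that)
    show "\<phi> i x \<in> carrier (A' i)" "\<phi> i \<one>\<^bsub>A i\<^esub> = \<one>\<^bsub>A' i\<^esub>"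
      "\<phi> i (x \<otimes>\<^bsub>A i\<^esub> y) = \<phi> i x \<otimes>\<^bsub>A' i\<^esub> \<phi> i y"
      "\<phi> i (x \<oplus>\<^bsub>A i\<^esub> y) = \<phi> i x \<oplus>\<^bsub>A' i\<^esub> \<phi> i y"
      "\<phi> i (c \<odot>\<^bsub>A i\<^esub> x) = c \<odot>\<^bsub>A' i\<^esub> \<phi> i x"
      using that by simp_all
  qed
  have c: "(\<lambda>i. \<phi> i (h i)) \<in> (\<Pi> i\<in>J. carrier (A' i))" if "h \<in> (\<Pi>\<^sub>E i\<in>J. carrier (A i))" for h
  proof (rule Pi_I)
    fix i assume i: "i \<in> J"
    then have "h i \<in> carrier (A i)"
      using that by (rule PiE_mem[rotated])
    from \<phi>c[OF i this this] show "\<phi> i (h i) \<in> carrier (A' i)" .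
  qed
  have u: "(\<lambda>i. \<phi> i ((h(a := z)) i)) = (\<lambda>i. \<phi> i (h i))(a := \<phi> a z)" for h a z
    by (rule ext) simp
  obtain g where g: "g \<in> K_algebra_hom (tensor J A) (tensor J A')"
    "\<And>h. h \<in> (\<Pi>\<^sub>E i\<in>J. carrier (A i)) \<Longrightarrow> g (pure_tensor J A h) = ?p h"
  proof (rule T.hom_extend[of "tensor J A'" ?p])
    show "?p \<in> (\<Pi>\<^sub>E i\<in>J. carrier (A i)) \<rightarrow> carrier (tensor J A')"
      by (intro Pi_I T'.pure_closed c)
    show "?p (\<lambda>i\<in>J. \<one>\<^bsub>A i\<^esub>) = \<one>\<^bsub>tensor J A'\<^esub>"
      unfolding T'.pure_one[symmetric]
    proof (rule T'.pure_cong)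
      fix i assume i: "i \<in> J"
      show "\<phi> i ((\<lambda>i\<in>J. \<one>\<^bsub>A i\<^esub>) i) = \<one>\<^bsub>A' i\<^esub>"
        using i \<phi>_one[OF i T.A_simps(4) T.A_simps(4)] by simp
    qed
    show "?p (\<lambda>i\<in>J. h i \<otimes>\<^bsub>A i\<^esub> k i) = ?p h \<otimes>\<^bsub>tensor J A'\<^esub> ?p k"
      if hk: "h \<in> (\<Pi>\<^sub>E i\<in>J. carrier (A i))" "k \<in> (\<Pi>\<^sub>E i\<in>J. carrier (A i))" for h k
      unfolding T'.pure_mult[OF c[OF hk(1)] c[OF hk(2)]]
    proof (rule T'.pure_cong)
      fix i assume i: "i \<in> J"
      show "\<phi> i ((\<lambda>i\<in>J. h i \<otimes>\<^bsub>A i\<^esub> k i) i) = \<phi> i (h i) \<otimes>\<^bsub>A' i\<^esub> \<phi> i (k i)"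
        using i \<phi>_mult[OF i PiE_mem[OF hk(1) i] PiE_mem[OF hk(2) i]] by simp
    qed
    show "?p (k(a := x \<oplus>\<^bsub>A a\<^esub> y)) = ?p (k(a := x)) \<oplus>\<^bsub>tensor J A'\<^esub> ?p (k(a := y))"
      if k: "k \<in> (\<Pi>\<^sub>E i\<in>J. carrier (A i))" "a \<in> J" "x \<in> carrier (A a)" "y \<in> carrier (A a)" for k a x y
      unfolding u \<phi>_add[OF k(2-4)]
      by (rule T'.pure_add[OF c[OF k(1)] k(2) \<phi>c[OF k(2,3,3)] \<phi>c[OF k(2,4,4)]])
    show "?p (k(a := c' \<odot>\<^bsub>A a\<^esub> x)) = c' \<odot>\<^bsub>tensor J A'\<^esub> ?p (k(a := x))"
      if k: "k \<in> (\<Pi>\<^sub>E i\<in>J. carrier (A i))" "a \<in> J" "x \<in> carrier (A a)" for k a c' x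
      unfolding u \<phi>_smult[OF k(2,3,3)]
      by (rule T'.pure_smult[OF c[OF k(1)] k(2) \<phi>c[OF k(2,3,3)]])
    show "K_alg (tensor J A')"
      by (rule T'.K_alg_TT)
  qed blast
  have "g (pure_tensor J A h) = ?p h" if h: "h \<in> (\<Pi> i\<in>J. carrier (A i))" for h
  proof -
    have "restrict h J \<in> (\<Pi>\<^sub>E i\<in>J. carrier (A i))"
      using h by simp
    then have "g (pure_tensor J A h) = ?p (restrict h J)"
      using g(2) T.pure_restrict by metis
    also have "\<dots> = ?p h"
      by (rule T'.pure_cong) simp
    finally show ?thesis .
  qed
  with g(1) show ?thesis
    using that by blast
qed

section \<open>Linear forms on tensor products\<close>

locale tensor_form_alg = tensor_alg +
  fixes f :: "'a \<Rightarrow> 'b \<Rightarrow> laurent"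
  assumes f: "\<And>i. i \<in> J \<Longrightarrow> K_linear (A i) (f i)"
begin

abbreviation "TF \<equiv> tensor_form J f"
abbreviation "pf \<equiv> \<lambda>h. \<Prod>a\<in>J. f a (h a)"

lemma f_add: "i \<in> J \<Longrightarrow> x \<in> carrier (A i) \<Longrightarrow> y \<in> carrier (A i) \<Longrightarrow> f i (x \<oplus>\<^bsub>A i\<^esub> y) = f i x + f i y"
  and f_smult: "i \<in> J \<Longrightarrow> x \<in> carrier (A i) \<Longrightarrow> f i (c \<odot>\<^bsub>A i\<^esub> x) = c * f i x"
  using f by (auto simp: K_linear_def)

lemma pf_split: "a \<in> J \<Longrightarrow> pf h = f a (h a) * (\<Prod>b\<in>J - {a}. f b (h b))"
  using fin by (simp add: prod.remove)

text \<open>The form is linear but not multiplicative, so vanishing on the relations would not give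
  vanishing on the two-sided ideal; hence the factors \<open>q\<close> and \<open>q'\<close>.
  Multiplying a relation by monomials on both sides changes each slot by a linear map, and the
  relation in slot a survives.\<close>

lemma lin_rel:
  assumes r: "r \<in> rels" and q: "q \<in> carrier MA" "q' \<in> carrier MA"
  shows "lin pf (q \<otimes>\<^bsub>MA\<^esub> r \<otimes>\<^bsub>MA\<^esub> q') = 0"
proof -
  have base: "lin pf (Poly_Mapping.single h c \<otimes>\<^bsub>MA\<^esub> r \<otimes>\<^bsub>MA\<^esub> Poly_Mapping.single h' c') = 0"
    if h: "h \<in> carrier PG" "h' \<in> carrier PG" for h h' c c'
  proof -
    \<comment> \<open>\<open>w k\<close> is the value of the form on the componentwise product h k
      h'; only its dependence on slot a of \<open>k\<close> matters.\<close>
    define w where "w k = pf (\<lambda>i\<in>J. (h i \<otimes>\<^bsub>A i\<^esub> k i) \<otimes>\<^bsub>A i\<^esub> h' i)" for k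
    have hc: "h i \<in> carrier (A i)" "h' i \<in> carrier (A i)" if "i \<in> J" for i
      using h that by auto
    have w: "w (k(a := z)) = f a ((h a \<otimes>\<^bsub>A a\<^esub> z) \<otimes>\<^bsub>A a\<^esub> h' a)
        * (\<Prod>b\<in>J - {a}. f b ((h b \<otimes>\<^bsub>A b\<^esub> k b) \<otimes>\<^bsub>A b\<^esub> h' b))" if "a \<in> J" for k a z
      unfolding w_def using that by (subst pf_split[of a]) (auto intro!: prod.cong)
    have pfw: "(\<Prod>a\<in>J. f a ((\<lambda>i\<in>J. (\<lambda>i\<in>J. h i \<otimes>\<^bsub>A i\<^esub> k i) i \<otimes>\<^bsub>A i\<^esub> h' i) a)) = w k" for k
      unfolding w_def by (rule prod.cong) auto
    have ls: "lin pf (Poly_Mapping.single h c \<otimes>\<^bsub>MA\<^esub> Poly_Mapping.single k e \<otimes>\<^bsub>MA\<^esub> Poly_Mapping.single h' c')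
        = c * e * c' * w k" for k e
      using pfw[of k] by simp
    from r consider k a x y where "k \<in> (\<Pi>\<^sub>E i\<in>J. carrier (A i))" "a \<in> J" "x \<in> carrier (A a)" "y \<in> carrier (A a)"
      "r = Poly_Mapping.single (k(a := x \<oplus>\<^bsub>A a\<^esub> y)) 1
        - Poly_Mapping.single (k(a := x)) 1 - Poly_Mapping.single (k(a := y)) 1"
    | k a e x where "k \<in> (\<Pi>\<^sub>E i\<in>J. carrier (A i))" "a \<in> J" "x \<in> carrier (A a)"
      "r = Poly_Mapping.single (k(a := e \<odot>\<^bsub>A a\<^esub> x)) 1 - Poly_Mapping.single (k(a := x)) e"
      unfolding multilinear_rels_def by blast
    then show ?thesis
    proof cases
      case 1
      interpret a: K_alg "A a" by (rule A) fact
      have "f a ((h a \<otimes>\<^bsub>A a\<^esub> (x \<oplus>\<^bsub>A a\<^esub> y)) \<otimes>\<^bsub>A a\<^esub> h' a)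
          = f a ((h a \<otimes>\<^bsub>A a\<^esub> x) \<otimes>\<^bsub>A a\<^esub> h' a) + f a ((h a \<otimes>\<^bsub>A a\<^esub> y) \<otimes>\<^bsub>A a\<^esub> h' a)"
        using 1 hc[OF 1(2)] by (simp add: a.r_distr a.l_distr f_add)
      then have "w (k(a := x \<oplus>\<^bsub>A a\<^esub> y)) = w (k(a := x)) + w (k(a := y))"
        unfolding w[OF 1(2)] by (simp add: distrib_right)
      then show ?thesis
        unfolding 1(5) monoid_algebra_mult_diff lin_diff ls by (simp add: algebra_simps)
    next
      case 2
      interpret a: K_alg "A a" by (rule A) fact
      have "f a ((h a \<otimes>\<^bsub>A a\<^esub> (e \<odot>\<^bsub>A a\<^esub> x)) \<otimes>\<^bsub>A a\<^esub> h' a) = e * f a ((h a \<otimes>\<^bsub>A a\<^esub> x) \<otimes>\<^bsub>A a\<^esub> h' a)"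
        using 2 hc[OF 2(2)] by (simp add: a.smult_mult_l a.smult_mult_r f_smult)
      then have "w (k(a := e \<odot>\<^bsub>A a\<^esub> x)) = e * w (k(a := x))"
        unfolding w[OF 2(2)] by (simp add: mult.assoc)
      then show ?thesis
        unfolding 2(4) monoid_algebra_mult_diff lin_diff ls by (simp add: algebra_simps)
    qed
  qed
  show ?thesis
    using q(1)
  proof (induction q rule: monoid_algebra_induct)
    case (single h c)
    note h = this
    from q(2) show ?case
      by (induction q' rule: monoid_algebra_induct)
        (use base h in \<open>simp_all add: monoid_algebra_mult_distr lin_add del: monoid_algebra_simps monoid_algebra_mult_single\<close>)
  qed (simp_all add: monoid_algebra_mult_distl lin_add)
qed

lemma lin_ideal:
  assumes "p \<in> Tq.I" shows "lin pf p = 0"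
proof -
  \<comment> \<open>The elements all of whose two-sided multiples are killed: these form a two-sided
    ideal, and taking both factors to be 1 recovers the claim.\<close>
  define Z where "Z = {p \<in> carrier MA. \<forall>q\<in>carrier MA. \<forall>q'\<in>carrier MA. lin pf (q \<otimes>\<^bsub>MA\<^esub> p \<otimes>\<^bsub>MA\<^esub> q') = 0}"
  have ZI: "p \<in> Z" if "p \<in> carrier MA"
    "\<And>q q'. q \<in> carrier MA \<Longrightarrow> q' \<in> carrier MA \<Longrightarrow> lin pf (q \<otimes>\<^bsub>MA\<^esub> p \<otimes>\<^bsub>MA\<^esub> q') = 0" for p
    unfolding Z_def using that by blast
  have Zc: "p \<in> carrier MA" if "p \<in> Z" for p
    using that unfolding Z_def by blast
  have Z0: "lin pf (q \<otimes>\<^bsub>MA\<^esub> p \<otimes>\<^bsub>MA\<^esub> q') = 0" if "p \<in> Z" "q \<in> carrier MA" "q' \<in> carrier MA" for p q q'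
    using that unfolding Z_def by blast
  have "Tq.I \<subseteq> Z"
  proof (rule Tq.I_subset_kernel)
    show "subgroup Z (add_monoid MA)"
    proof (rule Tq.add.subgroupI)
      have "0 \<in> Z"
        unfolding Z_def by simp
      then show "Z \<noteq> {}"
        by blast
      show "Z \<subseteq> carrier MA"
        using Zc by blast
      fix p assume p: "p \<in> Z"
      have m: "0 - p \<in> carrier MA"
        by (rule monoid_algebra_diff_closed[OF _ Zc[OF p]]) simp
      have "\<ominus>\<^bsub>MA\<^esub> p = 0 - p"
        by (rule Tq.minus_equality[OF _ Zc[OF p] m]) simp
      moreover have "0 - p \<in> Z"
        by (rule ZI[OF m]) (simp only: monoid_algebra_mult_diff lin_diff Z0[OF p] monoid_algebra_mult_zero lin_zero diff_0_right)
      ultimately show "\<ominus>\<^bsub>MA\<^esub> p \<in> Z"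
        by simp
      fix q assume q: "q \<in> Z"
      have "p + q \<in> Z"
        by (rule ZI, intro monoid_algebra_add_closed Zc p q)
          (simp only: monoid_algebra_mult_distl monoid_algebra_mult_distr lin_add Z0[OF p] Z0[OF q] add_0_right)
      then show "p \<oplus>\<^bsub>MA\<^esub> q \<in> Z"
        by simp
    qed
    show "rels \<subseteq> Z"
      using rels_closed lin_rel ZI by blast
    fix x z assume z: "z \<in> Z" and x: "x \<in> carrier MA"
    note z' = Zc[OF z]
    show "x \<otimes>\<^bsub>MA\<^esub> z \<in> Z"
    proof (rule ZI)
      fix q q' assume q: "q \<in> carrier MA" "q' \<in> carrier MA"
      have "q \<otimes>\<^bsub>MA\<^esub> (x \<otimes>\<^bsub>MA\<^esub> z) \<otimes>\<^bsub>MA\<^esub> q' = (q \<otimes>\<^bsub>MA\<^esub> x) \<otimes>\<^bsub>MA\<^esub> z \<otimes>\<^bsub>MA\<^esub> q'"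
        using q x z' by (simp only: Tq.m_assoc Tq.m_closed)
      then show "lin pf (q \<otimes>\<^bsub>MA\<^esub> (x \<otimes>\<^bsub>MA\<^esub> z) \<otimes>\<^bsub>MA\<^esub> q') = 0"
        using Z0[OF z Tq.m_closed[OF q(1) x] q(2)] by (simp only:)
    qed (intro Tq.m_closed x z')
    show "z \<otimes>\<^bsub>MA\<^esub> x \<in> Z"
    proof (rule ZI)
      fix q q' assume q: "q \<in> carrier MA" "q' \<in> carrier MA"
      have "q \<otimes>\<^bsub>MA\<^esub> (z \<otimes>\<^bsub>MA\<^esub> x) \<otimes>\<^bsub>MA\<^esub> q' = q \<otimes>\<^bsub>MA\<^esub> z \<otimes>\<^bsub>MA\<^esub> (x \<otimes>\<^bsub>MA\<^esub> q')"
        using q x z' by (simp only: Tq.m_assoc Tq.m_closed)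
      then show "lin pf (q \<otimes>\<^bsub>MA\<^esub> (z \<otimes>\<^bsub>MA\<^esub> x) \<otimes>\<^bsub>MA\<^esub> q') = 0"
        using Z0[OF z q(1) Tq.m_closed[OF x q(2)]] by (simp only:)
    qed (intro Tq.m_closed x z')
  qed
  with assms have p: "p \<in> Z"
    by blast
  have "\<one>\<^bsub>MA\<^esub> \<otimes>\<^bsub>MA\<^esub> p \<otimes>\<^bsub>MA\<^esub> \<one>\<^bsub>MA\<^esub> = p"
    using Zc[OF p] by (simp only: Tq.l_one Tq.r_one)
  with Z0[OF p Tq.one_closed Tq.one_closed] show ?thesis
    by (simp only:)
qed

text \<open>Two representatives differ by an element of the ideal, on which the form vanishes; so
  the choice inside \<open>tensor_form\<close> does not affect the value.\<close>

lemma TF_cls: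
  assumes p: "p \<in> carrier MA" shows "TF (Tq.cls p) = lin pf p"
proof -
  define q where "q = (SOME q. q \<in> Tq.cls p)"
  have "q \<in> Tq.cls p"
    unfolding q_def using Tq.cls_self[OF p] by (rule someI)
  then have q: "q \<in> carrier MA" "Tq.cls q = Tq.cls p"
    using Tq.mem_cls[OF p] by auto
  then have "q \<ominus>\<^bsub>MA\<^esub> p \<in> Tq.I"
    using p by (simp add: Tq.cls_eq_iff del: monoid_algebra_simps)
  moreover have "\<ominus>\<^bsub>MA\<^esub> p = 0 - p"
    by (rule Tq.minus_equality) (use p monoid_algebra_diff_closed[of 0 PG p] in simp_all)
  ultimately have "q - p \<in> Tq.I"
    by (simp add: a_minus_def)
  then have "lin pf q = lin pf p"
    using lin_ideal[of "q - p"] by (simp add: lin_diff)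
  then show ?thesis
    by (simp add: tensor_form_def q_def[symmetric] lin_def)
qed

lemma TF_pure: "h \<in> (\<Pi> i\<in>J. carrier (A i)) \<Longrightarrow> TF (pure h) = pf h"
  unfolding pure_cls by (subst TF_cls, rule single_in_monoid_algebra, erule restrict_PG) simp

lemma TF_add:
  assumes "x \<in> carrier TT" "y \<in> carrier TT"
  shows "TF (x \<oplus>\<^bsub>TT\<^esub> y) = TF x + TF y"
proof -
  obtain p q where "p \<in> carrier MA" "x = Tq.cls p" "q \<in> carrier MA" "y = Tq.cls q"
    using assms unfolding TT_eq by (metis Tq.quotE)
  then show ?thesis
    using monoid_algebra_add_closed[of p PG q]
    by (simp add: TT_eq Tq.quot_ops TF_cls lin_add del: monoid_algebra_simps(1))
qed

lemma TF_smult: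
  assumes "x \<in> carrier TT"
  shows "TF (c \<odot>\<^bsub>TT\<^esub> x) = c * TF x"
proof -
  obtain p where p: "p \<in> carrier MA" "x = Tq.cls p"
    using assms unfolding TT_eq by (metis Tq.quotE)
  then have "c \<odot>\<^bsub>MA\<^esub> p \<in> carrier MA"
    by blast
  with p show ?thesis
    by (simp add: TT_eq Tq.quot_smult TF_cls lin_smult del: monoid_algebra_simps(1))
qed

lemma TF_zero: "TF \<zero>\<^bsub>TT\<^esub> = 0"
  using TF_smult[of "\<zero>\<^bsub>TT\<^esub>" 0] by simp

lemma TF_finsum: "finite S \<Longrightarrow> (\<And>i. i \<in> S \<Longrightarrow> g i \<in> carrier TT) \<Longrightarrow> TF (\<Oplus>\<^bsub>TT\<^esub>i\<in>S. g i) = (\<Sum>i\<in>S. TF (g i))"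
proof (induction S rule: finite_induct)
  case (insert x F)
  then have "g \<in> F \<rightarrow> carrier TT" "g x \<in> carrier TT" "TF (\<Oplus>\<^bsub>TT\<^esub>i\<in>F. g i) = (\<Sum>i\<in>F. TF (g i))"
    by auto
  with insert(1,2) show ?case
    by (simp add: TF_add)
qed (simp add: TF_zero)

text \<open>Both sides are bilinear, so pure tensors suffice, and there the trace property can be
  applied in each factor separately.\<close>

lemma TF_commute:
  assumes tr: "\<And>i x y. i \<in> J \<Longrightarrow> x \<in> carrier (A i) \<Longrightarrow> y \<in> carrier (A i) \<Longrightarrow> f i (x \<otimes>\<^bsub>A i\<^esub> y) = f i (y \<otimes>\<^bsub>A i\<^esub> x)"
    and "x \<in> carrier TT" "y \<in> carrier TT"
  shows "TF (x \<otimes>\<^bsub>TT\<^esub> y) = TF (y \<otimes>\<^bsub>TT\<^esub> x)"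
  using assms(2)
proof (induction x rule: TT_induct)
  case (pure h)
  note h = this
  from assms(3) show ?case
  proof (induction y rule: TT_induct)
    case (pure k)
    have "h i \<in> carrier (A i)" "k i \<in> carrier (A i)" if "i \<in> J" for i
      using h pure that by auto
    moreover from this have "(\<lambda>i. h i \<otimes>\<^bsub>A i\<^esub> k i) \<in> (\<Pi> i\<in>J. carrier (A i))"
      "(\<lambda>i. k i \<otimes>\<^bsub>A i\<^esub> h i) \<in> (\<Pi> i\<in>J. carrier (A i))"
      by (simp_all add: A_simps)
    ultimately show ?case
      using h pure by (simp add: pure_mult TF_pure tr)
  qed (use h in \<open>simp_all add: pure_closed Tn.l_distr Tn.r_distr TF_add Tn.smult_mult_l Tn.smult_mult_r TF_smult\<close>)
qed (use assms(3) in \<open>simp_all add: pure_closed Tn.l_distr Tn.r_distr TF_add Tn.smult_mult_l Tn.smult_mult_r TF_smult\<close>)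

end

section \<open>Reduced words in the symmetric group\<close>

abbreviation sw :: "nat \<Rightarrow> nat \<Rightarrow> nat" where
  "sw i \<equiv> transpose i (Suc i)"

lemma word_perm_simps [simp]:
  "word_perm [] = id" "word_perm (i # is) = sw i \<circ> word_perm is"
  by (simp_all add: word_perm_def)

lemma sw_sw [simp]: "sw i \<circ> (sw i \<circ> w) = w" "w \<circ> sw i \<circ> sw i = w"
  by (auto simp: fun_eq_iff)

lemma sw_permutes: "i \<in> {1..<n} \<Longrightarrow> sw i permutes {1..n}"
  by (rule permutes_swap_id) auto

lemma word_perm_permutes: "set is \<subseteq> {1..<n} \<Longrightarrow> word_perm is permutes {1..n}"
proof (induction "is")
  case Nil
  show ?case
    unfolding word_perm_simps by (rule permutes_id)
next
  case (Cons i "is")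
  then show ?case
    unfolding word_perm_simps by (intro permutes_compose sw_permutes) auto
qed

lemma bij_word_perm: "bij (word_perm is)"
proof (induction "is")
  case Nil
  show ?case
    unfolding word_perm_simps by (rule bij_id)
next
  case (Cons i "is")
  then show ?case
    unfolding word_perm_simps by (intro bij_comp[OF _ involuntory_imp_bij] Cons) simp
qed

lemma inv_sw_comp: "bij w \<Longrightarrow> inv_into UNIV (sw i \<circ> w) = inv_into UNIV w \<circ> sw i"
  by (subst o_inv_distrib) (auto simp: inv_transpose_eq)

section \<open>Inversions and the length function\<close>

definition invs :: "nat \<Rightarrow> (nat \<Rightarrow> nat) \<Rightarrow> (nat \<times> nat) set" where
  "invs n v = {(p, q). p \<in> {1..n} \<and> q \<in> {1..n} \<and> p < q \<and> v q < v p}"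

lemma finite_invs [simp]: "finite (invs n v)"
  by (rule finite_subset[of _ "{1..n} \<times> {1..n}"]) (auto simp: invs_def)

lemma sw_less: "p < q \<Longrightarrow> (p, q) \<noteq> (i, Suc i) \<Longrightarrow> sw i p < sw i q"
  by (auto simp: transpose_def)

lemma sw_range: "i \<in> {1..<n} \<Longrightarrow> p \<in> {1..n} \<Longrightarrow> sw i p \<in> {1..n}"
  by (auto simp: transpose_def)

text \<open>Applying s_i to both members of a pair maps the old inversions injectively to the new
  ones, and the only new inversion missed is (i, i+1).\<close>

lemma card_invs_ascent:
  assumes i: "i \<in> {1..<n}" and v: "v i < v (Suc i)"
  shows "card (invs n (v \<circ> sw i)) = Suc (card (invs n v))"
proof -
  let ?s = "map_prod (sw i) (sw i)"
  have ss: "?s (?s x) = x" for x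
    by (cases x) simp
  have mem: "?s x \<in> invs n (v \<circ> sw i)" if "x \<in> invs n v" for x
  proof -
    obtain p q where x: "x = (p, q)" by (cases x)
    have pq: "p \<in> {1..n}" "q \<in> {1..n}" "p < q" "v q < v p"
      using that unfolding x invs_def by blast+
    then have "(p, q) \<noteq> (i, Suc i)"
      using v by auto
    then have "sw i p < sw i q" "sw i p \<in> {1..n}" "sw i q \<in> {1..n}"
      using pq sw_less sw_range[OF i] by blast+
    then show ?thesis
      using pq unfolding x invs_def by simp
  qed
  have mem': "?s x \<in> invs n v" if "x \<in> invs n (v \<circ> sw i)" "x \<noteq> (i, Suc i)" for x
  proof -
    obtain p q where x: "x = (p, q)" by (cases x)
    have pq: "p \<in> {1..n}" "q \<in> {1..n}" "p < q" "v (sw i q) < v (sw i p)"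
      using that(1) unfolding x invs_def by simp_all
    then have "sw i p < sw i q" "sw i p \<in> {1..n}" "sw i q \<in> {1..n}"
      using that(2) x sw_less sw_range[OF i] by blast+
    then show ?thesis
      using pq unfolding x invs_def by simp
  qed
  have "invs n (v \<circ> sw i) = insert (i, Suc i) (?s ` invs n v)"
  proof (intro equalityI subsetI)
    fix x assume x: "x \<in> invs n (v \<circ> sw i)"
    show "x \<in> insert (i, Suc i) (?s ` invs n v)"
    proof (cases "x = (i, Suc i)")
      case False
      have "?s (?s x) \<in> ?s ` invs n v"
        by (rule imageI) (rule mem'[OF x False])
      then show ?thesis
        unfolding ss by (rule insertI2)
    next
      case True
      then show ?thesis
        by (rule ssubst) (rule insertI1)
    qed
  next
    fix x assume "x \<in> insert (i, Suc i) (?s ` invs n v)"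
    then show "x \<in> invs n (v \<circ> sw i)"
    proof
      assume x: "x = (i, Suc i)"
      show ?thesis
        unfolding x invs_def using i v by simp
    next
      assume "x \<in> ?s ` invs n v"
      then show ?thesis
        by (rule imageE) (use mem in simp)
    qed
  qed
  \<comment> \<open>A preimage of (i, i+1) would have to be (i+1, i), which is not an ordered
    pair.\<close>
  moreover have "(i, Suc i) \<notin> ?s ` invs n v"
  proof
    assume "(i, Suc i) \<in> ?s ` invs n v"
    then obtain p q where "(p, q) \<in> invs n v" "sw i p = i" "sw i q = Suc i"
      by auto
    then have "p = sw i i" "q = sw i (Suc i)"
      by (metis transpose_involutory)+
    moreover have "p < q"
      using \<open>(p, q) \<in> invs n v\<close> by (simp add: invs_def)
    ultimately show False
      by simp
  qed
  moreover have "card (?s ` invs n v) = card (invs n v)"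
    by (intro card_image inj_on_inverseI[where g = ?s] ss)
  ultimately show ?thesis
    by simp
qed

lemma card_invs_descent:
  assumes i: "i \<in> {1..<n}" and v: "v (Suc i) < v i"
  shows "card (invs n v) = Suc (card (invs n (v \<circ> sw i)))"
  using card_invs_ascent[OF i, of "v \<circ> sw i"] v by (simp add: comp_assoc[symmetric])

text \<open>The pair (p, q) is an inversion of the inverse of \<open>w\<close> exactly if the
  preimages of q and p, in this order, are an inversion of \<open>w\<close>.\<close>

lemma card_invs_inv:
  assumes "w permutes {1..n}"
  shows "card (invs n (inv_into UNIV w)) = card (invs n w)"
proof -
  let ?v = "inv_into UNIV w"
  have w: "w (?v p) = p" "?v (w p) = p" for p
    using assms by (simp_all add: permutes_inverses)
  have r: "w p \<in> {1..n} \<longleftrightarrow> p \<in> {1..n}" "?v p \<in> {1..n} \<longleftrightarrow> p \<in> {1..n}" for p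
    using permutes_in_image[OF assms] permutes_in_image[OF permutes_inv[OF assms]] by auto
  have "bij_betw (\<lambda>(p, q). (?v q, ?v p)) (invs n ?v) (invs n w)"
  proof (rule bij_betw_byWitness[where f' = "\<lambda>(p, q). (w q, w p)"])
    show "(\<lambda>(p, q). (?v q, ?v p)) ` invs n ?v \<subseteq> invs n w"
      using w r unfolding invs_def by fastforce
    show "(\<lambda>(p, q). (w q, w p)) ` invs n w \<subseteq> invs n ?v"
      using w r unfolding invs_def by fastforce
  qed (auto simp: w)
  then show ?thesis
    by (rule bij_betw_same_card)
qed

text \<open>A letter is added on the left, which multiplies the inverse permutation by s_i on the
  right. The condition says that this step is an ascent of the inverse, so that each letter creates
  an inversion.\<close>

fun red :: "nat list \<Rightarrow> bool" where
  "red [] \<longleftrightarrow> True"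
| "red (i # is) \<longleftrightarrow> red is \<and> inv_into UNIV (word_perm is) i < inv_into UNIV (word_perm is) (Suc i)"

text \<open>Every letter changes the number of inversions of the inverse by 1, up or down; the bound
  is attained exactly when it always goes up.\<close>

lemma red_iff_length:
  assumes "set is \<subseteq> {1..<n}"
  shows "card (invs n (inv_into UNIV (word_perm is))) \<le> length is"
    and "red is \<longleftrightarrow> card (invs n (inv_into UNIV (word_perm is))) = length is"
proof -
  have "card (invs n (inv_into UNIV (word_perm is))) \<le> length is \<and>
    (red is \<longleftrightarrow> card (invs n (inv_into UNIV (word_perm is))) = length is)"
    using assms
  proof (induction "is")
    case Nil
    have "invs n (\<lambda>p. p) = {}"
      by (auto simp: invs_def)
    then show ?case
      by simp
  next
    case (Cons i "is")
    let ?v = "inv_into UNIV (word_perm is)"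
    have i: "i \<in> {1..<n}"
      using Cons by simp
    have eq: "inv_into UNIV (word_perm (i # is)) = ?v \<circ> sw i"
      by (simp add: inv_sw_comp bij_word_perm)
    have "?v i \<noteq> ?v (Suc i)"
      using bij_is_inj[OF bij_imp_bij_inv[OF bij_word_perm]] by (metis inj_eq n_not_Suc_n)
    then consider "?v i < ?v (Suc i)" | "?v (Suc i) < ?v i"
      by linarith
    then show ?case
    proof cases
      case 1
      have "card (invs n (inv_into UNIV (word_perm (i # is)))) = Suc (card (invs n ?v))"
        unfolding eq by (rule card_invs_ascent[OF i 1])
      then show ?thesis
        using Cons 1 by (simp del: word_perm_simps)
    next
      case 2
      have "card (invs n ?v) = Suc (card (invs n (inv_into UNIV (word_perm (i # is)))))"
        unfolding eq by (rule card_invs_descent[OF i 2])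
      then show ?thesis
        using Cons 2 by (auto simp del: word_perm_simps)
    qed
  qed
  then show "card (invs n (inv_into UNIV (word_perm is))) \<le> length is"
    "red is \<longleftrightarrow> card (invs n (inv_into UNIV (word_perm is))) = length is"
    by auto
qed

text \<open>By injectivity \<open>v\<close> is strictly increasing along {1..n}, so v(i) \<ge> i for
  each i there, and the identity is the only such permutation.\<close>

lemma no_descent_imp_id:
  assumes v: "v permutes {1..n}" and asc: "\<And>i. i \<in> {1..<n} \<Longrightarrow> v i \<le> v (Suc i)"
  shows "v = id"
proof (rule permutes_natset_ge[OF v], rule ballI)
  fix i assume "i \<in> {1..n}"
  then have "1 \<le> i" "i \<le> n"
    by auto
  then show "i \<le> v i"
  proof (induction i rule: dec_induct)
    case base
    then show ?case
      using permutes_in_image[OF v, of 1] by auto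
  next
    case (step i)
    then have "v i \<noteq> v (Suc i)"
      using permutes_inj[OF v] by (metis inj_eq n_not_Suc_n)
    moreover have "v i \<le> v (Suc i)"
      using step asc by simp
    ultimately show ?case
      using step by simp
  qed
qed

text \<open>Sorting: a descent of the inverse at i supplies the first letter, and s_i w has fewer
  inversions. Without descents the permutation is the identity.\<close>

lemma red_word_exists:
  assumes "w permutes {1..n}"
  obtains "is" where "set is \<subseteq> {1..<n}" "word_perm is = w" "red is"
proof -
  have "\<exists>is. set is \<subseteq> {1..<n} \<and> word_perm is = w \<and> red is"
    using assms
  proof (induction "card (invs n (inv_into UNIV w))" arbitrary: w rule: less_induct)
    case less
    let ?v = "inv_into UNIV w"
    show ?case
    proof (cases "\<exists>i\<in>{1..<n}. ?v (Suc i) < ?v i")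
      case True
      then obtain i where i: "i \<in> {1..<n}" "?v (Suc i) < ?v i"
        by blast
      have inv: "inv_into UNIV (sw i \<circ> w) = ?v \<circ> sw i"
        using less permutes_bij inv_sw_comp by blast
      have "sw i \<circ> w permutes {1..n}"
        using less sw_permutes[OF i(1)] by (intro permutes_compose) auto
      moreover have "card (invs n (inv_into UNIV (sw i \<circ> w))) < card (invs n ?v)"
        unfolding inv using card_invs_descent[OF i] by simp
      ultimately obtain "is" where "is": "set is \<subseteq> {1..<n}" "word_perm is = sw i \<circ> w" "red is"
        using less by blast
      then have "set (i # is) \<subseteq> {1..<n} \<and> word_perm (i # is) = w \<and> red (i # is)"
        using i by (simp add: inv)
      then show ?thesis
        by blast
    next
      case False
      then have "?v = id"
        using permutes_inv[OF less(2)] by (intro no_descent_imp_id[of _ n]) (auto simp: not_less)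
      then have "w = id"
        using permutes_inv_inv[OF less(2)] by simp
      then show ?thesis
        by (intro exI[of _ "[]"]) simp
    qed
  qed
  then show ?thesis
    using that by blast
qed

lemma perm_length_eq:
  assumes "w permutes {1..n}"
  shows "perm_length n w = card (invs n w)"
proof -
  obtain "is" where "is": "set is \<subseteq> {1..<n}" "word_perm is = w" "red is"
    by (rule red_word_exists[OF assms])
  have "perm_length n w = card (invs n (inv_into UNIV w))"
    unfolding perm_length_def
  proof (rule Least_equality)
    show "\<exists>is. set is \<subseteq> {1..<n} \<and> word_perm is = w \<and> length is = card (invs n (inv_into UNIV w))"
      by (rule exI[of _ "is"]) (use "is" red_iff_length(2)[OF "is"(1)] in simp)
    show "card (invs n (inv_into UNIV w)) \<le> r"
      if "\<exists>is. set is \<subseteq> {1..<n} \<and> word_perm is = w \<and> length is = r" for r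
      using that red_iff_length(1) by blast
  qed
  then show ?thesis
    using card_invs_inv[OF assms] by simp
qed

lemma red_length:
  assumes "set is \<subseteq> {1..<n}" "red is"
  shows "perm_length n (word_perm is) = length is"
  using assms red_iff_length(2)[OF assms(1)] perm_length_eq[OF word_perm_permutes[OF assms(1)]]
    card_invs_inv[OF word_perm_permutes[OF assms(1)]] by simp

lemma reduced_word:
  assumes "w permutes {1..n}"
  shows "set (reduced_word n w) \<subseteq> {1..<n}" "word_perm (reduced_word n w) = w" "red (reduced_word n w)"
proof -
  obtain "is" where "is": "set is \<subseteq> {1..<n}" "word_perm is = w" "red is"
    by (rule red_word_exists[OF assms])
  have "length is = perm_length n w"
    using red_length[OF "is"(1,3)] "is"(2) by simp
  then have "\<exists>is. set is \<subseteq> {1..<n} \<and> word_perm is = w \<and> length is = perm_length n w"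
    using "is"(1,2) by blast
  from someI_ex[OF this] have *: "set (reduced_word n w) \<subseteq> {1..<n} \<and> word_perm (reduced_word n w) = w
      \<and> length (reduced_word n w) = perm_length n w"
    unfolding reduced_word_def .
  then show "set (reduced_word n w) \<subseteq> {1..<n}" "word_perm (reduced_word n w) = w"
    by auto
  from red_iff_length(2)[OF this(1)] show "red (reduced_word n w)"
    using * perm_length_eq[OF assms] card_invs_inv[OF assms] by simp
qed

lemma red_same_length:
  assumes "set is \<subseteq> {1..<n}" "red is" "set js \<subseteq> {1..<n}" "red js" "word_perm is = word_perm js"
  shows "length is = length js"
  using red_length[OF assms(1,2)] red_length[OF assms(3,4)] assms(5) by simp

lemma reduced_word_id [simp]: "reduced_word n id = []"
proof -
  note r = reduced_word[OF permutes_id, of n]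
  have "length (reduced_word n id) = length ([] :: nat list)"
    by (rule red_same_length[OF r(1) r(3)]) (simp_all add: r(2))
  then show ?thesis
    by simp
qed

lemma reduced_word_sw:
  assumes "i \<in> {1..<n}" shows "reduced_word n (sw i) = [i]"
proof -
  note r = reduced_word[OF sw_permutes[OF assms]]
  have "length (reduced_word n (sw i)) = length [i]"
    by (rule red_same_length[OF r(1) r(3)]) (use assms in \<open>simp_all add: r(2)\<close>)
  then have "length (reduced_word n (sw i)) = Suc 0"
    by simp
  then obtain j where j: "reduced_word n (sw i) = [j]"
    unfolding length_Suc_conv length_0_conv by blast
  \<comment> \<open>The single letter is found by evaluating at j: the left-hand side is j+1, and
    s_i maps j to j+1 only for j = i.\<close>
  have "word_perm [j] j = sw i j"
    using r(2) unfolding j by (rule fun_cong)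
  then have "sw i j = Suc j"
    by simp
  then have "j = i"
    unfolding transpose_def by presburger
  then show ?thesis
    using j by simp
qed

text \<open>For the first letter i let v be the inverse of the permutation of the remaining word.
  Preservation of blocks gives \<beta>(i+1) = \<beta>(v(i)) and \<beta>(v(i+1)) = \<beta>(i); since
  v(i) < v(i+1) and \<beta> is weakly increasing, all these values coincide. Then s_i preserves the
  blocks, hence so does the remaining word, and the argument repeats.\<close>

lemma red_word_young:
  fixes \<beta> :: "nat \<Rightarrow> nat"
  assumes "set is \<subseteq> {1..<n}" "red is"
    and mono: "\<And>p q. p \<in> {1..n} \<Longrightarrow> q \<in> {1..n} \<Longrightarrow> p \<le> q \<Longrightarrow> \<beta> p \<le> \<beta> q"
    and "\<forall>p\<in>{1..n}. \<beta> (word_perm is p) = \<beta> p"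
  shows "\<forall>i\<in>set is. \<beta> i = \<beta> (Suc i)"
  using assms(1,2,4)
proof (induction "is")
  case (Cons i "is")
  let ?W = "word_perm is" and ?v = "inv_into UNIV (word_perm is)"
  have i: "i \<in> {1..n}" "Suc i \<in> {1..n}" and is_n: "set is \<subseteq> {1..<n}"
    using Cons.prems(1) by auto
  have W: "?W permutes {1..n}"
    using is_n by (rule word_perm_permutes)
  have v1: "?W (?v p) = p" for p
    using permutes_inverses(1)[OF W] by simp
  have v2: "?v p \<in> {1..n}" if "p \<in> {1..n}" for p
    using permutes_in_image[OF permutes_inv[OF W]] that by blast
  have W2: "?W p \<in> {1..n}" if "p \<in> {1..n}" for p
    using permutes_in_image[OF W] that by blast
  have lt: "?v i < ?v (Suc i)" and "red is"
    using Cons.prems(2) by simp_all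
  have w: "\<beta> (sw i (?W p)) = \<beta> p" if "p \<in> {1..n}" for p
    using Cons.prems(3) that by simp
  have \<beta>v: "\<beta> (sw i p) = \<beta> (?v p)" if "p \<in> {1..n}" for p
    using w[OF v2[OF that]] unfolding v1 .
  have "\<beta> (Suc i) = \<beta> (?v i)"
    using \<beta>v[OF i(1)] by simp
  also have "\<dots> \<le> \<beta> (?v (Suc i))"
    using lt v2[OF i(1)] v2[OF i(2)] by (intro mono) simp_all
  also have "\<dots> = \<beta> i"
    using \<beta>v[OF i(2)] by simp
  finally have "\<beta> (Suc i) \<le> \<beta> i" .
  moreover have "\<beta> i \<le> \<beta> (Suc i)"
    using i by (rule mono) simp
  ultimately have eq: "\<beta> i = \<beta> (Suc i)"
    by (rule antisym[rotated])
  have sw: "\<beta> (sw i p) = \<beta> p" for p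
    using eq by (cases "p = i"; cases "p = Suc i") simp_all
  have "\<forall>p\<in>{1..n}. \<beta> (?W p) = \<beta> p"
    using w unfolding sw by blast
  from Cons.IH[OF is_n \<open>red is\<close> this] show ?case
    using eq by simp
qed simp

text \<open>Matsumoto's theorem for Young subgroups, whose blocks are the level sets of \<open>\<beta>\<close>.\<close>

locale braid_family = monoid M for M :: "('a, 'b) monoid_scheme" (structure) +
  fixes n :: nat and \<beta> :: "nat \<Rightarrow> nat" and g :: "nat \<Rightarrow> 'a"
  assumes mono: "\<And>p q. p \<in> {1..n} \<Longrightarrow> q \<in> {1..n} \<Longrightarrow> p \<le> q \<Longrightarrow> \<beta> p \<le> \<beta> q"
    and g: "\<And>i. i \<in> {1..<n} \<Longrightarrow> \<beta> i = \<beta> (Suc i) \<Longrightarrow> g i \<in> carrier M"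
    and comm: "\<And>i j. i \<in> {1..<n} \<Longrightarrow> \<beta> i = \<beta> (Suc i) \<Longrightarrow> j \<in> {1..<n} \<Longrightarrow> \<beta> j = \<beta> (Suc j) \<Longrightarrow>
      Suc i < j \<Longrightarrow> g i \<otimes> g j = g j \<otimes> g i"
    and braid: "\<And>i. i \<in> {1..<n} \<Longrightarrow> Suc i \<in> {1..<n} \<Longrightarrow> \<beta> i = \<beta> (Suc i) \<Longrightarrow> \<beta> (Suc i) = \<beta> (Suc (Suc i)) \<Longrightarrow>
      g i \<otimes> (g (Suc i) \<otimes> g i) = g (Suc i) \<otimes> (g i \<otimes> g (Suc i))"
begin

text \<open>The block condition is imposed on the permutation and not on the letters;
  \<open>red_word_young\<close> transfers it to the letters, so that all factors \<open>g i\<close>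
  lie in the monoid.\<close>

definition good :: "nat list \<Rightarrow> bool" where
  "good is \<longleftrightarrow> set is \<subseteq> {1..<n} \<and> red is \<and> (\<forall>p\<in>{1..n}. \<beta> (word_perm is p) = \<beta> p)"

lemma good_letters:
  assumes "good is" shows "\<forall>i\<in>set is. i \<in> {1..<n} \<and> \<beta> i = \<beta> (Suc i)"
proof -
  have g: "set is \<subseteq> {1..<n}" "red is" "\<forall>p\<in>{1..n}. \<beta> (word_perm is p) = \<beta> p"
    using assms unfolding good_def by blast+
  have "\<forall>i\<in>set is. \<beta> i = \<beta> (Suc i)"
    by (rule red_word_young[OF g(1,2) _ g(3)]) (rule mono)
  then show ?thesis
    using g(1) by blast
qed

lemma good_carrier: "good is \<Longrightarrow> set (map g is) \<subseteq> carrier M"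
  using good_letters g by fastforce

lemma good_tl: assumes "good (i # is)" shows "good is"
proof -
  have eq: "\<beta> i = \<beta> (Suc i)"
    using good_letters[OF assms] by simp
  have sw: "\<beta> (sw i p) = \<beta> p" for p
    using eq by (cases "p = i"; cases "p = Suc i") simp_all
  have "set (i # is) \<subseteq> {1..<n}" "red (i # is)" "\<forall>p\<in>{1..n}. \<beta> (sw i (word_perm is p)) = \<beta> p"
    using assms unfolding good_def word_perm_simps o_apply by blast+
  then show ?thesis
    unfolding good_def sw by simp
qed

text \<open>If both i and j can start a reduced word of \<open>w\<close>, then there are two reduced
  words starting with i and with j that differ by a single braid relation at the front.\<close>

lemma braid_step:
  assumes w: "w permutes {1..n}" "\<forall>p\<in>{1..n}. \<beta> (w p) = \<beta> p"
    and ij: "i \<in> {1..<n}" "j \<in> {1..<n}" "i < j"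
    and d: "inv_into UNIV w (Suc i) < inv_into UNIV w i" "inv_into UNIV w (Suc j) < inv_into UNIV w j"
  shows "\<exists>xs ys. good (i # xs) \<and> good (j # ys) \<and> word_perm (i # xs) = w \<and> word_perm (j # ys) = w
    \<and> mprod M (map g (i # xs)) = mprod M (map g (j # ys))"
proof -
  let ?v = "inv_into UNIV w"
  have bw: "bij w"
    using w(1) by (rule permutes_bij)
  show ?thesis
  proof (cases "Suc i < j")
    case True
    \<comment> \<open>Commuting case: both letters are removed from the left of
      \<open>w\<close>.\<close>
    define w' where "w' = sw j \<circ> (sw i \<circ> w)"
    have "w' permutes {1..n}"
      unfolding w'_def using w ij by (intro permutes_compose sw_permutes)
    then obtain ks where ks: "set ks \<subseteq> {1..<n}" "word_perm ks = w'" "red ks"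
      by (rule red_word_exists)
    have inv: "inv_into UNIV (word_perm ks) = ?v \<circ> sw i \<circ> sw j"
      unfolding ks w'_def using bw by (simp add: inv_sw_comp bij_comp)
    have inv': "inv_into UNIV (word_perm (k # ks)) = ?v \<circ> sw i \<circ> sw j \<circ> sw k" for k
      by (simp add: inv_sw_comp bij_word_perm inv)
    have cm: "sw i \<circ> sw j = sw j \<circ> sw i"
      using True by (intro ext) (simp add: transpose_def)
    have wp: "word_perm (i # j # ks) = w" "word_perm (j # i # ks) = w"
      using cm by (simp_all add: ks w'_def fun_eq_iff)
    have "red (i # j # ks)" "red (j # i # ks)"
      using True d ks(3) by (simp_all only: red.simps inv inv') (auto simp: transpose_def)
    then have good: "good (i # j # ks)" "good (j # i # ks)"
      unfolding good_def wp using ks ij w by auto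
    have "mprod M (map g (i # j # ks)) = mprod M (map g (j # i # ks))"
      using comm[of i j] good_letters[OF good(1)] good_carrier[OF good(1)] True
      by (simp add: m_assoc[symmetric])
    then show ?thesis
      using good wp by blast
  next
    case False
    then have j: "j = Suc i"
      using ij by simp
    \<comment> \<open>Adjacent case: the longest element s_i s_j s_i of the subgroup generated by
      s_i and s_j is removed from the left of \<open>w\<close>.\<close>
    define w' where "w' = sw i \<circ> (sw j \<circ> (sw i \<circ> w))"
    have "w' permutes {1..n}"
      unfolding w'_def using w ij by (intro permutes_compose sw_permutes)
    then obtain ks where ks: "set ks \<subseteq> {1..<n}" "word_perm ks = w'" "red ks"
      by (rule red_word_exists)
    have inv: "inv_into UNIV (word_perm ks) = ?v \<circ> sw i \<circ> sw j \<circ> sw i"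
      unfolding ks w'_def using bw by (simp add: inv_sw_comp bij_comp)
    have inv': "inv_into UNIV (word_perm (k # ks)) = ?v \<circ> sw i \<circ> sw j \<circ> sw i \<circ> sw k" for k
      by (simp add: inv_sw_comp bij_word_perm inv)
    have inv'': "inv_into UNIV (word_perm (l # k # ks)) = ?v \<circ> sw i \<circ> sw j \<circ> sw i \<circ> sw k \<circ> sw l" for k l
      by (subst word_perm_simps(2), subst inv_sw_comp, rule bij_word_perm, subst inv') simp
    have cm: "sw i (sw j (sw i p)) = sw j (sw i (sw j p))" for p
      unfolding j by (auto simp: transpose_def)
    have wp: "word_perm (i # j # i # ks) = w" "word_perm (j # i # j # ks) = w"
      by (simp_all add: ks w'_def fun_eq_iff) (simp add: cm)
    have "red (i # j # i # ks)" "red (j # i # j # ks)"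
      using d ks(3) unfolding j by (simp_all only: red.simps inv inv' inv'' j) (auto simp: transpose_def)
    then have good: "good (i # j # i # ks)" "good (j # i # j # ks)"
      unfolding good_def wp using ks ij w by auto
    have c: "g i \<in> carrier M" "g j \<in> carrier M" "mprod M (map g ks) \<in> carrier M"
      using good_carrier[OF good(1)] by auto
    have "g i \<otimes> (g j \<otimes> g i) = g j \<otimes> (g i \<otimes> g j)"
      unfolding j using good_letters[OF good(1)] ij j by (intro braid) auto
    then have "(g i \<otimes> (g j \<otimes> g i)) \<otimes> mprod M (map g ks) = (g j \<otimes> (g i \<otimes> g j)) \<otimes> mprod M (map g ks)"
      by simp
    then have "mprod M (map g (i # j # i # ks)) = mprod M (map g (j # i # j # ks))"
      using c by (simp add: m_assoc)
    then show ?thesis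
      using good wp by blast
  qed
qed

text \<open>Induction on the length. \<open>braid_step\<close> (or, for equal first letters, the
  first word itself) supplies two words with equal products that start with the first letters i and
  j of the given ones. Each given word then shares its first letter with one of them, and the tails
  are compared by induction.\<close>

theorem matsumoto:
  "good is \<Longrightarrow> good js \<Longrightarrow> word_perm is = word_perm js \<Longrightarrow> mprod M (map g is) = mprod M (map g js)"
proof (induction "length is" arbitrary: "is" js rule: less_induct)
  case less
  have len: "length is = length js"
    using less by (intro red_same_length[of _ n]) (auto simp: good_def)
  show ?case
  proof (cases "is")
    case Nil
    then show ?thesis
      using len by simp
  next
    case (Cons i is')
    then obtain j js' where js: "js = j # js'"
      using len by (cases js) auto
    define w where "w = word_perm is"
    have w: "w permutes {1..n}" "\<forall>p\<in>{1..n}. \<beta> (w p) = \<beta> p"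
      unfolding w_def using less(2) word_perm_permutes[of "is" n] unfolding good_def by blast+
    have desc: "inv_into UNIV w (Suc k) < inv_into UNIV w k \<and> k \<in> {1..<n}" if "good (k # ks)" "word_perm (k # ks) = w" for k ks
    proof -
      have "inv_into UNIV w = inv_into UNIV (word_perm ks) \<circ> sw k"
        using that(2)[symmetric] by (simp add: inv_sw_comp bij_word_perm)
      then show ?thesis
        using that(1) by (simp add: good_def)
    qed
    have IH: "mprod M (map g ks) = mprod M (map g ls)"
      if "good (k # ks)" "good (k # ls)" "word_perm (k # ks) = w" "word_perm (k # ls) = w" "length (k # ls) = length is" for k ks ls
    proof -
      have "word_perm ls = word_perm ks"
        using that sw_sw(1)[of k "word_perm ks"] sw_sw(1)[of k "word_perm ls"] by simp
      then show ?thesis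
        using less(1)[of ls ks] that good_tl by simp
    qed
    have di: "inv_into UNIV w (Suc i) < inv_into UNIV w i \<and> i \<in> {1..<n}"
      by (rule desc[of _ is']) (use less Cons in \<open>simp_all add: w_def\<close>)
    have dj: "inv_into UNIV w (Suc j) < inv_into UNIV w j \<and> j \<in> {1..<n}"
      by (rule desc[of _ js']) (use less js in \<open>simp_all add: w_def\<close>)
    have "\<exists>xs ys. good (i # xs) \<and> good (j # ys) \<and> word_perm (i # xs) = w \<and> word_perm (j # ys) = w
      \<and> mprod M (map g (i # xs)) = mprod M (map g (j # ys))"
    proof -
      consider "i = j" | "i < j" | "j < i"
        by linarith
      then show ?thesis
      proof cases
        case 1
        then show ?thesis
          using less(2) Cons w_def by blast
      next
        case 2
        then show ?thesis
          using di dj by (intro braid_step w) auto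
      next
        case 3
        then have "\<exists>ys xs. good (j # ys) \<and> good (i # xs) \<and> word_perm (j # ys) = w \<and> word_perm (i # xs) = w
          \<and> mprod M (map g (j # ys)) = mprod M (map g (i # xs))"
          using di dj by (intro braid_step w) auto
        then show ?thesis
          by metis
      qed
    qed
    then obtain xs ys where xy: "good (i # xs)" "good (j # ys)" "word_perm (i # xs) = w" "word_perm (j # ys) = w"
      "mprod M (map g (i # xs)) = mprod M (map g (j # ys))"
      by blast
    have "mprod M (map g xs) = mprod M (map g is')"
      using xy less Cons by (intro IH[of i]) (simp_all add: w_def)
    moreover have "mprod M (map g ys) = mprod M (map g js')"
      using xy less js len by (intro IH[of j]) (simp_all add: w_def)
    ultimately show ?thesis
      using xy(5) by (simp add: Cons js)
  qed
qed

end

section \<open>Colourings and Young subgroups\<close>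

primrec cnt :: "(nat \<Rightarrow> nat) \<Rightarrow> nat \<Rightarrow> nat \<Rightarrow> nat" where
  "cnt c 0 a = 0"
| "cnt c (Suc m) a = cnt c m a + (if c (Suc m) = a then 1 else 0)"

text \<open>The place of j among the positions of its own colour, counted from 1. It becomes the
  index inside the tensor factor that belongs to this colour.\<close>

definition rank :: "(nat \<Rightarrow> nat) \<Rightarrow> nat \<Rightarrow> nat" where
  "rank c j = cnt c j (c j)"

lemma cnt_card: "cnt c m a = card {k \<in> {1..m}. c k = a}"
proof (induction m)
  case (Suc m)
  have "{k \<in> {1..Suc m}. c k = a} = (if c (Suc m) = a then insert (Suc m) {k \<in> {1..m}. c k = a}
    else {k \<in> {1..m}. c k = a})"
    by (auto simp: le_Suc_eq)
  then show ?case
    using Suc by simp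
qed simp

lemma cnt_mono: "m \<le> m' \<Longrightarrow> cnt c m a \<le> cnt c m' a"
  by (induction m' rule: dec_induct) auto

lemma cnt_cong: "(\<And>k. k \<in> {1..m} \<Longrightarrow> c k = c' k) \<Longrightarrow> cnt c m a = cnt c' m a"
  by (induction m) simp_all

lemma rank_cong: "(\<And>k. k \<in> {1..j} \<Longrightarrow> c k = c' k) \<Longrightarrow> 1 \<le> j \<Longrightarrow> rank c j = rank c' j"
  unfolding rank_def using cnt_cong[of j c c'] by simp

lemma rank_pos: "1 \<le> j \<Longrightarrow> 1 \<le> rank c j"
  by (cases j) (simp_all add: rank_def)

lemma rank_le: "j \<le> n \<Longrightarrow> rank c j \<le> cnt c n (c j)"
  unfolding rank_def by (rule cnt_mono)

lemma rank_less:
  assumes "j < k" "c j = c k" shows "rank c j < rank c k"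
proof -
  obtain k' where k: "k = Suc k'" "j \<le> k'"
    using assms(1) by (cases k) auto
  have "cnt c j (c k) \<le> cnt c k' (c k)"
    by (rule cnt_mono) (rule k)
  then show ?thesis
    using assms(2) by (simp add: rank_def k(1))
qed

lemma rank_Suc: "c i = c (Suc i) \<Longrightarrow> rank c (Suc i) = Suc (rank c i)"
  by (simp add: rank_def)

lemma cnt_sw_less: "m < i \<Longrightarrow> cnt (c \<circ> sw i) m a = cnt c m a"
  by (rule cnt_cong) simp

text \<open>Both exchanged positions are among the first \<open>m\<close>, so only their order
  changes.\<close>

lemma cnt_sw:
  assumes "1 \<le> i" "i < m" shows "cnt (c \<circ> sw i) m a = cnt c m a"
proof -
  obtain k where i: "i = Suc k"
    using assms(1) by (cases i) auto
  from assms(2) have "Suc i \<le> m"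
    by simp
  then show ?thesis
  proof (induction m rule: dec_induct)
    case base
    have "cnt (c \<circ> sw i) k a = cnt c k a"
      by (rule cnt_sw_less) (simp add: i)
    moreover have step: "cnt f (Suc i) a = cnt f k a + (if f i = a then 1 else 0) + (if f (Suc i) = a then 1 else 0)" for f
      unfolding i by simp
    ultimately show ?case
      unfolding step[of "c \<circ> sw i"] step[of c] by (simp del: cnt.simps)
  next
    case (step m)
    then have "sw i (Suc m) = Suc m"
      by (intro transpose_apply_other) auto
    then show ?case
      using step by simp
  qed
qed

lemma rank_sw_other:
  assumes "1 \<le> i" "j \<noteq> i" "j \<noteq> Suc i"
  shows "rank (c \<circ> sw i) j = rank c j"
proof -
  have "cnt (c \<circ> sw i) j a = cnt c j a" for a
    using assms cnt_sw_less[of j i] cnt_sw[of i j] by (cases "j < i") auto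
  then show ?thesis
    using assms by (simp add: rank_def)
qed

text \<open>Exchanging two neighbours of different colours keeps the order within each colour, so
  the rank travels with the strand.\<close>

lemma rank_sw:
  assumes "1 \<le> i" "c i \<noteq> c (Suc i)"
  shows "rank (c \<circ> sw i) (sw i j) = rank c j"
proof -
  obtain k where i: "i = Suc k"
    using assms(1) by (cases i) auto
  consider "j = i" | "j = Suc i" | "j \<noteq> i" "j \<noteq> Suc i"
    by blast
  then show ?thesis
  proof cases
    case 1
    have "cnt (c \<circ> sw i) (Suc i) (c i) = cnt c (Suc i) (c i)"
      using assms(1) by (rule cnt_sw) simp
    also have "\<dots> = cnt c i (c i)"
      using assms(2) by simp
    finally show ?thesis
      unfolding 1 rank_def by simp
  next
    case 2
    have k: "cnt (c \<circ> sw i) k (c (Suc i)) = cnt c k (c (Suc i))"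
      by (rule cnt_sw_less) (simp add: i)
    have step: "cnt f i a = cnt f k a + (if f i = a then 1 else 0)" for f a
      unfolding i by simp
    have "cnt (c \<circ> sw i) i (c (Suc i)) = cnt c k (c (Suc i)) + 1"
      unfolding step[of "c \<circ> sw i"] k by simp
    moreover have "cnt c (Suc i) (c (Suc i)) = cnt c k (c (Suc i)) + 1"
      using assms(2) step[of c "c (Suc i)"] by simp
    ultimately show ?thesis
      unfolding 2 rank_def by simp
  next
    case 3
    then show ?thesis
      using rank_sw_other[OF assms(1) 3] by simp
  qed
qed

section \<open>Sorting the positions by colour\<close>

definition wt :: "nat \<Rightarrow> nat \<Rightarrow> (nat \<Rightarrow> nat) \<Rightarrow> nat \<Rightarrow> nat" where
  "wt d n c = (\<lambda>a. if a \<in> {1..d} then cnt c n a else 0)"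

definition colouring :: "nat \<Rightarrow> nat \<Rightarrow> (nat \<Rightarrow> nat) \<Rightarrow> bool" where
  "colouring d n c \<longleftrightarrow> (\<forall>j\<in>{1..n}. c j \<in> {1..d})"

lemma colouringD: "colouring d n c \<Longrightarrow> j \<in> {1..n} \<Longrightarrow> c j \<in> {1..d}"
  by (simp add: colouring_def)

lemma wt_sw: "i \<in> {1..<n} \<Longrightarrow> wt d n (c \<circ> sw i) = wt d n c"
  unfolding wt_def by (rule ext) (simp add: cnt_sw)

lemma colouring_sw: "colouring d n c \<Longrightarrow> i \<in> {1..<n} \<Longrightarrow> colouring d n (c \<circ> sw i)"
  unfolding colouring_def using sw_range[of i n] by fastforce

lemma sum_wt:
  assumes "colouring d n c" shows "(\<Sum>a\<in>{1..d}. wt d n c a) = n"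
proof -
  have "(\<Sum>a\<in>{1..d}. cnt c m a) = m" if "m \<le> n" for m
    using that
  proof (induction m)
    case (Suc m)
    then have "c (Suc m) \<in> {1..d}"
      using colouringD[OF assms, of "Suc m"] by simp
    then show ?case
      using Suc by (simp add: sum.distrib)
  qed simp
  then show ?thesis
    by (simp add: wt_def)
qed

lemma wt_composition: "colouring d n c \<Longrightarrow> wt d n c \<in> compositions d n"
  unfolding compositions_def using sum_wt[of d n c] by (simp add: wt_def)

lemma offset_Suc: "1 \<le> a \<Longrightarrow> offset \<mu> (Suc a) = offset \<mu> a + \<mu> a"
  by (simp add: offset_def)

lemma offset_mono: "a \<le> b \<Longrightarrow> offset \<mu> a \<le> offset \<mu> b"
  unfolding offset_def by (rule sum_mono2) auto

lemma offset_less: "1 \<le> a \<Longrightarrow> a < b \<Longrightarrow> offset \<mu> a + \<mu> a \<le> offset \<mu> b"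
  using offset_mono[of "Suc a" b \<mu>] by (simp add: offset_Suc)

text \<open>The intervals between consecutive offsets are disjoint, which is the uniqueness behind
  the definite description in \<open>block\<close>.\<close>

lemma block_eq:
  assumes "1 \<le> a" "offset \<mu> a < j" "j \<le> offset \<mu> a + \<mu> a"
  shows "block \<mu> j = a"
  unfolding block_def
proof (rule the_equality)
  fix b assume b: "1 \<le> b \<and> offset \<mu> b < j \<and> j \<le> offset \<mu> b + \<mu> b"
  show "b = a"
  proof (rule linorder_cases[of a b])
    assume "a < b"
    then show ?thesis
      using offset_less[of a b \<mu>] assms b by linarith
  next
    assume "b < a"
    then show ?thesis
      using offset_less[of b a \<mu>] assms b by linarith
  qed simp
qed (use assms in simp)

text \<open>The stable sorting permutation of a colouring. For the colouring of a character \<chi>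
  it is the inverse of \<pi>_\<chi>, see \<open>char_perm_inv\<close>; it is the identity outside
  {1..n}, so that it is a permutation in the sense of \<open>permutes\<close>.\<close>

definition pos :: "nat \<Rightarrow> nat \<Rightarrow> (nat \<Rightarrow> nat) \<Rightarrow> nat \<Rightarrow> nat" where
  "pos d n c j = (if j \<in> {1..n} then offset (wt d n c) (c j) + rank c j else j)"

context
  fixes d n :: nat and c :: "nat \<Rightarrow> nat"
  assumes col: "colouring d n c"
begin

lemma pos_bounds:
  assumes j: "j \<in> {1..n}"
  shows "offset (wt d n c) (c j) < pos d n c j"
    "pos d n c j \<le> offset (wt d n c) (c j) + wt d n c (c j)"
proof -
  have "1 \<le> rank c j" "rank c j \<le> cnt c n (c j)"
    using j rank_pos[of j c] rank_le[of j n c] by simp_all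
  then show "offset (wt d n c) (c j) < pos d n c j"
    "pos d n c j \<le> offset (wt d n c) (c j) + wt d n c (c j)"
    using j colouringD[OF col j] by (simp_all add: pos_def wt_def)
qed

lemma pos_block:
  assumes j: "j \<in> {1..n}" shows "block (wt d n c) (pos d n c j) = c j"
  using colouringD[OF col j] by (intro block_eq pos_bounds j) simp

lemma pos_range:
  assumes j: "j \<in> {1..n}" shows "pos d n c j \<in> {1..n}"
proof -
  have cj: "c j \<in> {1..d}"
    by (rule colouringD[OF col j])
  have "offset (wt d n c) (c j) + wt d n c (c j) \<le> offset (wt d n c) (Suc d)"
    using cj by (intro offset_less) auto
  also have "\<dots> = n"
    using sum_wt[OF col] by (simp add: offset_def atLeastLessThanSuc_atLeastAtMost)
  finally show ?thesis
    using pos_bounds[OF j] by simp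
qed

lemma pos_less_same:
  assumes "j \<in> {1..n}" "k \<in> {1..n}" "j < k" "c j = c k"
  shows "pos d n c j < pos d n c k"
  using rank_less[OF assms(3,4)] assms unfolding pos_def by simp

lemma pos_less_colour:
  assumes "j \<in> {1..n}" "k \<in> {1..n}" "c j < c k"
  shows "pos d n c j < pos d n c k"
  using pos_bounds[OF assms(1)] pos_bounds[OF assms(2)] offset_less[of "c j" "c k" "wt d n c"]
    assms(3) colouringD[OF col assms(1)] by simp

lemma pos_inj: "inj_on (pos d n c) {1..n}"
proof (rule inj_onI)
  fix j k assume jk: "j \<in> {1..n}" "k \<in> {1..n}" "pos d n c j = pos d n c k"
  then have "c j = c k"
    using pos_block by metis
  then show "j = k"
    using jk pos_less_same[of j k] pos_less_same[of k j] by (metis less_irrefl linorder_neqE_nat)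
qed

lemma pos_permutes: "pos d n c permutes {1..n}"
proof (rule bij_imp_permutes)
  have "pos d n c ` {1..n} = {1..n}"
    using pos_range by (intro endo_inj_surj pos_inj) auto
  then show "bij_betw (pos d n c) {1..n} {1..n}"
    using pos_inj by (simp add: bij_betw_def)
qed (auto simp: pos_def)

lemma pos_surj:
  assumes "p \<in> {1..n}" obtains j where "j \<in> {1..n}" "p = pos d n c j"
  using permutes_image[OF pos_permutes] assms by blast

lemma block_mono:
  assumes "p \<in> {1..n}" "q \<in> {1..n}" "p \<le> q"
  shows "block (wt d n c) p \<le> block (wt d n c) q"
proof -
  obtain j where j: "j \<in> {1..n}" "p = pos d n c j"
    by (rule pos_surj[OF assms(1)])
  obtain k where k: "k \<in> {1..n}" "q = pos d n c k"
    by (rule pos_surj[OF assms(2)])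
  have "\<not> c k < c j"
    using pos_less_colour[OF k(1) j(1)] assms(3) j k by auto
  then show ?thesis
    unfolding j(2) k(2) pos_block[OF j(1)] pos_block[OF k(1)] by simp
qed

lemma block_range:
  assumes "p \<in> {1..n}" shows "block (wt d n c) p \<in> {1..d}"
proof -
  obtain j where j: "j \<in> {1..n}" "p = pos d n c j"
    by (rule pos_surj[OF assms])
  show ?thesis
    unfolding j(2) pos_block[OF j(1)] by (rule colouringD[OF col j(1)])
qed

lemma pos_Suc:
  assumes i: "i \<in> {1..<n}" and "c i = c (Suc i)"
  shows "pos d n c (Suc i) = Suc (pos d n c i)" "pos d n c i \<in> {1..<n}"
proof -
  show 1: "pos d n c (Suc i) = Suc (pos d n c i)"
    using i assms(2) rank_Suc[OF assms(2)] by (simp add: pos_def)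
  show "pos d n c i \<in> {1..<n}"
    using pos_range[of i] pos_range[of "Suc i"] i unfolding 1 by simp
qed

text \<open>For equal colours, sorting sends i and i+1 to neighbouring places, so it conjugates s_i
  into another simple transposition.\<close>

lemma pos_sw_same:
  assumes i: "i \<in> {1..<n}" "c i = c (Suc i)"
  shows "pos d n c (sw i j) = sw (pos d n c i) (pos d n c j)"
proof -
  have inj: "inj (pos d n c)"
    by (rule permutes_inj[OF pos_permutes])
  consider "j = i" | "j = Suc i" | "j \<noteq> i" "j \<noteq> Suc i"
    by blast
  then show ?thesis
  proof cases
    case 3
    then have "pos d n c j \<noteq> pos d n c i" "pos d n c j \<noteq> Suc (pos d n c i)"
      using inj pos_Suc(1)[OF i] by (metis inj_eq)+
    then show ?thesis
      using 3 by simp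
  qed (use pos_Suc(1)[OF i] in simp_all)
qed

text \<open>For different colours, sorting absorbs s_i: colours and ranks move with the strands, so
  the sorted places are the same before and after the exchange.\<close>

lemma pos_sw_other:
  assumes i: "i \<in> {1..<n}" "c i \<noteq> c (Suc i)"
  shows "pos d n (c \<circ> sw i) (sw i j) = pos d n c j"
proof (cases "j \<in> {1..n}")
  case True
  then have "sw i j \<in> {1..n}"
    by (rule sw_range[OF i(1)])
  moreover have "rank (c \<circ> sw i) (sw i j) = rank c j"
    using i by (intro rank_sw) auto
  ultimately show ?thesis
    using True by (simp add: pos_def wt_sw[OF i(1)])
next
  case False
  then have "j \<noteq> i" "j \<noteq> Suc i"
    using i by auto
  then have "sw i j = j"
    by simp
  moreover have "pos d n c' j = j" for c'
    using False by (simp only: pos_def if_False)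
  ultimately show ?thesis
    by (simp only:)
qed

text \<open>Being increasing on the blocks characterises the element of minimal length in its coset modulo
  the Young subgroup.\<close>

lemma pos_unique:
  assumes w: "w permutes {1..n}" and cw: "\<And>p. p \<in> {1..n} \<Longrightarrow> c (w p) = block (wt d n c) p"
    and asc: "\<And>p. p \<in> {1..<n} \<Longrightarrow> block (wt d n c) p = block (wt d n c) (Suc p) \<Longrightarrow> w p < w (Suc p)"
  shows "inv_into UNIV w = pos d n c"
proof -
  have wr: "w p \<in> {1..n}" if "p \<in> {1..n}" for p
    using permutes_in_image[OF w] that by blast
  \<comment> \<open>The composite has no descents: inside a block by \<open>asc\<close> together
    with stability of the sorting, and between blocks because sorting respects the order of the
    colours.\<close>
  have "pos d n c \<circ> w = id"
  proof (rule no_descent_imp_id)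
    show "pos d n c \<circ> w permutes {1..n}"
      by (rule permutes_compose[OF w pos_permutes])
    fix p assume p: "p \<in> {1..<n}"
    then have p': "p \<in> {1..n}" "Suc p \<in> {1..n}"
      by auto
    have "block (wt d n c) p \<le> block (wt d n c) (Suc p)"
      using p' by (rule block_mono) simp
    then consider "block (wt d n c) p = block (wt d n c) (Suc p)" | "block (wt d n c) p < block (wt d n c) (Suc p)"
      by linarith
    then have "pos d n c (w p) < pos d n c (w (Suc p))"
    proof cases
      case 1
      show ?thesis
        by (rule pos_less_same[OF wr[OF p'(1)] wr[OF p'(2)] asc[OF p 1]
              trans[OF cw[OF p'(1)] trans[OF 1 cw[OF p'(2), symmetric]]]])
    next
      case 2
      show ?thesis
        by (rule pos_less_colour[OF wr[OF p'(1)] wr[OF p'(2)]]) (simp only: cw[OF p'(1)] cw[OF p'(2)] 2)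
    qed
    then show "(pos d n c \<circ> w) p \<le> (pos d n c \<circ> w) (Suc p)"
      by simp
  qed
  then have "pos d n c (w p) = p" for p
    by (metis comp_apply id_apply)
  moreover have "w (pos d n c p) = p" for p
    using calculation permutes_inj[OF pos_permutes] by (metis inj_eq)
  ultimately show ?thesis
    by (intro inv_unique_comp) (simp_all add: fun_eq_iff)
qed

end

text \<open>Deleting the letters which exchange two colours turns a reduced word of \<open>w\<close> into a reduced word
  of the permutation \<open>w\<close> induces between the blocks; this is where the powers of \<open>u\<close> come from.\<close>

fun subword :: "nat \<Rightarrow> nat \<Rightarrow> (nat \<Rightarrow> nat) \<Rightarrow> nat list \<Rightarrow> nat list" where
  "subword d n c [] = []"
| "subword d n c (i # is) =
     (if c i = c (Suc i) then pos d n c i # subword d n (c \<circ> sw i) is else subword d n (c \<circ> sw i) is)"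

lemma sw_invariant: "c i = c (Suc i) \<Longrightarrow> c \<circ> sw i = c"
  by (rule ext) (metis comp_apply transpose_apply_first transpose_apply_second transpose_apply_other)

lemma colouring_word:
  "colouring d n c \<Longrightarrow> set is \<subseteq> {1..<n} \<Longrightarrow> colouring d n (c \<circ> word_perm is)"
proof (induction "is" arbitrary: c)
  case (Cons i "is")
  have "colouring d n (c \<circ> sw i \<circ> word_perm is)"
    using Cons.prems by (intro Cons.IH colouring_sw) auto
  then show ?case
    by (simp only: word_perm_simps comp_assoc)
qed (simp add: colouring_def)

lemma wt_word:
  "set is \<subseteq> {1..<n} \<Longrightarrow> wt d n (c \<circ> word_perm is) = wt d n c"
proof (induction "is" arbitrary: c)
  case (Cons i "is")
  have "wt d n (c \<circ> sw i \<circ> word_perm is) = wt d n (c \<circ> sw i)"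
    using Cons.prems by (intro Cons.IH) auto
  then show ?case
    using Cons.prems by (simp only: word_perm_simps comp_assoc) (simp add: wt_sw)
qed simp

text \<open>The remaining letters intertwine the two sortings. A letter between equal colours is
  carried through \<open>pos\<close> by \<open>pos_sw_same\<close>, and a letter between different
  colours disappears by \<open>pos_sw_other\<close>.\<close>

lemma subword_perm:
  "colouring d n c \<Longrightarrow> set is \<subseteq> {1..<n} \<Longrightarrow>
    word_perm (subword d n c is) (pos d n (c \<circ> word_perm is) j) = pos d n c (word_perm is j)"
proof (induction "is" arbitrary: c)
  case (Cons i "is")
  have i: "i \<in> {1..<n}"
    using Cons.prems(2) by simp
  have cw: "c \<circ> word_perm (i # is) = (c \<circ> sw i) \<circ> word_perm is"
    by (simp only: word_perm_simps comp_assoc)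
  have IH: "word_perm (subword d n (c \<circ> sw i) is) (pos d n (c \<circ> word_perm (i # is)) j)
      = pos d n (c \<circ> sw i) (word_perm is j)"
    unfolding cw using Cons.prems by (intro Cons.IH colouring_sw) auto
  have wj: "word_perm (i # is) j = sw i (word_perm is j)"
    by simp
  show ?case
  proof (cases "c i = c (Suc i)")
    case True
    have sub: "word_perm (subword d n c (i # is)) p = sw (pos d n c i) (word_perm (subword d n (c \<circ> sw i) is) p)" for p
      using True by simp
    show ?thesis
      unfolding sub unfolding IH unfolding wj pos_sw_same[OF Cons.prems(1) i True]
        sw_invariant[of c i, OF True] ..
  next
    case False
    have sub: "subword d n c (i # is) = subword d n (c \<circ> sw i) is"
      using False by simp
    have "pos d n (c \<circ> sw i) (sw i (sw i (word_perm is j))) = pos d n c (sw i (word_perm is j))"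
      by (rule pos_sw_other[OF Cons.prems(1) i False])
    then show ?thesis
      unfolding sub IH wj transpose_involutory .
  qed
qed simp

lemma subword_letters:
  "colouring d n c \<Longrightarrow> set is \<subseteq> {1..<n} \<Longrightarrow> set (subword d n c is) \<subseteq> {1..<n}"
proof (induction "is" arbitrary: c)
  case (Cons i "is")
  have "set (subword d n (c \<circ> sw i) is) \<subseteq> {1..<n}"
    using Cons.prems by (intro Cons.IH colouring_sw) auto
  then show ?case
    using pos_Suc(2)[OF Cons.prems(1), of i] Cons.prems(2) by simp
qed simp

text \<open>Only a letter between equal colours has to be tested. The ascent in the original word
  compares two places that carry the same colour in the permuted colouring, and sorting preserves
  the order within a colour.\<close>

lemma subword_red:
  "colouring d n c \<Longrightarrow> set is \<subseteq> {1..<n} \<Longrightarrow> red is \<Longrightarrow> red (subword d n c is)"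
proof (induction "is" arbitrary: c)
  case (Cons i "is")
  have i: "i \<in> {1..<n}" and is_n: "set is \<subseteq> {1..<n}"
    using Cons.prems(2) by simp_all
  have IH: "red (subword d n (c \<circ> sw i) is)"
    using Cons.prems by (intro Cons.IH colouring_sw) auto
  show ?case
  proof (cases "c i = c (Suc i)")
    case True
    let ?W = "word_perm is" and ?v = "inv_into UNIV (word_perm is)"
    let ?W' = "word_perm (subword d n c is)"
    have c: "c \<circ> sw i = c"
      by (rule sw_invariant[OF True])
    have W: "?W permutes {1..n}"
      by (rule word_perm_permutes[OF is_n])
    have v: "?W (?v p) = p" for p
      by (rule permutes_inverses(1)[OF W])
    have vr: "?v p \<in> {1..n}" if "p \<in> {1..n}" for p
      using permutes_in_image[OF permutes_inv[OF W]] that by blast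
    \<comment> \<open>The inverse of the shortened word is the inverse of the full word seen through
      the two sortings.\<close>
    have key: "inv_into UNIV ?W' (pos d n c p) = pos d n (c \<circ> ?W) (?v p)" for p
    proof (rule inv_f_eq[OF bij_is_inj[OF bij_word_perm]])
      show "?W' (pos d n (c \<circ> ?W) (?v p)) = pos d n c p"
        using subword_perm[OF Cons.prems(1) is_n, of "?v p"] by (simp add: v)
    qed
    have lt: "?v i < ?v (Suc i)"
      using Cons.prems(3) by simp
    have i': "i \<in> {1..n}" "Suc i \<in> {1..n}"
      using i by auto
    have "pos d n (c \<circ> ?W) (?v i) < pos d n (c \<circ> ?W) (?v (Suc i))"
      by (rule pos_less_same[OF colouring_word[OF Cons.prems(1) is_n] vr[OF i'(1)] vr[OF i'(2)] lt])
        (simp add: v True)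
    then have "inv_into UNIV ?W' (pos d n c i) < inv_into UNIV ?W' (Suc (pos d n c i))"
      unfolding key[symmetric] pos_Suc(1)[OF Cons.prems(1) i True] .
    then show ?thesis
      using IH True by (simp add: c)
  next
    case False
    then show ?thesis
      using IH by simp
  qed
qed simp

text \<open>By the intertwining, the sorted place of j is sent to the sorted place of w(j). The
  block of the image is the colour of w(j) under \<open>c\<close>, and this is also the colour of j
  under the permuted colouring, hence the block of the argument.\<close>

lemma subword_block:
  assumes c: "colouring d n c" and is_n: "set is \<subseteq> {1..<n}" and p: "p \<in> {1..n}"
  shows "block (wt d n c) (word_perm (subword d n c is) p) = block (wt d n c) p"
proof -
  note c' = colouring_word[OF c is_n]
  obtain j where j: "j \<in> {1..n}" "p = pos d n (c \<circ> word_perm is) j"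
    by (rule pos_surj[OF c' p])
  have "word_perm is j \<in> {1..n}"
    using permutes_in_image[OF word_perm_permutes[OF is_n]] j(1) by blast
  then have "block (wt d n c) (word_perm (subword d n c is) p) = c (word_perm is j)"
    unfolding j(2) subword_perm[OF c is_n] by (rule pos_block[OF c])
  moreover have "block (wt d n c) p = c (word_perm is j)"
    using pos_block[OF c' j(1)] unfolding j(2) wt_word[OF is_n] by simp
  ultimately show ?thesis
    by simp
qed

text \<open>In terms of characters the right-hand side is \<pi>_\<chi>^-1 w^-1 \<pi>_{w(\<chi>)},
  the permutation occurring in \<open>Psi_value\<close>, when the word represents w^-1.\<close>

lemma subword_conj:
  assumes c: "colouring d n c" and is_n: "set is \<subseteq> {1..<n}"
  shows "word_perm (subword d n c is)
    = pos d n c \<circ> word_perm is \<circ> inv_into UNIV (pos d n (c \<circ> word_perm is))"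
proof -
  have P: "pos d n (c \<circ> word_perm is) permutes {1..n}"
    by (rule pos_permutes[OF colouring_word[OF c is_n]])
  show ?thesis
  proof (rule ext)
    fix p
    have "pos d n (c \<circ> word_perm is) (inv_into UNIV (pos d n (c \<circ> word_perm is)) p) = p"
      by (rule permutes_inverses(1)[OF P])
    then show "word_perm (subword d n c is) p = (pos d n c \<circ> word_perm is \<circ> inv_into UNIV (pos d n (c \<circ> word_perm is))) p"
      using subword_perm[OF c is_n, of "inv_into UNIV (pos d n (c \<circ> word_perm is)) p"] by (simp only: o_apply)
  qed
qed

subsection \<open>Characters\<close>

text \<open>Replacing the value of a character by its index in the enumeration \<xi> makes the
  linear order of the blocks available.\<close>

definition colour :: "nat \<Rightarrow> (nat \<Rightarrow> complex) \<Rightarrow> (nat \<Rightarrow> complex) \<Rightarrow> nat \<Rightarrow> nat" where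
  "colour d \<xi> \<chi> j = inv_into {1..d} \<xi> (\<chi> j)"

locale roots =
  fixes d :: nat and \<xi> :: "nat \<Rightarrow> complex"
  assumes d: "1 \<le> d" and \<xi>: "bij_betw \<xi> {1..d} {z. z ^ d = 1}"
begin

abbreviation "col \<equiv> colour d \<xi>"

lemma \<xi>_inv: "z ^ d = 1 \<Longrightarrow> \<xi> (inv_into {1..d} \<xi> z) = z"
  and inv_range: "z ^ d = 1 \<Longrightarrow> inv_into {1..d} \<xi> z \<in> {1..d}"
  and inv_\<xi>: "a \<in> {1..d} \<Longrightarrow> inv_into {1..d} \<xi> (\<xi> a) = a"
  and \<xi>_root: "a \<in> {1..d} \<Longrightarrow> \<xi> a ^ d = 1"
proof -
  have im: "\<xi> ` {1..d} = {z. z ^ d = 1}" and inj: "inj_on \<xi> {1..d}"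
    using \<xi> by (auto simp: bij_betw_def)
  show "z ^ d = 1 \<Longrightarrow> \<xi> (inv_into {1..d} \<xi> z) = z"
    using im by (intro f_inv_into_f) blast
  show "z ^ d = 1 \<Longrightarrow> inv_into {1..d} \<xi> z \<in> {1..d}"
    using im by (intro inv_into_into) blast
  show "a \<in> {1..d} \<Longrightarrow> inv_into {1..d} \<xi> (\<xi> a) = a"
    using inj by (rule inv_into_f_f)
  show "a \<in> {1..d} \<Longrightarrow> \<xi> a ^ d = 1"
    using im by blast
qed

lemma chars_root: "\<chi> \<in> chars d n \<Longrightarrow> j \<in> {1..n} \<Longrightarrow> \<chi> j ^ d = 1"
  unfolding chars_def by (auto dest: PiE_mem)

lemma finite_chars: "finite (chars d n)"
proof -
  have "finite {z::complex. z ^ d = 1}"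
    using \<xi> by (auto dest: bij_betw_finite)
  then show ?thesis
    unfolding chars_def by (intro finite_PiE) auto
qed

lemma colouring_col: "\<chi> \<in> chars d n \<Longrightarrow> colouring d n (col \<chi>)"
  unfolding colouring_def colour_def using chars_root inv_range by blast

lemma \<xi>_col: "\<chi> \<in> chars d n \<Longrightarrow> j \<in> {1..n} \<Longrightarrow> \<xi> (col \<chi> j) = \<chi> j"
  unfolding colour_def by (intro \<xi>_inv chars_root)

lemma col_eq_iff:
  assumes "\<chi> \<in> chars d n" "j \<in> {1..n}" "k \<in> {1..n}"
  shows "col \<chi> j = col \<chi> k \<longleftrightarrow> \<chi> j = \<chi> k"
  using \<xi>_col[OF assms(1,2)] \<xi>_col[OF assms(1,3)] by (metis colour_def)

lemma col_comp: "col (\<chi> \<circ> w) = col \<chi> \<circ> w"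
  by (rule ext) (simp add: colour_def)

lemma Comp_eq: "\<chi> \<in> chars d n \<Longrightarrow> Comp d \<xi> n \<chi> = wt d n (col \<chi>)"
proof -
  assume \<chi>: "\<chi> \<in> chars d n"
  have "{j \<in> {1..n}. \<chi> j = \<xi> a} = {k \<in> {1..n}. col \<chi> k = a}" if "a \<in> {1..d}" for a
    using \<xi>_col[OF \<chi>] inv_\<xi>[OF that] by (auto simp: colour_def)
  then show ?thesis
    unfolding Comp_def wt_def cnt_card by (intro ext) simp
qed

lemma Comp_composition: "\<chi> \<in> chars d n \<Longrightarrow> Comp d \<xi> n \<chi> \<in> compositions d n"
  using Comp_eq colouring_col wt_composition by simp

text \<open>Characters are extensional functions; \<open>w\<close> fixes every index outside {1..n},
  so the value \<open>undefined\<close> there survives.\<close>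

lemma chars_comp:
  assumes \<chi>: "\<chi> \<in> chars d n" and w: "w permutes {1..n}"
  shows "\<chi> \<circ> w \<in> chars d n"
proof -
  have "(\<chi> \<circ> w) j = undefined" if "j \<notin> {1..n}" for j
    using PiE_arb[OF \<chi>[unfolded chars_def] that] permutes_not_in[OF w that] by simp
  moreover have "(\<chi> \<circ> w) j ^ d = 1" if "j \<in> {1..n}" for j
    using chars_root[OF \<chi>, of "w j"] permutes_in_image[OF w] that by simp
  ultimately show ?thesis
    unfolding chars_def by (intro PiE_I CollectI)
qed

lemma chars_sw: "\<chi> \<in> chars d n \<Longrightarrow> i \<in> {1..<n} \<Longrightarrow> \<chi> \<circ> sw i \<in> chars d n"
  by (intro chars_comp sw_permutes)

lemma Comp_sw: "\<chi> \<in> chars d n \<Longrightarrow> i \<in> {1..<n} \<Longrightarrow> Comp d \<xi> n (\<chi> \<circ> sw i) = Comp d \<xi> n \<chi>"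
  by (simp add: Comp_eq chars_sw col_comp wt_sw)

text \<open>Minimality of the length forces \<pi>_\<chi> to increase on every block, and by
  \<open>pos_unique\<close> an element of the coset with this property is the inverse of the sorting
  permutation.\<close>

lemma char_perm_inv:
  assumes \<chi>: "\<chi> \<in> chars d n"
  shows "inv_into UNIV (char_perm d \<xi> n \<chi>) = pos d n (col \<chi>)" "char_perm d \<xi> n \<chi> permutes {1..n}"
proof -
  let ?c = "col \<chi>" and ?\<mu> = "wt d n (col \<chi>)"
  note c = colouring_col[OF \<chi>]
  let ?P = "\<lambda>w. w permutes {1..n} \<and> char_act w (char0 \<xi> n (Comp d \<xi> n \<chi>)) = \<chi>"
  have act: "char_act w (char0 \<xi> n (Comp d \<xi> n \<chi>)) = \<chi> \<longleftrightarrow> (\<forall>p\<in>{1..n}. \<chi> (w p) = \<xi> (block ?\<mu> p))"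
    if w: "w permutes {1..n}" for w
  proof
    assume *: "char_act w (char0 \<xi> n (Comp d \<xi> n \<chi>)) = \<chi>"
    show "\<forall>p\<in>{1..n}. \<chi> (w p) = \<xi> (block ?\<mu> p)"
    proof
      fix p assume p: "p \<in> {1..n}"
      have "\<chi> (w p) = char0 \<xi> n (Comp d \<xi> n \<chi>) (inv_into UNIV w (w p))"
        using fun_cong[OF *, of "w p"] by (simp add: char_act_def)
      then show "\<chi> (w p) = \<xi> (block ?\<mu> p)"
        using p by (simp add: permutes_inverses(2)[OF w] char0_def Comp_eq[OF \<chi>])
    qed
  next
    assume *: "\<forall>p\<in>{1..n}. \<chi> (w p) = \<xi> (block ?\<mu> p)"
    show "char_act w (char0 \<xi> n (Comp d \<xi> n \<chi>)) = \<chi>"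
    proof
      fix j
      have v: "inv_into UNIV w permutes {1..n}"
        by (rule permutes_inv[OF w])
      show "char_act w (char0 \<xi> n (Comp d \<xi> n \<chi>)) j = \<chi> j"
      proof (cases "j \<in> {1..n}")
        case True
        then have "inv_into UNIV w j \<in> {1..n}"
          using permutes_in_image[OF v] by blast
        moreover from this have "\<chi> (w (inv_into UNIV w j)) = \<xi> (block ?\<mu> (inv_into UNIV w j))"
          using * by blast
        ultimately show ?thesis
          by (simp add: char_act_def char0_def Comp_eq[OF \<chi>] permutes_inverses(1)[OF w])
      next
        case False
        then show ?thesis
          using PiE_arb[OF \<chi>[unfolded chars_def] False] permutes_not_in[OF v False]
          by (simp only: char_act_def char0_def o_apply restrict_apply if_False)
      qed
    qed
  qed
  define \<pi> where "\<pi> = char_perm d \<xi> n \<chi>"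
  have pv: "inv_into UNIV (pos d n ?c) permutes {1..n}"
    by (rule permutes_inv[OF pos_permutes[OF c]])
  have "\<chi> (inv_into UNIV (pos d n ?c) p) = \<xi> (block ?\<mu> p)" if p: "p \<in> {1..n}" for p
  proof -
    obtain j where j: "j \<in> {1..n}" "p = pos d n ?c j"
      by (rule pos_surj[OF c p])
    show ?thesis
      unfolding j(2) permutes_inverses(2)[OF pos_permutes[OF c]] pos_block[OF c j(1)]
      by (simp add: \<xi>_col[OF \<chi> j(1)])
  qed
  \<comment> \<open>The inverse of the sorting permutation is a candidate, so the minimum over all
    candidates is attained.\<close>
  then have ex: "?P (inv_into UNIV (pos d n ?c))"
    using act[OF pv] pv by blast
  have \<pi>P: "?P \<pi>"
    unfolding \<pi>_def char_perm_def by (rule arg_min_natI[where P = ?P, OF ex])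
  have \<pi>min: "perm_length n \<pi> \<le> perm_length n w" if "?P w" for w
    unfolding \<pi>_def char_perm_def by (rule arg_min_nat_le[where P = ?P, OF that])
  have \<pi>: "\<pi> permutes {1..n}"
    using \<pi>P by blast
  have \<pi>\<chi>: "\<chi> (\<pi> p) = \<xi> (block ?\<mu> p)" if "p \<in> {1..n}" for p
    using \<pi>P act[OF \<pi>] that by blast
  have "inv_into UNIV \<pi> = pos d n ?c"
  proof (rule pos_unique[OF c \<pi>])
    fix p assume p: "p \<in> {1..n}"
    have "?c (\<pi> p) = inv_into {1..d} \<xi> (\<xi> (block ?\<mu> p))"
      by (simp add: colour_def \<pi>\<chi>[OF p])
    then show "?c (\<pi> p) = block ?\<mu> p"
      unfolding inv_\<xi>[OF block_range[OF c p]] .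
  next
    fix p assume p: "p \<in> {1..<n}" and b: "block ?\<mu> p = block ?\<mu> (Suc p)"
    show "\<pi> p < \<pi> (Suc p)"
    proof (rule ccontr)
      assume "\<not> \<pi> p < \<pi> (Suc p)"
      moreover have "\<pi> p \<noteq> \<pi> (Suc p)"
        using permutes_inj[OF \<pi>] by (metis inj_eq n_not_Suc_n)
      ultimately have "\<pi> (Suc p) < \<pi> p"
        by linarith
      \<comment> \<open>A descent inside a block can be undone: s_p fixes the sorted character, so
        \<pi> s_p is a candidate as well, and it is shorter.\<close>
      from card_invs_descent[OF p this] have less: "card (invs n (\<pi> \<circ> sw p)) < card (invs n \<pi>)"
        by simp
      have \<pi>s: "\<pi> \<circ> sw p permutes {1..n}"
        by (rule permutes_compose[OF sw_permutes[OF p] \<pi>])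
      have "\<forall>q\<in>{1..n}. \<chi> ((\<pi> \<circ> sw p) q) = \<xi> (block ?\<mu> q)"
      proof
        fix q assume q: "q \<in> {1..n}"
        have "block ?\<mu> (sw p q) = block ?\<mu> q"
          using b by (cases "q = p"; cases "q = Suc p") simp_all
        then show "\<chi> ((\<pi> \<circ> sw p) q) = \<xi> (block ?\<mu> q)"
          using \<pi>\<chi>[OF sw_range[OF p q]] by simp
      qed
      then have "?P (\<pi> \<circ> sw p)"
        using act[OF \<pi>s] \<pi>s by blast
      from \<pi>min[OF this] show False
        using less unfolding perm_length_eq[OF \<pi>] perm_length_eq[OF \<pi>s] by linarith
    qed
  qed
  then show "inv_into UNIV (char_perm d \<xi> n \<chi>) = pos d n (col \<chi>)" "char_perm d \<xi> n \<chi> permutes {1..n}"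
    using \<pi> unfolding \<pi>_def by blast+
qed

end

section \<open>Presented algebras\<close>

lemma (in K_hom) hom_a_minus: "x \<in> carrier A \<Longrightarrow> y \<in> carrier A \<Longrightarrow> f (x \<ominus>\<^bsub>A\<^esub> y) = f x \<ominus>\<^bsub>B\<^esub> f y"
  by (simp add: a_minus_def)

lemma monoid_algebra_minus:
  assumes "monoid M" "p \<in> carrier (monoid_algebra M)" "q \<in> carrier (monoid_algebra M)"
  shows "p \<ominus>\<^bsub>monoid_algebra M\<^esub> q = p - q"
proof -
  interpret K_alg "monoid_algebra M"
    by (rule K_alg_monoid_algebra) fact
  have "0 - q \<in> carrier (monoid_algebra M)"
    by (rule monoid_algebra_diff_closed[OF _ assms(3)]) simp
  from minus_equality[OF _ assms(3) this] have "\<ominus>\<^bsub>monoid_algebra M\<^esub> q = 0 - q"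
    by simp
  then show ?thesis
    by (simp add: a_minus_def)
qed

lemma hom_monoid_algebra_diff:
  assumes "K_hom (monoid_algebra M) B f" "monoid M" "p \<in> carrier (monoid_algebra M)" "q \<in> carrier (monoid_algebra M)"
  shows "f (p - q) = f p \<ominus>\<^bsub>B\<^esub> f q"
  using K_hom.hom_a_minus[OF assms(1,3,4)] monoid_algebra_minus[OF assms(2-4)] by simp

lemma hom_monoid_algebra_sum:
  assumes "K_hom (monoid_algebra M) B f" "finite S" "\<And>s. s \<in> S \<Longrightarrow> w s \<in> carrier M"
  shows "(\<Sum>s\<in>S. Poly_Mapping.single (w s) (c s)) \<in> carrier (monoid_algebra M) \<and>
    f (\<Sum>s\<in>S. Poly_Mapping.single (w s) (c s)) = (\<Oplus>\<^bsub>B\<^esub>s\<in>S. f (Poly_Mapping.single (w s) (c s)))"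
  using assms(2,3)
proof (induction S rule: finite_induct)
  case empty
  show ?case
    using K_hom.hom_zero[OF assms(1)] K_hom.axioms(2)[OF assms(1)] by (simp add: K_alg_def abelian_monoid.finsum_empty ring.is_abelian_group abelian_group.axioms(1))
next
  case (insert s S)
  interpret K_hom "monoid_algebra M" B f by fact
  have s: "Poly_Mapping.single (w s) (c s) \<in> carrier (monoid_algebra M)"
    using insert by (intro single_in_monoid_algebra) simp
  have S: "(\<Sum>s\<in>S. Poly_Mapping.single (w s) (c s)) \<in> carrier (monoid_algebra M)"
    "f (\<Sum>s\<in>S. Poly_Mapping.single (w s) (c s)) = (\<Oplus>\<^bsub>B\<^esub>s\<in>S. f (Poly_Mapping.single (w s) (c s)))"
    using insert by auto
  have "(\<lambda>s. f (Poly_Mapping.single (w s) (c s))) \<in> S \<rightarrow> carrier B"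
    using insert by (intro Pi_I hom_closed single_in_monoid_algebra) simp
  then show ?case
    using insert(1,2) hom_add[OF s S(1)] monoid_algebra_add_closed[OF s S(1)] hom_closed[OF s] S(2) by simp
qed

abbreviation FA :: "nat \<Rightarrow> (gen list \<Rightarrow>\<^sub>0 laurent) K_algebra" where
  "FA n \<equiv> monoid_algebra (free_monoid (yh_gens n))"

text \<open>The defining relations that equate two words. They are kept apart from the quadratic
  relation because they can be checked along the rows of monomial matrices, while the quadratic one
  involves sums.\<close>

definition word_rels :: "nat \<Rightarrow> nat \<Rightarrow> (gen list \<times> gen list) set" where
  "word_rels d n =
     (if n \<ge> 1 then {([X1, X1inv], []), ([X1inv, X1], [])} else {}) \<union>
     {([G i, G j], [G j, G i]) | i j. i \<in> {1..<n} \<and> j \<in> {1..<n} \<and> \<bar>int i - int j\<bar> > 1} \<union>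
     {([G i, G (Suc i), G i], [G (Suc i), G i, G (Suc i)]) | i. i \<in> {1..<n} \<and> Suc i \<in> {1..<n}} \<union>
     (if n \<ge> 2 then {([X1, G 1, X1, G 1], [G 1, X1, G 1, X1])} else {}) \<union>
     {([X1, G i], [G i, X1]) | i. i \<in> {2..<n}} \<union>
     {([T i, T j], [T j, T i]) | i j. i \<in> {1..n} \<and> j \<in> {1..n}} \<union>
     {([G i, T j], [T (transpose i (Suc i) j), G i]) | i j. i \<in> {1..<n} \<and> j \<in> {1..n}} \<union>
     {(replicate d (T j), []) | j. j \<in> {1..n}} \<union>
     {([X1, T j], [T j, X1]) | j. j \<in> {1..n}}"

definition quad_word :: "nat \<Rightarrow> nat \<Rightarrow> nat \<Rightarrow> gen list" where
  "quad_word d i s = replicate s (T i) @ replicate (d - s) (T (Suc i)) @ [G i]"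

definition quad_coeff :: "nat \<Rightarrow> laurent" where
  "quad_coeff d = K_const (1 / of_nat d) * v_var"

definition quad_rel :: "nat \<Rightarrow> nat \<Rightarrow> gen list \<Rightarrow>\<^sub>0 laurent" where
  "quad_rel d i = mon [G i, G i] - (Poly_Mapping.single [] (u_pow 2) +
        (\<Sum>s\<in>{1..d}. Poly_Mapping.single (quad_word d i s) (quad_coeff d)))"

lemma yh_rels_eq:
  "yh_rels d n = (\<lambda>(w, w'). mon w - mon w') ` word_rels d n \<union> quad_rel d ` {1..<n}"
proof -
  have im: "(\<lambda>(w, w'). mon w - mon w') ` {(f i, g i) | i. P i} = {mon (f i) - mon (g i) | i. P i}"
    for f g :: "nat \<Rightarrow> gen list" and P
    by (simp add: setcompr_eq_image image_image)
  have im2: "(\<lambda>(w, w'). mon w - mon w') ` {(f i j, g i j) | i j. P i j} = {mon (f i j) - mon (g i j) | i j. P i j}"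
    for f g :: "nat \<Rightarrow> nat \<Rightarrow> gen list" and P
    by force
  have imif: "(\<lambda>(w, w'). mon w - mon w') ` (if b then S else {}) = (if b then (\<lambda>(w, w'). mon w - mon w') ` S else {})"
    for b and S :: "(gen list \<times> gen list) set"
    by simp
  have q: "quad_rel d ` {1..<n} = {quad_rel d i | i. i \<in> {1..<n}}"
    by blast
  show ?thesis
    unfolding yh_rels_def word_rels_def image_Un im im2 imif q quad_rel_def quad_word_def quad_coeff_def
    by (simp only: image_insert image_empty prod.case)
qed

lemma word_rels_iff:
  "(w, w') \<in> word_rels d n \<longleftrightarrow>
     (1 \<le> n \<and> (w = [X1, X1inv] \<and> w' = [] \<or> w = [X1inv, X1] \<and> w' = [])) \<or>
     (\<exists>i j. w = [G i, G j] \<and> w' = [G j, G i] \<and> i \<in> {1..<n} \<and> j \<in> {1..<n} \<and> \<bar>int i - int j\<bar> > 1) \<or>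
     (\<exists>i. w = [G i, G (Suc i), G i] \<and> w' = [G (Suc i), G i, G (Suc i)] \<and> i \<in> {1..<n} \<and> Suc i \<in> {1..<n}) \<or>
     (2 \<le> n \<and> w = [X1, G 1, X1, G 1] \<and> w' = [G 1, X1, G 1, X1]) \<or>
     (\<exists>i. w = [X1, G i] \<and> w' = [G i, X1] \<and> i \<in> {2..<n}) \<or>
     (\<exists>i j. w = [T i, T j] \<and> w' = [T j, T i] \<and> i \<in> {1..n} \<and> j \<in> {1..n}) \<or>
     (\<exists>i j. w = [G i, T j] \<and> w' = [T (sw i j), G i] \<and> i \<in> {1..<n} \<and> j \<in> {1..n}) \<or>
     (\<exists>j. w = replicate d (T j) \<and> w' = [] \<and> j \<in> {1..n}) \<or>
     (\<exists>j. w = [X1, T j] \<and> w' = [T j, X1] \<and> j \<in> {1..n})"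
proof -
  have if_set: "(w, w') \<in> (if b then S else {}) \<longleftrightarrow> b \<and> (w, w') \<in> S" for b S
    by simp
  show ?thesis
    unfolding word_rels_def
    by (simp only: Un_iff if_set mem_Collect_eq insert_iff empty_iff prod.inject simp_thms disj_assoc conj_assoc)
qed

lemma word_rels_cases:
  assumes "(w, w') \<in> word_rels d n"
  obtains (inv) "1 \<le> n" "w = [X1, X1inv]" "w' = []" | (inv') "1 \<le> n" "w = [X1inv, X1]" "w' = []"
  | (far) i j where "i \<in> {1..<n}" "j \<in> {1..<n}" "\<bar>int i - int j\<bar> > 1" "w = [G i, G j]" "w' = [G j, G i]"
  | (braid) i where "i \<in> {1..<n}" "Suc i \<in> {1..<n}" "w = [G i, G (Suc i), G i]" "w' = [G (Suc i), G i, G (Suc i)]"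
  | (XG1) "2 \<le> n" "w = [X1, G 1, X1, G 1]" "w' = [G 1, X1, G 1, X1]"
  | (XG) i where "i \<in> {2..<n}" "w = [X1, G i]" "w' = [G i, X1]"
  | (TT) i j where "i \<in> {1..n}" "j \<in> {1..n}" "w = [T i, T j]" "w' = [T j, T i]"
  | (GT) i j where "i \<in> {1..<n}" "j \<in> {1..n}" "w = [G i, T j]" "w' = [T (sw i j), G i]"
  | (Td) j where "j \<in> {1..n}" "w = replicate d (T j)" "w' = []"
  | (XT) j where "j \<in> {1..n}" "w = [X1, T j]" "w' = [T j, X1]"
  using assms unfolding word_rels_iff
  by (elim disjE exE conjE) (erule (2) that | erule (4) that | erule (3) that)+

lemma yh_relsE:
  assumes "r \<in> yh_rels d n"
  obtains (word) w w' where "(w, w') \<in> word_rels d n" "r = mon w - mon w'"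
    | (quad) i where "i \<in> {1..<n}" "r = quad_rel d i"
proof -
  from assms consider "r \<in> (\<lambda>(w, w'). mon w - mon w') ` word_rels d n" | "r \<in> quad_rel d ` {1..<n}"
    unfolding yh_rels_eq by blast
  then show ?thesis
  proof cases
    case 1
    then obtain x where x: "r = (\<lambda>(w, w'). mon w - mon w') x" "x \<in> word_rels d n"
      by (rule imageE)
    obtain w w' where "x = (w, w')"
      by (cases x)
    with x show ?thesis
      using word by simp
  next
    case 2
    then show ?thesis
      by (rule imageE) (rule quad)
  qed
qed

lemma yh_gens_simps [simp]:
  "G i \<in> yh_gens n \<longleftrightarrow> i \<in> {1..<n}"
  "T j \<in> yh_gens n \<longleftrightarrow> j \<in> {1..n}"
  "X1 \<in> yh_gens n \<longleftrightarrow> 1 \<le> n"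
  "X1inv \<in> yh_gens n \<longleftrightarrow> 1 \<le> n"
  by (auto simp: yh_gens_def)

lemma replicate_lists [simp]: "x \<in> S \<Longrightarrow> replicate k x \<in> lists S"
  by (induction k) auto

lemma word_rels_lists:
  assumes "(w, w') \<in> word_rels d n" shows "w \<in> lists (yh_gens n)" "w' \<in> lists (yh_gens n)"
proof -
  have "w \<in> lists (yh_gens n) \<and> w' \<in> lists (yh_gens n)"
    using assms
  proof (cases rule: word_rels_cases)
    case (GT i j)
    then show ?thesis
      using sw_range[OF GT(1,2)] by simp
  qed simp_all
  then show "w \<in> lists (yh_gens n)" "w' \<in> lists (yh_gens n)"
    by blast+
qed

lemma quad_word_lists: "i \<in> {1..<n} \<Longrightarrow> quad_word d i s \<in> lists (yh_gens n)"
  by (simp add: quad_word_def)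

lemma quad_rel_closed:
  assumes i: "i \<in> {1..<n}" shows "quad_rel d i \<in> carrier (FA n)"
proof -
  have s: "(\<Sum>s\<in>S. Poly_Mapping.single (quad_word d i s) (quad_coeff d)) \<in> carrier (FA n)" if "finite S" for S
    using that
  proof (induction S rule: finite_induct)
    case (insert s S)
    have "Poly_Mapping.single (quad_word d i s) (quad_coeff d) \<in> carrier (FA n)"
      by (rule single_in_monoid_algebra) (simp add: quad_word_lists[OF i])
    from monoid_algebra_add_closed[OF this insert.IH] show ?case
      using insert by simp
  qed simp
  show ?thesis
    unfolding quad_rel_def using i
    by (intro monoid_algebra_diff_closed monoid_algebra_add_closed single_in_monoid_algebra s) auto
qed

lemma yh_rels_closed: "yh_rels d n \<subseteq> carrier (FA n)"
proof
  fix r assume "r \<in> yh_rels d n"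
  then show "r \<in> carrier (FA n)"
  proof (cases rule: yh_relsE)
    case (word w w')
    then show ?thesis
      using word_rels_lists[OF word(1)] unfolding word(2)
      by (intro monoid_algebra_diff_closed single_in_monoid_algebra) simp_all
  qed (simp only: quad_rel_closed)
qed

lemma K_quot_YH: "K_quot (FA n) (yh_rels d n)"
  by (intro K_quot.intro K_quot_axioms.intro K_alg_monoid_algebra monoid_free_monoid yh_rels_closed)

lemma K_alg_YH: "K_alg (YH d n)"
  unfolding YH_def by (rule K_quot.K_alg_Q[OF K_quot_YH])

interpretation YA: K_alg "YH d n" for d n
  by (rule K_alg_YH)

abbreviation yh_class :: "nat \<Rightarrow> nat \<Rightarrow> (gen list \<Rightarrow>\<^sub>0 laurent) \<Rightarrow> yh" where
  "yh_class d n \<equiv> algebra_class (FA n) (yh_rels d n)"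

definition yh_word :: "nat \<Rightarrow> nat \<Rightarrow> gen list \<Rightarrow> yh" where
  "yh_word d n w = yh_class d n (mon w)"

lemma K_hom_class: "K_hom (FA n) (YH d n) (yh_class d n)"
  unfolding YH_def by (rule K_quot.K_hom_cls[OF K_quot_YH])

lemma mon_closed: "w \<in> lists (yh_gens n) \<Longrightarrow> Poly_Mapping.single w c \<in> carrier (FA n)"
  by (rule single_in_monoid_algebra) simp

lemma yh_word_closed [simp]: "w \<in> lists (yh_gens n) \<Longrightarrow> yh_word d n w \<in> carrier (YH d n)"
  unfolding yh_word_def by (intro K_hom.hom_closed[OF K_hom_class] mon_closed)

lemma yh_word_Nil: "yh_word d n [] = \<one>\<^bsub>YH d n\<^esub>"
  using K_hom.hom_one[OF K_hom_class[of n d]] by (simp add: yh_word_def)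

lemma yh_word_append:
  assumes "v \<in> lists (yh_gens n)" "w \<in> lists (yh_gens n)"
  shows "yh_word d n (v @ w) = yh_word d n v \<otimes>\<^bsub>YH d n\<^esub> yh_word d n w"
  using K_hom.hom_mult[OF K_hom_class mon_closed[OF assms(1)] mon_closed[OF assms(2)], of d 1 1]
  by (simp add: yh_word_def)

lemma yh_word_Cons:
  assumes "x \<in> yh_gens n" "w \<in> lists (yh_gens n)"
  shows "yh_word d n (x # w) = yh_gen d n x \<otimes>\<^bsub>YH d n\<^esub> yh_word d n w"
  using yh_word_append[of "[x]" n w d] assms by (simp add: yh_gen_def yh_word_def)

lemma yh_gen_closed [simp]: "x \<in> yh_gens n \<Longrightarrow> yh_gen d n x \<in> carrier (YH d n)"
  using yh_word_closed[of "[x]" n d] by (simp add: yh_word_def yh_gen_def)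

lemma yh_class_single:
  assumes "w \<in> lists (yh_gens n)"
  shows "yh_class d n (Poly_Mapping.single w c) = c \<odot>\<^bsub>YH d n\<^esub> yh_word d n w"
  using K_hom.hom_smult[OF K_hom_class mon_closed[OF assms], of d c 1] by (simp add: yh_word_def)

lemma yh_word_rel:
  assumes "(w, w') \<in> word_rels d n" shows "yh_word d n w = yh_word d n w'"
proof -
  note l = word_rels_lists[OF assms]
  have "mon w - mon w' \<in> yh_rels d n"
    unfolding yh_rels_eq using assms by force
  from K_quot.cls_zero_rel[OF K_quot_YH this] have "yh_class d n (mon w - mon w') = \<zero>\<^bsub>YH d n\<^esub>"
    unfolding YH_def .
  then have "yh_word d n w \<ominus>\<^bsub>YH d n\<^esub> yh_word d n w' = \<zero>\<^bsub>YH d n\<^esub>"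
    unfolding hom_monoid_algebra_diff[OF K_hom_class monoid_free_monoid mon_closed[OF l(1)] mon_closed[OF l(2)]] yh_word_def .
  then show ?thesis
    using l by (simp add: YA.r_right_minus_eq)
qed

lemma yh_quad:
  assumes i: "i \<in> {1..<n}"
  shows "yh_word d n [G i, G i] = u_pow 2 \<odot>\<^bsub>YH d n\<^esub> \<one>\<^bsub>YH d n\<^esub>
    \<oplus>\<^bsub>YH d n\<^esub> (\<Oplus>\<^bsub>YH d n\<^esub>s\<in>{1..d}. quad_coeff d \<odot>\<^bsub>YH d n\<^esub> yh_word d n (quad_word d i s))"
proof -
  let ?S = "\<Sum>s\<in>{1..d}. Poly_Mapping.single (quad_word d i s) (quad_coeff d)"
  have ql: "quad_word d i s \<in> lists (yh_gens n)" for s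
    by (rule quad_word_lists[OF i])
  have S: "?S \<in> carrier (FA n)" "yh_class d n ?S
      = (\<Oplus>\<^bsub>YH d n\<^esub>s\<in>{1..d}. yh_class d n (Poly_Mapping.single (quad_word d i s) (quad_coeff d)))"
    using hom_monoid_algebra_sum[OF K_hom_class, where S = "{1..d}" and w = "quad_word d i" and c = "\<lambda>_. quad_coeff d"] ql by simp_all
  have g: "[G i, G i] \<in> lists (yh_gens n)" "[] \<in> lists (yh_gens n)"
    using i by auto
  have sc: "Poly_Mapping.single [] (u_pow 2) + ?S \<in> carrier (FA n)"
    by (intro monoid_algebra_add_closed mon_closed g S)
  have "quad_rel d i \<in> yh_rels d n"
    unfolding yh_rels_eq using i by blast
  from K_quot.cls_zero_rel[OF K_quot_YH this] have "yh_class d n (quad_rel d i) = \<zero>\<^bsub>YH d n\<^esub>"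
    unfolding YH_def .
  then have "yh_word d n [G i, G i] \<ominus>\<^bsub>YH d n\<^esub> yh_class d n (Poly_Mapping.single [] (u_pow 2) + ?S) = \<zero>\<^bsub>YH d n\<^esub>"
    unfolding quad_rel_def hom_monoid_algebra_diff[OF K_hom_class monoid_free_monoid mon_closed[OF g(1)] sc] yh_word_def .
  then have "yh_word d n [G i, G i] = yh_class d n (Poly_Mapping.single [] (u_pow 2) + ?S)"
    using K_hom.hom_closed[OF K_hom_class sc] yh_word_closed[OF g(1)] by (simp add: YA.r_right_minus_eq)
  also have "\<dots> = yh_class d n (Poly_Mapping.single [] (u_pow 2)) \<oplus>\<^bsub>YH d n\<^esub> yh_class d n ?S"
    using K_hom.hom_add[OF K_hom_class mon_closed[OF g(2)] S(1)] by simp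
  finally show ?thesis
    unfolding S(2) yh_class_single[OF g(2)] yh_class_single[OF ql] yh_word_Nil .
qed

lemma YH_induct [consumes 1, case_names word add smult]:
  assumes x: "x \<in> carrier (YH d n)"
    and w: "\<And>w. w \<in> lists (yh_gens n) \<Longrightarrow> P (yh_word d n w)"
    and a: "\<And>x y. x \<in> carrier (YH d n) \<Longrightarrow> y \<in> carrier (YH d n) \<Longrightarrow> P x \<Longrightarrow> P y \<Longrightarrow> P (x \<oplus>\<^bsub>YH d n\<^esub> y)"
    and s: "\<And>c x. x \<in> carrier (YH d n) \<Longrightarrow> P x \<Longrightarrow> P (c \<odot>\<^bsub>YH d n\<^esub> x)"
  shows "P x"
proof -
  obtain p where p: "p \<in> carrier (FA n)" "x = yh_class d n p"
    using x unfolding YH_def by (rule K_quot.quotE[OF K_quot_YH])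
  have single: "P (yh_class d n (Poly_Mapping.single w c))" if "w \<in> lists (yh_gens n)" for w c
    unfolding yh_class_single[OF that] by (intro s w yh_word_closed that)
  have "P (yh_class d n p)"
    using p(1)
  proof (induction p rule: monoid_algebra_induct)
    case zero
    show ?case
      using single[of "[]" 0] by simp
  next
    case (single x c)
    then show ?case
      using \<open>\<And>w c. w \<in> lists (yh_gens n) \<Longrightarrow> P (yh_class d n (Poly_Mapping.single w c))\<close> by simp
  next
    case (add p q)
    have "yh_class d n (p + q) = yh_class d n p \<oplus>\<^bsub>YH d n\<^esub> yh_class d n q"
      using K_hom.hom_add[OF K_hom_class add(1,2)] by simp
    then show ?case
      using a[OF K_hom.hom_closed[OF K_hom_class add(1)] K_hom.hom_closed[OF K_hom_class add(2)] add(3,4)] by simp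
  qed
  then show ?thesis
    by (simp add: p(2))
qed

text \<open>The universal property of the presentation, with the relations expressed through
  products over words instead of elements of the free algebra.\<close>

lemma YH_lift:
  assumes B: "K_alg B" and \<phi>: "\<And>x. x \<in> yh_gens n \<Longrightarrow> \<phi> x \<in> carrier B"
    and rel: "\<And>w w'. (w, w') \<in> word_rels d n \<Longrightarrow> mprod B (map \<phi> w) = mprod B (map \<phi> w')"
    and quad: "\<And>i. i \<in> {1..<n} \<Longrightarrow> mprod B (map \<phi> [G i, G i]) = u_pow 2 \<odot>\<^bsub>B\<^esub> \<one>\<^bsub>B\<^esub>
      \<oplus>\<^bsub>B\<^esub> (\<Oplus>\<^bsub>B\<^esub>s\<in>{1..d}. quad_coeff d \<odot>\<^bsub>B\<^esub> mprod B (map \<phi> (quad_word d i s)))"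
  obtains f where "f \<in> K_algebra_hom (YH d n) B"
    "\<And>w. w \<in> lists (yh_gens n) \<Longrightarrow> f (yh_word d n w) = mprod B (map \<phi> w)"
proof -
  interpret B: K_alg B by fact
  let ?\<psi> = "\<lambda>w. mprod B (map \<phi> w)"
  let ?F = "ma_extend B ?\<psi>"
  have set: "set (map \<phi> w) \<subseteq> carrier B" if "w \<in> lists (yh_gens n)" for w
    using that \<phi> by auto
  have \<psi>c: "?\<psi> w \<in> carrier B" if "w \<in> lists (yh_gens n)" for w
    by (intro B.mprod_closed set that)
  have F: "?F \<in> K_algebra_hom (FA n) B"
  proof (rule B.ma_extend_hom[OF monoid_free_monoid])
    show "?\<psi> \<in> carrier (free_monoid (yh_gens n)) \<rightarrow> carrier B"
      using \<psi>c by simp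
    show "?\<psi> (v \<otimes>\<^bsub>free_monoid (yh_gens n)\<^esub> w) = ?\<psi> v \<otimes>\<^bsub>B\<^esub> ?\<psi> w"
      if "v \<in> carrier (free_monoid (yh_gens n))" "w \<in> carrier (free_monoid (yh_gens n))" for v w
      using B.mprod_append[of "map \<phi> v" "map \<phi> w"] set[of v] set[of w] that by simp
  qed simp
  then have KF: "K_hom (FA n) B ?F"
    by (intro K_hom.intro K_hom_axioms.intro B K_alg_monoid_algebra monoid_free_monoid)
  have Fs: "?F (Poly_Mapping.single w c) = c \<odot>\<^bsub>B\<^esub> ?\<psi> w" if "w \<in> lists (yh_gens n)" for w c
    by (rule B.ma_extend_single) (rule \<psi>c[OF that])
  have "?F r = \<zero>\<^bsub>B\<^esub>" if "r \<in> yh_rels d n" for r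
  proof -
    from that show ?thesis
    proof (cases rule: yh_relsE)
      case 1: (word w w')
      note l = word_rels_lists[OF 1(1)]
      show ?thesis
        unfolding 1(2) hom_monoid_algebra_diff[OF KF monoid_free_monoid mon_closed[OF l(1)] mon_closed[OF l(2)]]
          Fs[OF l(1)] Fs[OF l(2)] rel[OF 1(1)]
        using \<psi>c[OF l(2)] by simp
    next
      case 2: (quad i)
      have ql: "quad_word d i s \<in> lists (yh_gens n)" for s
        by (rule quad_word_lists[OF 2(1)])
      let ?S = "\<Sum>s\<in>{1..d}. Poly_Mapping.single (quad_word d i s) (quad_coeff d)"
      have S: "?S \<in> carrier (FA n)" "?F ?S = (\<Oplus>\<^bsub>B\<^esub>s\<in>{1..d}. ?F (Poly_Mapping.single (quad_word d i s) (quad_coeff d)))"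
        using hom_monoid_algebra_sum[OF KF, where S = "{1..d}" and w = "quad_word d i" and c = "\<lambda>_. quad_coeff d"] ql by simp_all
      have g: "[G i, G i] \<in> lists (yh_gens n)" "[] \<in> lists (yh_gens n)"
        using 2(1) by auto
      have sc: "Poly_Mapping.single [] (u_pow 2) + ?S \<in> carrier (FA n)"
        by (intro monoid_algebra_add_closed mon_closed g S)
      have "?F (Poly_Mapping.single [] (u_pow 2) + ?S) = ?F (Poly_Mapping.single [] (u_pow 2)) \<oplus>\<^bsub>B\<^esub> ?F ?S"
        using K_hom.hom_add[OF KF mon_closed[OF g(2)] S(1)] by simp
      also have "\<dots> = ?\<psi> [G i, G i]"
        unfolding S(2) Fs[OF g(2)] Fs[OF ql] quad[OF 2(1)] by simp
      finally have "?F (quad_rel d i) = 1 \<odot>\<^bsub>B\<^esub> ?\<psi> [G i, G i] \<ominus>\<^bsub>B\<^esub> ?\<psi> [G i, G i]"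
        unfolding quad_rel_def hom_monoid_algebra_diff[OF KF monoid_free_monoid mon_closed[OF g(1)] sc] Fs[OF g(1)]
        by (simp only:)
      then show ?thesis
        unfolding 2(2) using \<psi>c[OF g(1)] by (simp del: list.map mprod_Cons)
    qed
  qed
  from K_quot.hom_lift[OF K_quot_YH B F this]
  obtain f where f: "f \<in> K_algebra_hom (YH d n) B" "\<And>x. x \<in> carrier (FA n) \<Longrightarrow> f (yh_class d n x) = ?F x"
    unfolding YH_def by blast
  have "f (yh_word d n w) = ?\<psi> w" if "w \<in> lists (yh_gens n)" for w
    unfolding yh_word_def f(2)[OF mon_closed[OF that]] Fs[OF that] using \<psi>c[OF that] by simp
  with f(1) show ?thesis
    using that by blast
qed

subsection \<open>Inclusions\<close>

lemma yh_gens_mono: "yh_gens n \<subseteq> yh_gens (Suc n)"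
  by (auto simp: yh_gens_def)

lemma lists_gens_mono: "w \<in> lists (yh_gens n) \<Longrightarrow> w \<in> lists (yh_gens (Suc n))"
  using lists_mono[OF yh_gens_mono] by blast

lemma word_rels_mono: "word_rels d n \<subseteq> word_rels d (Suc n)"
proof (rule subrelI)
  fix w w' assume "(w, w') \<in> word_rels d n"
  then show "(w, w') \<in> word_rels d (Suc n)"
  proof (cases rule: word_rels_cases)
    case (Td j)
    then have "\<exists>j. w = replicate d (T j) \<and> w' = [] \<and> j \<in> {1..Suc n}"
      by (intro exI[of _ j]) simp
    then show ?thesis
      unfolding word_rels_iff by blast
  qed (simp_all add: word_rels_iff)
qed

lemma yh_rels_mono: "yh_rels d n \<subseteq> yh_rels d (Suc n)"
  unfolding yh_rels_eq by (intro Un_mono image_mono word_rels_mono) auto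

lemma FA_mono: "p \<in> carrier (FA n) \<Longrightarrow> p \<in> carrier (FA (Suc n))"
  using lists_mono[OF yh_gens_mono[of n]] by simp

text \<open>The relations for n strands are among those for n+1, so all elements of a class lie in
  one larger class; the union defining \<open>yh_incl\<close> collapses to it.\<close>

lemma yh_incl:
  shows "yh_incl d n \<in> K_algebra_hom (YH d n) (YH d (Suc n))"
    and "w \<in> lists (yh_gens n) \<Longrightarrow> yh_incl d n (yh_word d n w) = yh_word d (Suc n) w"
proof -
  let ?c = "yh_class d (Suc n)"
  have h: "?c \<in> K_algebra_hom (FA n) (YH d (Suc n))"
  proof -
    interpret K_hom "FA (Suc n)" "YH d (Suc n)" ?c
      by (rule K_hom_class)
    \<comment> \<open>The two free algebras share the formula for the product; only their carriers
      differ.\<close>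
    have mult: "x \<otimes>\<^bsub>FA n\<^esub> y = x \<otimes>\<^bsub>FA (Suc n)\<^esub> y" for x y
      by (simp add: monoid_algebra_def free_monoid_def)
    have r: "?c \<in> ring_hom (FA n) (YH d (Suc n))"
    proof (rule ring_hom_memI)
      fix x y assume x: "x \<in> carrier (FA n)" and y: "y \<in> carrier (FA n)"
      show "?c x \<in> carrier (YH d (Suc n))"
        by (intro hom_closed FA_mono x)
      show "?c (x \<otimes>\<^bsub>FA n\<^esub> y) = ?c x \<otimes>\<^bsub>YH d (Suc n)\<^esub> ?c y"
        unfolding mult by (rule hom_mult[OF FA_mono[OF x] FA_mono[OF y]])
      show "?c (x \<oplus>\<^bsub>FA n\<^esub> y) = ?c x \<oplus>\<^bsub>YH d (Suc n)\<^esub> ?c y"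
        using hom_add[OF FA_mono[OF x] FA_mono[OF y]] by simp
    next
      show "?c \<one>\<^bsub>FA n\<^esub> = \<one>\<^bsub>YH d (Suc n)\<^esub>"
        using hom_one by simp
    qed
    have "?c (c \<odot>\<^bsub>FA n\<^esub> x) = c \<odot>\<^bsub>YH d (Suc n)\<^esub> ?c x" if "x \<in> carrier (FA n)" for c x
      using hom_smult[OF FA_mono[OF that], of c] by simp
    with r show ?thesis
      unfolding K_algebra_hom_def by blast
  qed
  have z: "?c r = \<zero>\<^bsub>YH d (Suc n)\<^esub>" if "r \<in> yh_rels d n" for r
    using K_quot.cls_zero_rel[OF K_quot_YH] yh_rels_mono that unfolding YH_def by blast
  from K_quot.hom_lift[OF K_quot_YH K_alg_YH h z]
  obtain f where f: "f \<in> K_algebra_hom (YH d n) (YH d (Suc n))" "\<And>x. x \<in> carrier (FA n) \<Longrightarrow> f (yh_class d n x) = ?c x"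
    unfolding YH_def by blast
  have incl: "yh_incl d n (yh_class d n p) = ?c p" if p: "p \<in> carrier (FA n)" for p
  proof -
    have "?c q = ?c p" if q: "q \<in> yh_class d n p" for q
    proof -
      note m = K_quot.mem_cls[OF K_quot_YH p q]
      show ?thesis
        using f(2)[OF m(1)] f(2)[OF p] unfolding m(2) by simp
    qed
    moreover have "p \<in> yh_class d n p"
      by (rule K_quot.cls_self[OF K_quot_YH p])
    ultimately show ?thesis
      unfolding yh_incl_def by blast
  qed
  have eq: "yh_incl d n x = f x" if x: "x \<in> carrier (YH d n)" for x
  proof -
    obtain p where p: "p \<in> carrier (FA n)" "x = yh_class d n p"
      using x unfolding YH_def by (rule K_quot.quotE[OF K_quot_YH])
    show ?thesis
      unfolding p(2) incl[OF p(1)] f(2)[OF p(1)] ..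
  qed
  interpret f: K_hom "YH d n" "YH d (Suc n)" f
    by (intro K_hom.intro K_hom_axioms.intro K_alg_YH f)
  have "yh_incl d n \<in> ring_hom (YH d n) (YH d (Suc n))"
    by (rule ring_hom_memI) (simp_all add: eq)
  then show "yh_incl d n \<in> K_algebra_hom (YH d n) (YH d (Suc n))"
    unfolding K_algebra_hom_def by (simp add: eq)
  show "yh_incl d n (yh_word d n w) = yh_word d (Suc n) w" if "w \<in> lists (yh_gens n)"
    unfolding yh_word_def by (rule incl[OF mon_closed[OF that]])
qed

lemma yh_incl_gen: "x \<in> yh_gens n \<Longrightarrow> yh_incl d n (yh_gen d n x) = yh_gen d (Suc n) x"
  using yh_incl(2)[of "[x]" n d] by (simp add: yh_word_def yh_gen_def)

subsection \<open>Relations between the generators\<close>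

lemma u_pow_add: "u_pow a * u_pow b = u_pow (a + b)"
  by (simp add: u_pow_def mult_single)

lemma u_pow_0 [simp]: "u_pow 0 = 1"
  by (simp add: u_pow_def flip: zero_prod_def)

lemma K_const_mult: "K_const a * K_const b = K_const (a * b)"
  by (simp add: K_const_def mult_single)

lemma K_const_1 [simp]: "K_const 1 = 1"
  by (simp add: K_const_def)

lemma K_const_0 [simp]: "K_const 0 = 0"
  by (simp add: K_const_def)

lemma K_const_sum: "K_const (\<Sum>s\<in>S. f s) = (\<Sum>s\<in>S. K_const (f s))"
  by (induction S rule: infinite_finite_induct) (simp_all add: K_const_def single_add)

context monoid
begin

text \<open>With two different elements this moves g_i past a power of t_i, turning it into a power
  of t_{i+1}; with \<open>a = b\<close> it is commutation.\<close>

lemma pow_intertwine: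
  assumes "x \<in> carrier G" "a \<in> carrier G" "b \<in> carrier G" "x \<otimes> a = b \<otimes> x"
  shows "x \<otimes> a [^] (k::nat) = b [^] k \<otimes> x"
proof (induction k)
  case (Suc k)
  have "x \<otimes> a [^] Suc k = (x \<otimes> a [^] k) \<otimes> a"
    using assms(1-3) by (simp add: m_assoc)
  also have "\<dots> = b [^] k \<otimes> (x \<otimes> a)"
    unfolding Suc using assms(1-3) by (simp add: m_assoc)
  also have "\<dots> = b [^] Suc k \<otimes> x"
    unfolding assms(4) using assms(1-3) by (simp add: m_assoc)
  finally show ?case .
qed (use assms in simp)

lemma pow_commute:
  assumes "a \<in> carrier G" "b \<in> carrier G" "a \<otimes> b = b \<otimes> a"
  shows "a [^] (k::nat) \<otimes> b [^] (l::nat) = b [^] l \<otimes> a [^] k"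
proof -
  have "b \<otimes> a [^] k = a [^] k \<otimes> b"
    using assms by (intro pow_intertwine) auto
  then show ?thesis
    using assms by (intro pow_intertwine) auto
qed

end

lemma yh_word_eval:
  "w \<in> lists (yh_gens n) \<Longrightarrow> yh_word d n w = mprod (YH d n) (map (yh_gen d n) w)"
proof (induction w)
  case (Cons x w)
  then have "x \<in> yh_gens n" "w \<in> lists (yh_gens n)"
    by auto
  with Cons.IH show ?case
    by (simp add: yh_word_Cons)
qed (simp add: yh_word_Nil)

lemma yh_gen_rel:
  assumes "(w, w') \<in> word_rels d n"
  shows "mprod (YH d n) (map (yh_gen d n) w) = mprod (YH d n) (map (yh_gen d n) w')"
  using yh_word_rel[OF assms] word_rels_lists[OF assms] by (simp only: yh_word_eval)

lemma yh_gen_rel2: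
  assumes "([x, y], [x', y']) \<in> word_rels d n"
  shows "yh_gen d n x \<otimes>\<^bsub>YH d n\<^esub> yh_gen d n y = yh_gen d n x' \<otimes>\<^bsub>YH d n\<^esub> yh_gen d n y'"
  using yh_gen_rel[OF assms] word_rels_lists[OF assms] by simp

context
  fixes d n :: nat
begin

lemma X1_Units:
  assumes "1 \<le> n" shows "yh_gen d n X1 \<in> Units (YH d n)"
    and "inv\<^bsub>YH d n\<^esub> yh_gen d n X1 = yh_gen d n X1inv"
proof -
  have 1: "([X1, X1inv], []) \<in> word_rels d n" "([X1inv, X1], []) \<in> word_rels d n"
    using assms by (simp_all add: word_rels_iff)
  have c: "yh_gen d n X1 \<in> carrier (YH d n)" "yh_gen d n X1inv \<in> carrier (YH d n)"
    using assms by simp_all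
  have e: "yh_gen d n X1 \<otimes>\<^bsub>YH d n\<^esub> yh_gen d n X1inv = \<one>\<^bsub>YH d n\<^esub>"
    "yh_gen d n X1inv \<otimes>\<^bsub>YH d n\<^esub> yh_gen d n X1 = \<one>\<^bsub>YH d n\<^esub>"
    using yh_gen_rel[OF 1(1)] yh_gen_rel[OF 1(2)] c by simp_all
  show "yh_gen d n X1 \<in> Units (YH d n)"
    unfolding Units_def using c e by blast
  show "inv\<^bsub>YH d n\<^esub> yh_gen d n X1 = yh_gen d n X1inv"
    by (rule YA.inv_char[OF c e])
qed

lemma T_pow:
  assumes "j \<in> {1..n}" shows "yh_t d n j [^]\<^bsub>YH d n\<^esub> d = \<one>\<^bsub>YH d n\<^esub>"
proof -
  have "(replicate d (T j), []) \<in> word_rels d n"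
    using assms unfolding word_rels_iff by blast
  from yh_gen_rel[OF this] show ?thesis
    using assms by (simp add: map_replicate YA.mprod_replicate yh_t_def)
qed

lemma T_commute:
  assumes "i \<in> {1..n}" "j \<in> {1..n}"
  shows "yh_t d n i \<otimes>\<^bsub>YH d n\<^esub> yh_t d n j = yh_t d n j \<otimes>\<^bsub>YH d n\<^esub> yh_t d n i"
  unfolding yh_t_def using assms by (intro yh_gen_rel2) (unfold word_rels_iff, blast)

lemma G_T:
  assumes "i \<in> {1..<n}" "j \<in> {1..n}"
  shows "yh_g d n i \<otimes>\<^bsub>YH d n\<^esub> yh_t d n j = yh_t d n (sw i j) \<otimes>\<^bsub>YH d n\<^esub> yh_g d n i"
  unfolding yh_t_def yh_g_def using assms by (intro yh_gen_rel2) (unfold word_rels_iff, blast)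

lemma t_closed: "j \<in> {1..n} \<Longrightarrow> yh_t d n j \<in> carrier (YH d n)"
  by (simp add: yh_t_def)

lemma g_closed: "i \<in> {1..<n} \<Longrightarrow> yh_g d n i \<in> carrier (YH d n)"
  by (simp add: yh_g_def)

lemma T_Units:
  assumes "1 \<le> d" "j \<in> {1..n}" shows "yh_t d n j \<in> Units (YH d n)"
proof -
  obtain e where e: "d = Suc e"
    using assms(1) by (cases d) auto
  note c = t_closed[OF assms(2)]
  have "yh_t d n j [^]\<^bsub>YH d n\<^esub> e \<otimes>\<^bsub>YH d n\<^esub> yh_t d n j = \<one>\<^bsub>YH d n\<^esub>"
    using T_pow[OF assms(2)] unfolding e by simp
  moreover have "yh_t d n j \<otimes>\<^bsub>YH d n\<^esub> yh_t d n j [^]\<^bsub>YH d n\<^esub> e = \<one>\<^bsub>YH d n\<^esub>"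
    using T_pow[OF assms(2)] YA.nat_pow_Suc2[OF c, of e] unfolding e by simp
  ultimately show ?thesis
    unfolding Units_def using c YA.nat_pow_closed[OF c, of e] by blast
qed

lemma yh_quad_word:
  assumes i: "i \<in> {1..<n}"
  shows "yh_word d n (quad_word d i s) = (yh_t d n i [^]\<^bsub>YH d n\<^esub> s \<otimes>\<^bsub>YH d n\<^esub>
    yh_t d n (Suc i) [^]\<^bsub>YH d n\<^esub> (d - s)) \<otimes>\<^bsub>YH d n\<^esub> yh_g d n i"
proof -
  have t: "T i \<in> yh_gens n" "T (Suc i) \<in> yh_gens n" "G i \<in> yh_gens n"
    using i by auto
  have "yh_word d n (replicate k x) = yh_gen d n x [^]\<^bsub>YH d n\<^esub> k" if "x \<in> yh_gens n" for x k
    using that by (simp add: yh_word_eval map_replicate YA.mprod_replicate)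
  moreover have "yh_word d n [G i] = yh_g d n i"
    by (simp add: yh_word_def yh_g_def yh_gen_def)
  ultimately show ?thesis
    unfolding quad_word_def yh_t_def using t
    by (subst yh_word_append, simp, simp, subst yh_word_append, simp, simp)
      (simp add: yh_g_def YA.m_assoc)
qed

text \<open>With E = v e_i the quadratic relation reads (g_i - E) g_i = u^2. Conjugation by g_i
  exchanges t_i and t_{i+1} and so permutes the summands of E, whence E commutes with g_i, and u^-2
  (g_i - E) is a two-sided inverse.\<close>

lemma G_Units:
  assumes d: "1 \<le> d" and i: "i \<in> {1..<n}" shows "yh_g d n i \<in> Units (YH d n)"
proof -
  let ?Y = "YH d n" and ?g = "yh_g d n i" and ?t = "yh_t d n i" and ?t' = "yh_t d n (Suc i)"
  define Q where "Q s = ?t [^]\<^bsub>?Y\<^esub> s \<otimes>\<^bsub>?Y\<^esub> ?t' [^]\<^bsub>?Y\<^esub> (d - s)" for s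
  define E where "E = (\<Oplus>\<^bsub>?Y\<^esub>s\<in>{1..d}. quad_coeff d \<odot>\<^bsub>?Y\<^esub> Q s)"
  have i': "i \<in> {1..n}" "Suc i \<in> {1..n}"
    using i by auto
  have g: "?g \<in> carrier ?Y" and t: "?t \<in> carrier ?Y" "?t' \<in> carrier ?Y"
    by (rule g_closed[OF i], rule t_closed[OF i'(1)], rule t_closed[OF i'(2)])
  have Qc: "Q s \<in> carrier ?Y" for s
    unfolding Q_def using t by simp
  have Ec: "E \<in> carrier ?Y"
    unfolding E_def by (intro YA.finsum_closed Pi_I YA.smult_closed Qc)
  have gt: "?g \<otimes>\<^bsub>?Y\<^esub> ?t = ?t' \<otimes>\<^bsub>?Y\<^esub> ?g" "?g \<otimes>\<^bsub>?Y\<^esub> ?t' = ?t \<otimes>\<^bsub>?Y\<^esub> ?g"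
    using G_T[OF i i'(1)] G_T[OF i i'(2)] by simp_all
  \<comment> \<open>Exchanging the two t's turns s into d - s. The index s = d is kept, since d - s
    = 0 lies outside the range of summation; there both sides agree because t^d = 1.\<close>
  have gQ: "?g \<otimes>\<^bsub>?Y\<^esub> Q s = Q (if s = d then d else d - s) \<otimes>\<^bsub>?Y\<^esub> ?g" if s: "s \<in> {1..d}" for s
  proof -
    have "?g \<otimes>\<^bsub>?Y\<^esub> Q s = (?g \<otimes>\<^bsub>?Y\<^esub> ?t [^]\<^bsub>?Y\<^esub> s) \<otimes>\<^bsub>?Y\<^esub> ?t' [^]\<^bsub>?Y\<^esub> (d - s)"
      unfolding Q_def using g t by (simp add: YA.m_assoc)
    also have "\<dots> = ?t' [^]\<^bsub>?Y\<^esub> s \<otimes>\<^bsub>?Y\<^esub> (?g \<otimes>\<^bsub>?Y\<^esub> ?t' [^]\<^bsub>?Y\<^esub> (d - s))"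
      unfolding YA.pow_intertwine[OF g t(1,2) gt(1)] using g t by (simp add: YA.m_assoc)
    also have "\<dots> = (?t' [^]\<^bsub>?Y\<^esub> s \<otimes>\<^bsub>?Y\<^esub> ?t [^]\<^bsub>?Y\<^esub> (d - s)) \<otimes>\<^bsub>?Y\<^esub> ?g"
      unfolding YA.pow_intertwine[OF g t(2,1) gt(2)] using g t by (simp add: YA.m_assoc)
    also have "?t' [^]\<^bsub>?Y\<^esub> s \<otimes>\<^bsub>?Y\<^esub> ?t [^]\<^bsub>?Y\<^esub> (d - s) = Q (if s = d then d else d - s)"
    proof (cases "s = d")
      case True
      then show ?thesis
        using t T_pow[OF i'(1)] T_pow[OF i'(2)] by (simp add: Q_def)
    next
      case False
      have ct: "?t' \<otimes>\<^bsub>?Y\<^esub> ?t = ?t \<otimes>\<^bsub>?Y\<^esub> ?t'"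
        by (rule T_commute[OF i'(2,1)])
      show ?thesis
        using False s YA.pow_commute[OF t(2,1) ct, of s "d - s"] by (simp add: Q_def)
    qed
    finally show ?thesis .
  qed
  have comm: "?g \<otimes>\<^bsub>?Y\<^esub> E = E \<otimes>\<^bsub>?Y\<^esub> ?g"
  proof -
    let ?f = "\<lambda>s. if s = d then d else d - s"
    have cl: "(\<lambda>s. quad_coeff d \<odot>\<^bsub>?Y\<^esub> Q s) \<in> S \<rightarrow> carrier ?Y" for S
      using Qc by simp
    have cl': "(\<lambda>s. quad_coeff d \<odot>\<^bsub>?Y\<^esub> Q s \<otimes>\<^bsub>?Y\<^esub> ?g) \<in> S \<rightarrow> carrier ?Y" for S
      using Qc g by simp
    have inj: "inj_on ?f {1..d}"
      by (rule inj_onI) (auto split: if_splits)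
    have "?f ` {1..d} \<subseteq> {1..d}"
      by auto
    with inj have im: "?f ` {1..d} = {1..d}"
      by (intro endo_inj_surj) auto
    have "?g \<otimes>\<^bsub>?Y\<^esub> E = (\<Oplus>\<^bsub>?Y\<^esub>s\<in>{1..d}. ?g \<otimes>\<^bsub>?Y\<^esub> (quad_coeff d \<odot>\<^bsub>?Y\<^esub> Q s))"
      unfolding E_def by (rule YA.finsum_rdistr[OF _ g cl]) simp
    also have "\<dots> = (\<Oplus>\<^bsub>?Y\<^esub>s\<in>{1..d}. quad_coeff d \<odot>\<^bsub>?Y\<^esub> Q (?f s) \<otimes>\<^bsub>?Y\<^esub> ?g)"
    proof (rule YA.finsum_cong'[OF refl])
      show "(\<lambda>s. quad_coeff d \<odot>\<^bsub>?Y\<^esub> Q (?f s) \<otimes>\<^bsub>?Y\<^esub> ?g) \<in> {1..d} \<rightarrow> carrier ?Y"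
        using Qc g by simp
      fix s assume "s \<in> {1..d}"
      from gQ[OF this] show "?g \<otimes>\<^bsub>?Y\<^esub> (quad_coeff d \<odot>\<^bsub>?Y\<^esub> Q s) = quad_coeff d \<odot>\<^bsub>?Y\<^esub> Q (?f s) \<otimes>\<^bsub>?Y\<^esub> ?g"
        using Qc g by (simp only: YA.smult_mult_r YA.smult_mult_l)
    qed
    also have "\<dots> = (\<Oplus>\<^bsub>?Y\<^esub>s\<in>?f ` {1..d}. quad_coeff d \<odot>\<^bsub>?Y\<^esub> Q s \<otimes>\<^bsub>?Y\<^esub> ?g)"
      by (rule YA.finsum_reindex[OF cl' inj, symmetric])
    also have "\<dots> = E \<otimes>\<^bsub>?Y\<^esub> ?g"
      unfolding im E_def by (rule YA.finsum_ldistr[OF _ g cl, symmetric]) simp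
    finally show ?thesis .
  qed
  have "?g \<otimes>\<^bsub>?Y\<^esub> ?g = u_pow 2 \<odot>\<^bsub>?Y\<^esub> \<one>\<^bsub>?Y\<^esub> \<oplus>\<^bsub>?Y\<^esub> E \<otimes>\<^bsub>?Y\<^esub> ?g"
  proof -
    have "yh_word d n [G i, G i] = ?g \<otimes>\<^bsub>?Y\<^esub> ?g"
      using i g by (simp add: yh_word_eval yh_g_def)
    moreover have "E \<otimes>\<^bsub>?Y\<^esub> ?g = (\<Oplus>\<^bsub>?Y\<^esub>s\<in>{1..d}. quad_coeff d \<odot>\<^bsub>?Y\<^esub> Q s \<otimes>\<^bsub>?Y\<^esub> ?g)"
      unfolding E_def by (rule YA.finsum_ldistr[OF _ g]) (use Qc in simp_all)
    moreover have "\<dots> = (\<Oplus>\<^bsub>?Y\<^esub>s\<in>{1..d}. quad_coeff d \<odot>\<^bsub>?Y\<^esub> yh_word d n (quad_word d i s))"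
    proof (rule YA.finsum_cong'[OF refl])
      show "(\<lambda>s. quad_coeff d \<odot>\<^bsub>?Y\<^esub> yh_word d n (quad_word d i s)) \<in> {1..d} \<rightarrow> carrier ?Y"
        using quad_word_lists[OF i] by simp
      fix s
      show "quad_coeff d \<odot>\<^bsub>?Y\<^esub> Q s \<otimes>\<^bsub>?Y\<^esub> ?g = quad_coeff d \<odot>\<^bsub>?Y\<^esub> yh_word d n (quad_word d i s)"
        unfolding yh_quad_word[OF i] Q_def[symmetric] by (rule YA.smult_mult_l[OF Qc g])
    qed
    ultimately show ?thesis
      using yh_quad[OF i, of d] by (simp only:)
  qed
  then have 1: "?g \<otimes>\<^bsub>?Y\<^esub> ?g \<ominus>\<^bsub>?Y\<^esub> E \<otimes>\<^bsub>?Y\<^esub> ?g = u_pow 2 \<odot>\<^bsub>?Y\<^esub> \<one>\<^bsub>?Y\<^esub>"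
    using g Ec by (simp add: YA.minus_eq YA.a_assoc YA.r_neg)
  define L where "L = u_pow (-2) \<odot>\<^bsub>?Y\<^esub> (?g \<ominus>\<^bsub>?Y\<^esub> E)"
  have uu: "u_pow (-2) * u_pow 2 = 1"
    by (simp add: u_pow_add)
  have Lc: "L \<in> carrier ?Y"
    unfolding L_def using g Ec by simp
  have d1: "(?g \<ominus>\<^bsub>?Y\<^esub> E) \<otimes>\<^bsub>?Y\<^esub> ?g = ?g \<otimes>\<^bsub>?Y\<^esub> ?g \<ominus>\<^bsub>?Y\<^esub> E \<otimes>\<^bsub>?Y\<^esub> ?g"
    using g Ec by (simp add: YA.minus_eq YA.l_distr YA.l_minus)
  have d2: "?g \<otimes>\<^bsub>?Y\<^esub> (?g \<ominus>\<^bsub>?Y\<^esub> E) = ?g \<otimes>\<^bsub>?Y\<^esub> ?g \<ominus>\<^bsub>?Y\<^esub> ?g \<otimes>\<^bsub>?Y\<^esub> E"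
    using g Ec by (simp add: YA.minus_eq YA.r_distr YA.r_minus)
  have "L \<otimes>\<^bsub>?Y\<^esub> ?g = u_pow (-2) \<odot>\<^bsub>?Y\<^esub> ((?g \<ominus>\<^bsub>?Y\<^esub> E) \<otimes>\<^bsub>?Y\<^esub> ?g)"
    unfolding L_def using g Ec by (intro YA.smult_mult_l YA.minus_closed)
  then have "L \<otimes>\<^bsub>?Y\<^esub> ?g = \<one>\<^bsub>?Y\<^esub>"
    unfolding d1 1 by (simp add: YA.smult_smult uu)
  moreover have "?g \<otimes>\<^bsub>?Y\<^esub> L = u_pow (-2) \<odot>\<^bsub>?Y\<^esub> (?g \<otimes>\<^bsub>?Y\<^esub> (?g \<ominus>\<^bsub>?Y\<^esub> E))"
    unfolding L_def using g Ec by (intro YA.smult_mult_r YA.minus_closed)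
  then have "?g \<otimes>\<^bsub>?Y\<^esub> L = \<one>\<^bsub>?Y\<^esub>"
    unfolding d2 comm 1 by (simp add: YA.smult_smult uu)
  ultimately show ?thesis
    unfolding Units_def using g Lc by blast
qed

end

text \<open>For d = 1 the relation t_j^d = 1 gives t_j = 1, and the sum over s has the single term v
  g_i.\<close>

lemma hecke_quad:
  assumes i: "i \<in> {1..<n}"
  shows "yh_g 1 n i \<otimes>\<^bsub>hecke n\<^esub> yh_g 1 n i = u_pow 2 \<odot>\<^bsub>hecke n\<^esub> \<one>\<^bsub>hecke n\<^esub> \<oplus>\<^bsub>hecke n\<^esub> v_var \<odot>\<^bsub>hecke n\<^esub> yh_g 1 n i"
proof -
  have i': "i \<in> {1..n}"
    using i by auto
  have g: "yh_g 1 n i \<in> carrier (hecke n)"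
    by (rule g_closed[OF i])
  have t: "yh_t 1 n i = \<one>\<^bsub>hecke n\<^esub>"
    using T_pow[OF i', of 1] t_closed[OF i', of 1] by simp
  have "yh_word 1 n [G i, G i] = yh_g 1 n i \<otimes>\<^bsub>hecke n\<^esub> yh_g 1 n i"
    using i g by (simp add: yh_word_eval yh_g_def)
  moreover have "yh_word 1 n (quad_word 1 i 1) = yh_g 1 n i"
    unfolding yh_quad_word[OF i] t using g by simp
  moreover have "quad_coeff 1 = v_var"
    by (simp add: quad_coeff_def)
  ultimately show ?thesis
    using yh_quad[OF i, of 1] g by simp
qed

subsection \<open>The tensor products of affine Hecke algebras\<close>

lemma tensor_alg_hecke: "tensor_alg {1..d::nat} (\<lambda>a. hecke (\<mu> a))"
  by (rule tensor_alg.intro) (simp_all add: K_alg_YH)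

lemma K_alg_Hmu: "K_alg (Hmu d \<mu>)"
  unfolding Hmu_def by (rule tensor_alg.K_alg_TT[OF tensor_alg_hecke])

interpretation HA: K_alg "Hmu d \<mu>" for d \<mu>
  by (rule K_alg_Hmu)

lemma in_factor_eq: "in_factor d \<mu> a = tensor_alg.ins {1..d} (\<lambda>a. hecke (\<mu> a)) a"
  by (rule ext) (simp only: in_factor_def tensor_alg.ins_def[OF tensor_alg_hecke])

lemma K_hom_in_factor: "a \<in> {1..d} \<Longrightarrow> K_hom (hecke (\<mu> a)) (Hmu d \<mu>) (in_factor d \<mu> a)"
  unfolding in_factor_eq Hmu_def by (rule tensor_alg.K_hom_ins[OF tensor_alg_hecke])

lemma in_factor_commute:
  assumes "a \<in> {1..d}" "b \<in> {1..d}" "a \<noteq> b" "x \<in> carrier (hecke (\<mu> a))" "y \<in> carrier (hecke (\<mu> b))"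
  shows "in_factor d \<mu> a x \<otimes>\<^bsub>Hmu d \<mu>\<^esub> in_factor d \<mu> b y = in_factor d \<mu> b y \<otimes>\<^bsub>Hmu d \<mu>\<^esub> in_factor d \<mu> a x"
  unfolding in_factor_eq Hmu_def using assms by (rule tensor_alg.ins_commute[OF tensor_alg_hecke])

text \<open>The entries of the matrices of the generators are either elements of this form or
  scalars.\<close>

definition hg :: "nat \<Rightarrow> (nat \<Rightarrow> nat) \<Rightarrow> nat \<Rightarrow> gen \<Rightarrow> hmu" where
  "hg d \<mu> a x = in_factor d \<mu> a (yh_gen 1 (\<mu> a) x)"

context
  fixes d :: nat and \<mu> :: "nat \<Rightarrow> nat" and a :: nat
  assumes a: "a \<in> {1..d}"
begin

interpretation H: K_hom "hecke (\<mu> a)" "Hmu d \<mu>" "in_factor d \<mu> a"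
  by (rule K_hom_in_factor[OF a])

lemma hg_closed [simp]: "x \<in> yh_gens (\<mu> a) \<Longrightarrow> hg d \<mu> a x \<in> carrier (Hmu d \<mu>)"
  unfolding hg_def by (intro H.hom_closed yh_gen_closed)

lemma hg_rel:
  assumes "(w, w') \<in> word_rels 1 (\<mu> a)"
  shows "mprod (Hmu d \<mu>) (map (hg d \<mu> a) w) = mprod (Hmu d \<mu>) (map (hg d \<mu> a) w')"
proof -
  have eq: "in_factor d \<mu> a (mprod (hecke (\<mu> a)) (map (yh_gen 1 (\<mu> a)) v)) = mprod (Hmu d \<mu>) (map (hg d \<mu> a) v)"
    if v: "v \<in> lists (yh_gens (\<mu> a))" for v
  proof -
    have "set (map (yh_gen 1 (\<mu> a)) v) \<subseteq> carrier (hecke (\<mu> a))"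
      using v by auto
    from H.hom_mprod[OF this] show ?thesis
      by (simp add: hg_def[abs_def] o_def)
  qed
  show ?thesis
    using yh_gen_rel[OF assms] eq[OF word_rels_lists(1)[OF assms]] eq[OF word_rels_lists(2)[OF assms]] by simp
qed

lemma hg_far:
  assumes "i \<in> {1..<\<mu> a}" "j \<in> {1..<\<mu> a}" "Suc i < j"
  shows "hg d \<mu> a (G i) \<otimes>\<^bsub>Hmu d \<mu>\<^esub> hg d \<mu> a (G j) = hg d \<mu> a (G j) \<otimes>\<^bsub>Hmu d \<mu>\<^esub> hg d \<mu> a (G i)"
proof -
  have "([G i, G j], [G j, G i]) \<in> word_rels 1 (\<mu> a)"
    using assms by (simp add: word_rels_iff)
  from hg_rel[OF this] show ?thesis
    using assms by simp
qed

lemma hg_braid: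
  assumes "i \<in> {1..<\<mu> a}" "Suc i \<in> {1..<\<mu> a}"
  shows "hg d \<mu> a (G i) \<otimes>\<^bsub>Hmu d \<mu>\<^esub> (hg d \<mu> a (G (Suc i)) \<otimes>\<^bsub>Hmu d \<mu>\<^esub> hg d \<mu> a (G i))
    = hg d \<mu> a (G (Suc i)) \<otimes>\<^bsub>Hmu d \<mu>\<^esub> (hg d \<mu> a (G i) \<otimes>\<^bsub>Hmu d \<mu>\<^esub> hg d \<mu> a (G (Suc i)))"
proof -
  have "([G i, G (Suc i), G i], [G (Suc i), G i, G (Suc i)]) \<in> word_rels 1 (\<mu> a)"
    using assms by (simp add: word_rels_iff)
  from hg_rel[OF this] show ?thesis
    using assms by simp
qed

lemma hg_XG1:
  assumes "2 \<le> \<mu> a"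
  shows "hg d \<mu> a X1 \<otimes>\<^bsub>Hmu d \<mu>\<^esub> (hg d \<mu> a (G 1) \<otimes>\<^bsub>Hmu d \<mu>\<^esub> (hg d \<mu> a X1 \<otimes>\<^bsub>Hmu d \<mu>\<^esub> hg d \<mu> a (G 1)))
    = hg d \<mu> a (G 1) \<otimes>\<^bsub>Hmu d \<mu>\<^esub> (hg d \<mu> a X1 \<otimes>\<^bsub>Hmu d \<mu>\<^esub> (hg d \<mu> a (G 1) \<otimes>\<^bsub>Hmu d \<mu>\<^esub> hg d \<mu> a X1))"
proof -
  have "([X1, G 1, X1, G 1], [G 1, X1, G 1, X1]) \<in> word_rels 1 (\<mu> a)"
    using assms by (simp add: word_rels_iff)
  from hg_rel[OF this] show ?thesis
    using assms by simp
qed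

lemma hg_XG:
  assumes "i \<in> {2..<\<mu> a}"
  shows "hg d \<mu> a X1 \<otimes>\<^bsub>Hmu d \<mu>\<^esub> hg d \<mu> a (G i) = hg d \<mu> a (G i) \<otimes>\<^bsub>Hmu d \<mu>\<^esub> hg d \<mu> a X1"
proof -
  have "([X1, G i], [G i, X1]) \<in> word_rels 1 (\<mu> a)"
    using assms by (simp add: word_rels_iff)
  from hg_rel[OF this] show ?thesis
    using assms by simp
qed

lemma hg_X_inv:
  assumes "1 \<le> \<mu> a"
  shows "hg d \<mu> a X1 \<otimes>\<^bsub>Hmu d \<mu>\<^esub> hg d \<mu> a X1inv = \<one>\<^bsub>Hmu d \<mu>\<^esub>"
    "hg d \<mu> a X1inv \<otimes>\<^bsub>Hmu d \<mu>\<^esub> hg d \<mu> a X1 = \<one>\<^bsub>Hmu d \<mu>\<^esub>"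
proof -
  have 1: "([X1, X1inv], []) \<in> word_rels 1 (\<mu> a)" "([X1inv, X1], []) \<in> word_rels 1 (\<mu> a)"
    using assms by (simp_all add: word_rels_iff)
  show "hg d \<mu> a X1 \<otimes>\<^bsub>Hmu d \<mu>\<^esub> hg d \<mu> a X1inv = \<one>\<^bsub>Hmu d \<mu>\<^esub>"
    "hg d \<mu> a X1inv \<otimes>\<^bsub>Hmu d \<mu>\<^esub> hg d \<mu> a X1 = \<one>\<^bsub>Hmu d \<mu>\<^esub>"
    using hg_rel[OF 1(1)] hg_rel[OF 1(2)] assms by simp_all
qed

lemma hg_quad:
  assumes i: "i \<in> {1..<\<mu> a}"
  shows "hg d \<mu> a (G i) \<otimes>\<^bsub>Hmu d \<mu>\<^esub> hg d \<mu> a (G i)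
    = u_pow 2 \<odot>\<^bsub>Hmu d \<mu>\<^esub> \<one>\<^bsub>Hmu d \<mu>\<^esub> \<oplus>\<^bsub>Hmu d \<mu>\<^esub> v_var \<odot>\<^bsub>Hmu d \<mu>\<^esub> hg d \<mu> a (G i)"
proof -
  have g: "yh_gen 1 (\<mu> a) (G i) \<in> carrier (hecke (\<mu> a))"
    using i by simp
  have "hg d \<mu> a (G i) \<otimes>\<^bsub>Hmu d \<mu>\<^esub> hg d \<mu> a (G i)
      = in_factor d \<mu> a (yh_gen 1 (\<mu> a) (G i) \<otimes>\<^bsub>hecke (\<mu> a)\<^esub> yh_gen 1 (\<mu> a) (G i))"
    unfolding hg_def by (rule H.hom_mult[OF g g, symmetric])
  also have "\<dots> = in_factor d \<mu> a (u_pow 2 \<odot>\<^bsub>hecke (\<mu> a)\<^esub> \<one>\<^bsub>hecke (\<mu> a)\<^esub>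
      \<oplus>\<^bsub>hecke (\<mu> a)\<^esub> v_var \<odot>\<^bsub>hecke (\<mu> a)\<^esub> yh_gen 1 (\<mu> a) (G i))"
    by (rule arg_cong[OF hecke_quad[OF i, unfolded yh_g_def]])
  also have "\<dots> = u_pow 2 \<odot>\<^bsub>Hmu d \<mu>\<^esub> \<one>\<^bsub>Hmu d \<mu>\<^esub> \<oplus>\<^bsub>Hmu d \<mu>\<^esub> v_var \<odot>\<^bsub>Hmu d \<mu>\<^esub> hg d \<mu> a (G i)"
    by (simp only: H.hom_add H.hom_smult H.hom_one g YA.smult_closed YA.one_closed hg_def)
  finally show ?thesis .
qed

end

lemma hg_commute:
  assumes "a \<in> {1..d}" "b \<in> {1..d}" "a \<noteq> b" "x \<in> yh_gens (\<mu> a)" "y \<in> yh_gens (\<mu> b)"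
  shows "hg d \<mu> a x \<otimes>\<^bsub>Hmu d \<mu>\<^esub> hg d \<mu> b y = hg d \<mu> b y \<otimes>\<^bsub>Hmu d \<mu>\<^esub> hg d \<mu> a x"
  unfolding hg_def using assms by (intro in_factor_commute yh_gen_closed)

section \<open>Monomial matrices\<close>

lemma comp_sw_sw: "f \<circ> sw i \<circ> sw i = f"
  by (rule ext) simp

lemma (in K_alg) finsum_smult_left:
  assumes "finite S" "x \<in> carrier A"
  shows "(\<Oplus>s\<in>S. c s \<odot> x) = (\<Sum>s\<in>S. c s) \<odot> x"
  using assms(1)
proof (induction S rule: finite_induct)
  case (insert s S)
  have "(\<lambda>s. c s \<odot> x) \<in> S \<rightarrow> carrier A"
    using assms(2) by simp
  then show ?case
    using insert assms(2) by (simp add: smult_l_distr)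
qed (use assms(2) in simp)

lemma (in K_alg) scalar_mult:
  assumes "x \<in> carrier A"
  shows "(c \<odot> \<one>) \<otimes> x = c \<odot> x" "x \<otimes> (c \<odot> \<one>) = c \<odot> x"
  using assms by (simp_all add: smult_mult_l smult_mult_r)

text \<open>A word \<open>w\<close> in the generators acts by a monomial matrix, whose row \<open>\<chi>\<close> has the entry \<open>wval n w \<chi>\<close>
  in the column \<open>wperm w \<chi>\<close>.\<close>

primrec gperm :: "gen \<Rightarrow> (nat \<Rightarrow> complex) \<Rightarrow> nat \<Rightarrow> complex" where
  "gperm (G i) \<chi> = \<chi> \<circ> sw i"
| "gperm X1 \<chi> = \<chi>"
| "gperm X1inv \<chi> = \<chi>"
| "gperm (T j) \<chi> = \<chi>"

primrec wperm :: "gen list \<Rightarrow> (nat \<Rightarrow> complex) \<Rightarrow> nat \<Rightarrow> complex" where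
  "wperm [] \<chi> = \<chi>"
| "wperm (x # w) \<chi> = wperm w (gperm x \<chi>)"

context roots
begin

abbreviation "Hc n \<chi> \<equiv> Hmu d (Comp d \<xi> n \<chi>)"

definition mono_mat :: "nat \<Rightarrow> ((nat \<Rightarrow> complex) \<Rightarrow> nat \<Rightarrow> complex) \<Rightarrow> ((nat \<Rightarrow> complex) \<Rightarrow> hmu) \<Rightarrow> mats" where
  "mono_mat n \<sigma> h = (\<lambda>\<mu>\<in>compositions d n. \<lambda>\<psi>\<in>chars_of d \<xi> n \<mu>. \<lambda>\<psi>'\<in>chars_of d \<xi> n \<mu>.
     if \<psi>' = \<sigma> \<psi> then h \<psi> else \<zero>\<^bsub>Hmu d \<mu>\<^esub>)"

text \<open>Characters with different compositions belong to different direct summands;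
  \<open>\<sigma>\<close> has to preserve the composition for the column of a row to lie in the same
  matrix block. In this way one map on all characters describes all blocks at once.\<close>

definition adm :: "nat \<Rightarrow> ((nat \<Rightarrow> complex) \<Rightarrow> nat \<Rightarrow> complex) \<Rightarrow> ((nat \<Rightarrow> complex) \<Rightarrow> hmu) \<Rightarrow> bool" where
  "adm n \<sigma> h \<longleftrightarrow> (\<forall>\<chi>\<in>chars d n. \<sigma> \<chi> \<in> chars d n \<and> Comp d \<xi> n (\<sigma> \<chi>) = Comp d \<xi> n \<chi> \<and> h \<chi> \<in> carrier (Hc n \<chi>))"

lemma admD:
  assumes "adm n \<sigma> h" "\<chi> \<in> chars d n"
  shows "\<sigma> \<chi> \<in> chars d n" "Comp d \<xi> n (\<sigma> \<chi>) = Comp d \<xi> n \<chi>" "h \<chi> \<in> carrier (Hc n \<chi>)"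
  using assms by (simp_all add: adm_def)

lemma chars_ofD: "\<chi> \<in> chars_of d \<xi> n \<mu> \<Longrightarrow> \<chi> \<in> chars d n \<and> Comp d \<xi> n \<chi> = \<mu>"
  by (simp add: chars_of_def)

lemma finite_chars_of: "finite (chars_of d \<xi> n \<mu>)"
  unfolding chars_of_def using finite_chars by simp

lemma K_alg_Mats: "K_alg (Mats d \<xi> n)"
  unfolding Mats_def by (intro K_alg_direct_sum K_alg_mat_algebra K_alg_Hmu finite_chars_of)

lemma Mats_carrier: "M \<in> carrier (Mats d \<xi> n) \<longleftrightarrow> M \<in> (\<Pi>\<^sub>E \<mu>\<in>compositions d n.
    \<Pi>\<^sub>E \<psi>\<in>chars_of d \<xi> n \<mu>. \<Pi>\<^sub>E \<psi>'\<in>chars_of d \<xi> n \<mu>. carrier (Hmu d \<mu>))"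
  unfolding Mats_def direct_sum_simps mat_algebra_simps ..

lemma mono_mat_closed:
  assumes "adm n \<sigma> h" shows "mono_mat n \<sigma> h \<in> carrier (Mats d \<xi> n)"
  unfolding Mats_carrier mono_mat_def
proof (intro restrict_PiE_iff[THEN iffD2] ballI)
  fix \<mu> \<psi> \<psi>'
  assume "\<psi> \<in> chars_of d \<xi> n \<mu>"
  from chars_ofD[OF this] have "h \<psi> \<in> carrier (Hmu d \<mu>)"
    using admD(3)[OF assms] by blast
  then show "(if \<psi>' = \<sigma> \<psi> then h \<psi> else \<zero>\<^bsub>Hmu d \<mu>\<^esub>) \<in> carrier (Hmu d \<mu>)"
    by simp
qed

text \<open>In a row whose entry is zero the column may be changed freely. The quadratic relation
  relies on this second alternative, since e_i kills the rows in which s_i moves the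
  character.\<close>

lemma mono_mat_cong:
  assumes "\<And>\<chi>. \<chi> \<in> chars d n \<Longrightarrow> (\<sigma> \<chi> = \<sigma>' \<chi> \<and> h \<chi> = h' \<chi>) \<or> (h \<chi> = \<zero>\<^bsub>Hc n \<chi>\<^esub> \<and> h' \<chi> = \<zero>\<^bsub>Hc n \<chi>\<^esub>)"
  shows "mono_mat n \<sigma> h = mono_mat n \<sigma>' h'"
  unfolding mono_mat_def
proof (intro restrict_ext)
  fix \<mu> \<psi> \<psi>'
  assume "\<psi> \<in> chars_of d \<xi> n \<mu>"
  then have \<psi>: "\<psi> \<in> chars d n" "Comp d \<xi> n \<psi> = \<mu>"
    by (auto dest: chars_ofD)
  from assms[OF \<psi>(1)] show "(if \<psi>' = \<sigma> \<psi> then h \<psi> else \<zero>\<^bsub>Hmu d \<mu>\<^esub>) = (if \<psi>' = \<sigma>' \<psi> then h' \<psi> else \<zero>\<^bsub>Hmu d \<mu>\<^esub>)"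
    unfolding \<psi>(2) by (elim disjE conjE) simp_all
qed

text \<open>In the sum over the intermediate column only \<open>k = \<sigma> \<psi>\<close>
  contributes, so rows compose along a path.\<close>

lemma mono_mat_mult:
  assumes h: "adm n \<sigma> h" "adm n \<sigma>' h'"
  shows "mono_mat n \<sigma> h \<otimes>\<^bsub>Mats d \<xi> n\<^esub> mono_mat n \<sigma>' h'
    = mono_mat n (\<lambda>\<chi>. \<sigma>' (\<sigma> \<chi>)) (\<lambda>\<chi>. h \<chi> \<otimes>\<^bsub>Hc n \<chi>\<^esub> h' (\<sigma> \<chi>))"
proof -
  have "(\<Oplus>\<^bsub>Hmu d \<mu>\<^esub>k\<in>chars_of d \<xi> n \<mu>. mono_mat n \<sigma> h \<mu> \<psi> k \<otimes>\<^bsub>Hmu d \<mu>\<^esub> mono_mat n \<sigma>' h' \<mu> k \<psi>')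
    = (if \<psi>' = \<sigma>' (\<sigma> \<psi>) then h \<psi> \<otimes>\<^bsub>Hc n \<psi>\<^esub> h' (\<sigma> \<psi>) else \<zero>\<^bsub>Hmu d \<mu>\<^esub>)" (is "?L = ?R")
    if \<mu>: "\<mu> \<in> compositions d n" "\<psi> \<in> chars_of d \<xi> n \<mu>" "\<psi>' \<in> chars_of d \<xi> n \<mu>" for \<mu> \<psi> \<psi>'
  proof -
    have \<psi>: "\<psi> \<in> chars d n" "Comp d \<xi> n \<psi> = \<mu>"
      using chars_ofD[OF \<mu>(2)] by blast+
    note a = admD[OF h(1) \<psi>(1)]
    have \<sigma>\<psi>: "\<sigma> \<psi> \<in> chars_of d \<xi> n \<mu>"
      using a \<psi>(2) by (simp add: chars_of_def)
    have h\<psi>: "h \<psi> \<in> carrier (Hmu d \<mu>)"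
      using a(3) \<psi>(2) by simp
    have h'k: "h' k \<in> carrier (Hmu d \<mu>)" if "k \<in> chars_of d \<xi> n \<mu>" for k
      using chars_ofD[OF that] admD(3)[OF h(2), of k] by simp
    have R: "?R \<in> carrier (Hmu d \<mu>)"
      using h\<psi> h'k[OF \<sigma>\<psi>] \<psi>(2) by simp
    have "?L = (\<Oplus>\<^bsub>Hmu d \<mu>\<^esub>k\<in>chars_of d \<xi> n \<mu>. if k = \<sigma> \<psi> then ?R else \<zero>\<^bsub>Hmu d \<mu>\<^esub>)"
    proof (rule HA.finsum_cong'[OF refl])
      show "(\<lambda>k. if k = \<sigma> \<psi> then ?R else \<zero>\<^bsub>Hmu d \<mu>\<^esub>) \<in> chars_of d \<xi> n \<mu> \<rightarrow> carrier (Hmu d \<mu>)"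
        using R by (intro Pi_I) (simp del: if_split add: if_split[of "\<lambda>x. x \<in> carrier (Hmu d \<mu>)"])
      fix k assume k: "k \<in> chars_of d \<xi> n \<mu>"
      have "mono_mat n \<sigma> h \<mu> \<psi> k = (if k = \<sigma> \<psi> then h \<psi> else \<zero>\<^bsub>Hmu d \<mu>\<^esub>)"
        "mono_mat n \<sigma>' h' \<mu> k \<psi>' = (if \<psi>' = \<sigma>' k then h' k else \<zero>\<^bsub>Hmu d \<mu>\<^esub>)"
        using \<mu> k by (simp_all add: mono_mat_def)
      then show "mono_mat n \<sigma> h \<mu> \<psi> k \<otimes>\<^bsub>Hmu d \<mu>\<^esub> mono_mat n \<sigma>' h' \<mu> k \<psi>' = (if k = \<sigma> \<psi> then ?R else \<zero>\<^bsub>Hmu d \<mu>\<^esub>)"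
        using h\<psi> h'k[OF k] \<psi>(2) by simp
    qed
    also have "\<dots> = ?R"
      by (rule HA.finsum_single[OF \<sigma>\<psi> finite_chars_of R])
    finally show ?thesis .
  qed
  then show ?thesis
    unfolding Mats_def direct_sum_simps mat_algebra_simps
    by (subst (3) mono_mat_def) (intro restrict_ext, simp)
qed

lemma mono_mat_one: "mono_mat n (\<lambda>\<chi>. \<chi>) (\<lambda>\<chi>. \<one>\<^bsub>Hc n \<chi>\<^esub>) = \<one>\<^bsub>Mats d \<xi> n\<^esub>"
  unfolding Mats_def direct_sum_simps mat_algebra_simps mono_mat_def
  by (intro restrict_ext) (auto dest: chars_ofD)

lemma mono_mat_add:
  assumes "adm n \<sigma> h" "adm n \<sigma> h'"
  shows "mono_mat n \<sigma> h \<oplus>\<^bsub>Mats d \<xi> n\<^esub> mono_mat n \<sigma> h' = mono_mat n \<sigma> (\<lambda>\<chi>. h \<chi> \<oplus>\<^bsub>Hc n \<chi>\<^esub> h' \<chi>)"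
  unfolding Mats_def direct_sum_simps mat_algebra_simps mono_mat_def
  by (intro restrict_ext) (auto dest: chars_ofD)

lemma mono_mat_smult:
  assumes "adm n \<sigma> h"
  shows "c \<odot>\<^bsub>Mats d \<xi> n\<^esub> mono_mat n \<sigma> h = mono_mat n \<sigma> (\<lambda>\<chi>. c \<odot>\<^bsub>Hc n \<chi>\<^esub> h \<chi>)"
  unfolding Mats_def direct_sum_simps mat_algebra_simps mono_mat_def
  by (intro restrict_ext) (auto dest: chars_ofD)

lemma mono_mat_zero: "mono_mat n \<sigma> (\<lambda>\<chi>. \<zero>\<^bsub>Hc n \<chi>\<^esub>) = \<zero>\<^bsub>Mats d \<xi> n\<^esub>"
  unfolding Mats_def direct_sum_simps mat_algebra_simps mono_mat_def
  by (intro restrict_ext) (auto dest: chars_ofD)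

lemma adm_finsum:
  assumes "finite S" "\<And>s. s \<in> S \<Longrightarrow> adm n \<sigma> (h s)" "\<And>\<chi>. \<chi> \<in> chars d n \<Longrightarrow> \<sigma> \<chi> \<in> chars d n \<and> Comp d \<xi> n (\<sigma> \<chi>) = Comp d \<xi> n \<chi>"
  shows "adm n \<sigma> (\<lambda>\<chi>. \<Oplus>\<^bsub>Hc n \<chi>\<^esub>s\<in>S. h s \<chi>)"
  unfolding adm_def
proof (intro ballI conjI)
  fix \<chi> assume \<chi>: "\<chi> \<in> chars d n"
  show "(\<Oplus>\<^bsub>Hc n \<chi>\<^esub>s\<in>S. h s \<chi>) \<in> carrier (Hc n \<chi>)"
    by (intro HA.finsum_closed Pi_I admD(3)[OF assms(2) \<chi>])
qed (use assms(3) in simp_all)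

lemma mono_mat_finsum:
  assumes "finite S" "\<And>s. s \<in> S \<Longrightarrow> adm n \<sigma> (h s)" "\<And>\<chi>. \<chi> \<in> chars d n \<Longrightarrow> \<sigma> \<chi> \<in> chars d n \<and> Comp d \<xi> n (\<sigma> \<chi>) = Comp d \<xi> n \<chi>"
  shows "(\<Oplus>\<^bsub>Mats d \<xi> n\<^esub>s\<in>S. mono_mat n \<sigma> (h s)) = mono_mat n \<sigma> (\<lambda>\<chi>. \<Oplus>\<^bsub>Hc n \<chi>\<^esub>s\<in>S. h s \<chi>)"
  using assms(1,2)
proof (induction S rule: finite_induct)
  case empty
  interpret M: K_alg "Mats d \<xi> n"
    by (rule K_alg_Mats)
  show ?case
    by (simp add: mono_mat_zero)
next
  case (insert s S)
  interpret M: K_alg "Mats d \<xi> n"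
    by (rule K_alg_Mats)
  have s: "adm n \<sigma> (h s)" and S: "\<And>s. s \<in> S \<Longrightarrow> adm n \<sigma> (h s)"
    using insert by blast+
  have "(\<lambda>s. mono_mat n \<sigma> (h s)) \<in> S \<rightarrow> carrier (Mats d \<xi> n)"
    by (intro Pi_I mono_mat_closed S)
  then have "(\<Oplus>\<^bsub>Mats d \<xi> n\<^esub>s\<in>insert s S. mono_mat n \<sigma> (h s))
      = mono_mat n \<sigma> (h s) \<oplus>\<^bsub>Mats d \<xi> n\<^esub> mono_mat n \<sigma> (\<lambda>\<chi>. \<Oplus>\<^bsub>Hc n \<chi>\<^esub>s\<in>S. h s \<chi>)"
    using insert(1,2) mono_mat_closed[OF s] insert.IH[OF S] by simp
  also have "\<dots> = mono_mat n \<sigma> (\<lambda>\<chi>. h s \<chi> \<oplus>\<^bsub>Hc n \<chi>\<^esub> (\<Oplus>\<^bsub>Hc n \<chi>\<^esub>s\<in>S. h s \<chi>))"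
    by (rule mono_mat_add[OF s adm_finsum[OF insert(1) S assms(3)]])
  also have "\<dots> = mono_mat n \<sigma> (\<lambda>\<chi>. \<Oplus>\<^bsub>Hc n \<chi>\<^esub>s\<in>insert s S. h s \<chi>)"
  proof (rule mono_mat_cong, rule disjI1, rule conjI[OF refl])
    fix \<chi> assume \<chi>: "\<chi> \<in> chars d n"
    have "(\<lambda>s. h s \<chi>) \<in> S \<rightarrow> carrier (Hc n \<chi>)"
      by (intro Pi_I admD(3)[OF S \<chi>])
    from HA.finsum_insert[OF insert(1,2) this admD(3)[OF s \<chi>]]
    show "h s \<chi> \<oplus>\<^bsub>Hc n \<chi>\<^esub> (\<Oplus>\<^bsub>Hc n \<chi>\<^esub>s\<in>S. h s \<chi>) = (\<Oplus>\<^bsub>Hc n \<chi>\<^esub>s\<in>insert s S. h s \<chi>)"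
      by (rule sym)
  qed
  finally show ?case .
qed

subsection \<open>The images of the generators\<close>

text \<open>For p and p+1 of equal value this is the generator with index \<pi>_\<chi>^-1(p) under
  the identification of the tensor product with a subalgebra, see \<open>hmu_g_pos\<close>. Using
  colour and rank makes it easy to follow when other strands move.\<close>

definition Gval :: "nat \<Rightarrow> (nat \<Rightarrow> complex) \<Rightarrow> nat \<Rightarrow> hmu" where
  "Gval n \<chi> p = hg d (Comp d \<xi> n \<chi>) (col \<chi> p) (G (rank (col \<chi>) p))"

text \<open>In a row with \<chi>(t_i) \<noteq> \<chi>(t_{i+1}) the element e_i acts as 0, so g_i^2 =
  u^2 has to hold; the entry u in this row and in the exchanged one achieves it. The t_j act by the
  values of the character.\<close>

primrec gval :: "nat \<Rightarrow> gen \<Rightarrow> (nat \<Rightarrow> complex) \<Rightarrow> hmu" where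
  "gval n (G i) \<chi> = (if \<chi> i = \<chi> (Suc i) then Gval n \<chi> i else u_pow 1 \<odot>\<^bsub>Hc n \<chi>\<^esub> \<one>\<^bsub>Hc n \<chi>\<^esub>)"
| "gval n X1 \<chi> = hg d (Comp d \<xi> n \<chi>) (col \<chi> 1) X1"
| "gval n X1inv \<chi> = hg d (Comp d \<xi> n \<chi>) (col \<chi> 1) X1inv"
| "gval n (T j) \<chi> = K_const (\<chi> j) \<odot>\<^bsub>Hc n \<chi>\<^esub> \<one>\<^bsub>Hc n \<chi>\<^esub>"

primrec wval :: "nat \<Rightarrow> gen list \<Rightarrow> (nat \<Rightarrow> complex) \<Rightarrow> hmu" where
  "wval n [] \<chi> = \<one>\<^bsub>Hc n \<chi>\<^esub>"
| "wval n (x # w) \<chi> = gval n x \<chi> \<otimes>\<^bsub>Hc n \<chi>\<^esub> wval n w (gperm x \<chi>)"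

lemma col_range: "\<chi> \<in> chars d n \<Longrightarrow> j \<in> {1..n} \<Longrightarrow> col \<chi> j \<in> {1..d}"
  by (rule colouringD[OF colouring_col])

lemma Comp_col:
  assumes "\<chi> \<in> chars d n" "j \<in> {1..n}"
  shows "Comp d \<xi> n \<chi> (col \<chi> j) = cnt (col \<chi>) n (col \<chi> j)"
  using col_range[OF assms] by (simp add: Comp_eq[OF assms(1)] wt_def)

lemma rank_col_le:
  assumes "\<chi> \<in> chars d n" "j \<in> {1..n}"
  shows "rank (col \<chi>) j \<in> {1..Comp d \<xi> n \<chi> (col \<chi> j)}"
  using rank_pos[of j "col \<chi>"] rank_le[of j n "col \<chi>"] assms(2) by (simp add: Comp_col[OF assms])

lemma rank_col_less:
  assumes "\<chi> \<in> chars d n" "i \<in> {1..<n}" "\<chi> i = \<chi> (Suc i)"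
  shows "rank (col \<chi>) i \<in> {1..<Comp d \<xi> n \<chi> (col \<chi> i)}"
proof -
  have i: "i \<in> {1..n}" "Suc i \<in> {1..n}"
    using assms(2) by auto
  have c: "col \<chi> i = col \<chi> (Suc i)"
    using col_eq_iff[OF assms(1) i] assms(3) by simp
  show ?thesis
    using rank_col_le[OF assms(1) i(1)] rank_col_le[OF assms(1) i(2)] rank_Suc[OF c] c by simp
qed

lemma Gval_closed:
  assumes "\<chi> \<in> chars d n" "i \<in> {1..<n}" "\<chi> i = \<chi> (Suc i)"
  shows "Gval n \<chi> i \<in> carrier (Hc n \<chi>)"
  unfolding Gval_def using rank_col_less[OF assms] assms(2)
  by (intro hg_closed col_range[OF assms(1)]) simp_all

lemma X_pos: "\<chi> \<in> chars d n \<Longrightarrow> 1 \<le> n \<Longrightarrow> 1 \<le> Comp d \<xi> n \<chi> (col \<chi> 1)"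
  using rank_col_le[of \<chi> n 1] by simp

lemma sw_fixed: "\<chi> i = \<chi> (Suc i) \<Longrightarrow> \<chi> \<circ> sw i = \<chi>"
  by (rule ext) (metis comp_apply transpose_apply_first transpose_apply_second transpose_apply_other)

lemma gval_closed:
  assumes "x \<in> yh_gens n" "\<chi> \<in> chars d n"
  shows "gval n x \<chi> \<in> carrier (Hc n \<chi>)"
proof (cases x)
  case (G i)
  then show ?thesis
    using assms Gval_closed[of \<chi> n i] by simp
next
  case X1
  then have n: "1 \<le> n"
    using assms by simp
  show ?thesis
    unfolding X1 gval.simps by (intro hg_closed col_range[OF assms(2)]) (use n X_pos[OF assms(2) n] in simp_all)
next
  case X1inv
  then have n: "1 \<le> n"
    using assms by simp
  show ?thesis
    unfolding X1inv gval.simps by (intro hg_closed col_range[OF assms(2)]) (use n X_pos[OF assms(2) n] in simp_all)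
qed simp

lemma gperm_chars:
  assumes "x \<in> yh_gens n" "\<chi> \<in> chars d n"
  shows "gperm x \<chi> \<in> chars d n" "Comp d \<xi> n (gperm x \<chi>) = Comp d \<xi> n \<chi>"
  using assms chars_sw[OF assms(2)] Comp_sw[OF assms(2)] by (cases x; simp)+

lemma gval_adm: "x \<in> yh_gens n \<Longrightarrow> adm n (gperm x) (gval n x)"
  unfolding adm_def using gperm_chars gval_closed by blast

lemma wval_adm: "w \<in> lists (yh_gens n) \<Longrightarrow> adm n (wperm w) (wval n w)"
proof (induction w)
  case Nil
  show ?case
    by (simp add: adm_def)
next
  case (Cons x w)
  then have x: "x \<in> yh_gens n" and w: "adm n (wperm w) (wval n w)"
    by auto
  show ?case
    unfolding adm_def
  proof (intro ballI conjI)
    fix \<chi> assume \<chi>: "\<chi> \<in> chars d n"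
    note g = gperm_chars[OF x \<chi>]
    note a = admD[OF w g(1)]
    show "wperm (x # w) \<chi> \<in> chars d n" "Comp d \<xi> n (wperm (x # w) \<chi>) = Comp d \<xi> n \<chi>"
      using a g by simp_all
    show "wval n (x # w) \<chi> \<in> carrier (Hc n \<chi>)"
      using gval_closed[OF x \<chi>] a(3) g(2) by simp
  qed
qed

definition gmat :: "nat \<Rightarrow> gen \<Rightarrow> mats" where
  "gmat n x = mono_mat n (gperm x) (gval n x)"

lemma gmat_word:
  "w \<in> lists (yh_gens n) \<Longrightarrow> mprod (Mats d \<xi> n) (map (gmat n) w) = mono_mat n (wperm w) (wval n w)"
proof (induction w)
  case Nil
  have "mono_mat n (wperm []) (wval n []) = mono_mat n (\<lambda>\<chi>. \<chi>) (\<lambda>\<chi>. \<one>\<^bsub>Hc n \<chi>\<^esub>)"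
    by (rule mono_mat_cong) simp
  then show ?case
    by (simp only: mono_mat_one list.map mprod_Nil)
next
  case (Cons x w)
  then have x: "x \<in> yh_gens n" and w: "w \<in> lists (yh_gens n)"
    by auto
  have "mprod (Mats d \<xi> n) (map (gmat n) (x # w)) = mono_mat n (gperm x) (gval n x) \<otimes>\<^bsub>Mats d \<xi> n\<^esub> mono_mat n (wperm w) (wval n w)"
    unfolding list.map mprod_Cons Cons.IH[OF w] unfolding gmat_def ..
  also have "\<dots> = mono_mat n (\<lambda>\<chi>. wperm w (gperm x \<chi>)) (\<lambda>\<chi>. gval n x \<chi> \<otimes>\<^bsub>Hc n \<chi>\<^esub> wval n w (gperm x \<chi>))"
    by (rule mono_mat_mult[OF gval_adm[OF x] wval_adm[OF w]])
  also have "\<dots> = mono_mat n (wperm (x # w)) (wval n (x # w))"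
    by (rule mono_mat_cong) simp
  finally show ?case .
qed

section \<open>The defining relations, row by row\<close>

lemma Gval_sw:
  assumes \<chi>: "\<chi> \<in> chars d n" and i: "i \<in> {1..<n}" "\<chi> i \<noteq> \<chi> (Suc i)"
  shows "Gval n (\<chi> \<circ> sw i) (sw i p) = Gval n \<chi> p"
proof -
  have "col \<chi> i \<noteq> col \<chi> (Suc i)"
    using col_eq_iff[OF \<chi>, of i "Suc i"] i by auto
  then have "rank (col \<chi> \<circ> sw i) (sw i p) = rank (col \<chi>) p"
    using i(1) by (intro rank_sw) auto
  then show ?thesis
    unfolding Gval_def by (simp add: Comp_sw[OF \<chi> i(1)] col_comp)
qed

text \<open>Away from i and i+1 the exchange is invisible to colour and rank, whether or not the two
  exchanged values agree.\<close>

lemma Gval_sw_other: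
  assumes \<chi>: "\<chi> \<in> chars d n" and i: "i \<in> {1..<n}" and p: "p \<noteq> i" "p \<noteq> Suc i"
  shows "Gval n (\<chi> \<circ> sw i) p = Gval n \<chi> p"
proof -
  have "rank (col \<chi> \<circ> sw i) p = rank (col \<chi>) p"
    using i p by (intro rank_sw_other) auto
  then show ?thesis
    unfolding Gval_def using p by (simp add: Comp_sw[OF \<chi> i(1)] col_comp)
qed

text \<open>If one of the two entries is the scalar u there is nothing to do. Otherwise they are
  generators of different factors, which commute, or of one factor with indices that are at least 2
  apart.\<close>

lemma row_far:
  assumes \<chi>: "\<chi> \<in> chars d n" and ij: "i \<in> {1..<n}" "j \<in> {1..<n}" "Suc i < j"
  shows "wval n [G i, G j] \<chi> = wval n [G j, G i] \<chi>"
proof -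
  let ?H = "Hc n \<chi>"
  let ?A = "gval n (G i) \<chi>" and ?B = "gval n (G j) \<chi>"
  have c: "?A \<in> carrier ?H" "?B \<in> carrier ?H"
    using ij by (intro gval_closed[OF _ \<chi>]; simp)+
  have B: "gval n (G j) (\<chi> \<circ> sw i) = ?B" and A: "gval n (G i) (\<chi> \<circ> sw j) = ?A"
    using ij Gval_sw_other[OF \<chi> ij(1), of j] Gval_sw_other[OF \<chi> ij(2), of i]
    by (simp_all add: Comp_sw[OF \<chi> ij(1)] Comp_sw[OF \<chi> ij(2)])
  have "wval n [G i, G j] \<chi> = ?A \<otimes>\<^bsub>?H\<^esub> ?B"
    unfolding wval.simps gperm.simps B using c by (simp add: Comp_sw[OF \<chi> ij(1)] Comp_sw[OF chars_sw[OF \<chi> ij(1)] ij(2)] del: gval.simps)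
  moreover have "wval n [G j, G i] \<chi> = ?B \<otimes>\<^bsub>?H\<^esub> ?A"
    unfolding wval.simps gperm.simps A using c by (simp add: Comp_sw[OF \<chi> ij(2)] Comp_sw[OF chars_sw[OF \<chi> ij(2)] ij(1)] del: gval.simps)
  moreover have "?A \<otimes>\<^bsub>?H\<^esub> ?B = ?B \<otimes>\<^bsub>?H\<^esub> ?A"
  proof (cases "\<chi> i = \<chi> (Suc i) \<and> \<chi> j = \<chi> (Suc j)")
    case False
    then have "?A = u_pow 1 \<odot>\<^bsub>?H\<^esub> \<one>\<^bsub>?H\<^esub> \<or> ?B = u_pow 1 \<odot>\<^bsub>?H\<^esub> \<one>\<^bsub>?H\<^esub>"
      by auto
    then show ?thesis
      using c by (elim disjE) (simp_all only: HA.scalar_mult)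
  next
    case True
    have r: "i \<in> {1..n}" "j \<in> {1..n}" "Suc i \<in> {1..n}"
      using ij by auto
    note Ri = rank_col_less[OF \<chi> ij(1) conjunct1[OF True]] and Rj = rank_col_less[OF \<chi> ij(2) conjunct2[OF True]]
    have AB: "?A = Gval n \<chi> i" "?B = Gval n \<chi> j"
      using True by simp_all
    show ?thesis
    proof (cases "col \<chi> i = col \<chi> j")
      case same: True
      have "col \<chi> i = col \<chi> (Suc i)"
        using col_eq_iff[OF \<chi> r(1,3)] True by simp
      \<comment> \<open>The position i+1 has the same colour and a rank strictly between those of i
        and j, hence the gap of at least 2.\<close>
      then have "rank (col \<chi>) i < rank (col \<chi>) (Suc i)" "rank (col \<chi>) (Suc i) < rank (col \<chi>) j"
        using same ij(3) by (intro rank_less; simp)+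
      then show ?thesis
        unfolding AB Gval_def same using Ri Rj same
        by (intro hg_far col_range[OF \<chi> r(2)]) simp_all
    next
      case False
      then show ?thesis
        unfolding AB Gval_def using Ri Rj by (intro hg_commute col_range[OF \<chi>] r) simp_all
    qed
  qed
  ultimately show ?thesis
    by (simp only:)
qed

text \<open>Cases by which of the three values agree. If all agree, this is the braid relation of
  one factor. If exactly two agree, each side consists of one generator and two factors u, and the
  two generators coincide. If all differ, both sides are u^3.\<close>

lemma row_braid:
  assumes \<chi>: "\<chi> \<in> chars d n" and i: "i \<in> {1..<n}" "Suc i \<in> {1..<n}"
  shows "wval n [G i, G (Suc i), G i] \<chi> = wval n [G (Suc i), G i, G (Suc i)] \<chi>"
proof -
  let ?H = "Hc n \<chi>" and ?j = "Suc i"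
  let ?u = "u_pow 1 \<odot>\<^bsub>?H\<^esub> \<one>\<^bsub>?H\<^esub>"
  define \<chi>1 where "\<chi>1 = \<chi> \<circ> sw i"
  define \<chi>2 where "\<chi>2 = \<chi> \<circ> sw ?j"
  define \<chi>12 where "\<chi>12 = \<chi>1 \<circ> sw ?j"
  define \<chi>21 where "\<chi>21 = \<chi>2 \<circ> sw i"
  have ch: "\<chi>1 \<in> chars d n" "\<chi>2 \<in> chars d n" "\<chi>12 \<in> chars d n" "\<chi>21 \<in> chars d n"
    unfolding \<chi>1_def \<chi>2_def \<chi>12_def \<chi>21_def by (intro chars_sw \<chi> i)+
  have Cc: "Comp d \<xi> n \<chi>1 = Comp d \<xi> n \<chi>" "Comp d \<xi> n \<chi>2 = Comp d \<xi> n \<chi>"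
    unfolding \<chi>1_def \<chi>2_def by (intro Comp_sw \<chi> i)+
  have Cc2: "Comp d \<xi> n \<chi>12 = Comp d \<xi> n \<chi>" "Comp d \<xi> n \<chi>21 = Comp d \<xi> n \<chi>"
    unfolding \<chi>12_def \<chi>21_def using Comp_sw[OF ch(1) i(2)] Comp_sw[OF ch(2) i(1)] Cc by simp_all
  have Cc3: "Comp d \<xi> n (\<chi>12 \<circ> sw i) = Comp d \<xi> n \<chi>" "Comp d \<xi> n (\<chi>21 \<circ> sw ?j) = Comp d \<xi> n \<chi>"
    using Comp_sw[OF ch(3) i(1)] Comp_sw[OF ch(4) i(2)] Cc2 by simp_all
  let ?A = "\<chi> i" and ?B = "\<chi> ?j" and ?C = "\<chi> (Suc ?j)"
  have v: "\<chi>1 i = ?B" "\<chi>1 ?j = ?A" "\<chi>1 (Suc ?j) = ?C"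
    "\<chi>2 i = ?A" "\<chi>2 ?j = ?C" "\<chi>2 (Suc ?j) = ?B"
    unfolding \<chi>1_def \<chi>2_def by (simp_all add: transpose_def)
  have v2: "\<chi>12 i = ?B" "\<chi>12 ?j = ?C" "\<chi>12 (Suc ?j) = ?A"
    "\<chi>21 i = ?C" "\<chi>21 ?j = ?A" "\<chi>21 (Suc ?j) = ?B"
    unfolding \<chi>12_def \<chi>21_def using v by (simp_all add: transpose_def)
  have g: "gval n (G i) \<chi> = (if ?A = ?B then Gval n \<chi> i else ?u)"
    "gval n (G ?j) \<chi>1 = (if ?A = ?C then Gval n \<chi>1 ?j else ?u)"
    "gval n (G i) \<chi>12 = (if ?B = ?C then Gval n \<chi>12 i else ?u)"
    "gval n (G ?j) \<chi> = (if ?B = ?C then Gval n \<chi> ?j else ?u)"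
    "gval n (G i) \<chi>2 = (if ?A = ?C then Gval n \<chi>2 i else ?u)"
    "gval n (G ?j) \<chi>21 = (if ?A = ?B then Gval n \<chi>21 ?j else ?u)"
    using v v2 by (simp_all add: Cc Cc2)
  have gc: "gval n (G i) \<chi> \<in> carrier ?H" "gval n (G ?j) \<chi>1 \<in> carrier ?H" "gval n (G i) \<chi>12 \<in> carrier ?H"
    "gval n (G ?j) \<chi> \<in> carrier ?H" "gval n (G i) \<chi>2 \<in> carrier ?H" "gval n (G ?j) \<chi>21 \<in> carrier ?H"
    using gval_closed[of "G i" n \<chi>] gval_closed[of "G ?j" n \<chi>1] gval_closed[of "G i" n \<chi>12]
      gval_closed[of "G ?j" n \<chi>] gval_closed[of "G i" n \<chi>2] gval_closed[of "G ?j" n \<chi>21] i \<chi> ch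
    by (simp_all only: yh_gens_simps Cc Cc2)
  have L: "wval n [G i, G ?j, G i] \<chi> = gval n (G i) \<chi> \<otimes>\<^bsub>?H\<^esub> (gval n (G ?j) \<chi>1 \<otimes>\<^bsub>?H\<^esub> gval n (G i) \<chi>12)"
    unfolding wval.simps gperm.simps \<chi>1_def[symmetric] \<chi>12_def[symmetric] Cc Cc2 Cc3 using gc by (simp only: HA.r_one)
  have R: "wval n [G ?j, G i, G ?j] \<chi> = gval n (G ?j) \<chi> \<otimes>\<^bsub>?H\<^esub> (gval n (G i) \<chi>2 \<otimes>\<^bsub>?H\<^esub> gval n (G ?j) \<chi>21)"
    unfolding wval.simps gperm.simps \<chi>2_def[symmetric] \<chi>21_def[symmetric] Cc Cc2 Cc3 using gc by (simp only: HA.r_one)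
  have s1: "Gval n \<chi>1 (sw i p) = Gval n \<chi> p" if "?A \<noteq> ?B" for p
    unfolding \<chi>1_def by (rule Gval_sw[OF \<chi> i(1) that])
  have s2: "Gval n \<chi>2 (sw ?j p) = Gval n \<chi> p" if "?B \<noteq> ?C" for p
    unfolding \<chi>2_def by (rule Gval_sw[OF \<chi> i(2) that])
  have s12: "Gval n \<chi>12 (sw ?j p) = Gval n \<chi>1 p" if "?A \<noteq> ?C" for p
    unfolding \<chi>12_def by (rule Gval_sw[OF ch(1) i(2)]) (simp add: v that)
  have s21: "Gval n \<chi>21 (sw i p) = Gval n \<chi>2 p" if "?A \<noteq> ?C" for p
    unfolding \<chi>21_def by (rule Gval_sw[OF ch(2) i(1)]) (simp add: v that)
  have swji: "sw ?j i = i"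
    by (simp add: transpose_def)
  \<comment> \<open>The two strands of equal value keep colour and rank while the third strand
    crosses them, so the generator met in the last row on one side is the one met in another row on
    the other side.\<close>
  have 1: "Gval n \<chi>21 ?j = Gval n \<chi> i" if "?A = ?B" "?B \<noteq> ?C"
    using s21[of i] s2[of i] that swji by simp
  have 2: "Gval n \<chi>12 i = Gval n \<chi> ?j" if "?B = ?C" "?A \<noteq> ?B"
    using s12[of i] s1[of ?j] that swji by simp
  have 3: "Gval n \<chi>1 ?j = Gval n \<chi>2 i" if "?A = ?C" "?A \<noteq> ?B"
    using s1[of i] s2[of i] that swji by simp
  show ?thesis
  proof (cases "?A = ?B \<and> ?B = ?C")
    case True
    have eq: "\<chi>1 = \<chi>" "\<chi>2 = \<chi>"
      unfolding \<chi>1_def \<chi>2_def using True by (auto intro: sw_fixed)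
    have eq2: "\<chi>12 = \<chi>" "\<chi>21 = \<chi>"
      unfolding \<chi>12_def \<chi>21_def eq using True by (auto intro: sw_fixed)
    have r: "i \<in> {1..n}" "?j \<in> {1..n}"
      using i by auto
    have c: "col \<chi> i = col \<chi> ?j"
      using col_eq_iff[OF \<chi> r] True by simp
    have "Gval n \<chi> i \<otimes>\<^bsub>?H\<^esub> (Gval n \<chi> ?j \<otimes>\<^bsub>?H\<^esub> Gval n \<chi> i) = Gval n \<chi> ?j \<otimes>\<^bsub>?H\<^esub> (Gval n \<chi> i \<otimes>\<^bsub>?H\<^esub> Gval n \<chi> ?j)"
      unfolding Gval_def c[symmetric] rank_Suc[of "col \<chi>" i, OF c]
      using rank_col_less[OF \<chi> i(1) conjunct1[OF True]] rank_col_less[OF \<chi> i(2) conjunct2[OF True]]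
      unfolding c[symmetric] rank_Suc[of "col \<chi>" i, OF c] by (intro hg_braid col_range[OF \<chi> r(1)])
    then show ?thesis
      unfolding L R g eq eq2 using True by simp
  next
    case False
    have uc: "?u \<in> carrier ?H"
      by simp
    consider "?A = ?B" "?B \<noteq> ?C" | "?B = ?C" "?A \<noteq> ?B" | "?A = ?C" "?A \<noteq> ?B" | "?A \<noteq> ?B" "?B \<noteq> ?C" "?A \<noteq> ?C"
      using False by metis
    then show ?thesis
    proof cases
      case c: 1
      then have AC: "?A \<noteq> ?C"
        by simp
      have x: "Gval n \<chi> i \<in> carrier ?H"
        using gc(1) c by simp
      show ?thesis
        unfolding L R g 1[OF c] using c AC x by (simp add: HA.scalar_mult HA.smult_mult_l HA.smult_mult_r)
    next
      case c: 2
      then have AC: "?A \<noteq> ?C"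
        by simp
      have x: "Gval n \<chi> ?j \<in> carrier ?H"
        using gc(4) c by simp
      show ?thesis
        unfolding L R g 2[OF c] using c AC x by (simp add: HA.scalar_mult HA.smult_mult_l HA.smult_mult_r)
    next
      case c: 3
      then have BC: "?B \<noteq> ?C"
        by simp
      have x: "Gval n \<chi>2 i \<in> carrier ?H"
        using gc(5) g(5) c by simp
      show ?thesis
        unfolding L R g 3[OF c] using c BC x by (simp add: HA.scalar_mult HA.smult_mult_l HA.smult_mult_r)
    next
      case c: 4
      then show ?thesis
        unfolding L R g by simp
    qed
  qed
qed

text \<open>If the first two values agree, this is the relation of one factor, since position 1 has
  rank 1. Otherwise both entries of g_1 are u, and the entries of X_1 in the two rows lie in
  different factors and commute.\<close>

lemma row_XG1:
  assumes \<chi>: "\<chi> \<in> chars d n" and n: "2 \<le> n"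
  shows "wval n [X1, G 1, X1, G 1] \<chi> = wval n [G 1, X1, G 1, X1] \<chi>"
proof -
  let ?H = "Hc n \<chi>"
  define \<chi>1 where "\<chi>1 = \<chi> \<circ> sw 1"
  have i: "1 \<in> {1..<n}"
    using n by simp
  have i': "1 \<in> {1..n}" "Suc 1 \<in> {1..n}"
    using n by simp_all
  have ch: "\<chi>1 \<in> chars d n" and Cc: "Comp d \<xi> n \<chi>1 = Comp d \<xi> n \<chi>"
    unfolding \<chi>1_def by (intro chars_sw[OF \<chi> i] Comp_sw[OF \<chi> i])+
  have bck: "\<chi>1 \<circ> sw 1 = \<chi>"
    unfolding \<chi>1_def by (rule comp_sw_sw)
  have c: "gval n X1 \<chi> \<in> carrier ?H" "gval n X1 \<chi>1 \<in> carrier ?H" "gval n (G 1) \<chi> \<in> carrier ?H" "gval n (G 1) \<chi>1 \<in> carrier ?H"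
    using gval_closed[of X1 n \<chi>] gval_closed[of X1 n \<chi>1] gval_closed[of "G 1" n \<chi>] gval_closed[of "G 1" n \<chi>1] n \<chi> ch i
    by (simp_all add: Cc del: gval.simps)
  have L: "wval n [X1, G 1, X1, G 1] \<chi> = gval n X1 \<chi> \<otimes>\<^bsub>?H\<^esub> (gval n (G 1) \<chi> \<otimes>\<^bsub>?H\<^esub> (gval n X1 \<chi>1 \<otimes>\<^bsub>?H\<^esub> gval n (G 1) \<chi>1))"
    unfolding wval.simps gperm.simps \<chi>1_def[symmetric] bck Cc using c by (simp only: HA.r_one)
  have R: "wval n [G 1, X1, G 1, X1] \<chi> = gval n (G 1) \<chi> \<otimes>\<^bsub>?H\<^esub> (gval n X1 \<chi>1 \<otimes>\<^bsub>?H\<^esub> (gval n (G 1) \<chi>1 \<otimes>\<^bsub>?H\<^esub> gval n X1 \<chi>))"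
    unfolding wval.simps gperm.simps \<chi>1_def[symmetric] bck Cc using c by (simp only: HA.r_one)
  show ?thesis
  proof (cases "\<chi> 1 = \<chi> (Suc 1)")
    case True
    have eq: "\<chi>1 = \<chi>"
      unfolding \<chi>1_def by (rule sw_fixed[OF True])
    have r: "rank (col \<chi>) 1 = 1"
      by (simp add: rank_def)
    have g: "gval n (G 1) \<chi> = hg d (Comp d \<xi> n \<chi>) (col \<chi> 1) (G 1)"
      unfolding gval.simps Gval_def r using True by (simp only: if_True simp_thms)
    have "2 \<le> Comp d \<xi> n \<chi> (col \<chi> 1)"
      using rank_col_less[OF \<chi> i True] unfolding r by simp
    then show ?thesis
      unfolding L R eq g gval.simps(2) by (rule hg_XG1[OF col_range[OF \<chi> i'(1)]])
  next
    case False
    have u: "gval n (G 1) \<chi> = u_pow 1 \<odot>\<^bsub>?H\<^esub> \<one>\<^bsub>?H\<^esub>" "gval n (G 1) \<chi>1 = u_pow 1 \<odot>\<^bsub>?H\<^esub> \<one>\<^bsub>?H\<^esub>"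
      using False Cc by (simp_all add: \<chi>1_def)
    have c1: "col \<chi>1 1 = col \<chi> (Suc 1)"
      by (simp add: colour_def \<chi>1_def)
    have "col \<chi> 1 \<noteq> col \<chi> (Suc 1)"
      using col_eq_iff[OF \<chi> i'] False by simp
    moreover have "1 \<le> Comp d \<xi> n \<chi> (col \<chi> 1)" "1 \<le> Comp d \<xi> n \<chi> (col \<chi> (Suc 1))"
      using X_pos[OF \<chi>] X_pos[OF ch] n unfolding c1 Cc by simp_all
    ultimately have "gval n X1 \<chi> \<otimes>\<^bsub>?H\<^esub> gval n X1 \<chi>1 = gval n X1 \<chi>1 \<otimes>\<^bsub>?H\<^esub> gval n X1 \<chi>"
      unfolding gval.simps c1 Cc by (intro hg_commute col_range[OF \<chi>] i') simp_all
    then show ?thesis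
      unfolding L R u using c by (simp only: HA.scalar_mult HA.smult_mult_r HA.smult_mult_l HA.smult_closed HA.m_closed)
  qed
qed

lemma row_XG:
  assumes \<chi>: "\<chi> \<in> chars d n" and i: "i \<in> {2..<n}"
  shows "wval n [X1, G i] \<chi> = wval n [G i, X1] \<chi>"
proof -
  let ?H = "Hc n \<chi>"
  have i': "i \<in> {1..<n}" "1 \<le> n" "1 \<in> {1..n}" "i \<in> {1..n}"
    using i by auto
  have X: "gval n X1 (\<chi> \<circ> sw i) = gval n X1 \<chi>"
    using i by (simp add: Comp_sw[OF \<chi> i'(1)] colour_def transpose_def)
  have c: "gval n X1 \<chi> \<in> carrier ?H" "gval n (G i) \<chi> \<in> carrier ?H"
    using i' by (intro gval_closed[OF _ \<chi>]; simp)+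
  have "wval n [X1, G i] \<chi> = gval n X1 \<chi> \<otimes>\<^bsub>?H\<^esub> gval n (G i) \<chi>"
    unfolding wval.simps gperm.simps Comp_sw[OF \<chi> i'(1)] using c by (simp only: HA.r_one)
  moreover have "wval n [G i, X1] \<chi> = gval n (G i) \<chi> \<otimes>\<^bsub>?H\<^esub> gval n X1 \<chi>"
    unfolding wval.simps gperm.simps X Comp_sw[OF \<chi> i'(1)] using c by (simp only: HA.r_one)
  moreover have "gval n X1 \<chi> \<otimes>\<^bsub>?H\<^esub> gval n (G i) \<chi> = gval n (G i) \<chi> \<otimes>\<^bsub>?H\<^esub> gval n X1 \<chi>"
  proof (cases "\<chi> i = \<chi> (Suc i)")
    case False
    then have "gval n (G i) \<chi> = u_pow 1 \<odot>\<^bsub>?H\<^esub> \<one>\<^bsub>?H\<^esub>"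
      by simp
    then show ?thesis
      using c by (simp only: HA.scalar_mult)
  next
    case True
    note R = rank_col_less[OF \<chi> i'(1) True]
    have g: "gval n (G i) \<chi> = hg d (Comp d \<xi> n \<chi>) (col \<chi> i) (G (rank (col \<chi>) i))"
      using True by (simp add: Gval_def)
    show ?thesis
    proof (cases "col \<chi> 1 = col \<chi> i")
      case same: True
      \<comment> \<open>Position 1 comes before i in the same colour, so the rank of i is at least 2
        and the generator commutes with X_1 of its factor.\<close>
      have "rank (col \<chi>) 1 < rank (col \<chi>) i"
        using i same by (intro rank_less) auto
      then have "rank (col \<chi>) i \<in> {2..<Comp d \<xi> n \<chi> (col \<chi> i)}"
        using R rank_pos[of 1 "col \<chi>"] by simp
      then show ?thesis
        unfolding g gval.simps(2) same by (rule hg_XG[OF col_range[OF \<chi> i'(4)]])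
    next
      case False
      then show ?thesis
        unfolding g gval.simps(2) using R X_pos[OF \<chi> i'(2)]
        by (intro hg_commute col_range[OF \<chi>] i') simp_all
    qed
  qed
  ultimately show ?thesis
    by (simp only:)
qed

lemma wval_T:
  assumes "\<chi> \<in> chars d n" "w \<in> lists (yh_gens n)"
  shows "wval n (replicate k (T j) @ w) \<chi> = K_const (\<chi> j ^ k) \<odot>\<^bsub>Hc n \<chi>\<^esub> wval n w \<chi>"
    "wperm (replicate k (T j) @ w) \<chi> = wperm w \<chi>"
proof -
  have c: "wval n w \<chi> \<in> carrier (Hc n \<chi>)"
    by (rule admD(3)[OF wval_adm[OF assms(2)] assms(1)])
  show "wval n (replicate k (T j) @ w) \<chi> = K_const (\<chi> j ^ k) \<odot>\<^bsub>Hc n \<chi>\<^esub> wval n w \<chi>"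
  proof (induction k)
    case (Suc k)
    then show ?case
      using c by (simp add: HA.scalar_mult HA.smult_smult K_const_mult)
  qed (use c in simp)
  show "wperm (replicate k (T j) @ w) \<chi> = wperm w \<chi>"
    by (induction k) simp_all
qed

lemma row_rel:
  assumes rel: "(w, w') \<in> word_rels d n" and \<chi>: "\<chi> \<in> chars d n"
  shows "wperm w \<chi> = wperm w' \<chi> \<and> wval n w \<chi> = wval n w' \<chi>"
  using rel
proof (cases rule: word_rels_cases)
  case inv
  show ?thesis
    using inv hg_X_inv(1)[OF col_range[OF \<chi>, of 1], of "Comp d \<xi> n \<chi>"] X_pos[OF \<chi> inv(1)]
      gval_closed[of X1inv n \<chi>] \<chi> by simp
next
  case inv'
  show ?thesis
    using inv' hg_X_inv(2)[OF col_range[OF \<chi>, of 1], of "Comp d \<xi> n \<chi>"] X_pos[OF \<chi> inv'(1)]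
      gval_closed[of X1 n \<chi>] \<chi> by simp
next
  case (far i j)
  have p: "\<chi> \<circ> sw i \<circ> sw j = \<chi> \<circ> sw j \<circ> sw i"
  proof (rule ext)
    fix p
    have "sw i (sw j p) = sw j (sw i p)"
      using far(3) unfolding transpose_def by auto
    then show "(\<chi> \<circ> sw i \<circ> sw j) p = (\<chi> \<circ> sw j \<circ> sw i) p"
      by simp
  qed
  from far(3) consider "Suc i < j" | "Suc j < i"
    by linarith
  then have "wval n [G i, G j] \<chi> = wval n [G j, G i] \<chi>"
    by cases (use row_far[OF \<chi> far(1,2)] row_far[OF \<chi> far(2,1)] in simp_all)
  then show ?thesis
    unfolding far(4,5) using p by simp
next
  case (braid i)
  have p: "\<chi> \<circ> sw i \<circ> sw (Suc i) \<circ> sw i = \<chi> \<circ> sw (Suc i) \<circ> sw i \<circ> sw (Suc i)"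
    by (rule ext) (simp add: transpose_def)
  show ?thesis
    unfolding braid(3,4) using p row_braid[OF \<chi> braid(1,2)] by simp
next
  case XG1
  show ?thesis
    unfolding XG1(2,3) using row_XG1[OF \<chi> XG1(1)] by simp
next
  case (XG i)
  show ?thesis
    unfolding XG(2,3) using row_XG[OF \<chi> XG(1)] by simp
next
  case (TT i j)
  show ?thesis
    unfolding TT(3,4) by (simp add: HA.scalar_mult HA.smult_smult K_const_mult mult.commute)
next
  case (GT i j)
  have c: "gval n (G i) \<chi> \<in> carrier (Hc n \<chi>)"
    using GT(1) by (intro gval_closed[OF _ \<chi>]) simp
  show ?thesis
    unfolding GT(3,4) using c Comp_sw[OF \<chi> GT(1)] by (simp add: HA.scalar_mult del: gval.simps(1))
next
  case (Td j)
  show ?thesis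
    unfolding Td(2,3) using wval_T[OF \<chi>, of "[]" d j] chars_root[OF \<chi> Td(1)] by simp
next
  case (XT j)
  have c: "gval n X1 \<chi> \<in> carrier (Hc n \<chi>)"
    using XT(1) by (intro gval_closed[OF _ \<chi>]) simp
  show ?thesis
    unfolding XT(2,3) using c by (simp add: HA.scalar_mult del: gval.simps(2))
qed

text \<open>For z \<noteq> w the sum is z times the cofactor of z - w in z^d - w^d = 0. It is the
  value of d e_i in a row where t_i and t_{i+1} act by z and w, the exponent d - s standing for
  -s.\<close>

lemma root_sum:
  assumes "z ^ d = 1" "w ^ d = 1"
  shows "(\<Sum>s\<in>{1..d}. z ^ s * w ^ (d - s)) = (if z = w then of_nat d else (0::complex))"
proof (cases "z = w")
  case True
  have "z ^ s * z ^ (d - s) = 1" if "s \<in> {1..d}" for s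
    using that assms(1) by (simp flip: power_add)
  then show ?thesis
    using True by simp
next
  case False
  have "0 = (z - w) * (\<Sum>s<d. w ^ (d - Suc s) * z ^ s)"
    using power_diff_sumr2[of z d w] assms by simp
  then have "(\<Sum>s<d. w ^ (d - Suc s) * z ^ s) = 0"
    using False by simp
  moreover have "(\<Sum>s\<in>{1..d}. z ^ s * w ^ (d - s)) = (\<Sum>s<d. z * (w ^ (d - Suc s) * z ^ s))"
    by (simp add: sum.atLeast1_atMost_eq mult_ac)
  ultimately show ?thesis
    using False by (simp flip: sum_distrib_left)
qed

text \<open>In each row e_i acts as 1 or 0 according to whether the values at i and i+1 agree. The
  first case is the quadratic relation of a Hecke factor, the second is u u = u^2.\<close>

lemma quad_row:
  assumes i: "i \<in> {1..<n}"
  shows "mono_mat n (wperm [G i, G i]) (wval n [G i, G i]) = u_pow 2 \<odot>\<^bsub>Mats d \<xi> n\<^esub> \<one>\<^bsub>Mats d \<xi> n\<^esub>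
    \<oplus>\<^bsub>Mats d \<xi> n\<^esub> (\<Oplus>\<^bsub>Mats d \<xi> n\<^esub>s\<in>{1..d}. quad_coeff d \<odot>\<^bsub>Mats d \<xi> n\<^esub>
      mono_mat n (wperm (quad_word d i s)) (wval n (quad_word d i s)))"
proof -
  let ?M = "Mats d \<xi> n" and ?\<sigma> = "\<lambda>\<chi>. \<chi> \<circ> sw i"
  have Gi: "[G i] \<in> lists (yh_gens n)" "G i \<in> yh_gens n"
    using i by simp_all
  let ?k = "\<lambda>s \<chi>. K_const (\<chi> i ^ s * \<chi> (Suc i) ^ (d - s))"
  have gc: "gval n (G i) \<chi> \<in> carrier (Hc n \<chi>)" if "\<chi> \<in> chars d n" for \<chi>
    by (rule gval_closed[OF Gi(2) that])
  have sws: "?\<sigma> \<chi> \<in> chars d n \<and> Comp d \<xi> n (?\<sigma> \<chi>) = Comp d \<xi> n \<chi>" if "\<chi> \<in> chars d n" for \<chi>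
    using chars_sw[OF that i] Comp_sw[OF that i] by simp
  have adm1: "adm n ?\<sigma> (\<lambda>\<chi>. c s \<chi> \<odot>\<^bsub>Hc n \<chi>\<^esub> gval n (G i) \<chi>)" for c :: "nat \<Rightarrow> (nat \<Rightarrow> complex) \<Rightarrow> laurent" and s
    unfolding adm_def using sws gc by simp
  have quad: "mono_mat n (wperm (quad_word d i s)) (wval n (quad_word d i s))
      = mono_mat n ?\<sigma> (\<lambda>\<chi>. ?k s \<chi> \<odot>\<^bsub>Hc n \<chi>\<^esub> gval n (G i) \<chi>)" for s
  proof (rule mono_mat_cong, rule disjI1)
    fix \<chi> assume \<chi>: "\<chi> \<in> chars d n"
    have w: "replicate (d - s) (T (Suc i)) @ [G i] \<in> lists (yh_gens n)"
      using i by simp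
    have "wval n [G i] \<chi> = gval n (G i) \<chi>"
      using gc[OF \<chi>] by (simp only: wval.simps gperm.simps Comp_sw[OF \<chi> i] HA.r_one)
    then show "wperm (quad_word d i s) \<chi> = ?\<sigma> \<chi> \<and> wval n (quad_word d i s) \<chi> = ?k s \<chi> \<odot>\<^bsub>Hc n \<chi>\<^esub> gval n (G i) \<chi>"
      unfolding quad_word_def wval_T[OF \<chi> w] wval_T[OF \<chi> Gi(1)]
      using gc[OF \<chi>] by (simp only: HA.smult_smult K_const_mult wperm.simps gperm.simps simp_thms)
  qed
  have "(\<Oplus>\<^bsub>?M\<^esub>s\<in>{1..d}. quad_coeff d \<odot>\<^bsub>?M\<^esub> mono_mat n (wperm (quad_word d i s)) (wval n (quad_word d i s)))
    = (\<Oplus>\<^bsub>?M\<^esub>s\<in>{1..d}. mono_mat n ?\<sigma> (\<lambda>\<chi>. quad_coeff d \<odot>\<^bsub>Hc n \<chi>\<^esub> (?k s \<chi> \<odot>\<^bsub>Hc n \<chi>\<^esub> gval n (G i) \<chi>)))"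
    unfolding quad mono_mat_smult[OF adm1[of ?k]] ..
  also have "\<dots> = mono_mat n ?\<sigma> (\<lambda>\<chi>. \<Oplus>\<^bsub>Hc n \<chi>\<^esub>s\<in>{1..d}. quad_coeff d \<odot>\<^bsub>Hc n \<chi>\<^esub> (?k s \<chi> \<odot>\<^bsub>Hc n \<chi>\<^esub> gval n (G i) \<chi>))"
  proof (rule mono_mat_finsum)
    show "adm n ?\<sigma> (\<lambda>\<chi>. quad_coeff d \<odot>\<^bsub>Hc n \<chi>\<^esub> (?k s \<chi> \<odot>\<^bsub>Hc n \<chi>\<^esub> gval n (G i) \<chi>))" for s
      unfolding adm_def using sws gc by simp
  qed (use sws in simp_all)
  \<comment> \<open>The matrix of e_i g_i may be regarded as diagonal: in the rows that s_i moves
    its entry is zero, and the other rows are fixed by s_i.\<close>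
  also have "\<dots> = mono_mat n (\<lambda>\<chi>. \<chi>) (\<lambda>\<chi>. if \<chi> i = \<chi> (Suc i) then v_var \<odot>\<^bsub>Hc n \<chi>\<^esub> Gval n \<chi> i else \<zero>\<^bsub>Hc n \<chi>\<^esub>)"
  proof (rule mono_mat_cong)
    fix \<chi> assume \<chi>: "\<chi> \<in> chars d n"
    have r: "\<chi> i ^ d = 1" "\<chi> (Suc i) ^ d = 1"
      using i by (intro chars_root[OF \<chi>]; simp)+
    have "(\<Oplus>\<^bsub>Hc n \<chi>\<^esub>s\<in>{1..d}. quad_coeff d \<odot>\<^bsub>Hc n \<chi>\<^esub> (?k s \<chi> \<odot>\<^bsub>Hc n \<chi>\<^esub> gval n (G i) \<chi>))
        = (\<Oplus>\<^bsub>Hc n \<chi>\<^esub>s\<in>{1..d}. (quad_coeff d * ?k s \<chi>) \<odot>\<^bsub>Hc n \<chi>\<^esub> gval n (G i) \<chi>)"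
      using gc[OF \<chi>] by (simp only: HA.smult_smult)
    also have "\<dots> = (\<Sum>s\<in>{1..d}. quad_coeff d * ?k s \<chi>) \<odot>\<^bsub>Hc n \<chi>\<^esub> gval n (G i) \<chi>"
      by (rule HA.finsum_smult_left[OF _ gc[OF \<chi>]]) simp
    also have "(\<Sum>s\<in>{1..d}. quad_coeff d * ?k s \<chi>) = quad_coeff d * K_const (if \<chi> i = \<chi> (Suc i) then of_nat d else 0)"
      by (simp only: sum_distrib_left[symmetric] K_const_sum[symmetric] root_sum[OF r])
    also have "\<dots> = (if \<chi> i = \<chi> (Suc i) then v_var else 0)"
    proof -
      have "K_const (1 / of_nat d) * v_var * K_const (of_nat d) = K_const (1 / of_nat d * of_nat d) * v_var"
        by (simp only: K_const_mult[symmetric] mult_ac)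
      then show ?thesis
        using d by (simp add: quad_coeff_def)
    qed
    finally have S: "(\<Oplus>\<^bsub>Hc n \<chi>\<^esub>s\<in>{1..d}. quad_coeff d \<odot>\<^bsub>Hc n \<chi>\<^esub> (?k s \<chi> \<odot>\<^bsub>Hc n \<chi>\<^esub> gval n (G i) \<chi>))
        = (if \<chi> i = \<chi> (Suc i) then v_var else 0) \<odot>\<^bsub>Hc n \<chi>\<^esub> gval n (G i) \<chi>" .
    show "(?\<sigma> \<chi> = \<chi> \<and> (\<Oplus>\<^bsub>Hc n \<chi>\<^esub>s\<in>{1..d}. quad_coeff d \<odot>\<^bsub>Hc n \<chi>\<^esub> (?k s \<chi> \<odot>\<^bsub>Hc n \<chi>\<^esub> gval n (G i) \<chi>))
          = (if \<chi> i = \<chi> (Suc i) then v_var \<odot>\<^bsub>Hc n \<chi>\<^esub> Gval n \<chi> i else \<zero>\<^bsub>Hc n \<chi>\<^esub>))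
      \<or> ((\<Oplus>\<^bsub>Hc n \<chi>\<^esub>s\<in>{1..d}. quad_coeff d \<odot>\<^bsub>Hc n \<chi>\<^esub> (?k s \<chi> \<odot>\<^bsub>Hc n \<chi>\<^esub> gval n (G i) \<chi>)) = \<zero>\<^bsub>Hc n \<chi>\<^esub>
        \<and> (if \<chi> i = \<chi> (Suc i) then v_var \<odot>\<^bsub>Hc n \<chi>\<^esub> Gval n \<chi> i else \<zero>\<^bsub>Hc n \<chi>\<^esub>) = \<zero>\<^bsub>Hc n \<chi>\<^esub>)"
    proof (cases "\<chi> i = \<chi> (Suc i)")
      case True
      then show ?thesis
        unfolding S using sw_fixed[OF True] by simp
    next
      case False
      then show ?thesis
        unfolding S using gc[OF \<chi>] by simp
    qed
  qed
  finally have sum: "(\<Oplus>\<^bsub>?M\<^esub>s\<in>{1..d}. quad_coeff d \<odot>\<^bsub>?M\<^esub> mono_mat n (wperm (quad_word d i s)) (wval n (quad_word d i s)))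
    = mono_mat n (\<lambda>\<chi>. \<chi>) (\<lambda>\<chi>. if \<chi> i = \<chi> (Suc i) then v_var \<odot>\<^bsub>Hc n \<chi>\<^esub> Gval n \<chi> i else \<zero>\<^bsub>Hc n \<chi>\<^esub>)" .
  have a1: "adm n (\<lambda>\<chi>. \<chi>) (\<lambda>\<chi>. \<one>\<^bsub>Hc n \<chi>\<^esub>)" "adm n (\<lambda>\<chi>. \<chi>) (\<lambda>\<chi>. u_pow 2 \<odot>\<^bsub>Hc n \<chi>\<^esub> \<one>\<^bsub>Hc n \<chi>\<^esub>)"
    by (simp_all add: adm_def)
  have a2: "adm n (\<lambda>\<chi>. \<chi>) (\<lambda>\<chi>. if \<chi> i = \<chi> (Suc i) then v_var \<odot>\<^bsub>Hc n \<chi>\<^esub> Gval n \<chi> i else \<zero>\<^bsub>Hc n \<chi>\<^esub>)"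
    unfolding adm_def using Gval_closed[OF _ i] by simp
  have one: "u_pow 2 \<odot>\<^bsub>?M\<^esub> \<one>\<^bsub>?M\<^esub> = mono_mat n (\<lambda>\<chi>. \<chi>) (\<lambda>\<chi>. u_pow 2 \<odot>\<^bsub>Hc n \<chi>\<^esub> \<one>\<^bsub>Hc n \<chi>\<^esub>)"
    unfolding mono_mat_one[symmetric] by (rule mono_mat_smult[OF a1(1)])
  show ?thesis
    unfolding sum one mono_mat_add[OF a1(2) a2]
  proof (rule mono_mat_cong, rule disjI1)
    fix \<chi> assume \<chi>: "\<chi> \<in> chars d n"
    have bck: "\<chi> \<circ> sw i \<circ> sw i = \<chi>"
      by (rule comp_sw_sw)
    have g2: "gval n (G i) (\<chi> \<circ> sw i) \<in> carrier (Hc n \<chi>)"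
      using gc[of "\<chi> \<circ> sw i"] sws[OF \<chi>] by simp
    have w: "wval n [G i, G i] \<chi> = gval n (G i) \<chi> \<otimes>\<^bsub>Hc n \<chi>\<^esub> gval n (G i) (\<chi> \<circ> sw i)"
      unfolding wval.simps gperm.simps bck Comp_sw[OF \<chi> i] using g2 by (simp only: HA.r_one)
    have i1: "i \<in> {1..n}"
      using i by simp
    have "wval n [G i, G i] \<chi> = u_pow 2 \<odot>\<^bsub>Hc n \<chi>\<^esub> \<one>\<^bsub>Hc n \<chi>\<^esub> \<oplus>\<^bsub>Hc n \<chi>\<^esub>
        (if \<chi> i = \<chi> (Suc i) then v_var \<odot>\<^bsub>Hc n \<chi>\<^esub> Gval n \<chi> i else \<zero>\<^bsub>Hc n \<chi>\<^esub>)"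
    proof (cases "\<chi> i = \<chi> (Suc i)")
      case True
      have "Gval n \<chi> i \<otimes>\<^bsub>Hc n \<chi>\<^esub> Gval n \<chi> i = u_pow 2 \<odot>\<^bsub>Hc n \<chi>\<^esub> \<one>\<^bsub>Hc n \<chi>\<^esub> \<oplus>\<^bsub>Hc n \<chi>\<^esub> v_var \<odot>\<^bsub>Hc n \<chi>\<^esub> Gval n \<chi> i"
        unfolding Gval_def by (rule hg_quad[where \<mu> = "Comp d \<xi> n \<chi>", OF col_range[OF \<chi> i1] rank_col_less[OF \<chi> i True]])
      then show ?thesis
        unfolding w sw_fixed[OF True] gval.simps using True by (simp only: if_True simp_thms)
    next
      case False
      have n: "(\<chi> \<circ> sw i) i \<noteq> (\<chi> \<circ> sw i) (Suc i)"
        using False by simp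
      show ?thesis
        unfolding w gval.simps Comp_sw[OF \<chi> i] using False n
        by (simp only: if_False HA.scalar_mult HA.smult_closed HA.one_closed HA.smult_smult u_pow_add HA.r_zero) simp
    qed
    then show "wperm [G i, G i] \<chi> = \<chi> \<and> wval n [G i, G i] \<chi> = u_pow 2 \<odot>\<^bsub>Hc n \<chi>\<^esub> \<one>\<^bsub>Hc n \<chi>\<^esub> \<oplus>\<^bsub>Hc n \<chi>\<^esub>
        (if \<chi> i = \<chi> (Suc i) then v_var \<odot>\<^bsub>Hc n \<chi>\<^esub> Gval n \<chi> i else \<zero>\<^bsub>Hc n \<chi>\<^esub>)"
      by (simp only: wperm.simps gperm.simps bck simp_thms)
  qed
qed

theorem Phi_exists:
  obtains f where "f \<in> K_algebra_hom (YH d n) (Mats d \<xi> n)"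
    "\<And>w. w \<in> lists (yh_gens n) \<Longrightarrow> f (yh_word d n w) = mono_mat n (wperm w) (wval n w)"
proof (rule YH_lift[OF K_alg_Mats[of n], of n "gmat n" d])
  show "gmat n x \<in> carrier (Mats d \<xi> n)" if "x \<in> yh_gens n" for x
    unfolding gmat_def by (intro mono_mat_closed gval_adm that)
  show "mprod (Mats d \<xi> n) (map (gmat n) w) = mprod (Mats d \<xi> n) (map (gmat n) w')"
    if "(w, w') \<in> word_rels d n" for w w'
    unfolding gmat_word[OF word_rels_lists(1)[OF that]] gmat_word[OF word_rels_lists(2)[OF that]]
    by (rule mono_mat_cong) (use row_rel[OF that] in blast)
  show "mprod (Mats d \<xi> n) (map (gmat n) [G i, G i]) = u_pow 2 \<odot>\<^bsub>Mats d \<xi> n\<^esub> \<one>\<^bsub>Mats d \<xi> n\<^esub>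
    \<oplus>\<^bsub>Mats d \<xi> n\<^esub> (\<Oplus>\<^bsub>Mats d \<xi> n\<^esub>s\<in>{1..d}. quad_coeff d \<odot>\<^bsub>Mats d \<xi> n\<^esub>
      mprod (Mats d \<xi> n) (map (gmat n) (quad_word d i s)))" if i: "i \<in> {1..<n}" for i
  proof -
    have "[G i, G i] \<in> lists (yh_gens n)"
      using i by simp
    then show ?thesis
      unfolding gmat_word[OF quad_word_lists[OF i]] by (simp only: gmat_word quad_row[OF i])
  qed
  fix f assume f: "f \<in> K_algebra_hom (YH d n) (Mats d \<xi> n)"
    "\<And>w. w \<in> lists (yh_gens n) \<Longrightarrow> f (yh_word d n w) = mprod (Mats d \<xi> n) (map (gmat n) w)"
  show thesis
    by (rule that[OF f(1)]) (simp only: f(2) gmat_word)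
qed

end

section \<open>The isomorphism\<close>

lemma yh_X_Suc: "1 \<le> j \<Longrightarrow> yh_X d n (Suc j) = u_pow (-2) \<odot>\<^bsub>YH d n\<^esub>
    (yh_g d n j \<otimes>\<^bsub>YH d n\<^esub> yh_X d n j \<otimes>\<^bsub>YH d n\<^esub> yh_g d n j)"
  by (cases j) simp_all

lemma yh_X_Units:
  assumes "1 \<le> d" shows "j \<in> {1..n} \<Longrightarrow> yh_X d n j \<in> Units (YH d n)"
proof (induction j)
  case (Suc j)
  show ?case
  proof (cases "j = 0")
    case True
    then show ?thesis
      using X1_Units(1)[of n d] Suc by simp
  next
    case False
    then have j: "1 \<le> j" "j \<in> {1..n}" "j \<in> {1..<n}"
      using Suc by auto
    show ?thesis
      unfolding yh_X_Suc[OF j(1)]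
      by (rule YA.smult_Units(1)[where c' = "u_pow 2"])
        (simp_all add: YA.Units_m_closed G_Units[OF assms j(3)] Suc.IH[OF j(2)] u_pow_add)
  qed
qed simp

lemma (in monoid) int_pow_uminus: "x [^] (- int k) = inv (x [^] k)"
proof (cases "k = 0")
  case True
  then show ?thesis
    by (simp only: int_pow_def2 of_nat_0 minus_zero less_irrefl if_False nat_zero_as_int nat_pow_0 inv_one) simp
next
  case False
  then have "- int k < 0"
    by simp
  then show ?thesis
    by (simp only: int_pow_def2 if_True minus_minus nat_int)
qed

lemma hmu_g_eq: "hmu_g d \<mu> i = hg d \<mu> (block \<mu> i) (G (i - offset \<mu> (block \<mu> i)))"
  unfolding hmu_g_def Let_def hg_def yh_g_def ..

context roots
begin

text \<open>This is what makes the product over a reduced word in \<open>hmu_gw\<close> independent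
  of the reduced word. Letters in different blocks commute because they belong to different tensor
  factors.\<close>

lemma braid_family_hmu:
  assumes \<chi>: "\<chi> \<in> chars d n"
  shows "braid_family (Hc n \<chi>) n (block (Comp d \<xi> n \<chi>)) (hmu_g d (Comp d \<xi> n \<chi>))"
proof -
  let ?\<mu> = "Comp d \<xi> n \<chi>"
  note c = colouring_col[OF \<chi>]
  note \<mu> = Comp_eq[OF \<chi>]
  have br: "block ?\<mu> p \<in> {1..d}" if "p \<in> {1..n}" for p
    unfolding \<mu> by (rule block_range[OF c that])
  have bd: "offset ?\<mu> (block ?\<mu> p) < p \<and> p \<le> offset ?\<mu> (block ?\<mu> p) + ?\<mu> (block ?\<mu> p)" if p: "p \<in> {1..n}" for p
  proof -
    obtain j where j: "j \<in> {1..n}" "p = pos d n (col \<chi>) j"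
      by (rule pos_surj[OF c p])
    show ?thesis
      unfolding \<mu> j(2) pos_block[OF c j(1)] using pos_bounds[OF c j(1)] by simp
  qed
  \<comment> \<open>Both i and i+1 lie in the block, so the local index of i is strictly below the
    size of the factor, as a generator index must be.\<close>
  have r: "i - offset ?\<mu> (block ?\<mu> i) \<in> {1..<?\<mu> (block ?\<mu> i)}"
    if i: "i \<in> {1..<n}" "block ?\<mu> i = block ?\<mu> (Suc i)" for i
  proof -
    have "offset ?\<mu> (block ?\<mu> i) < i"
      using bd[of i] i(1) by simp
    moreover have "Suc i \<le> offset ?\<mu> (block ?\<mu> i) + ?\<mu> (block ?\<mu> i)"
      using bd[of "Suc i"] i by simp
    ultimately show ?thesis
      by auto
  qed
  show ?thesis
  proof (intro braid_family.intro braid_family_axioms.intro)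
    show "monoid (Hc n \<chi>)"
      by (rule HA.monoid_axioms)
    show "block ?\<mu> p \<le> block ?\<mu> q" if "p \<in> {1..n}" "q \<in> {1..n}" "p \<le> q" for p q
      unfolding \<mu> by (rule block_mono[OF c that])
    show "hmu_g d ?\<mu> i \<in> carrier (Hc n \<chi>)" if i: "i \<in> {1..<n}" "block ?\<mu> i = block ?\<mu> (Suc i)" for i
      unfolding hmu_g_eq using r[OF i] i(1) by (intro hg_closed br) simp_all
    show "hmu_g d ?\<mu> i \<otimes>\<^bsub>Hc n \<chi>\<^esub> hmu_g d ?\<mu> j = hmu_g d ?\<mu> j \<otimes>\<^bsub>Hc n \<chi>\<^esub> hmu_g d ?\<mu> i"
      if i: "i \<in> {1..<n}" "block ?\<mu> i = block ?\<mu> (Suc i)" and j: "j \<in> {1..<n}" "block ?\<mu> j = block ?\<mu> (Suc j)"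
        and ij: "Suc i < j" for i j
    proof (cases "block ?\<mu> i = block ?\<mu> j")
      case True
      have bi: "block ?\<mu> i \<in> {1..d}"
        using i(1) by (intro br) simp
      have lt: "Suc (i - offset ?\<mu> (block ?\<mu> i)) < j - offset ?\<mu> (block ?\<mu> i)"
      proof -
        have "offset ?\<mu> (block ?\<mu> i) < i"
          using bd[of i] i(1) by simp
        then show ?thesis
          using ij by arith
      qed
      show ?thesis
        unfolding hmu_g_eq True[symmetric]
        by (rule hg_far[where a = "block ?\<mu> i" and \<mu> = ?\<mu>, OF bi r[OF i] _ lt]) (use r[OF j] in \<open>simp only: True\<close>)
    next
      case False
      show ?thesis
        unfolding hmu_g_eq using r[OF i] r[OF j] i(1) j(1) False by (intro hg_commute br) simp_all
    qed
    show "hmu_g d ?\<mu> i \<otimes>\<^bsub>Hc n \<chi>\<^esub> (hmu_g d ?\<mu> (Suc i) \<otimes>\<^bsub>Hc n \<chi>\<^esub> hmu_g d ?\<mu> i)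
        = hmu_g d ?\<mu> (Suc i) \<otimes>\<^bsub>Hc n \<chi>\<^esub> (hmu_g d ?\<mu> i \<otimes>\<^bsub>Hc n \<chi>\<^esub> hmu_g d ?\<mu> (Suc i))"
      if i: "i \<in> {1..<n}" "Suc i \<in> {1..<n}" "block ?\<mu> i = block ?\<mu> (Suc i)" "block ?\<mu> (Suc i) = block ?\<mu> (Suc (Suc i))" for i
    proof -
      have bi: "block ?\<mu> (Suc i) \<in> {1..d}"
        using i(2) by (intro br) simp
      have s: "Suc i - offset ?\<mu> (block ?\<mu> (Suc i)) = Suc (i - offset ?\<mu> (block ?\<mu> (Suc i)))"
        using bd[of i] i(1) unfolding i(3) by (simp add: Suc_diff_le)
      show ?thesis
        unfolding hmu_g_eq i(3) s
        by (rule hg_braid[where a = "block ?\<mu> (Suc i)" and \<mu> = ?\<mu>, OF bi r[OF i(1,3), unfolded i(3)] r[OF i(2,4), unfolded s]])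
    qed
  qed
qed

lemma pos_minus_offset:
  assumes "\<chi> \<in> chars d n" "j \<in> {1..n}"
  shows "block (Comp d \<xi> n \<chi>) (pos d n (col \<chi>) j) = col \<chi> j"
    "pos d n (col \<chi>) j - offset (Comp d \<xi> n \<chi>) (col \<chi> j) = rank (col \<chi>) j"
  unfolding Comp_eq[OF assms(1)] using pos_block[OF colouring_col[OF assms(1)] assms(2)] assms(2)
  by (simp_all add: pos_def)

text \<open>Reconciles the two indexings: a place in {1..n} after sorting, and the pair of colour
  and rank.\<close>

lemma hmu_g_pos:
  assumes "\<chi> \<in> chars d n" "i \<in> {1..n}"
  shows "hmu_g d (Comp d \<xi> n \<chi>) (pos d n (col \<chi>) i) = Gval n \<chi> i"
  unfolding hmu_g_eq pos_minus_offset[OF assms] Gval_def ..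

lemma wperm_G: "wperm (map G is) \<chi> = \<chi> \<circ> word_perm is"
  by (induction "is" arbitrary: \<chi>) (simp_all only: list.map wperm.simps gperm.simps word_perm_simps comp_assoc comp_id)

text \<open>Along the path of rows a letter between equal values contributes a generator and a
  letter between different values contributes u; so the exponent of u is the number of deleted
  letters.\<close>

lemma wval_G:
  assumes "\<chi> \<in> chars d n" "set is \<subseteq> {1..<n}"
  shows "wval n (map G is) \<chi> = u_pow (int (length is) - int (length (subword d n (col \<chi>) is)))
      \<odot>\<^bsub>Hc n \<chi>\<^esub> mprod (Hc n \<chi>) (map (hmu_g d (Comp d \<xi> n \<chi>)) (subword d n (col \<chi>) is)) \<and>
    set (map (hmu_g d (Comp d \<xi> n \<chi>)) (subword d n (col \<chi>) is)) \<subseteq> carrier (Hc n \<chi>)"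
  using assms
proof (induction "is" arbitrary: \<chi>)
  case (Cons i "is")
  have i: "i \<in> {1..<n}" "i \<in> {1..n}" "Suc i \<in> {1..n}" and is_n: "set is \<subseteq> {1..<n}"
    using Cons.prems(2) by auto
  note \<chi> = Cons.prems(1)
  note C = Comp_sw[OF \<chi> i(1)]
  let ?s = "subword d n (col \<chi> \<circ> sw i) is"
  let ?P = "mprod (Hc n \<chi>) (map (hmu_g d (Comp d \<xi> n \<chi>)) ?s)"
  have IH: "wval n (map G is) (\<chi> \<circ> sw i) = u_pow (int (length is) - int (length ?s)) \<odot>\<^bsub>Hc n \<chi>\<^esub> ?P"
    "set (map (hmu_g d (Comp d \<xi> n \<chi>)) ?s) \<subseteq> carrier (Hc n \<chi>)"
    using Cons.IH[OF chars_sw[OF \<chi> i(1)] is_n] unfolding C col_comp by blast+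
  have P: "?P \<in> carrier (Hc n \<chi>)"
    by (rule HA.mprod_closed[OF IH(2)])
  have w: "wval n (map G (i # is)) \<chi> = gval n (G i) \<chi> \<otimes>\<^bsub>Hc n \<chi>\<^esub>
      (u_pow (int (length is) - int (length ?s)) \<odot>\<^bsub>Hc n \<chi>\<^esub> ?P)"
    unfolding list.map wval.simps gperm.simps IH(1) ..
  show ?case
  proof (cases "\<chi> i = \<chi> (Suc i)")
    case True
    have c: "col \<chi> i = col \<chi> (Suc i)"
      using col_eq_iff[OF \<chi> i(2,3)] True by simp
    have s: "subword d n (col \<chi>) (i # is) = pos d n (col \<chi>) i # ?s"
      using c by simp
    have g: "gval n (G i) \<chi> = Gval n \<chi> i"
      using True by simp
    note gc = Gval_closed[OF \<chi> i(1) True]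
    show ?thesis
      unfolding w unfolding s g unfolding list.map mprod_Cons hmu_g_pos[OF \<chi> i(2)] list.set list.size
      using gc P IH(2) by (simp add: HA.smult_mult_r)
  next
    case False
    have c: "col \<chi> i \<noteq> col \<chi> (Suc i)"
      using col_eq_iff[OF \<chi> i(2,3)] False by simp
    have s: "subword d n (col \<chi>) (i # is) = ?s"
      using c by simp
    have g: "gval n (G i) \<chi> = u_pow 1 \<odot>\<^bsub>Hc n \<chi>\<^esub> \<one>\<^bsub>Hc n \<chi>\<^esub>"
      using False by simp
    have e: "u_pow 1 * u_pow (int (length is) - int (length ?s)) = u_pow (int (length (i # is)) - int (length ?s))"
      by (simp add: u_pow_add add_diff_eq)
    show ?thesis
      unfolding w unfolding s g using P IH(2) by (simp only: HA.scalar_mult HA.smult_closed HA.smult_smult e simp_thms)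
  qed
qed simp

section \<open>Diagonal matrices\<close>

definition Dg :: "nat \<Rightarrow> ((nat \<Rightarrow> complex) \<Rightarrow> hmu) \<Rightarrow> mats" where
  "Dg n h = mono_mat n (\<lambda>\<chi>. \<chi>) h"

definition diag :: "nat \<Rightarrow> ((nat \<Rightarrow> complex) \<Rightarrow> hmu) \<Rightarrow> bool" where
  "diag n h \<longleftrightarrow> (\<forall>\<chi>\<in>chars d n. h \<chi> \<in> carrier (Hc n \<chi>))"

lemma diag_adm: "diag n h \<longleftrightarrow> adm n (\<lambda>\<chi>. \<chi>) h"
  by (simp add: diag_def adm_def)

lemma Dg_closed: "diag n h \<Longrightarrow> Dg n h \<in> carrier (Mats d \<xi> n)"
  unfolding Dg_def diag_adm by (rule mono_mat_closed)

lemma Dg_cong: "(\<And>\<chi>. \<chi> \<in> chars d n \<Longrightarrow> h \<chi> = h' \<chi>) \<Longrightarrow> Dg n h = Dg n h'"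
  unfolding Dg_def by (rule mono_mat_cong) simp

lemma Dg_mult: "diag n h \<Longrightarrow> diag n h' \<Longrightarrow> Dg n h \<otimes>\<^bsub>Mats d \<xi> n\<^esub> Dg n h' = Dg n (\<lambda>\<chi>. h \<chi> \<otimes>\<^bsub>Hc n \<chi>\<^esub> h' \<chi>)"
  unfolding Dg_def diag_adm by (rule mono_mat_mult)

lemma Dg_one: "Dg n (\<lambda>\<chi>. \<one>\<^bsub>Hc n \<chi>\<^esub>) = \<one>\<^bsub>Mats d \<xi> n\<^esub>"
  unfolding Dg_def by (rule mono_mat_one)

lemma Dg_inv:
  assumes "\<And>\<chi>. \<chi> \<in> chars d n \<Longrightarrow> h \<chi> \<in> Units (Hc n \<chi>)"
  shows "Dg n h \<in> Units (Mats d \<xi> n)" "inv\<^bsub>Mats d \<xi> n\<^esub> Dg n h = Dg n (\<lambda>\<chi>. inv\<^bsub>Hc n \<chi>\<^esub> h \<chi>)"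
proof -
  interpret M: K_alg "Mats d \<xi> n"
    by (rule K_alg_Mats)
  have dg: "diag n h" "diag n (\<lambda>\<chi>. inv\<^bsub>Hc n \<chi>\<^esub> h \<chi>)"
    unfolding diag_def using assms HA.Units_closed HA.Units_inv_closed by blast+
  have 1: "Dg n h \<otimes>\<^bsub>Mats d \<xi> n\<^esub> Dg n (\<lambda>\<chi>. inv\<^bsub>Hc n \<chi>\<^esub> h \<chi>) = \<one>\<^bsub>Mats d \<xi> n\<^esub>"
    unfolding Dg_mult[OF dg] Dg_one[symmetric] by (rule Dg_cong) (rule HA.Units_r_inv[OF assms])
  have 2: "Dg n (\<lambda>\<chi>. inv\<^bsub>Hc n \<chi>\<^esub> h \<chi>) \<otimes>\<^bsub>Mats d \<xi> n\<^esub> Dg n h = \<one>\<^bsub>Mats d \<xi> n\<^esub>"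
    unfolding Dg_mult[OF dg(2,1)] Dg_one[symmetric] by (rule Dg_cong) (rule HA.Units_l_inv[OF assms])
  show "Dg n h \<in> Units (Mats d \<xi> n)"
    unfolding Units_def using 1 2 Dg_closed dg by blast
  show "inv\<^bsub>Mats d \<xi> n\<^esub> Dg n h = Dg n (\<lambda>\<chi>. inv\<^bsub>Hc n \<chi>\<^esub> h \<chi>)"
    by (rule M.inv_char[OF Dg_closed[OF dg(1)] Dg_closed[OF dg(2)] 1 2])
qed

lemma Dg_nat_pow: "diag n h \<Longrightarrow> Dg n h [^]\<^bsub>Mats d \<xi> n\<^esub> (k::nat) = Dg n (\<lambda>\<chi>. h \<chi> [^]\<^bsub>Hc n \<chi>\<^esub> k)"
proof (induction k)
  case 0
  interpret M: K_alg "Mats d \<xi> n"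
    by (rule K_alg_Mats)
  show ?case
    by (simp only: M.nat_pow_0 HA.nat_pow_0 Dg_one)
next
  case (Suc k)
  interpret M: K_alg "Mats d \<xi> n"
    by (rule K_alg_Mats)
  have "diag n (\<lambda>\<chi>. h \<chi> [^]\<^bsub>Hc n \<chi>\<^esub> k)"
    using Suc.prems by (simp add: diag_def)
  from Dg_mult[OF this Suc.prems] show ?case
    unfolding M.nat_pow_Suc HA.nat_pow_Suc Suc.IH[OF Suc.prems] .
qed

lemma Dg_int_pow:
  assumes "\<And>\<chi>. \<chi> \<in> chars d n \<Longrightarrow> h \<chi> \<in> Units (Hc n \<chi>)"
  shows "Dg n h [^]\<^bsub>Mats d \<xi> n\<^esub> (k::int) = Dg n (\<lambda>\<chi>. h \<chi> [^]\<^bsub>Hc n \<chi>\<^esub> k)"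
proof -
  have dg: "diag n h"
    unfolding diag_def using assms HA.Units_closed by blast
  show ?thesis
  proof (cases "k < 0")
    case True
    have "inv\<^bsub>Mats d \<xi> n\<^esub> Dg n (\<lambda>\<chi>. h \<chi> [^]\<^bsub>Hc n \<chi>\<^esub> nat (- k)) = Dg n (\<lambda>\<chi>. inv\<^bsub>Hc n \<chi>\<^esub> (h \<chi> [^]\<^bsub>Hc n \<chi>\<^esub> nat (- k)))"
      by (rule Dg_inv(2)) (rule HA.Units_pow_closed[OF assms])
    then show ?thesis
      using True by (simp only: int_pow_def2 if_True Dg_nat_pow[OF dg])
  next
    case False
    then show ?thesis
      by (simp only: int_pow_def2 if_False Dg_nat_pow[OF dg])
  qed
qed

lemma Dg_mprod:
  assumes "\<And>j. j \<in> set js \<Longrightarrow> diag n (h j)"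
  shows "mprod (Mats d \<xi> n) (map (\<lambda>j. Dg n (h j)) js) = Dg n (\<lambda>\<chi>. mprod (Hc n \<chi>) (map (\<lambda>j. h j \<chi>) js))
    \<and> diag n (\<lambda>\<chi>. mprod (Hc n \<chi>) (map (\<lambda>j. h j \<chi>) js))"
  using assms
proof (induction js)
  case Nil
  show ?case
    by (simp add: Dg_one diag_def)
next
  case (Cons j js)
  have IH: "mprod (Mats d \<xi> n) (map (\<lambda>j. Dg n (h j)) js) = Dg n (\<lambda>\<chi>. mprod (Hc n \<chi>) (map (\<lambda>j. h j \<chi>) js))"
    "diag n (\<lambda>\<chi>. mprod (Hc n \<chi>) (map (\<lambda>j. h j \<chi>) js))"
    using Cons by simp_all
  have j: "diag n (h j)"
    using Cons.prems by simp
  have "diag n (\<lambda>\<chi>. h j \<chi> \<otimes>\<^bsub>Hc n \<chi>\<^esub> mprod (Hc n \<chi>) (map (\<lambda>j. h j \<chi>) js))"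
    using IH(2) j unfolding diag_def by (intro ballI HA.m_closed) blast+
  then show ?case
    unfolding list.map mprod_Cons IH(1) Dg_mult[OF j IH(2)] by blast
qed

text \<open>Diagonal matrices with one complex constant per row. They contain the images of the t_j
  and of the idempotents, and turn computations with these into arithmetic of complex
  numbers.\<close>

definition Sc :: "nat \<Rightarrow> ((nat \<Rightarrow> complex) \<Rightarrow> complex) \<Rightarrow> mats" where
  "Sc n c = Dg n (\<lambda>\<chi>. K_const (c \<chi>) \<odot>\<^bsub>Hc n \<chi>\<^esub> \<one>\<^bsub>Hc n \<chi>\<^esub>)"

lemma diag_scalar: "diag n (\<lambda>\<chi>. c \<chi> \<odot>\<^bsub>Hc n \<chi>\<^esub> \<one>\<^bsub>Hc n \<chi>\<^esub>)"
  by (simp add: diag_def)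

lemma Sc_closed: "Sc n c \<in> carrier (Mats d \<xi> n)"
  unfolding Sc_def by (rule Dg_closed[OF diag_scalar])

lemma Sc_cong: "(\<And>\<chi>. \<chi> \<in> chars d n \<Longrightarrow> c \<chi> = c' \<chi>) \<Longrightarrow> Sc n c = Sc n c'"
  unfolding Sc_def by (rule Dg_cong) simp

lemma Sc_one: "Sc n (\<lambda>_. 1) = \<one>\<^bsub>Mats d \<xi> n\<^esub>"
  unfolding Sc_def Dg_one[symmetric] by (rule Dg_cong) simp

lemma Sc_mult: "Sc n c \<otimes>\<^bsub>Mats d \<xi> n\<^esub> Sc n c' = Sc n (\<lambda>\<chi>. c \<chi> * c' \<chi>)"
  unfolding Sc_def Dg_mult[OF diag_scalar diag_scalar]
  by (rule Dg_cong) (simp add: HA.scalar_mult HA.smult_smult K_const_mult mult.commute)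

lemma Sc_smult: "K_const k \<odot>\<^bsub>Mats d \<xi> n\<^esub> Sc n c = Sc n (\<lambda>\<chi>. k * c \<chi>)"
  unfolding Sc_def Dg_def mono_mat_smult[OF diag_scalar[unfolded diag_adm]]
  by (rule mono_mat_cong) (simp add: HA.smult_smult K_const_mult)

lemma Sc_add: "Sc n c \<oplus>\<^bsub>Mats d \<xi> n\<^esub> Sc n c' = Sc n (\<lambda>\<chi>. c \<chi> + c' \<chi>)"
  unfolding Sc_def Dg_def mono_mat_add[OF diag_scalar[unfolded diag_adm] diag_scalar[unfolded diag_adm]]
  by (rule mono_mat_cong) (simp add: HA.smult_l_distr[symmetric] K_const_def single_add)

lemma Sc_finsum: "finite S \<Longrightarrow> (\<Oplus>\<^bsub>Mats d \<xi> n\<^esub>s\<in>S. Sc n (c s)) = Sc n (\<lambda>\<chi>. \<Sum>s\<in>S. c s \<chi>)"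
proof (induction S rule: finite_induct)
  case empty
  interpret M: K_alg "Mats d \<xi> n"
    by (rule K_alg_Mats)
  have "Sc n (\<lambda>\<chi>. 0) = K_const 0 \<odot>\<^bsub>Mats d \<xi> n\<^esub> Sc n (\<lambda>\<chi>. 0)"
    unfolding Sc_smult by simp
  then show ?case
    using M.smult_zero_left[OF Sc_closed] by simp
next
  case (insert s S)
  interpret M: K_alg "Mats d \<xi> n"
    by (rule K_alg_Mats)
  have "(\<lambda>s. Sc n (c s)) \<in> S \<rightarrow> carrier (Mats d \<xi> n)"
    by (intro Pi_I Sc_closed)
  then show ?case
    using insert by (simp add: Sc_closed Sc_add)
qed

lemma Sc_pow: "Sc n c [^]\<^bsub>Mats d \<xi> n\<^esub> (k::nat) = Sc n (\<lambda>\<chi>. c \<chi> ^ k)"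
proof (induction k)
  case 0
  interpret M: K_alg "Mats d \<xi> n"
    by (rule K_alg_Mats)
  show ?case
    by (simp add: Sc_one)
next
  case (Suc k)
  interpret M: K_alg "Mats d \<xi> n"
    by (rule K_alg_Mats)
  show ?case
    by (simp only: M.nat_pow_Suc Suc Sc_mult power_Suc2)
qed

lemma Sc_inv:
  assumes "\<And>\<chi>. \<chi> \<in> chars d n \<Longrightarrow> c \<chi> \<noteq> 0"
  shows "inv\<^bsub>Mats d \<xi> n\<^esub> Sc n c = Sc n (\<lambda>\<chi>. inverse (c \<chi>))"
proof -
  interpret M: K_alg "Mats d \<xi> n"
    by (rule K_alg_Mats)
  have "Sc n (\<lambda>\<chi>. c \<chi> * inverse (c \<chi>)) = Sc n (\<lambda>_. 1)" "Sc n (\<lambda>\<chi>. inverse (c \<chi>) * c \<chi>) = Sc n (\<lambda>_. 1)"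
    by (rule Sc_cong; use assms in simp)+
  then show ?thesis
    by (intro M.inv_char Sc_closed) (simp_all only: Sc_mult Sc_one)
qed

lemma Sc_mprod: "mprod (Mats d \<xi> n) (map (\<lambda>j. Sc n (c j)) js) = Sc n (\<lambda>\<chi>. \<Prod>j\<leftarrow>js. c j \<chi>)"
  by (induction js) (simp_all add: Sc_one Sc_mult)

text \<open>Orthogonality of the characters of the cyclic group of order d, as a geometric series in
  z/w. This is the form in which the roots of unity enter \<open>idem\<close>.\<close>

lemma root_sum':
  assumes "z ^ d = 1" "w ^ d = 1"
  shows "(\<Sum>s\<in>{0..<d}. z ^ s * inverse (w ^ s)) = (if z = w then of_nat d else (0::complex))"
proof -
  have w: "w \<noteq> 0"
    using assms(2) d by (auto simp: power_0_left)
  have e: "(\<Sum>s\<in>{0..<d}. z ^ s * inverse (w ^ s)) = (\<Sum>s<d. (z / w) ^ s)"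
    unfolding atLeast0LessThan by (rule sum.cong[OF refl]) (simp add: divide_inverse power_mult_distrib power_inverse)
  show ?thesis
  proof (cases "z = w")
    case True
    then show ?thesis
      unfolding e using w by simp
  next
    case False
    then have "z / w \<noteq> 1"
      using w by simp
    from geometric_sum[OF this, of d] show ?thesis
      unfolding e using False assms by (simp add: power_divide)
  qed
qed

text \<open>A multiple of a matrix unit is a monomial matrix whose other rows vanish. The freedom in
  choosing \<open>\<sigma>\<close> allows the column map of the word under comparison to be
  used.\<close>

lemma mat_unit_mono:
  assumes \<chi>: "\<chi> \<in> chars d n" "\<sigma> \<chi> = \<chi>'"
  shows "mat_unit d \<xi> n (Comp d \<xi> n \<chi>) \<chi> \<chi>' h = mono_mat n \<sigma> (\<lambda>\<psi>. if \<psi> = \<chi> then h else \<zero>\<^bsub>Hc n \<psi>\<^esub>)"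
  unfolding mat_unit_def mono_mat_def
proof (intro restrict_ext)
  fix \<mu> \<psi> \<psi>'
  assume "\<psi> \<in> chars_of d \<xi> n \<mu>"
  then have \<psi>: "Comp d \<xi> n \<psi> = \<mu>"
    by (auto dest: chars_ofD)
  show "(if \<mu> = Comp d \<xi> n \<chi> \<and> \<psi> = \<chi> \<and> \<psi>' = \<chi>' then h else \<zero>\<^bsub>Hmu d \<mu>\<^esub>)
    = (if \<psi>' = \<sigma> \<psi> then if \<psi> = \<chi> then h else \<zero>\<^bsub>Hc n \<psi>\<^esub> else \<zero>\<^bsub>Hmu d \<mu>\<^esub>)"
    using \<psi> \<chi>(2) by (cases "\<psi> = \<chi>") simp_all
qed

text \<open>The diagonal entry of X_j in row \<chi>: under the identification of the tensor product
  with a subalgebra this is the X with index \<pi>_\<chi>^-1(j), see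
  \<open>hmu_X_pos\<close>.\<close>

definition Xval :: "nat \<Rightarrow> (nat \<Rightarrow> complex) \<Rightarrow> nat \<Rightarrow> hmu" where
  "Xval n \<chi> j = in_factor d (Comp d \<xi> n \<chi>) (col \<chi> j) (yh_X 1 (Comp d \<xi> n \<chi> (col \<chi> j)) (rank (col \<chi>) j))"

lemma hmu_X_pos:
  assumes "\<chi> \<in> chars d n" "j \<in> {1..n}"
  shows "hmu_X d (Comp d \<xi> n \<chi>) (pos d n (col \<chi>) j) = Xval n \<chi> j"
  unfolding hmu_X_def Let_def pos_minus_offset[OF assms] Xval_def ..

lemma Xval_Units:
  assumes "\<chi> \<in> chars d n" "j \<in> {1..n}"
  shows "Xval n \<chi> j \<in> Units (Hc n \<chi>)"
proof -
  interpret H: K_hom "hecke (Comp d \<xi> n \<chi> (col \<chi> j))" "Hc n \<chi>" "in_factor d (Comp d \<xi> n \<chi>) (col \<chi> j)"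
    by (rule K_hom_in_factor[OF col_range[OF assms]])
  show ?thesis
    unfolding Xval_def by (rule H.hom_Units[OF yh_X_Units[OF _ rank_col_le[OF assms]]]) simp
qed

end

text \<open>Only the values on words are fixed, so the locale serves both for the homomorphism built
  from the presentation and, once \<open>Psi_word\<close> is available, for \<open>Psi\<close>
  itself.\<close>

locale Phi_hom = roots d \<xi> + K_hom "YH d n" "Mats d \<xi> n" f for d \<xi> n f +
  assumes f_word: "w \<in> lists (yh_gens n) \<Longrightarrow> f (yh_word d n w) = mono_mat n (wperm w) (wval n w)"
begin

lemma f_gen: "x \<in> yh_gens n \<Longrightarrow> f (yh_gen d n x) = mono_mat n (gperm x) (gval n x)"
proof -
  assume x: "x \<in> yh_gens n"
  have "f (yh_gen d n x) = mono_mat n (wperm [x]) (wval n [x])"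
    using f_word[of "[x]"] x by (simp add: yh_word_def yh_gen_def)
  also have "\<dots> = mono_mat n (gperm x) (gval n x)"
  proof (rule mono_mat_cong, rule disjI1)
    fix \<chi> assume \<chi>: "\<chi> \<in> chars d n"
    show "wperm [x] \<chi> = gperm x \<chi> \<and> wval n [x] \<chi> = gval n x \<chi>"
      using gval_closed[OF x \<chi>] gperm_chars(2)[OF x \<chi>] by (simp only: wperm.simps wval.simps HA.r_one simp_thms)
  qed
  finally show ?thesis .
qed

lemma f_t: "j \<in> {1..n} \<Longrightarrow> f (yh_t d n j) = Sc n (\<lambda>\<chi>. \<chi> j)"
  unfolding yh_t_def Sc_def Dg_def by (subst f_gen) (auto intro: mono_mat_cong)

text \<open>By orthogonality the j-th factor of the idempotent projects to the rows that agree with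
  \<chi> at j; the product of these projections leaves row \<chi> alone.\<close>

lemma f_idem:
  assumes \<chi>: "\<chi> \<in> chars d n"
  shows "idem d n \<chi> \<in> carrier (YH d n)" "f (idem d n \<chi>) = Sc n (\<lambda>\<psi>. if \<psi> = \<chi> then 1 else 0)"
proof -
  let ?t = "\<lambda>j s. K_const (\<chi> j ^ s) \<odot>\<^bsub>YH d n\<^esub> (yh_t d n j [^]\<^bsub>YH d n\<^esub> (- int s))"
  let ?e = "\<lambda>j. K_const (1 / of_nat d) \<odot>\<^bsub>YH d n\<^esub> (\<Oplus>\<^bsub>YH d n\<^esub>s\<in>{0..<d}. ?t j s)"
  have tc: "?t j s \<in> carrier (YH d n)" if "j \<in> {1..n}" for j s
    using A.int_pow_Units[OF T_Units[OF d that]] by (intro A.smult_closed A.Units_closed)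
  have ec: "?e j \<in> carrier (YH d n)" if "j \<in> {1..n}" for j
    by (intro A.smult_closed A.finsum_closed Pi_I tc that)
  have ft: "f (?t j s) = Sc n (\<lambda>\<psi>. \<chi> j ^ s * inverse (\<psi> j ^ s))" if j: "j \<in> {1..n}" for j s
  proof -
    have u: "yh_t d n j \<in> Units (YH d n)"
      by (rule T_Units[OF d j])
    have nz: "\<psi> j ^ s \<noteq> 0" if "\<psi> \<in> chars d n" for \<psi>
      using chars_root[OF that j] d by (auto simp: power_0_left)
    have "yh_t d n j [^]\<^bsub>YH d n\<^esub> (- int s) = inv\<^bsub>YH d n\<^esub> (yh_t d n j [^]\<^bsub>YH d n\<^esub> s)"
      by (rule A.int_pow_uminus)
    then have "f (yh_t d n j [^]\<^bsub>YH d n\<^esub> (- int s)) = inv\<^bsub>Mats d \<xi> n\<^esub> (f (yh_t d n j) [^]\<^bsub>Mats d \<xi> n\<^esub> s)"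
      by (simp only: hom_inv[OF A.Units_pow_closed[OF u]] hom_nat_pow[OF t_closed[OF j]])
    also have "\<dots> = Sc n (\<lambda>\<psi>. inverse (\<psi> j ^ s))"
      unfolding f_t[OF j] Sc_pow by (rule Sc_inv[OF nz])
    finally show ?thesis
      using A.Units_closed[OF A.int_pow_Units[OF u]] by (simp only: hom_smult Sc_smult)
  qed
  have fe: "f (?e j) = Sc n (\<lambda>\<psi>. if \<psi> j = \<chi> j then 1 else 0)" if j: "j \<in> {1..n}" for j
  proof -
    have "f (?e j) = K_const (1 / of_nat d) \<odot>\<^bsub>Mats d \<xi> n\<^esub> f (\<Oplus>\<^bsub>YH d n\<^esub>s\<in>{0..<d}. ?t j s)"
      by (intro hom_smult A.finsum_closed Pi_I tc j)
    also have "f (\<Oplus>\<^bsub>YH d n\<^esub>s\<in>{0..<d}. ?t j s) = (\<Oplus>\<^bsub>Mats d \<xi> n\<^esub>s\<in>{0..<d}. f (?t j s))"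
      by (intro hom_finsum Pi_I tc j)
    also have "\<dots> = Sc n (\<lambda>\<psi>. \<Sum>s\<in>{0..<d}. \<chi> j ^ s * inverse (\<psi> j ^ s))"
      unfolding ft[OF j] by (rule Sc_finsum) simp
    also have "K_const (1 / of_nat d) \<odot>\<^bsub>Mats d \<xi> n\<^esub> \<dots> = Sc n (\<lambda>\<psi>. if \<psi> j = \<chi> j then 1 else 0)"
      unfolding Sc_smult
    proof (rule Sc_cong)
      fix \<psi> assume "\<psi> \<in> chars d n"
      from root_sum'[OF chars_root[OF \<chi> j] chars_root[OF this j]]
      show "1 / of_nat d * (\<Sum>s\<in>{0..<d}. \<chi> j ^ s * inverse (\<psi> j ^ s)) = (if \<psi> j = \<chi> j then 1 else 0)"
        using d by auto
    qed
    finally show ?thesis .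
  qed
  have set: "set (map ?e [1..<Suc n]) \<subseteq> carrier (YH d n)"
    using ec by auto
  show "idem d n \<chi> \<in> carrier (YH d n)"
    unfolding idem_def by (rule A.mprod_closed[OF set])
  have "f (idem d n \<chi>) = mprod (Mats d \<xi> n) (map (\<lambda>j. f (?e j)) [1..<Suc n])"
    unfolding idem_def hom_mprod[OF set] map_map o_def ..
  also have "map (\<lambda>j. f (?e j)) [1..<Suc n] = map (\<lambda>j. Sc n (\<lambda>\<psi>. if \<psi> j = \<chi> j then 1 else 0)) [1..<Suc n]"
    by (rule map_cong[OF refl]) (rule fe, auto)
  also have "mprod (Mats d \<xi> n) \<dots> = Sc n (\<lambda>\<psi>. \<Prod>j\<leftarrow>[1..<Suc n]. if \<psi> j = \<chi> j then 1 else 0)"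
    by (rule Sc_mprod)
  also have "\<dots> = Sc n (\<lambda>\<psi>. if \<psi> = \<chi> then 1 else 0)"
  proof (rule Sc_cong)
    fix \<psi> assume \<psi>: "\<psi> \<in> chars d n"
    have "(\<Prod>j\<leftarrow>js. if \<psi> j = \<chi> j then 1 else 0) = (if \<forall>j\<in>set js. \<psi> j = \<chi> j then 1 else (0::complex))" for js
      by (induction js) simp_all
    moreover have "(\<forall>j\<in>set [1..<Suc n]. \<psi> j = \<chi> j) \<longleftrightarrow> \<psi> = \<chi>"
    proof
      assume *: "\<forall>j\<in>set [1..<Suc n]. \<psi> j = \<chi> j"
      show "\<psi> = \<chi>"
        by (rule PiE_ext[OF \<psi>[unfolded chars_def] \<chi>[unfolded chars_def]]) (use *[unfolded set_upt atLeastLessThanSuc_atLeastAtMost] in \<open>rule bspec\<close>)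
    qed simp
    ultimately show "(\<Prod>j\<leftarrow>[1..<Suc n]. if \<psi> j = \<chi> j then 1 else 0) = (if \<psi> = \<chi> then 1 else (0::complex))"
      by (simp only:)
  qed
  finally show "f (idem d n \<chi>) = Sc n (\<lambda>\<psi>. if \<psi> = \<chi> then 1 else 0)" .
qed

text \<open>The recursion X_{j+1} = u^-2 g_j X_j g_j is read in each row. For equal values it is the
  same recursion inside one factor. For different values both g_j contribute u, which cancels
  u^-2.\<close>

lemma f_X: "j \<in> {1..n} \<Longrightarrow> f (yh_X d n j) = Dg n (\<lambda>\<chi>. Xval n \<chi> j)"
proof (induction j)
  case (Suc j)
  show ?case
  proof (cases "j = 0")
    case True
    then have n: "1 \<le> n"
      using Suc by simp
    have "f (yh_X d n (Suc j)) = mono_mat n (gperm X1) (gval n X1)"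
      using f_gen[of X1] n True by simp
    also have "\<dots> = Dg n (\<lambda>\<chi>. Xval n \<chi> (Suc j))"
      unfolding Dg_def
    proof (rule mono_mat_cong, rule disjI1)
      fix \<chi> assume "\<chi> \<in> chars d n"
      have r: "rank (col \<chi>) (Suc 0) = Suc 0"
        by (simp add: rank_def)
      show "gperm X1 \<chi> = \<chi> \<and> gval n X1 \<chi> = Xval n \<chi> (Suc j)"
        unfolding Xval_def r True by (simp add: hg_def)
    qed
    finally show ?thesis .
  next
    case False
    then have j: "1 \<le> j" "j \<in> {1..n}" "j \<in> {1..<n}" "Suc j \<in> {1..n}"
      using Suc by auto
    let ?M = "Mats d \<xi> n" and ?\<sigma> = "\<lambda>\<chi>. \<chi> \<circ> sw j"
    have Gj: "G j \<in> yh_gens n"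
      using j by simp
    have Xc: "yh_X d n j \<in> carrier (YH d n)"
      by (rule A.Units_closed[OF yh_X_Units[OF d j(2)]])
    note gc = g_closed[OF j(3), of d]
    have fg: "f (yh_g d n j) = mono_mat n (gperm (G j)) (gval n (G j))"
      unfolding yh_g_def by (rule f_gen[OF Gj])
    have a1: "adm n (gperm (G j)) (gval n (G j))"
      by (rule gval_adm[OF Gj])
    have a2: "adm n (\<lambda>\<chi>. \<chi>) (\<lambda>\<chi>. Xval n \<chi> j)"
      unfolding adm_def using Xval_Units[OF _ j(2)] HA.Units_closed by blast
    have a12: "adm n (\<lambda>\<chi>. gperm (G j) \<chi>) (\<lambda>\<chi>. gval n (G j) \<chi> \<otimes>\<^bsub>Hc n \<chi>\<^esub> Xval n (gperm (G j) \<chi>) j)"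
      unfolding adm_def
    proof (intro ballI conjI)
      fix \<chi> assume \<chi>: "\<chi> \<in> chars d n"
      note a = admD[OF a1 \<chi>]
      show "gperm (G j) \<chi> \<in> chars d n" "Comp d \<xi> n (gperm (G j) \<chi>) = Comp d \<xi> n \<chi>"
        by (rule a)+
      show "gval n (G j) \<chi> \<otimes>\<^bsub>Hc n \<chi>\<^esub> Xval n (gperm (G j) \<chi>) j \<in> carrier (Hc n \<chi>)"
        using a(3) admD(3)[OF a2 a(1)] unfolding a(2) by (rule HA.m_closed)
    qed
    have a123: "adm n (\<lambda>\<chi>. gperm (G j) (gperm (G j) \<chi>)) (\<lambda>\<chi>. (gval n (G j) \<chi> \<otimes>\<^bsub>Hc n \<chi>\<^esub> Xval n (gperm (G j) \<chi>) j) \<otimes>\<^bsub>Hc n \<chi>\<^esub> gval n (G j) (gperm (G j) \<chi>))"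
      unfolding adm_def
    proof (intro ballI conjI)
      fix \<chi> assume \<chi>: "\<chi> \<in> chars d n"
      note a = admD[OF a12 \<chi>]
      note b = admD[OF a1 a(1)]
      show "gperm (G j) (gperm (G j) \<chi>) \<in> chars d n" "Comp d \<xi> n (gperm (G j) (gperm (G j) \<chi>)) = Comp d \<xi> n \<chi>"
        using a b by simp_all
      show "(gval n (G j) \<chi> \<otimes>\<^bsub>Hc n \<chi>\<^esub> Xval n (gperm (G j) \<chi>) j) \<otimes>\<^bsub>Hc n \<chi>\<^esub> gval n (G j) (gperm (G j) \<chi>) \<in> carrier (Hc n \<chi>)"
        using a(3) b(3) unfolding a(2) by (rule HA.m_closed)
    qed
    have "f (yh_X d n (Suc j)) = u_pow (-2) \<odot>\<^bsub>?M\<^esub> ((f (yh_g d n j) \<otimes>\<^bsub>?M\<^esub> f (yh_X d n j)) \<otimes>\<^bsub>?M\<^esub> f (yh_g d n j))"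
      unfolding yh_X_Suc[OF j(1)] using Xc gc by (simp only: hom_smult hom_mult A.m_closed)
    also have "\<dots> = mono_mat n (\<lambda>\<chi>. gperm (G j) (gperm (G j) \<chi>))
      (\<lambda>\<chi>. u_pow (-2) \<odot>\<^bsub>Hc n \<chi>\<^esub> ((gval n (G j) \<chi> \<otimes>\<^bsub>Hc n \<chi>\<^esub> Xval n (gperm (G j) \<chi>) j) \<otimes>\<^bsub>Hc n \<chi>\<^esub> gval n (G j) (gperm (G j) \<chi>)))"
      unfolding fg Suc.IH[OF j(2)] Dg_def mono_mat_mult[OF a1 a2] mono_mat_mult[OF a12 a1] mono_mat_smult[OF a123] ..
    also have "\<dots> = Dg n (\<lambda>\<chi>. Xval n \<chi> (Suc j))"
      unfolding Dg_def
    proof (rule mono_mat_cong, rule disjI1, rule conjI)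
      fix \<chi> assume \<chi>: "\<chi> \<in> chars d n"
      show "gperm (G j) (gperm (G j) \<chi>) = \<chi>"
        unfolding gperm.simps by (rule comp_sw_sw)
      let ?\<mu> = "Comp d \<xi> n \<chi>"
      show "u_pow (-2) \<odot>\<^bsub>Hc n \<chi>\<^esub> ((gval n (G j) \<chi> \<otimes>\<^bsub>Hc n \<chi>\<^esub> Xval n (gperm (G j) \<chi>) j) \<otimes>\<^bsub>Hc n \<chi>\<^esub> gval n (G j) (gperm (G j) \<chi>)) = Xval n \<chi> (Suc j)"
      proof (cases "\<chi> j = \<chi> (Suc j)")
        case True
        have c: "col \<chi> j = col \<chi> (Suc j)"
          using col_eq_iff[OF \<chi> j(2,4)] True by simp
        have p: "gperm (G j) \<chi> = \<chi>"
          unfolding gperm.simps by (rule sw_fixed[OF True])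
        have g: "gval n (G j) \<chi> = Gval n \<chi> j"
          using True by simp
        let ?a = "col \<chi> (Suc j)" and ?r = "rank (col \<chi>) j"
        interpret h: K_hom "hecke (?\<mu> ?a)" "Hc n \<chi>" "in_factor d ?\<mu> ?a"
          by (rule K_hom_in_factor[OF col_range[OF \<chi> j(4)]])
        have r: "?r \<in> {1..<?\<mu> ?a}" "?r \<in> {1..?\<mu> ?a}" "1 \<le> ?r"
          using rank_col_less[OF \<chi> j(3) True] unfolding c by auto
        have X: "yh_X 1 (?\<mu> ?a) ?r \<in> carrier (hecke (?\<mu> ?a))"
          by (rule YA.Units_closed[OF yh_X_Units[OF _ r(2)]]) simp
        note gr = g_closed[OF r(1), of 1]
        have G: "Gval n \<chi> j = in_factor d ?\<mu> ?a (yh_g 1 (?\<mu> ?a) ?r)"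
          unfolding Gval_def hg_def yh_g_def c ..
        show ?thesis
          unfolding p g Xval_def c rank_Suc[of "col \<chi>" j, OF c] yh_X_Suc[OF r(3)] G
          using X gr by (simp only: h.hom_smult h.hom_mult YA.m_closed)
      next
        case False
        have g: "gval n (G j) \<chi> = u_pow 1 \<odot>\<^bsub>Hc n \<chi>\<^esub> \<one>\<^bsub>Hc n \<chi>\<^esub>"
          "gval n (G j) (gperm (G j) \<chi>) = u_pow 1 \<odot>\<^bsub>Hc n \<chi>\<^esub> \<one>\<^bsub>Hc n \<chi>\<^esub>"
          using False Comp_sw[OF \<chi> j(3)] by simp_all
        have "col \<chi> j \<noteq> col \<chi> (Suc j)"
          using col_eq_iff[OF \<chi> j(2,4)] False by simp
        \<comment> \<open>The strand at j+1 sits at j in the exchanged row and has kept its rank, so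
          the entry of X_j there is the wanted entry of X_{j+1} here.\<close>
        from rank_sw[OF j(1) this, of "Suc j"] have r: "rank (col \<chi> \<circ> sw j) j = rank (col \<chi>) (Suc j)"
          by simp
        have X: "Xval n (gperm (G j) \<chi>) j = Xval n \<chi> (Suc j)"
          unfolding Xval_def gperm.simps Comp_sw[OF \<chi> j(3)] col_comp r by simp
        have Xc: "Xval n \<chi> (Suc j) \<in> carrier (Hc n \<chi>)"
          by (rule HA.Units_closed[OF Xval_Units[OF \<chi> j(4)]])
        show ?thesis
          unfolding g X using Xc by (simp add: HA.scalar_mult HA.smult_mult_l HA.smult_mult_r HA.smult_smult u_pow_add)
      qed
    qed
    finally show ?thesis .
  qed
qed simp

lemma f_Xpow:
  shows "yh_Xpow d n lam \<in> carrier (YH d n)"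
    and "f (yh_Xpow d n lam) = Dg n (\<lambda>\<chi>. mprod (Hc n \<chi>) (map (\<lambda>j. Xval n \<chi> j [^]\<^bsub>Hc n \<chi>\<^esub> lam j) [1..<Suc n]))"
    and "diag n (\<lambda>\<chi>. mprod (Hc n \<chi>) (map (\<lambda>j. Xval n \<chi> j [^]\<^bsub>Hc n \<chi>\<^esub> lam j) [1..<Suc n]))"
proof -
  have u: "yh_X d n j [^]\<^bsub>YH d n\<^esub> lam j \<in> carrier (YH d n)" if "j \<in> {1..n}" for j
    by (rule A.Units_closed[OF A.int_pow_Units[OF yh_X_Units[OF d that]]])
  have set: "set (map (\<lambda>j. yh_X d n j [^]\<^bsub>YH d n\<^esub> lam j) [1..<Suc n]) \<subseteq> carrier (YH d n)"
    using u by auto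
  show "yh_Xpow d n lam \<in> carrier (YH d n)"
    unfolding yh_Xpow_def by (rule A.mprod_closed[OF set])
  have 1: "f (yh_X d n j [^]\<^bsub>YH d n\<^esub> lam j) = Dg n (\<lambda>\<chi>. Xval n \<chi> j [^]\<^bsub>Hc n \<chi>\<^esub> lam j)" if j: "j \<in> {1..n}" for j
    unfolding hom_int_pow[OF yh_X_Units[OF d j]] f_X[OF j] by (rule Dg_int_pow[OF Xval_Units[OF _ j]])
  have "f (yh_Xpow d n lam) = mprod (Mats d \<xi> n) (map (\<lambda>j. f (yh_X d n j [^]\<^bsub>YH d n\<^esub> lam j)) [1..<Suc n])"
    unfolding yh_Xpow_def hom_mprod[OF set] map_map o_def ..
  also have "map (\<lambda>j. f (yh_X d n j [^]\<^bsub>YH d n\<^esub> lam j)) [1..<Suc n] = map (\<lambda>j. Dg n (\<lambda>\<chi>. Xval n \<chi> j [^]\<^bsub>Hc n \<chi>\<^esub> lam j)) [1..<Suc n]"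
    by (rule map_cong[OF refl]) (rule 1, auto)
  finally have 2: "f (yh_Xpow d n lam) = mprod (Mats d \<xi> n) (map (\<lambda>j. Dg n (\<lambda>\<chi>. Xval n \<chi> j [^]\<^bsub>Hc n \<chi>\<^esub> lam j)) [1..<Suc n])" .
  have dg: "diag n (\<lambda>\<chi>. Xval n \<chi> j [^]\<^bsub>Hc n \<chi>\<^esub> lam j)" if "j \<in> set [1..<Suc n]" for j
    unfolding diag_def
  proof
    fix \<chi> assume \<chi>: "\<chi> \<in> chars d n"
    have "j \<in> {1..n}"
      using that by auto
    from HA.Units_closed[OF HA.int_pow_Units[OF Xval_Units[OF \<chi> this]]]
    show "Xval n \<chi> j [^]\<^bsub>Hc n \<chi>\<^esub> lam j \<in> carrier (Hc n \<chi>)" .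
  qed
  from Dg_mprod[where h = "\<lambda>j \<chi>. Xval n \<chi> j [^]\<^bsub>Hc n \<chi>\<^esub> lam j" and js = "[1..<Suc n]", OF dg]
  show "f (yh_Xpow d n lam) = Dg n (\<lambda>\<chi>. mprod (Hc n \<chi>) (map (\<lambda>j. Xval n \<chi> j [^]\<^bsub>Hc n \<chi>\<^esub> lam j) [1..<Suc n]))"
    "diag n (\<lambda>\<chi>. mprod (Hc n \<chi>) (map (\<lambda>j. Xval n \<chi> j [^]\<^bsub>Hc n \<chi>\<^esub> lam j) [1..<Suc n]))"
    unfolding 2 by blast+
qed

lemma f_g_word:
  assumes "set is \<subseteq> {1..<n}"
  shows "mprod (YH d n) (map (yh_g d n) is) = yh_word d n (map G is)" "map G is \<in> lists (yh_gens n)"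
proof -
  show l: "map G is \<in> lists (yh_gens n)"
    using assms by (auto simp: in_lists_conv_set)
  show "mprod (YH d n) (map (yh_g d n) is) = yh_word d n (map G is)"
    unfolding yh_word_eval[OF l] map_map by (simp add: o_def yh_g_def[abs_def])
qed

text \<open>The idempotent leaves only row \<chi>, so both sides are compared in a single entry. The
  power of u is the difference between the length of the word and that of its shortened form, and
  both words are reduced.\<close>

lemma f_value:
  assumes \<chi>: "\<chi> \<in> chars d n" and w: "w permutes {1..n}"
  shows "f (idem d n \<chi> \<otimes>\<^bsub>YH d n\<^esub> yh_Xpow d n lam \<otimes>\<^bsub>YH d n\<^esub> yh_gw d n (inv_into UNIV w)) = Psi_value d \<xi> n \<chi> lam w"
proof -
  let ?M = "Mats d \<xi> n" and ?\<mu> = "Comp d \<xi> n \<chi>"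
  define v where "v = inv_into UNIV w"
  define js where "js = reduced_word n v"
  define sub where "sub = subword d n (col \<chi>) js"
  have v: "v permutes {1..n}"
    unfolding v_def by (rule permutes_inv[OF w])
  note js = reduced_word[OF v, folded js_def]
  note c = colouring_col[OF \<chi>]
  note G = f_g_word[OF js(1)]
  have gw: "yh_gw d n v = yh_word d n (map G js)"
    unfolding yh_gw_def js_def[symmetric] by (rule G(1))
  let ?X = "\<lambda>\<chi>. mprod (Hc n \<chi>) (map (\<lambda>j. Xval n \<chi> j [^]\<^bsub>Hc n \<chi>\<^esub> lam j) [1..<Suc n])"
  let ?E = "\<lambda>\<psi>. K_const (if \<psi> = \<chi> then 1 else 0) \<odot>\<^bsub>Hc n \<psi>\<^esub> \<one>\<^bsub>Hc n \<psi>\<^esub>"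
  have a1: "adm n (\<lambda>\<chi>. \<chi>) ?E" "adm n (\<lambda>\<chi>. \<chi>) ?X" "adm n (wperm (map G js)) (wval n (map G js))"
    using diag_scalar[unfolded diag_adm, where c = "\<lambda>\<psi>. K_const (if \<psi> = \<chi> then 1 else 0)"]
      f_Xpow(3)[unfolded diag_adm] wval_adm[OF G(2)] by simp_all
  have a2: "adm n (\<lambda>\<chi>. \<chi>) (\<lambda>\<psi>. ?E \<psi> \<otimes>\<^bsub>Hc n \<psi>\<^esub> ?X \<psi>)"
    unfolding adm_def using admD(3)[OF a1(1)] admD(3)[OF a1(2)] by (intro ballI conjI HA.m_closed) simp_all
  have "f (idem d n \<chi> \<otimes>\<^bsub>YH d n\<^esub> yh_Xpow d n lam \<otimes>\<^bsub>YH d n\<^esub> yh_gw d n v)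
      = f (idem d n \<chi>) \<otimes>\<^bsub>?M\<^esub> f (yh_Xpow d n lam) \<otimes>\<^bsub>?M\<^esub> f (yh_word d n (map G js))"
    unfolding gw using f_idem(1)[OF \<chi>] f_Xpow(1) yh_word_closed[OF G(2)] by (simp only: hom_mult A.m_closed)
  also have "\<dots> = mono_mat n (\<lambda>\<psi>. wperm (map G js) \<psi>) (\<lambda>\<psi>. (?E \<psi> \<otimes>\<^bsub>Hc n \<psi>\<^esub> ?X \<psi>) \<otimes>\<^bsub>Hc n \<psi>\<^esub> wval n (map G js) \<psi>)"
    unfolding f_idem(2)[OF \<chi>] f_Xpow(2) f_word[OF G(2)] Sc_def Dg_def mono_mat_mult[OF a1(1,2)] mono_mat_mult[OF a2 a1(3)] ..
  finally have L: "f (idem d n \<chi> \<otimes>\<^bsub>YH d n\<^esub> yh_Xpow d n lam \<otimes>\<^bsub>YH d n\<^esub> yh_gw d n v)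
    = mono_mat n (\<lambda>\<psi>. wperm (map G js) \<psi>) (\<lambda>\<psi>. (?E \<psi> \<otimes>\<^bsub>Hc n \<psi>\<^esub> ?X \<psi>) \<otimes>\<^bsub>Hc n \<psi>\<^esub> wval n (map G js) \<psi>)" .
  let ?wc = "char_act w \<chi>"
  have wc: "?wc = \<chi> \<circ> v"
    by (simp add: char_act_def v_def)
  have wc_ch: "\<chi> \<circ> v \<in> chars d n"
    by (rule chars_comp[OF \<chi> v])
  have cp: "inv_into UNIV (char_perm d \<xi> n \<chi>) = pos d n (col \<chi>)"
    by (rule char_perm_inv(1)[OF \<chi>])
  have "inv_into UNIV (inv_into UNIV (char_perm d \<xi> n (\<chi> \<circ> v))) = char_perm d \<xi> n (\<chi> \<circ> v)"
    by (rule permutes_inv_inv[OF char_perm_inv(2)[OF wc_ch]])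
  then have cpw: "char_perm d \<xi> n (\<chi> \<circ> v) = inv_into UNIV (pos d n (col \<chi> \<circ> v))"
    unfolding char_perm_inv(1)[OF wc_ch] col_comp by (rule sym)
  \<comment> \<open>This is \<pi>_\<chi>^-1 w^-1 \<pi>_{w(\<chi>)}: the character w(\<chi>) is
    \<chi> composed with v = w^-1, and \<open>cpw\<close> expresses its \<pi> through the sorting of
    the permuted colouring.\<close>
  define x where "x = pos d n (col \<chi>) \<circ> v \<circ> inv_into UNIV (pos d n (col \<chi> \<circ> v))"
  have sub: "set sub \<subseteq> {1..<n}" "red sub" "word_perm sub = x" "\<forall>p\<in>{1..n}. block ?\<mu> (word_perm sub p) = block ?\<mu> p"
    unfolding sub_def x_def using subword_letters[OF c js(1)] subword_red[OF c js(1,3)] subword_conj[OF c js(1)] js(2)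
      subword_block[OF c js(1)] Comp_eq[OF \<chi>] by simp_all
  have x: "x permutes {1..n}"
    using word_perm_permutes[OF sub(1)] sub(3) by simp
  have len: "perm_length n v = length js" "perm_length n x = length sub"
    using red_length[OF js(1,3)] red_length[OF sub(1,2)] js(2) sub(3) by simp_all
  interpret B: braid_family "Hc n \<chi>" n "block ?\<mu>" "hmu_g d ?\<mu>"
    by (rule braid_family_hmu[OF \<chi>])
  note rx = reduced_word[OF x]
  \<comment> \<open>The word chosen inside \<open>hmu_gw\<close> and the shortened word may differ;
    both are reduced words of \<open>x\<close>, which preserves the blocks.\<close>
  have hgw: "hmu_gw d ?\<mu> n x = mprod (Hc n \<chi>) (map (hmu_g d ?\<mu>) sub)"
    unfolding hmu_gw_def
  proof (rule B.matsumoto)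
    show "B.good sub"
      unfolding B.good_def using sub by blast
    show "B.good (reduced_word n x)"
      unfolding B.good_def rx(2) using rx sub(3,4) by simp
    show "word_perm (reduced_word n x) = word_perm sub"
      unfolding rx(2) sub(3) ..
  qed
  note wG = wval_G[OF \<chi> js(1), folded sub_def]
  have Pc: "mprod (Hc n \<chi>) (map (hmu_g d ?\<mu>) sub) \<in> carrier (Hc n \<chi>)"
    using wG by (intro HA.mprod_closed) blast
  have Xc: "?X \<chi> \<in> carrier (Hc n \<chi>)"
    by (rule admD(3)[OF a1(2) \<chi>])
  have Xeq: "mprod (Hc n \<chi>) (map (\<lambda>j. hmu_X d ?\<mu> (pos d n (col \<chi>) j) [^]\<^bsub>Hc n \<chi>\<^esub> lam j) [1..<Suc n]) = ?X \<chi>"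
  proof (intro arg_cong[where f = "mprod (Hc n \<chi>)"] map_cong refl)
    fix j assume "j \<in> set [1..<Suc n]"
    then have "j \<in> {1..n}"
      by auto
    from hmu_X_pos[OF \<chi> this]
    show "hmu_X d ?\<mu> (pos d n (col \<chi>) j) [^]\<^bsub>Hc n \<chi>\<^esub> lam j = Xval n \<chi> j [^]\<^bsub>Hc n \<chi>\<^esub> lam j"
      by (simp only:)
  qed
  let ?u = "u_pow (int (length js) - int (length sub))"
  let ?h = "?X \<chi> \<otimes>\<^bsub>Hc n \<chi>\<^esub> mprod (Hc n \<chi>) (map (hmu_g d ?\<mu>) sub)"
  have hc: "?h \<in> carrier (Hc n \<chi>)"
    by (rule HA.m_closed[OF Xc Pc])
  have \<sigma>: "wperm (map G js) \<chi> = \<chi> \<circ> v"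
    unfolding wperm_G js(2) ..
  have "Psi_value d \<xi> n \<chi> lam w = ?u \<odot>\<^bsub>?M\<^esub> mat_unit d \<xi> n ?\<mu> \<chi> (\<chi> \<circ> v) ?h"
    unfolding Psi_value_def Let_def wc v_def[symmetric] cp cpw x_def[symmetric] len Xeq hgw ..
  also have "\<dots> = ?u \<odot>\<^bsub>?M\<^esub> mono_mat n (wperm (map G js)) (\<lambda>\<psi>. if \<psi> = \<chi> then ?h else \<zero>\<^bsub>Hc n \<psi>\<^esub>)"
    unfolding mat_unit_mono[where \<sigma> = "wperm (map G js)", OF \<chi> \<sigma>] ..
  also have "\<dots> = mono_mat n (wperm (map G js)) (\<lambda>\<psi>. ?u \<odot>\<^bsub>Hc n \<psi>\<^esub> (if \<psi> = \<chi> then ?h else \<zero>\<^bsub>Hc n \<psi>\<^esub>))"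
  proof (rule mono_mat_smult)
    show "adm n (wperm (map G js)) (\<lambda>\<psi>. if \<psi> = \<chi> then ?h else \<zero>\<^bsub>Hc n \<psi>\<^esub>)"
      unfolding adm_def using admD(1,2)[OF a1(3)] hc by simp
  qed
  also have "\<dots> = mono_mat n (\<lambda>\<psi>. wperm (map G js) \<psi>) (\<lambda>\<psi>. (?E \<psi> \<otimes>\<^bsub>Hc n \<psi>\<^esub> ?X \<psi>) \<otimes>\<^bsub>Hc n \<psi>\<^esub> wval n (map G js) \<psi>)"
  proof (rule mono_mat_cong, rule disjI1, rule conjI[OF refl])
    fix \<psi> assume \<psi>: "\<psi> \<in> chars d n"
    have W: "wval n (map G js) \<psi> \<in> carrier (Hc n \<psi>)"
      by (rule admD(3)[OF a1(3) \<psi>])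
    have X: "?X \<psi> \<in> carrier (Hc n \<psi>)"
      by (rule admD(3)[OF a1(2) \<psi>])
    show "?u \<odot>\<^bsub>Hc n \<psi>\<^esub> (if \<psi> = \<chi> then ?h else \<zero>\<^bsub>Hc n \<psi>\<^esub>) = (?E \<psi> \<otimes>\<^bsub>Hc n \<psi>\<^esub> ?X \<psi>) \<otimes>\<^bsub>Hc n \<psi>\<^esub> wval n (map G js) \<psi>"
    proof (cases "\<psi> = \<chi>")
      case True
      have "wval n (map G js) \<chi> = ?u \<odot>\<^bsub>Hc n \<chi>\<^esub> mprod (Hc n \<chi>) (map (hmu_g d ?\<mu>) sub)"
        using wG by blast
      then show ?thesis
        unfolding True using Xc Pc by (simp only: if_True K_const_1 HA.scalar_mult HA.smult_one HA.smult_mult_r simp_thms)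
    next
      case False
      then show ?thesis
        using W X by (simp only: if_False K_const_0 HA.scalar_mult HA.smult_zero_left HA.smult_zero_right HA.l_null simp_thms)
    qed
  qed
  finally show ?thesis
    using L unfolding v_def by (simp only:)
qed

end

section \<open>The action of the t_j on the idempotents\<close>

context monoid
begin

lemma mprod_ones: "(\<And>x. x \<in> set xs \<Longrightarrow> x = \<one>) \<Longrightarrow> mprod G xs = \<one>"
proof (induction xs)
  case (Cons x xs)
  have x: "x = \<one>"
    by (rule Cons.prems) simp
  have "mprod G xs = \<one>"
    by (rule Cons.IH, rule Cons.prems) simp
  then show ?case
    unfolding mprod_Cons x by simp
qed simp

lemma mprod_commute:
  assumes "y \<in> carrier G" "set xs \<subseteq> carrier G" "\<And>x. x \<in> set xs \<Longrightarrow> x \<otimes> y = y \<otimes> x"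
  shows "mprod G xs \<otimes> y = y \<otimes> mprod G xs"
  using assms(2,3)
proof (induction xs)
  case (Cons x xs)
  have x: "x \<in> carrier G" "mprod G xs \<in> carrier G" "x \<otimes> y = y \<otimes> x"
    using Cons.prems by auto
  have IH: "mprod G xs \<otimes> y = y \<otimes> mprod G xs"
    using Cons by simp
  have "mprod G (x # xs) \<otimes> y = x \<otimes> (y \<otimes> mprod G xs)"
    using x assms(1) by (simp add: m_assoc IH)
  also have "\<dots> = y \<otimes> mprod G (x # xs)"
    using x assms(1) by (simp add: m_assoc[symmetric])
  finally show ?case .
qed (use assms(1) in simp)

end

context K_alg
begin

text \<open>A cyclic shift over a full period. The induction proves the identity with the end terms
  \<open>P k\<close> and \<open>P 0\<close> added, which holds for every k; periodicity then allows
  them to be cancelled.\<close>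

lemma finsum_shift:
  assumes P: "\<And>s::nat. P s \<in> carrier A" and "P m = P 0"
  shows "(\<Oplus>s\<in>{0..<m}. P s) = (\<Oplus>s\<in>{0..<m}. P (Suc s))"
proof -
  have "P k \<oplus> (\<Oplus>s\<in>{0..<k}. P s) = P 0 \<oplus> (\<Oplus>s\<in>{0..<k}. P (Suc s))" for k
  proof (induction k)
    case (Suc k)
    have s: "(\<Oplus>s\<in>{0..<Suc k}. Q s) = Q k \<oplus> (\<Oplus>s\<in>{0..<k}. Q s)" if "\<And>s. Q s \<in> carrier A" for Q
      unfolding atLeast0_lessThan_Suc using that by (intro finsum_insert) auto
    have c: "(\<Oplus>s\<in>{0..<k}. P s) \<in> carrier A" "(\<Oplus>s\<in>{0..<k}. P (Suc s)) \<in> carrier A"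
      using P by (intro finsum_closed Pi_I; simp)+
    show ?case
      unfolding s[of P, OF P] s[of "\<lambda>s. P (Suc s)", OF P] Suc.IH
      using P c by (simp add: a_lcomm)
  qed simp
  from this[of m] have "P 0 \<oplus> (\<Oplus>s\<in>{0..<m}. P s) = P 0 \<oplus> (\<Oplus>s\<in>{0..<m}. P (Suc s))"
    unfolding assms(2) .
  moreover have "(\<Oplus>s\<in>{0..<m}. P s) \<in> carrier A" "(\<Oplus>s\<in>{0..<m}. P (Suc s)) \<in> carrier A"
    using P by (intro finsum_closed Pi_I; simp)+
  ultimately show ?thesis
    by (rule add.l_cancel[OF _ _ _ P])
qed

text \<open>Shifting s by one, the term with z^(s+1) t^(-s-1) becomes z times the term with z^s
  t^(-s) after multiplication by t. The period is m because z^m = 1 and t^m = 1.\<close>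

lemma root_idem:
  assumes t: "t \<in> Units A" "t [^] m = \<one>" and z: "z ^ m = 1"
  shows "(\<Oplus>s\<in>{0..<m}. K_const (z ^ s) \<odot> (t [^] (- int s))) \<otimes> t
    = K_const z \<odot> (\<Oplus>s\<in>{0..<m}. K_const (z ^ s) \<odot> (t [^] (- int s)))"
proof -
  define P where "P s = K_const (z ^ s) \<odot> inv (t [^] s)" for s
  have tc: "t \<in> carrier A" and u: "t [^] s \<in> Units A" and ic: "inv (t [^] s) \<in> carrier A" for s :: nat
    using t(1) Units_pow_closed Units_inv_closed by auto
  have Pc: "P s \<in> carrier A" for s
    unfolding P_def by (intro smult_closed ic)
  have P0: "P m = P 0"
    unfolding P_def t(2) z by simp
  have step: "P (Suc s) \<otimes> t = K_const z \<odot> P s" for s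
  proof -
    have tt: "t [^] s \<in> carrier A" "inv t \<in> carrier A"
      using u t(1) by auto
    have "inv (t [^] Suc s) = inv (t [^] s) \<otimes> inv t"
    proof (rule inv_char)
      have "t [^] Suc s \<otimes> (inv (t [^] s) \<otimes> inv t) = t \<otimes> (t [^] s \<otimes> inv (t [^] s)) \<otimes> inv t"
        unfolding nat_pow_Suc2[OF tc] using tc tt ic by (simp only: m_assoc m_closed)
      then show "t [^] Suc s \<otimes> (inv (t [^] s) \<otimes> inv t) = \<one>"
        using t(1) tc u by simp
      have "(inv (t [^] s) \<otimes> inv t) \<otimes> t [^] Suc s = inv (t [^] s) \<otimes> ((inv t \<otimes> t) \<otimes> t [^] s)"
        unfolding nat_pow_Suc2[OF tc] using tc tt ic by (simp only: m_assoc m_closed)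
      then show "(inv (t [^] s) \<otimes> inv t) \<otimes> t [^] Suc s = \<one>"
        using t(1) tt u by simp
    qed (use tc tt ic in auto)
    then have "inv (t [^] Suc s) \<otimes> t = inv (t [^] s)"
      using ic t(1) tc by (simp add: m_assoc Units_l_inv)
    then show ?thesis
      unfolding P_def using ic tc by (simp only: smult_mult_l smult_smult K_const_mult power_Suc)
  qed
  have "(\<Oplus>s\<in>{0..<m}. P s) \<otimes> t = (\<Oplus>s\<in>{0..<m}. P (Suc s) \<otimes> t)"
    unfolding finsum_shift[of P, OF Pc P0] using Pc tc by (intro finsum_ldistr) auto
  also have "\<dots> = K_const z \<odot> (\<Oplus>s\<in>{0..<m}. P s)"
    unfolding step using Pc by (intro smult_finsum[symmetric]) auto
  finally show ?thesis
    unfolding P_def int_pow_uminus .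
qed

end

text \<open>The prescribed values of \<open>Psi\<close> do not mention the t_j directly; this
  identity expresses E_\<chi> t_j through E_\<chi>. Only the j-th factor reacts to t_j, and the
  factors after it are passed by commutation.\<close>

lemma idem_T:
  assumes d: "1 \<le> d" and \<chi>: "\<And>i. i \<in> {1..n} \<Longrightarrow> \<chi> i ^ d = 1" and j: "j \<in> {1..n}"
  shows "idem d n \<chi> \<otimes>\<^bsub>YH d n\<^esub> yh_t d n j = K_const (\<chi> j) \<odot>\<^bsub>YH d n\<^esub> idem d n \<chi>"
proof -
  let ?Y = "YH d n"
  let ?t = "\<lambda>i s. K_const (\<chi> i ^ s) \<odot>\<^bsub>?Y\<^esub> (yh_t d n i [^]\<^bsub>?Y\<^esub> (- int s))"
  let ?e = "\<lambda>i. K_const (1 / of_nat d) \<odot>\<^bsub>?Y\<^esub> (\<Oplus>\<^bsub>?Y\<^esub>s\<in>{0..<d}. ?t i s)"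
  have pc: "yh_t d n i [^]\<^bsub>?Y\<^esub> (- int s) \<in> carrier ?Y" if "i \<in> {1..n}" for i s
    by (rule YA.Units_closed[OF YA.int_pow_Units[OF T_Units[OF d that]]])
  have tc: "?t i s \<in> carrier ?Y" if "i \<in> {1..n}" for i s
    by (rule YA.smult_closed[OF pc[OF that]])
  have sc: "(\<Oplus>\<^bsub>?Y\<^esub>s\<in>{0..<d}. ?t i s) \<in> carrier ?Y" if "i \<in> {1..n}" for i
    by (intro YA.finsum_closed Pi_I tc that)
  have ec: "?e i \<in> carrier ?Y" if "i \<in> {1..n}" for i
    by (intro YA.smult_closed sc that)
  note c = t_closed[OF j, of d]
  have com: "?e i \<otimes>\<^bsub>?Y\<^esub> yh_t d n j = yh_t d n j \<otimes>\<^bsub>?Y\<^esub> ?e i" if i: "i \<in> {1..n}" for i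
  proof -
    have p: "yh_t d n i [^]\<^bsub>?Y\<^esub> (- int s) \<otimes>\<^bsub>?Y\<^esub> yh_t d n j = yh_t d n j \<otimes>\<^bsub>?Y\<^esub> yh_t d n i [^]\<^bsub>?Y\<^esub> (- int s)" for s
    proof -
      have "yh_t d n j \<otimes>\<^bsub>?Y\<^esub> yh_t d n i [^]\<^bsub>?Y\<^esub> s = yh_t d n i [^]\<^bsub>?Y\<^esub> s \<otimes>\<^bsub>?Y\<^esub> yh_t d n j"
        by (rule YA.pow_intertwine[OF c t_closed[OF i] t_closed[OF i] T_commute[OF j i]])
      then show ?thesis
        unfolding YA.int_pow_uminus
        by (intro YA.inv_unit_comm YA.Units_pow_closed T_Units[OF d i] c) (rule sym)
    qed
    have "(\<Oplus>\<^bsub>?Y\<^esub>s\<in>{0..<d}. ?t i s) \<otimes>\<^bsub>?Y\<^esub> yh_t d n j = (\<Oplus>\<^bsub>?Y\<^esub>s\<in>{0..<d}. ?t i s \<otimes>\<^bsub>?Y\<^esub> yh_t d n j)"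
      by (intro YA.finsum_ldistr Pi_I tc i c) simp
    also have "\<dots> = (\<Oplus>\<^bsub>?Y\<^esub>s\<in>{0..<d}. yh_t d n j \<otimes>\<^bsub>?Y\<^esub> ?t i s)"
      by (simp only: YA.smult_mult_l[OF pc[OF i] c] YA.smult_mult_r[OF c pc[OF i]] p)
    also have "\<dots> = yh_t d n j \<otimes>\<^bsub>?Y\<^esub> (\<Oplus>\<^bsub>?Y\<^esub>s\<in>{0..<d}. ?t i s)"
      by (intro YA.finsum_rdistr[symmetric] Pi_I tc i c) simp
    finally show ?thesis
      by (simp only: YA.smult_mult_l[OF sc[OF i] c] YA.smult_mult_r[OF c sc[OF i]])
  qed
  have ej: "?e j \<otimes>\<^bsub>?Y\<^esub> yh_t d n j = K_const (\<chi> j) \<odot>\<^bsub>?Y\<^esub> ?e j"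
    unfolding YA.smult_mult_l[OF sc[OF j] c] YA.root_idem[OF T_Units[OF d j] T_pow[OF j] \<chi>[OF j]]
      YA.smult_smult[OF sc[OF j]] by (simp only: mult.commute)
  have "mprod ?Y (map ?e js) \<otimes>\<^bsub>?Y\<^esub> yh_t d n j = K_const (\<chi> j) \<odot>\<^bsub>?Y\<^esub> mprod ?Y (map ?e js)"
    if "set js \<subseteq> {1..n}" "j \<in> set js" for js
    using that
  proof (induction js)
    case (Cons i js)
    have i: "i \<in> {1..n}" and js: "set js \<subseteq> {1..n}"
      using Cons.prems by auto
    have set: "set (map ?e js) \<subseteq> carrier ?Y"
      using js ec by auto
    have M: "mprod ?Y (map ?e js) \<in> carrier ?Y"
      by (rule YA.mprod_closed[OF set])
    note e = ec[OF i]
    show ?case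
    proof (cases "j \<in> set js")
      case True
      show ?thesis
        unfolding list.map mprod_Cons YA.m_assoc[OF e M c] Cons.IH[OF js True] by (rule YA.smult_mult_r[OF e M])
    next
      case False
      then have ij: "i = j"
        using Cons.prems(2) by simp
      have "mprod ?Y (map ?e js) \<otimes>\<^bsub>?Y\<^esub> yh_t d n j = yh_t d n j \<otimes>\<^bsub>?Y\<^esub> mprod ?Y (map ?e js)"
        using com js by (intro YA.mprod_commute[OF c set]) auto
      then show ?thesis
        unfolding list.map mprod_Cons YA.m_assoc[OF e M c]
        unfolding ij by (simp only: YA.m_assoc[OF ec[OF j] c M, symmetric] ej YA.smult_mult_l[OF ec[OF j] M])
    qed
  qed simp
  then show ?thesis
    unfolding idem_def using j by (simp only: set_upt atLeastLessThanSuc_atLeastAtMost order_refl)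
qed

lemma yh_gw_id: "yh_gw d n id = \<one>\<^bsub>YH d n\<^esub>"
  unfolding yh_gw_def by simp

lemma yh_Xpow_0: "yh_Xpow d n (\<lambda>_. 0) = \<one>\<^bsub>YH d n\<^esub>"
  unfolding yh_Xpow_def using YA.int_pow_uminus[where k = 0] by (intro YA.mprod_ones) auto

lemma yh_Xpow_1:
  assumes "1 \<le> n"
  shows "yh_Xpow d n (\<lambda>j. if j = 1 then 1 else 0) = yh_gen d n X1"
proof -
  have u: "[1..<Suc n] = 1 # [2..<Suc n]"
    using assms by (simp add: upt_conv_Cons numeral_2_eq_2)
  have x: "yh_gen d n X1 \<in> carrier (YH d n)"
    using assms by simp
  have "mprod (YH d n) (map (\<lambda>j. yh_X d n j [^]\<^bsub>YH d n\<^esub> (if j = 1 then 1 else 0 :: int)) [2..<Suc n]) = \<one>\<^bsub>YH d n\<^esub>"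
    using YA.int_pow_uminus[where k = 0] by (intro YA.mprod_ones) auto
  then show ?thesis
    unfolding yh_Xpow_def u list.map mprod_Cons using x by (simp add: int_pow_def2)
qed

section \<open>Uniqueness of the homomorphism with the prescribed values\<close>

context Phi_hom
begin

context
  fixes g
  assumes g: "g \<in> K_algebra_hom (YH d n) (Mats d \<xi> n)"
    and gv: "\<And>\<chi> lam w. \<chi> \<in> chars d n \<Longrightarrow> w permutes {1..n} \<Longrightarrow>
      g (idem d n \<chi> \<otimes>\<^bsub>YH d n\<^esub> yh_Xpow d n lam \<otimes>\<^bsub>YH d n\<^esub> yh_gw d n (inv_into UNIV w))
        = f (idem d n \<chi> \<otimes>\<^bsub>YH d n\<^esub> yh_Xpow d n lam \<otimes>\<^bsub>YH d n\<^esub> yh_gw d n (inv_into UNIV w))"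
begin

interpretation g: K_hom "YH d n" "Mats d \<xi> n" g
  by (intro K_hom.intro K_hom_axioms.intro K_alg_YH K_alg_Mats g)

text \<open>The prescribed value for \<lambda> = 0 and the identity permutation.\<close>

lemma g_idem:
  assumes "\<chi> \<in> chars d n" shows "g (idem d n \<chi>) = f (idem d n \<chi>)"
  using gv[OF assms permutes_id, of "\<lambda>_. 0"] f_idem(1)[OF assms]
  by (simp only: inv_id yh_gw_id yh_Xpow_0 A.r_one)

text \<open>Shown for the images, where it says that the projections to the single rows add up to
  the identity matrix.\<close>

lemma sum_idem: "(\<Oplus>\<^bsub>Mats d \<xi> n\<^esub>\<chi>\<in>chars d n. f (idem d n \<chi>)) = \<one>\<^bsub>Mats d \<xi> n\<^esub>"
proof -
  have "(\<Oplus>\<^bsub>Mats d \<xi> n\<^esub>\<chi>\<in>chars d n. f (idem d n \<chi>)) = (\<Oplus>\<^bsub>Mats d \<xi> n\<^esub>\<chi>\<in>chars d n. Sc n (\<lambda>\<psi>. if \<psi> = \<chi> then 1 else 0))"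
    by (rule B.finsum_cong') (simp_all add: f_idem(2) Sc_closed)
  also have "\<dots> = Sc n (\<lambda>\<psi>. \<Sum>\<chi>\<in>chars d n. if \<psi> = \<chi> then 1 else 0)"
    by (rule Sc_finsum[OF finite_chars])
  also have "\<dots> = Sc n (\<lambda>_. 1)"
    by (rule Sc_cong) (simp add: finite_chars)
  finally show ?thesis
    unfolding Sc_one .
qed

text \<open>Inserting the decomposition of 1 on the left reduces equality at \<open>y\<close> to
  equality at each E_\<chi> y, the two homomorphisms having the same values at the
  idempotents.\<close>

lemma g_eq:
  assumes y: "y \<in> carrier (YH d n)"
    and eq: "\<And>\<chi>. \<chi> \<in> chars d n \<Longrightarrow> g (idem d n \<chi> \<otimes>\<^bsub>YH d n\<^esub> y) = f (idem d n \<chi> \<otimes>\<^bsub>YH d n\<^esub> y)"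
  shows "g y = f y"
proof -
  have c: "(\<lambda>\<chi>. f (idem d n \<chi>)) \<in> chars d n \<rightarrow> carrier (Mats d \<xi> n)"
    using f_idem(1) by (intro Pi_I hom_closed)
  have "g y = (\<Oplus>\<^bsub>Mats d \<xi> n\<^esub>\<chi>\<in>chars d n. f (idem d n \<chi>)) \<otimes>\<^bsub>Mats d \<xi> n\<^esub> g y"
    unfolding sum_idem by (rule B.l_one[OF g.hom_closed[OF y], symmetric])
  also have "\<dots> = (\<Oplus>\<^bsub>Mats d \<xi> n\<^esub>\<chi>\<in>chars d n. f (idem d n \<chi>) \<otimes>\<^bsub>Mats d \<xi> n\<^esub> g y)"
    by (rule B.finsum_ldistr[OF finite_chars g.hom_closed[OF y] c])
  also have "\<dots> = (\<Oplus>\<^bsub>Mats d \<xi> n\<^esub>\<chi>\<in>chars d n. f (idem d n \<chi>) \<otimes>\<^bsub>Mats d \<xi> n\<^esub> f y)"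
  proof (rule B.finsum_cong'[OF refl])
    show "(\<lambda>\<chi>. f (idem d n \<chi>) \<otimes>\<^bsub>Mats d \<xi> n\<^esub> f y) \<in> chars d n \<rightarrow> carrier (Mats d \<xi> n)"
      using f_idem(1) y by (intro Pi_I B.m_closed hom_closed)
    show "f (idem d n \<chi>) \<otimes>\<^bsub>Mats d \<xi> n\<^esub> g y = f (idem d n \<chi>) \<otimes>\<^bsub>Mats d \<xi> n\<^esub> f y" if "\<chi> \<in> chars d n" for \<chi>
      using eq[OF that] unfolding g.hom_mult[OF f_idem(1)[OF that] y] hom_mult[OF f_idem(1)[OF that] y] g_idem[OF that] .
  qed
  also have "\<dots> = (\<Oplus>\<^bsub>Mats d \<xi> n\<^esub>\<chi>\<in>chars d n. f (idem d n \<chi>)) \<otimes>\<^bsub>Mats d \<xi> n\<^esub> f y"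
    by (rule B.finsum_ldistr[OF finite_chars hom_closed[OF y] c, symmetric])
  also have "\<dots> = f y"
    unfolding sum_idem by (rule B.l_one[OF hom_closed[OF y]])
  finally show ?thesis .
qed

text \<open>E_\<chi> g_i and E_\<chi> X_1 are prescribed directly, with w = s_i or with \<lambda>
  the first unit vector. The inverse of X_1 follows since homomorphisms respect inverses, and t_j
  follows from \<open>idem_T\<close>.\<close>

lemma g_gen: "x \<in> yh_gens n \<Longrightarrow> g (yh_gen d n x) = f (yh_gen d n x)"
proof -
  assume x: "x \<in> yh_gens n"
  have X1: "g (yh_gen d n X1) = f (yh_gen d n X1)" if n: "1 \<le> n"
  proof (rule g_eq)
    show "yh_gen d n X1 \<in> carrier (YH d n)"
      using n by simp
    show "g (idem d n \<chi> \<otimes>\<^bsub>YH d n\<^esub> yh_gen d n X1) = f (idem d n \<chi> \<otimes>\<^bsub>YH d n\<^esub> yh_gen d n X1)" if "\<chi> \<in> chars d n" for \<chi>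
      using gv[OF that permutes_id, of "\<lambda>j. if j = 1 then 1 else 0"] f_idem(1)[OF that] n
      unfolding inv_id yh_gw_id yh_Xpow_1[OF n] by simp
  qed
  show ?thesis
  proof (cases x)
    case (G i)
    then have i: "i \<in> {1..<n}"
      using x by simp
    show ?thesis
      unfolding G yh_g_def[symmetric]
    proof (rule g_eq[OF g_closed[OF i]])
      fix \<chi> assume \<chi>: "\<chi> \<in> chars d n"
      have "yh_gw d n (inv_into UNIV (sw i)) = yh_g d n i"
        unfolding yh_gw_def inv_transpose_eq reduced_word_sw[OF i] using g_closed[OF i, of d] by simp
      then show "g (idem d n \<chi> \<otimes>\<^bsub>YH d n\<^esub> yh_g d n i) = f (idem d n \<chi> \<otimes>\<^bsub>YH d n\<^esub> yh_g d n i)"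
        using gv[OF \<chi> sw_permutes[OF i], of "\<lambda>_. 0"] f_idem(1)[OF \<chi>] unfolding yh_Xpow_0 by simp
    qed
  next
    case X1
    then show ?thesis
      using \<open>1 \<le> n \<Longrightarrow> _\<close> x by simp
  next
    case X1inv
    then have n: "1 \<le> n"
      using x by simp
    show ?thesis
      unfolding X1inv X1_Units(2)[OF n, symmetric]
      by (simp only: g.hom_inv[OF X1_Units(1)[OF n]] hom_inv[OF X1_Units(1)[OF n]] X1[OF n])
  next
    case (T j)
    then have j: "j \<in> {1..n}"
      using x by simp
    show ?thesis
      unfolding T yh_t_def[symmetric]
    proof (rule g_eq[OF t_closed[OF j]])
      fix \<chi> assume \<chi>: "\<chi> \<in> chars d n"
      have "idem d n \<chi> \<otimes>\<^bsub>YH d n\<^esub> yh_t d n j = K_const (\<chi> j) \<odot>\<^bsub>YH d n\<^esub> idem d n \<chi>"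
        by (rule idem_T[OF d chars_root[OF \<chi>] j])
      then show "g (idem d n \<chi> \<otimes>\<^bsub>YH d n\<^esub> yh_t d n j) = f (idem d n \<chi> \<otimes>\<^bsub>YH d n\<^esub> yh_t d n j)"
        by (simp only: g.hom_smult[OF f_idem(1)[OF \<chi>]] hom_smult[OF f_idem(1)[OF \<chi>]] g_idem[OF \<chi>])
    qed
  qed
qed

lemma g_word: "w \<in> lists (yh_gens n) \<Longrightarrow> g (yh_word d n w) = f (yh_word d n w)"
proof -
  assume w: "w \<in> lists (yh_gens n)"
  have set: "set (map (yh_gen d n) w) \<subseteq> carrier (YH d n)"
    using w by (auto simp: in_lists_conv_set)
  have "map g (map (yh_gen d n) w) = map f (map (yh_gen d n) w)"
    using w g_gen by (auto simp: in_lists_conv_set)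
  then show ?thesis
    unfolding yh_word_eval[OF w] by (simp only: g.hom_mprod[OF set] hom_mprod[OF set])
qed

end

end

theorem (in roots) Psi_word:
  shows "Psi d \<xi> n \<in> K_algebra_hom (YH d n) (Mats d \<xi> n)"
    and "w \<in> lists (yh_gens n) \<Longrightarrow> Psi d \<xi> n (yh_word d n w) = mono_mat n (wperm w) (wval n w)"
proof -
  obtain f where f: "f \<in> K_algebra_hom (YH d n) (Mats d \<xi> n)"
    "\<And>w. w \<in> lists (yh_gens n) \<Longrightarrow> f (yh_word d n w) = mono_mat n (wperm w) (wval n w)"
    by (rule Phi_exists) blast
  interpret F: Phi_hom d \<xi> n f
    by (intro Phi_hom.intro Phi_hom_axioms.intro roots_axioms K_hom.intro K_hom_axioms.intro K_alg_YH K_alg_Mats f)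
  have "Psi d \<xi> n \<in> K_algebra_hom (YH d n) (Mats d \<xi> n) \<and>
    (\<forall>\<chi>\<in>chars d n. \<forall>lam. \<forall>w. w permutes {1..n} \<longrightarrow>
        Psi d \<xi> n (idem d n \<chi> \<otimes>\<^bsub>YH d n\<^esub> yh_Xpow d n lam \<otimes>\<^bsub>YH d n\<^esub> yh_gw d n (inv_into UNIV w))
          = Psi_value d \<xi> n \<chi> lam w)"
    unfolding Psi_def by (rule someI[of _ f]) (intro conjI ballI allI impI f(1) F.f_value)
  then have P: "Psi d \<xi> n \<in> K_algebra_hom (YH d n) (Mats d \<xi> n)"
    and v: "\<And>\<chi> lam w. \<chi> \<in> chars d n \<Longrightarrow> w permutes {1..n} \<Longrightarrow>
        Psi d \<xi> n (idem d n \<chi> \<otimes>\<^bsub>YH d n\<^esub> yh_Xpow d n lam \<otimes>\<^bsub>YH d n\<^esub> yh_gw d n (inv_into UNIV w))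
          = f (idem d n \<chi> \<otimes>\<^bsub>YH d n\<^esub> yh_Xpow d n lam \<otimes>\<^bsub>YH d n\<^esub> yh_gw d n (inv_into UNIV w))"
    by (simp_all only: F.f_value)
  show "Psi d \<xi> n \<in> K_algebra_hom (YH d n) (Mats d \<xi> n)"
    by (rule P)
  show "Psi d \<xi> n (yh_word d n w) = mono_mat n (wperm w) (wval n w)" if w: "w \<in> lists (yh_gens n)"
    using f(2)[OF w] by (subst F.g_word[OF P _ w]) (rule v)
qed

section \<open>Traces\<close>

lemma hecke_0:
  assumes "x \<in> carrier (YH d 0)"
  obtains c where "x = c \<odot>\<^bsub>YH d 0\<^esub> \<one>\<^bsub>YH d 0\<^esub>"
proof -
  have "\<exists>c. x = c \<odot>\<^bsub>YH d 0\<^esub> \<one>\<^bsub>YH d 0\<^esub>"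
    using assms
  proof (induction x rule: YH_induct)
    case (word w)
    then have "w = []"
      by (cases w) (simp_all add: yh_gens_def)
    then show ?case
      by (intro exI[of _ 1]) (simp add: yh_word_Nil)
  next
    case (add x y)
    then show ?case
      by (auto simp flip: YA.smult_l_distr)
  next
    case (smult c x)
    then show ?case
      by (auto simp: YA.smult_smult)
  qed
  then show ?thesis
    using that by blast
qed

text \<open>Without relations the ideal is zero, so the coefficient of the empty word can be read
  off a class. This gives the uniqueness behind the definite description in
  \<open>trace0\<close>.\<close>

lemma hecke_0_unique:
  assumes "c \<odot>\<^bsub>YH d 0\<^esub> \<one>\<^bsub>YH d 0\<^esub> = c' \<odot>\<^bsub>YH d 0\<^esub> \<one>\<^bsub>YH d 0\<^esub>"
  shows "c = c'"
proof -
  interpret Q: K_quot "FA 0" "yh_rels d 0"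
    by (rule K_quot_YH)
  have nil: "[] \<in> lists (yh_gens 0)"
    by simp
  have "yh_rels d 0 = {}"
    unfolding yh_rels_eq word_rels_def by simp
  then have "Q.I \<subseteq> {\<zero>\<^bsub>FA 0\<^esub>}"
    using Q.genideal_minimal[OF Q.zeroideal, of "{}"] by simp
  moreover have "Poly_Mapping.single [] c \<ominus>\<^bsub>FA 0\<^esub> Poly_Mapping.single [] c' \<in> Q.I"
    using assms unfolding yh_word_Nil[symmetric] yh_class_single[OF nil, symmetric]
    by (simp only: Q.cls_eq_iff[OF mon_closed[OF nil] mon_closed[OF nil]])
  ultimately have "Poly_Mapping.single [] c \<ominus>\<^bsub>FA 0\<^esub> Poly_Mapping.single [] c' = 0"
    unfolding monoid_algebra_simps by blast
  then have "Poly_Mapping.single ([]::gen list) c - Poly_Mapping.single [] c' = 0"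
    by (simp only: monoid_algebra_minus[OF monoid_free_monoid mon_closed[OF nil] mon_closed[OF nil]])
  then have "Poly_Mapping.lookup (Poly_Mapping.single ([]::gen list) c) [] = Poly_Mapping.lookup (Poly_Mapping.single [] c') []"
    by simp
  then show ?thesis
    by (simp only: lookup_single_eq)
qed

lemma trace0_scalar: "trace0 (c \<odot>\<^bsub>hecke 0\<^esub> \<one>\<^bsub>hecke 0\<^esub>) = c"
  unfolding trace0_def by (rule the_equality) (auto dest: hecke_0_unique)

lemma K_linear_trace0: "K_linear (hecke 0) trace0"
  unfolding K_linear_def
proof (intro conjI ballI allI)
  fix x y assume x: "x \<in> carrier (hecke 0)" "y \<in> carrier (hecke 0)"
  obtain a b where ab: "x = a \<odot>\<^bsub>hecke 0\<^esub> \<one>\<^bsub>hecke 0\<^esub>" "y = b \<odot>\<^bsub>hecke 0\<^esub> \<one>\<^bsub>hecke 0\<^esub>"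
    using hecke_0[OF x(1)] hecke_0[OF x(2)] by metis
  show "trace0 (x \<oplus>\<^bsub>hecke 0\<^esub> y) = trace0 x + trace0 y"
    unfolding ab YA.smult_l_distr[OF YA.one_closed, symmetric] trace0_scalar ..
next
  fix c x assume x: "x \<in> carrier (hecke 0)"
  obtain a where a: "x = a \<odot>\<^bsub>hecke 0\<^esub> \<one>\<^bsub>hecke 0\<^esub>"
    using hecke_0[OF x] by metis
  show "trace0 (c \<odot>\<^bsub>hecke 0\<^esub> x) = c * trace0 x"
    unfolding a YA.smult_smult[OF YA.one_closed] trace0_scalar ..
qed

lemma hecke_0_commute:
  assumes x: "x \<in> carrier (YH d 0)" "y \<in> carrier (YH d 0)"
  shows "x \<otimes>\<^bsub>YH d 0\<^esub> y = y \<otimes>\<^bsub>YH d 0\<^esub> x"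
proof -
  obtain a where a: "x = a \<odot>\<^bsub>YH d 0\<^esub> \<one>\<^bsub>YH d 0\<^esub>"
    by (rule hecke_0[OF x(1)])
  show ?thesis
    unfolding a using x(2) by (simp only: YA.scalar_mult)
qed

lemma finite_compositions: "finite (compositions d n)"
proof (rule finite_subset)
  show "compositions d n \<subseteq> {f. \<forall>a. (a \<in> {1..d} \<longrightarrow> f a \<in> {0..n}) \<and> (a \<notin> {1..d} \<longrightarrow> f a = 0)}"
  proof (intro subsetI CollectI allI conjI impI)
    fix \<mu> a assume \<mu>: "\<mu> \<in> compositions d n"
    show "\<mu> a = 0" if "a \<notin> {1..d}"
      using \<mu> that unfolding compositions_def by blast
    show "\<mu> a \<in> {0..n}" if "a \<in> {1..d}"
      using member_le_sum[OF that, of \<mu>] \<mu> unfolding compositions_def by simp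
  qed
  show "finite {f. \<forall>a. (a \<in> {1..d} \<longrightarrow> f a \<in> {0..n}) \<and> (a \<notin> {1..d} \<longrightarrow> f a = (0::nat))}"
    by (rule finite_set_of_finite_funs) simp_all
qed

locale markov_family = roots +
  fixes \<tau> :: "(nat \<Rightarrow> nat) \<Rightarrow> nat \<Rightarrow> nat \<Rightarrow> yh \<Rightarrow> laurent"
  assumes \<tau>: "m \<in> Soc d \<Longrightarrow> a \<in> {1..d} \<Longrightarrow> m a \<noteq> 0 \<Longrightarrow> markov_trace 1 (\<tau> m a)"
begin

abbreviation fam :: "(nat \<Rightarrow> nat) \<Rightarrow> nat \<Rightarrow> yh \<Rightarrow> laurent" where
  "fam \<mu> a \<equiv> with_trace0 (\<tau> (socle \<mu>) a) (\<mu> a)"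

abbreviation "L \<mu> \<equiv> tensor_form {1..d} (fam \<mu>)"

text \<open>The condition n \<ge> 1 puts the socle into \<open>Soc d\<close>, and a positive part
  makes the socle nonzero at a, as the hypothesis on \<tau> demands.\<close>

lemma fam_markov:
  assumes "\<mu> \<in> compositions d n" "1 \<le> n" "a \<in> {1..d}" "1 \<le> \<mu> a"
  shows "markov_trace 1 (\<tau> (socle \<mu>) a)"
  using assms by (intro \<tau>) (auto simp: Soc_def socle_def)

lemma fam_linear:
  assumes "\<mu> \<in> compositions d n" "1 \<le> n" "a \<in> {1..d}"
  shows "K_linear (hecke (\<mu> a)) (fam \<mu> a)"
proof (cases "\<mu> a = 0")
  case True
  then show ?thesis
    by (simp only: with_trace0_def K_linear_trace0 simp_thms if_True)
next
  case False
  then have "1 \<le> \<mu> a"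
    by simp
  with fam_markov[OF assms this] show ?thesis
    unfolding with_trace0_def markov_trace_def using False by simp
qed

lemma fam_trace:
  assumes "\<mu> \<in> compositions d n" "1 \<le> n" "a \<in> {1..d}" "x \<in> carrier (hecke (\<mu> a))" "y \<in> carrier (hecke (\<mu> a))"
  shows "fam \<mu> a (x \<otimes>\<^bsub>hecke (\<mu> a)\<^esub> y) = fam \<mu> a (y \<otimes>\<^bsub>hecke (\<mu> a)\<^esub> x)"
proof (cases "\<mu> a = 0")
  case True
  have "x \<otimes>\<^bsub>hecke (\<mu> a)\<^esub> y = y \<otimes>\<^bsub>hecke (\<mu> a)\<^esub> x"
    using assms(4,5) unfolding True by (rule hecke_0_commute)
  then show ?thesis
    by (simp only:)
next
  case False
  then have "1 \<le> \<mu> a"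
    by simp
  with fam_markov[OF assms(1-3) this] show ?thesis
    unfolding with_trace0_def markov_trace_def using False assms(4,5) by simp
qed

lemma tensor_form_alg_fam:
  assumes "\<mu> \<in> compositions d n" "1 \<le> n"
  shows "tensor_form_alg {1..d} (\<lambda>a. hecke (\<mu> a)) (fam \<mu>)"
  by (intro tensor_form_alg.intro tensor_form_alg_axioms.intro tensor_alg_hecke fam_linear[OF assms])

context
  fixes n :: nat and \<mu> :: "nat \<Rightarrow> nat"
  assumes \<mu>: "\<mu> \<in> compositions d n" and n: "1 \<le> n"
begin

interpretation F: tensor_form_alg "{1..d}" "\<lambda>a. hecke (\<mu> a)" "fam \<mu>"
  by (rule tensor_form_alg_fam[OF \<mu> n])

lemmas Hmu_fold = Hmu_def[of d \<mu>, symmetric]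

lemmas L_add = F.TF_add[unfolded Hmu_fold]
  and L_smult = F.TF_smult[unfolded Hmu_fold]
  and L_zero = F.TF_zero[unfolded Hmu_fold]
  and L_finsum = F.TF_finsum[unfolded Hmu_fold]

lemma L_commute:
  assumes "x \<in> carrier (Hmu d \<mu>)" "y \<in> carrier (Hmu d \<mu>)"
  shows "L \<mu> (x \<otimes>\<^bsub>Hmu d \<mu>\<^esub> y) = L \<mu> (y \<otimes>\<^bsub>Hmu d \<mu>\<^esub> x)"
  using assms unfolding Hmu_def by (intro F.TF_commute fam_trace[OF \<mu> n])

end

section \<open>The linear form on matrices\<close>

definition form :: "nat \<Rightarrow> mats \<Rightarrow> laurent" where
  "form n M = (\<Sum>\<mu>\<in>compositions d n. L \<mu> (mat_trace (chars_of d \<xi> n \<mu>) (Hmu d \<mu>) (M \<mu>)))"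

lemma combined_form: "combined_trace d \<xi> \<tau> n y = form n (Psi d \<xi> n y)"
  unfolding combined_trace_def form_def ..

lemma form_entries:
  assumes n: "1 \<le> n" and M: "M \<in> carrier (Mats d \<xi> n)"
  shows "form n M = (\<Sum>\<mu>\<in>compositions d n. \<Sum>\<psi>\<in>chars_of d \<xi> n \<mu>. L \<mu> (M \<mu> \<psi> \<psi>))"
  unfolding form_def mat_trace_def
proof (rule sum.cong[OF refl], rule L_finsum[OF _ n])
  fix \<mu> assume \<mu>: "\<mu> \<in> compositions d n"
  show "\<mu> \<in> compositions d n" "finite (chars_of d \<xi> n \<mu>)"
    by (rule \<mu>, rule finite_chars_of)
  show "M \<mu> \<psi> \<psi> \<in> carrier (Hmu d \<mu>)" if "\<psi> \<in> chars_of d \<xi> n \<mu>" for \<psi>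
    using PiE_mem[OF PiE_mem[OF PiE_mem[OF M[unfolded Mats_carrier] \<mu>] that] that] .
qed

lemma Mats_entry:
  assumes "M \<in> carrier (Mats d \<xi> n)" "\<mu> \<in> compositions d n" "\<psi> \<in> chars_of d \<xi> n \<mu>" "\<psi>' \<in> chars_of d \<xi> n \<mu>"
  shows "M \<mu> \<psi> \<psi>' \<in> carrier (Hmu d \<mu>)"
  using PiE_mem[OF PiE_mem[OF PiE_mem[OF assms(1)[unfolded Mats_carrier] assms(2)] assms(3)] assms(4)] .

lemma form_add:
  assumes n: "1 \<le> n" and M: "M \<in> carrier (Mats d \<xi> n)" "N \<in> carrier (Mats d \<xi> n)"
  shows "form n (M \<oplus>\<^bsub>Mats d \<xi> n\<^esub> N) = form n M + form n N"
proof -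
  interpret M: K_alg "Mats d \<xi> n"
    by (rule K_alg_Mats)
  have "L \<mu> ((M \<oplus>\<^bsub>Mats d \<xi> n\<^esub> N) \<mu> \<psi> \<psi>) = L \<mu> (M \<mu> \<psi> \<psi>) + L \<mu> (N \<mu> \<psi> \<psi>)"
    if \<mu>: "\<mu> \<in> compositions d n" and \<psi>: "\<psi> \<in> chars_of d \<xi> n \<mu>" for \<mu> \<psi>
  proof -
    have "(M \<oplus>\<^bsub>Mats d \<xi> n\<^esub> N) \<mu> \<psi> \<psi> = M \<mu> \<psi> \<psi> \<oplus>\<^bsub>Hmu d \<mu>\<^esub> N \<mu> \<psi> \<psi>"
      using \<mu> \<psi> unfolding Mats_def by simp
    then show ?thesis
      using L_add[OF \<mu> n Mats_entry[OF M(1) \<mu> \<psi> \<psi>] Mats_entry[OF M(2) \<mu> \<psi> \<psi>]] by (simp only:)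
  qed
  then show ?thesis
    unfolding form_entries[OF n M(1)] form_entries[OF n M(2)] form_entries[OF n M.a_closed[OF M]] sum.distrib[symmetric]
    by (intro sum.cong refl)
qed

lemma form_smult:
  assumes n: "1 \<le> n" and M: "M \<in> carrier (Mats d \<xi> n)"
  shows "form n (c \<odot>\<^bsub>Mats d \<xi> n\<^esub> M) = c * form n M"
proof -
  interpret M: K_alg "Mats d \<xi> n"
    by (rule K_alg_Mats)
  have "L \<mu> ((c \<odot>\<^bsub>Mats d \<xi> n\<^esub> M) \<mu> \<psi> \<psi>) = c * L \<mu> (M \<mu> \<psi> \<psi>)"
    if \<mu>: "\<mu> \<in> compositions d n" and \<psi>: "\<psi> \<in> chars_of d \<xi> n \<mu>" for \<mu> \<psi>
  proof -
    have "(c \<odot>\<^bsub>Mats d \<xi> n\<^esub> M) \<mu> \<psi> \<psi> = c \<odot>\<^bsub>Hmu d \<mu>\<^esub> M \<mu> \<psi> \<psi>"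
      using \<mu> \<psi> unfolding Mats_def by simp
    then show ?thesis
      using L_smult[OF \<mu> n Mats_entry[OF M \<mu> \<psi> \<psi>]] by (simp only:)
  qed
  then show ?thesis
    unfolding form_entries[OF n M] form_entries[OF n M.smult_closed[OF M]] sum_distrib_left
    by (intro sum.cong refl)
qed

lemma form_commute:
  assumes n: "1 \<le> n" and M: "M \<in> carrier (Mats d \<xi> n)" "N \<in> carrier (Mats d \<xi> n)"
  shows "form n (M \<otimes>\<^bsub>Mats d \<xi> n\<^esub> N) = form n (N \<otimes>\<^bsub>Mats d \<xi> n\<^esub> M)"
proof -
  interpret M: K_alg "Mats d \<xi> n"
    by (rule K_alg_Mats)
  have entry: "L \<mu> ((M \<otimes>\<^bsub>Mats d \<xi> n\<^esub> N) \<mu> \<psi> \<psi>) = (\<Sum>\<psi>'\<in>chars_of d \<xi> n \<mu>. L \<mu> (M \<mu> \<psi> \<psi>' \<otimes>\<^bsub>Hmu d \<mu>\<^esub> N \<mu> \<psi>' \<psi>))"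
    if M: "M \<in> carrier (Mats d \<xi> n)" "N \<in> carrier (Mats d \<xi> n)"
      and \<mu>: "\<mu> \<in> compositions d n" and \<psi>: "\<psi> \<in> chars_of d \<xi> n \<mu>" for M N \<mu> \<psi>
  proof -
    have "(M \<otimes>\<^bsub>Mats d \<xi> n\<^esub> N) \<mu> \<psi> \<psi> = (\<Oplus>\<^bsub>Hmu d \<mu>\<^esub>\<psi>'\<in>chars_of d \<xi> n \<mu>. M \<mu> \<psi> \<psi>' \<otimes>\<^bsub>Hmu d \<mu>\<^esub> N \<mu> \<psi>' \<psi>)"
      using \<mu> \<psi> unfolding Mats_def by simp
    moreover have "L \<mu> \<dots> = (\<Sum>\<psi>'\<in>chars_of d \<xi> n \<mu>. L \<mu> (M \<mu> \<psi> \<psi>' \<otimes>\<^bsub>Hmu d \<mu>\<^esub> N \<mu> \<psi>' \<psi>))"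
      by (intro L_finsum[OF \<mu> n] finite_chars_of HA.m_closed Mats_entry[OF M(1)] Mats_entry[OF M(2)] \<mu> \<psi>)
    ultimately show ?thesis
      by (simp only:)
  qed
  have swap: "(\<Sum>\<psi>\<in>chars_of d \<xi> n \<mu>. L \<mu> ((M \<otimes>\<^bsub>Mats d \<xi> n\<^esub> N) \<mu> \<psi> \<psi>)) = (\<Sum>\<psi>\<in>chars_of d \<xi> n \<mu>. L \<mu> ((N \<otimes>\<^bsub>Mats d \<xi> n\<^esub> M) \<mu> \<psi> \<psi>))"
    if \<mu>: "\<mu> \<in> compositions d n" for \<mu>
  proof -
    have "(\<Sum>\<psi>\<in>chars_of d \<xi> n \<mu>. L \<mu> ((M \<otimes>\<^bsub>Mats d \<xi> n\<^esub> N) \<mu> \<psi> \<psi>))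
      = (\<Sum>\<psi>\<in>chars_of d \<xi> n \<mu>. \<Sum>\<psi>'\<in>chars_of d \<xi> n \<mu>. L \<mu> (M \<mu> \<psi> \<psi>' \<otimes>\<^bsub>Hmu d \<mu>\<^esub> N \<mu> \<psi>' \<psi>))"
      by (intro sum.cong refl entry[OF M \<mu>])
    also have "\<dots> = (\<Sum>\<psi>\<in>chars_of d \<xi> n \<mu>. \<Sum>\<psi>'\<in>chars_of d \<xi> n \<mu>. L \<mu> (N \<mu> \<psi>' \<psi> \<otimes>\<^bsub>Hmu d \<mu>\<^esub> M \<mu> \<psi> \<psi>'))"
      by (intro sum.cong refl L_commute[OF \<mu> n] Mats_entry[OF M(1)] Mats_entry[OF M(2)] \<mu>)
    also have "\<dots> = (\<Sum>\<psi>'\<in>chars_of d \<xi> n \<mu>. \<Sum>\<psi>\<in>chars_of d \<xi> n \<mu>. L \<mu> (N \<mu> \<psi>' \<psi> \<otimes>\<^bsub>Hmu d \<mu>\<^esub> M \<mu> \<psi> \<psi>'))"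
      by (rule sum.swap)
    also have "\<dots> = (\<Sum>\<psi>'\<in>chars_of d \<xi> n \<mu>. L \<mu> ((N \<otimes>\<^bsub>Mats d \<xi> n\<^esub> M) \<mu> \<psi>' \<psi>'))"
      by (intro sum.cong refl entry[OF M(2,1) \<mu>, symmetric])
    finally show ?thesis .
  qed
  show ?thesis
    unfolding form_entries[OF n M.m_closed[OF M]] form_entries[OF n M.m_closed[OF M(2,1)]]
    by (rule sum.cong[OF refl swap])
qed

text \<open>A row meets the diagonal only at a fixed point of \<open>\<sigma>\<close>, and the sum
  over compositions and their characters regroups into one sum over all characters.\<close>

lemma form_mono_mat:
  assumes n: "1 \<le> n" and a: "adm n \<sigma> h"
  shows "form n (mono_mat n \<sigma> h) = (\<Sum>\<chi>\<in>chars d n. if \<sigma> \<chi> = \<chi> then L (Comp d \<xi> n \<chi>) (h \<chi>) else 0)"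
proof -
  have "form n (mono_mat n \<sigma> h)
    = (\<Sum>\<mu>\<in>compositions d n. \<Sum>\<psi>\<in>{\<chi> \<in> chars d n. Comp d \<xi> n \<chi> = \<mu>}. if \<sigma> \<psi> = \<psi> then L (Comp d \<xi> n \<psi>) (h \<psi>) else 0)"
    unfolding form_entries[OF n mono_mat_closed[OF a]] chars_of_def[symmetric]
  proof (intro sum.cong refl)
    fix \<mu> \<psi> assume \<mu>: "\<mu> \<in> compositions d n" and \<psi>: "\<psi> \<in> chars_of d \<xi> n \<mu>"
    have m: "mono_mat n \<sigma> h \<mu> \<psi> \<psi> = (if \<psi> = \<sigma> \<psi> then h \<psi> else \<zero>\<^bsub>Hmu d \<mu>\<^esub>)"
      unfolding mono_mat_def using \<mu> \<psi> by simp
    have c: "Comp d \<xi> n \<psi> = \<mu>"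
      using chars_ofD[OF \<psi>] by blast
    show "L \<mu> (mono_mat n \<sigma> h \<mu> \<psi> \<psi>) = (if \<sigma> \<psi> = \<psi> then L (Comp d \<xi> n \<psi>) (h \<psi>) else 0)"
      unfolding m c using L_zero[OF \<mu> n] by (cases "\<sigma> \<psi> = \<psi>") simp_all
  qed
  also have "\<dots> = (\<Sum>\<chi>\<in>chars d n. if \<sigma> \<chi> = \<chi> then L (Comp d \<xi> n \<chi>) (h \<chi>) else 0)"
    by (rule sum.group[OF finite_chars finite_compositions]) (use Comp_composition in blast)
  finally show ?thesis .
qed

lemma Psi_hom: "K_hom (YH d n) (Mats d \<xi> n) (Psi d \<xi> n)"
  by (intro K_hom.intro K_hom_axioms.intro K_alg_YH K_alg_Mats Psi_word(1))

lemma combined_linear: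
  assumes "1 \<le> n" shows "K_linear (YH d n) (combined_trace d \<xi> \<tau> n)"
proof -
  interpret P: K_hom "YH d n" "Mats d \<xi> n" "Psi d \<xi> n"
    by (rule Psi_hom)
  show ?thesis
    unfolding K_linear_def combined_form using form_add[OF assms] form_smult[OF assms] by simp
qed

lemma combined_commute:
  assumes "1 \<le> n" "x \<in> carrier (YH d n)" "y \<in> carrier (YH d n)"
  shows "combined_trace d \<xi> \<tau> n (x \<otimes>\<^bsub>YH d n\<^esub> y) = combined_trace d \<xi> \<tau> n (y \<otimes>\<^bsub>YH d n\<^esub> x)"
proof -
  interpret P: K_hom "YH d n" "Mats d \<xi> n" "Psi d \<xi> n"
    by (rule Psi_hom)
  show ?thesis
    unfolding combined_form using form_commute[OF assms(1)] assms(2,3) by simp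
qed

end

subsection \<open>Adding a strand\<close>

text \<open>Abstracts what the last generator and its inverse have in common, so that one argument
  covers both Markov conditions. The quantification over all Markov traces is there because the
  trace in a factor varies with the socle.\<close>

definition markov_elt :: "nat \<Rightarrow> yh \<Rightarrow> bool" where
  "markov_elt m g \<longleftrightarrow> g \<in> carrier (hecke (Suc m)) \<and>
     (\<forall>\<rho> x. markov_trace 1 \<rho> \<longrightarrow> x \<in> carrier (hecke m) \<longrightarrow>
        \<rho> (Suc m) (yh_incl 1 m x \<otimes>\<^bsub>hecke (Suc m)\<^esub> g) = \<rho> m x)"

lemma markov_elt_g:
  assumes "1 \<le> m"
  shows "markov_elt m (yh_g 1 (Suc m) m)" "markov_elt m (inv\<^bsub>hecke (Suc m)\<^esub> yh_g 1 (Suc m) m)"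
proof -
  have m: "m \<in> {1..<Suc m}"
    using assms by simp
  have c: "yh_g 1 (Suc m) m \<in> carrier (hecke (Suc m))" "inv\<^bsub>hecke (Suc m)\<^esub> yh_g 1 (Suc m) m \<in> carrier (hecke (Suc m))"
    by (rule g_closed[OF m], rule YA.Units_inv_closed[OF G_Units[OF order_refl m]])
  show "markov_elt m (yh_g 1 (Suc m) m)" "markov_elt m (inv\<^bsub>hecke (Suc m)\<^esub> yh_g 1 (Suc m) m)"
    unfolding markov_elt_def markov_trace_def using c assms by blast+
qed

lemma sum_fun_upd_Suc:
  fixes \<mu> :: "'a \<Rightarrow> nat"
  assumes "finite S" "a \<in> S" shows "sum (\<mu>(a := Suc (\<mu> a))) S = Suc (sum \<mu> S)"
  using assms by (simp add: sum.remove[of S a])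

lemma compositions_Suc:
  assumes "\<mu> \<in> compositions d n" "a \<in> {1..d}"
  shows "\<mu>(a := Suc (\<mu> a)) \<in> compositions d (Suc n)"
proof -
  have "sum (\<mu>(a := Suc (\<mu> a))) {1..d} = Suc (sum \<mu> {1..d})"
    by (rule sum_fun_upd_Suc) (use assms(2) in simp_all)
  then show ?thesis
    using assms unfolding compositions_def by auto
qed

text \<open>The map on tensor products that adds a strand to the a-th factor. Its values on
  generators are used to compare matrix entries in \<open>wval_ext\<close>, and its values on pure
  tensors to evaluate the form in \<open>L_lift\<close>.\<close>

lemma lift_exists:
  assumes a: "a \<in> {1..d}"
  obtains \<iota> where "\<iota> \<in> K_algebra_hom (Hmu d \<mu>) (Hmu d (\<mu>(a := Suc (\<mu> a))))"
    "\<And>b x. b \<in> {1..d} \<Longrightarrow> x \<in> yh_gens (\<mu> b) \<Longrightarrow> \<iota> (hg d \<mu> b x) = hg d (\<mu>(a := Suc (\<mu> a))) b x"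
    "\<And>h. h \<in> (\<Pi> i\<in>{1..d}. carrier (hecke (\<mu> i))) \<Longrightarrow> \<iota> (pure_tensor {1..d} (\<lambda>i. hecke (\<mu> i)) h)
      = pure_tensor {1..d} (\<lambda>i. hecke ((\<mu>(a := Suc (\<mu> a))) i)) (\<lambda>i. if i = a then yh_incl 1 (\<mu> a) (h i) else h i)"
proof -
  let ?\<mu> = "\<mu>(a := Suc (\<mu> a))"
  let ?\<phi> = "\<lambda>i x. if i = a then yh_incl 1 (\<mu> a) x else x"
  have hom: "?\<phi> i \<in> K_algebra_hom (hecke (\<mu> i)) (hecke (?\<mu> i))" for i
  proof (cases "i = a")
    case True
    then show ?thesis
      using yh_incl(1)[of 1 "\<mu> a"] by simp
  next
    case False
    then show ?thesis
      by (simp add: K_algebra_hom_def ring_hom_def)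
  qed
  interpret T': tensor_alg "{1..d}" "\<lambda>i. hecke (?\<mu> i)"
    by (rule tensor_alg_hecke)
  obtain \<iota> where \<iota>: "\<iota> \<in> K_algebra_hom (Hmu d \<mu>) (Hmu d ?\<mu>)"
    "\<And>h. h \<in> (\<Pi> i\<in>{1..d}. carrier (hecke (\<mu> i))) \<Longrightarrow> \<iota> (pure_tensor {1..d} (\<lambda>i. hecke (\<mu> i)) h)
      = pure_tensor {1..d} (\<lambda>i. hecke (?\<mu> i)) (\<lambda>i. ?\<phi> i (h i))"
    unfolding Hmu_def using tensor_map[OF tensor_alg_hecke tensor_alg_hecke, where \<phi> = ?\<phi>, OF hom] by blast
  show thesis
  proof (rule that[OF \<iota>(1) _ \<iota>(2)])
    fix b x assume b: "b \<in> {1..d}" and x: "x \<in> yh_gens (\<mu> b)"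
    have h: "(\<lambda>i. \<one>\<^bsub>hecke (\<mu> i)\<^esub>)(b := yh_gen 1 (\<mu> b) x) \<in> (\<Pi> i\<in>{1..d}. carrier (hecke (\<mu> i)))"
      using x by (intro Pi_I) simp
    have one: "?\<phi> i \<one>\<^bsub>hecke (\<mu> i)\<^esub> = \<one>\<^bsub>hecke (?\<mu> i)\<^esub>" for i
      using hom[of i] unfolding K_algebra_hom_def by (auto dest: ring_hom_one)
    have gen: "?\<phi> b (yh_gen 1 (\<mu> b) x) = yh_gen 1 (?\<mu> b) x"
      using yh_incl_gen[OF x, of 1] by (cases "b = a") simp_all
    show "\<iota> (hg d \<mu> b x) = hg d ?\<mu> b x"
      unfolding hg_def in_factor_def \<iota>(2)[OF h]
    proof (rule T'.pure_cong)
      fix i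
      show "?\<phi> i (((\<lambda>i. \<one>\<^bsub>hecke (\<mu> i)\<^esub>)(b := yh_gen 1 (\<mu> b) x)) i) = ((\<lambda>i. \<one>\<^bsub>hecke (?\<mu> i)\<^esub>)(b := yh_gen 1 (?\<mu> b) x)) i"
      proof (cases "i = b")
        case True
        show ?thesis
          unfolding True fun_upd_same by (rule gen)
      next
        case False
        show ?thesis
          unfolding fun_upd_other[OF False] by (rule one)
      qed
    qed
  qed
qed

text \<open>Words for n strands only exchange positions up to n, so the value at n+1 is carried
  along unchanged.\<close>

lemma wperm_ext: "w \<in> lists (yh_gens n) \<Longrightarrow> wperm w (\<psi>(Suc n := z)) = (wperm w \<psi>)(Suc n := z)"
proof (induction w arbitrary: \<psi>)
  case (Cons x w)
  have x: "x \<in> yh_gens n" and w: "w \<in> lists (yh_gens n)"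
    using Cons.prems by auto
  have "gperm x (\<psi>(Suc n := z)) = (gperm x \<psi>)(Suc n := z)"
  proof (cases x)
    case (G i)
    then have "i < n"
      using x by simp
    then show ?thesis
      unfolding G gperm.simps by (intro ext) (auto simp: transpose_def)
  qed simp_all
  then show ?case
    unfolding wperm.simps by (simp only: Cons.IH[OF w])
qed simp

context roots
begin

lemma col_ext:
  assumes "a \<in> {1..d}" shows "col (\<psi>(Suc n := \<xi> a)) = (col \<psi>)(Suc n := a)"
proof
  fix j
  show "col (\<psi>(Suc n := \<xi> a)) j = ((col \<psi>)(Suc n := a)) j"
    unfolding colour_def fun_upd_apply using inv_\<xi>[OF assms] by (simp only: if_distrib[of "inv_into {1..d} \<xi>"])
qed

lemma chars_ext:
  assumes \<psi>: "\<psi> \<in> chars d n" and a: "a \<in> {1..d}"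
  shows "\<psi>(Suc n := \<xi> a) \<in> chars d (Suc n)"
  unfolding chars_def
proof (rule PiE_I)
  fix j
  show "(\<psi>(Suc n := \<xi> a)) j \<in> {z. z ^ d = 1}" if "j \<in> {1..Suc n}"
    using chars_root[OF \<psi>, of j] \<xi>_root[OF a] that by (cases "j = Suc n") auto
  show "(\<psi>(Suc n := \<xi> a)) j = undefined" if "j \<notin> {1..Suc n}"
    using PiE_arb[OF \<psi>[unfolded chars_def], of j] that by auto
qed

lemma chars_restrict:
  assumes \<chi>: "\<chi> \<in> chars d (Suc n)"
  shows "\<chi>(Suc n := undefined) \<in> chars d n"
  unfolding chars_def
proof (rule PiE_I)
  fix j
  show "(\<chi>(Suc n := undefined)) j \<in> {z. z ^ d = 1}" if "j \<in> {1..n}"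
    using chars_root[OF \<chi>, of j] that by auto
  show "(\<chi>(Suc n := undefined)) j = undefined" if "j \<notin> {1..n}"
    using PiE_arb[OF \<chi>[unfolded chars_def], of j] that by (cases "j = Suc n") auto
qed

lemma Comp_ext:
  assumes \<psi>: "\<psi> \<in> chars d n" and a: "a \<in> {1..d}"
  shows "Comp d \<xi> (Suc n) (\<psi>(Suc n := \<xi> a)) = (Comp d \<xi> n \<psi>)(a := Suc (Comp d \<xi> n \<psi> a))"
proof
  fix b
  have "cnt ((col \<psi>)(Suc n := a)) n c = cnt (col \<psi>) n c" for c
    by (rule cnt_cong) simp
  then show "Comp d \<xi> (Suc n) (\<psi>(Suc n := \<xi> a)) b = ((Comp d \<xi> n \<psi>)(a := Suc (Comp d \<xi> n \<psi> a))) b"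
    unfolding Comp_eq[OF chars_ext[OF assms]] Comp_eq[OF \<psi>] col_ext[OF a] wt_def using a by simp
qed

lemma rank_ext: "j \<in> {1..n} \<Longrightarrow> rank ((col \<psi>)(Suc n := a)) j = rank (col \<psi>) j"
  by (rule rank_cong) auto

context
  fixes n a :: nat and \<mu> :: "nat \<Rightarrow> nat" and \<iota>
  assumes a: "a \<in> {1..d}"
    and \<iota>: "\<iota> \<in> K_algebra_hom (Hmu d \<mu>) (Hmu d (\<mu>(a := Suc (\<mu> a))))"
    and \<iota>_hg: "\<And>b x. b \<in> {1..d} \<Longrightarrow> x \<in> yh_gens (\<mu> b) \<Longrightarrow> \<iota> (hg d \<mu> b x) = hg d (\<mu>(a := Suc (\<mu> a))) b x"
begin

interpretation \<iota>: K_hom "Hmu d \<mu>" "Hmu d (\<mu>(a := Suc (\<mu> a)))" \<iota>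
  by (intro K_hom.intro K_hom_axioms.intro K_alg_Hmu \<iota>)

text \<open>The added strand comes last, so it changes neither colour nor rank of the first n
  positions; the entry is the same generator, now in the tensor product whose a-th factor has one
  strand more.\<close>

lemma gval_ext:
  assumes \<psi>: "\<psi> \<in> chars d n" and \<mu>: "Comp d \<xi> n \<psi> = \<mu>" and x: "x \<in> yh_gens n"
  shows "gval (Suc n) x (\<psi>(Suc n := \<xi> a)) = \<iota> (gval n x \<psi>)"
proof -
  let ?\<chi> = "\<psi>(Suc n := \<xi> a)"
  have C: "Comp d \<xi> (Suc n) ?\<chi> = \<mu>(a := Suc (\<mu> a))"
    unfolding Comp_ext[OF \<psi> a] \<mu> ..
  have col: "col ?\<chi> j = col \<psi> j" if "j \<in> {1..n}" for j
    unfolding col_ext[OF a] using that by simp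
  show ?thesis
  proof (cases x)
    case (G i)
    then have i: "i \<in> {1..<n}" "i \<in> {1..n}"
      using x by simp_all
    then have e: "?\<chi> i = \<psi> i" "?\<chi> (Suc i) = \<psi> (Suc i)"
      by simp_all
    show ?thesis
    proof (cases "\<psi> i = \<psi> (Suc i)")
      case True
      have "Gval (Suc n) ?\<chi> i = \<iota> (Gval n \<psi> i)"
        unfolding Gval_def C col[OF i(2)] \<mu> unfolding col_ext[OF a] rank_ext[OF i(2)]
      proof (rule \<iota>_hg[symmetric])
        show "col \<psi> i \<in> {1..d}"
          by (rule col_range[OF \<psi> i(2)])
        show "G (rank (col \<psi>) i) \<in> yh_gens (\<mu> (col \<psi> i))"
          using rank_col_less[OF \<psi> i(1) True] unfolding \<mu> by simp
      qed
      then show ?thesis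
        unfolding G gval.simps e if_P[OF True] .
    next
      case False
      show ?thesis
        unfolding G gval.simps e if_not_P[OF False] C \<mu> by (simp only: \<iota>.hom_smult \<iota>.hom_one HA.one_closed)
    qed
  next
    case X1
    then have n: "1 \<le> n" "1 \<in> {1..n}"
      using x by simp_all
    show ?thesis
      unfolding X1 gval.simps C \<mu> col[OF n(2)]
      by (rule \<iota>_hg[symmetric, OF col_range[OF \<psi> n(2)]]) (use X_pos[OF \<psi> n(1)] \<mu> in simp)
  next
    case X1inv
    then have n: "1 \<le> n" "1 \<in> {1..n}"
      using x by simp_all
    show ?thesis
      unfolding X1inv gval.simps C \<mu> col[OF n(2)]
      by (rule \<iota>_hg[symmetric, OF col_range[OF \<psi> n(2)]]) (use X_pos[OF \<psi> n(1)] \<mu> in simp)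
  next
    case (T j)
    then have "?\<chi> j = \<psi> j"
      using x by simp
    then show ?thesis
      unfolding T gval.simps C \<mu> by (simp only: \<iota>.hom_smult \<iota>.hom_one HA.one_closed)
  qed
qed

lemma wval_ext:
  assumes "\<psi> \<in> chars d n" "Comp d \<xi> n \<psi> = \<mu>" "w \<in> lists (yh_gens n)"
  shows "wval (Suc n) w (\<psi>(Suc n := \<xi> a)) = \<iota> (wval n w \<psi>)"
  using assms
proof (induction w arbitrary: \<psi>)
  case Nil
  show ?case
    unfolding wval.simps Comp_ext[OF Nil(1) a] Nil(2) by (rule \<iota>.hom_one[symmetric])
next
  case (Cons x w)
  have x: "x \<in> yh_gens n" and w: "w \<in> lists (yh_gens n)"
    using Cons.prems(3) by auto
  note p = gperm_chars[OF x Cons.prems(1)]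
  have P: "Comp d \<xi> n (gperm x \<psi>) = \<mu>"
    unfolding p(2) by (rule Cons.prems(2))
  have g: "gperm x (\<psi>(Suc n := \<xi> a)) = (gperm x \<psi>)(Suc n := \<xi> a)"
    using wperm_ext[of "[x]" n \<psi> "\<xi> a"] x by simp
  have c: "gval n x \<psi> \<in> carrier (Hmu d \<mu>)" "wval n w (gperm x \<psi>) \<in> carrier (Hmu d \<mu>)"
    using gval_closed[OF x Cons.prems(1)] admD(3)[OF wval_adm[OF w] p(1)] unfolding P Cons.prems(2) by simp_all
  show ?case
    unfolding wval.simps g Comp_ext[OF Cons.prems(1) a] gval_ext[OF Cons.prems(1,2) x] Cons.IH[OF p(1) P w]
      Cons.prems(2) \<iota>.hom_mult[OF c] ..
qed

end

end

context markov_family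
begin

text \<open>Both sides are linear in \<open>y\<close>, so pure tensors suffice, and there the form
  is a product over the factors. The a-th factor is governed by \<open>markov_elt\<close>; every
  other factor is multiplied by 1.\<close>

lemma L_lift:
  assumes \<mu>: "\<mu> \<in> compositions d n" and n: "1 \<le> n" and a: "a \<in> {1..d}" and pos: "1 \<le> \<mu> a"
    and \<iota>: "\<iota> \<in> K_algebra_hom (Hmu d \<mu>) (Hmu d (\<mu>(a := Suc (\<mu> a))))"
    and \<iota>_pure: "\<And>h. h \<in> (\<Pi> i\<in>{1..d}. carrier (hecke (\<mu> i))) \<Longrightarrow> \<iota> (pure_tensor {1..d} (\<lambda>i. hecke (\<mu> i)) h)
      = pure_tensor {1..d} (\<lambda>i. hecke ((\<mu>(a := Suc (\<mu> a))) i)) (\<lambda>i. if i = a then yh_incl 1 (\<mu> a) (h i) else h i)"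
    and g: "markov_elt (\<mu> a) g"
    and y: "y \<in> carrier (Hmu d \<mu>)"
  shows "L (\<mu>(a := Suc (\<mu> a))) (\<iota> y \<otimes>\<^bsub>Hmu d (\<mu>(a := Suc (\<mu> a)))\<^esub> in_factor d (\<mu>(a := Suc (\<mu> a))) a g) = L \<mu> y"
proof -
  define \<mu>' where "\<mu>' = \<mu>(a := Suc (\<mu> a))"
  have \<mu>': "\<mu>' \<in> compositions d (Suc n)"
    unfolding \<mu>'_def by (rule compositions_Suc[OF \<mu> a])
  have \<mu>'a: "\<mu>' a = Suc (\<mu> a)" and \<mu>'_other: "\<And>i. i \<noteq> a \<Longrightarrow> \<mu>' i = \<mu> i"
    by (simp_all add: \<mu>'_def)
  have soc: "socle \<mu>' = socle \<mu>"
    unfolding socle_def \<mu>'_def using pos by auto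
  interpret F: tensor_form_alg "{1..d}" "\<lambda>a. hecke (\<mu> a)" "fam \<mu>"
    by (rule tensor_form_alg_fam[OF \<mu> n])
  interpret F': tensor_form_alg "{1..d}" "\<lambda>a. hecke (\<mu>' a)" "fam \<mu>'"
    by (rule tensor_form_alg_fam[OF \<mu>']) simp
  interpret \<iota>: K_hom "Hmu d \<mu>" "Hmu d \<mu>'" \<iota>
    unfolding \<mu>'_def by (intro K_hom.intro K_hom_axioms.intro K_alg_Hmu \<iota>)
  have gc: "g \<in> carrier (hecke (\<mu>' a))"
    using g unfolding \<mu>'a markov_elt_def by blast
  let ?g = "in_factor d \<mu>' a g"
  let ?one = "(\<lambda>b. \<one>\<^bsub>hecke (\<mu>' b)\<^esub>)(a := g)"
  have one: "?one \<in> (\<Pi> i\<in>{1..d}. carrier (hecke (\<mu>' i)))"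
    using gc by (intro Pi_I) simp
  have g': "?g \<in> carrier (Hmu d \<mu>')"
    unfolding in_factor_def Hmu_def by (rule F'.pure_closed[OF one])
  have "L \<mu>' (\<iota> y \<otimes>\<^bsub>Hmu d \<mu>'\<^esub> ?g) = L \<mu> y"
    using y unfolding Hmu_def[of d \<mu>]
  proof (induction y rule: F.TT_induct)
    case (pure h)
    have hc: "h i \<in> carrier (hecke (\<mu> i))" if "i \<in> {1..d}" for i
      by (rule Pi_mem[OF pure that])
    let ?k = "\<lambda>i. if i = a then yh_incl 1 (\<mu> a) (h i) else h i"
    interpret inc: K_hom "hecke (\<mu> a)" "hecke (Suc (\<mu> a))" "yh_incl 1 (\<mu> a)"
      by (intro K_hom.intro K_hom_axioms.intro K_alg_YH yh_incl)
    have k: "?k \<in> (\<Pi> i\<in>{1..d}. carrier (hecke (\<mu>' i)))"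
    proof (rule Pi_I)
      fix i assume i: "i \<in> {1..d}"
      show "?k i \<in> carrier (hecke (\<mu>' i))"
        using hc[OF i] inc.hom_closed[of "h i"] by (cases "i = a") (simp_all only: if_True if_False simp_thms \<mu>'a \<mu>'_other)
    qed
    have ko: "(\<lambda>i. ?k i \<otimes>\<^bsub>hecke (\<mu>' i)\<^esub> ?one i) \<in> (\<Pi> i\<in>{1..d}. carrier (hecke (\<mu>' i)))"
      by (rule Pi_I) (intro YA.m_closed Pi_mem[OF k] Pi_mem[OF one])
    have "\<iota> (F.pure h) = F'.pure ?k"
      using \<iota>_pure[OF pure] unfolding \<mu>'_def .
    then have "\<iota> (F.pure h) \<otimes>\<^bsub>Hmu d \<mu>'\<^esub> ?g = F'.pure (\<lambda>i. ?k i \<otimes>\<^bsub>hecke (\<mu>' i)\<^esub> ?one i)"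
      unfolding in_factor_def Hmu_def by (simp only: F'.pure_mult[OF k one])
    then have "L \<mu>' (\<iota> (F.pure h) \<otimes>\<^bsub>Hmu d \<mu>'\<^esub> ?g) = (\<Prod>i\<in>{1..d}. fam \<mu>' i (?k i \<otimes>\<^bsub>hecke (\<mu>' i)\<^esub> ?one i))"
      by (simp only: F'.TF_pure[OF ko])
    also have "\<dots> = (\<Prod>i\<in>{1..d}. fam \<mu> i (h i))"
    proof (rule prod.cong[OF refl])
      fix i assume i: "i \<in> {1..d}"
      show "fam \<mu>' i (?k i \<otimes>\<^bsub>hecke (\<mu>' i)\<^esub> ?one i) = fam \<mu> i (h i)"
      proof (cases "i = a")
        case True
        have "\<tau> (socle \<mu>) a (Suc (\<mu> a)) (yh_incl 1 (\<mu> a) (h a) \<otimes>\<^bsub>hecke (Suc (\<mu> a))\<^esub> g) = \<tau> (socle \<mu>) a (\<mu> a) (h a)"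
          using g fam_markov[OF \<mu> n a pos] hc[OF a] unfolding markov_elt_def by blast
        \<comment> \<open>Both sizes are positive, so \<open>with_trace0\<close> returns the given
          Markov trace in both and never the convention for size 0.\<close>
        moreover have "\<mu> a \<noteq> 0" "Suc (\<mu> a) \<noteq> 0"
          using pos by simp_all
        ultimately show ?thesis
          unfolding True soc \<mu>'a with_trace0_def by (simp only: if_False if_True simp_thms fun_upd_same)
      next
        case False
        show ?thesis
          unfolding soc \<mu>'_other[OF False] if_not_P[OF False] fun_upd_other[OF False] YA.r_one[OF hc[OF i]] ..
      qed
    qed
    also have "\<dots> = L \<mu> (F.pure h)"
      by (rule F.TF_pure[OF pure, symmetric])
    finally show ?case .
  next
    case (add x y)
    note c = add.hyps[folded Hmu_def[of d \<mu>]]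
    have "L \<mu>' (\<iota> (x \<oplus>\<^bsub>Hmu d \<mu>\<^esub> y) \<otimes>\<^bsub>Hmu d \<mu>'\<^esub> ?g) = L \<mu>' (\<iota> x \<otimes>\<^bsub>Hmu d \<mu>'\<^esub> ?g) + L \<mu>' (\<iota> y \<otimes>\<^bsub>Hmu d \<mu>'\<^esub> ?g)"
      unfolding \<iota>.hom_add[OF c] HA.l_distr[OF \<iota>.hom_closed[OF c(1)] \<iota>.hom_closed[OF c(2)] g']
      by (rule L_add[OF \<mu>' _ HA.m_closed[OF \<iota>.hom_closed[OF c(1)] g'] HA.m_closed[OF \<iota>.hom_closed[OF c(2)] g']]) simp
    then show ?case
      unfolding add.IH F.TF_add[OF add.hyps] Hmu_def[of d \<mu>] .
  next
    case (smult c x)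
    note x = smult.hyps[folded Hmu_def[of d \<mu>]]
    have "L \<mu>' (\<iota> (c \<odot>\<^bsub>Hmu d \<mu>\<^esub> x) \<otimes>\<^bsub>Hmu d \<mu>'\<^esub> ?g) = c * L \<mu>' (\<iota> x \<otimes>\<^bsub>Hmu d \<mu>'\<^esub> ?g)"
      unfolding \<iota>.hom_smult[OF x] HA.smult_mult_l[OF \<iota>.hom_closed[OF x] g']
      by (rule L_smult[OF \<mu>' _ HA.m_closed[OF \<iota>.hom_closed[OF x] g']]) simp
    then show ?case
      unfolding smult.IH F.TF_smult[OF smult.hyps] Hmu_def[of d \<mu>] .
  qed
  then show ?thesis
    unfolding \<mu>'_def .
qed

text \<open>Treats g_n and its inverse together: all that enters is that the matrix of
  \<open>y\<close> permutes the characters by s_n and that its entries in the rows with equal last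
  two values come from a \<open>markov_elt\<close>.\<close>

lemma markov_step:
  assumes n: "1 \<le> n" and x: "x \<in> carrier (YH d n)" and y: "y \<in> carrier (YH d (Suc n))"
    and Psi_y: "Psi d \<xi> (Suc n) y = mono_mat (Suc n) (gperm (G n)) k" and k: "adm (Suc n) (gperm (G n)) k"
    and val: "\<And>\<psi> a. \<psi> \<in> chars d n \<Longrightarrow> a \<in> {1..d} \<Longrightarrow> \<psi> n = \<xi> a \<Longrightarrow> \<exists>g. markov_elt (Comp d \<xi> n \<psi> a) g \<and>
      k (\<psi>(Suc n := \<xi> a)) = in_factor d ((Comp d \<xi> n \<psi>)(a := Suc (Comp d \<xi> n \<psi> a))) a g"
  shows "combined_trace d \<xi> \<tau> (Suc n) (yh_incl d n x \<otimes>\<^bsub>YH d (Suc n)\<^esub> y) = combined_trace d \<xi> \<tau> n x"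
proof -
  interpret inc: K_hom "YH d n" "YH d (Suc n)" "yh_incl d n"
    by (intro K_hom.intro K_hom_axioms.intro K_alg_YH yh_incl)
  interpret P: K_hom "YH d (Suc n)" "Mats d \<xi> (Suc n)" "Psi d \<xi> (Suc n)"
    by (rule Psi_hom)
  have lin: "K_linear (YH d n) (combined_trace d \<xi> \<tau> n)" "K_linear (YH d (Suc n)) (combined_trace d \<xi> \<tau> (Suc n))"
    using n by (intro combined_linear; simp)+
  from x show ?thesis
  proof (induction x rule: YH_induct)
    case (word w)
    note w' = lists_gens_mono[OF word]
    let ?\<sigma> = "\<lambda>\<chi>. gperm (G n) (wperm w \<chi>)"
    let ?h = "\<lambda>\<chi>. wval (Suc n) w \<chi> \<otimes>\<^bsub>Hc (Suc n) \<chi>\<^esub> k (wperm w \<chi>)"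
    let ?e = "\<lambda>\<psi>. \<psi>(Suc n := \<psi> n)"
    note aw = wval_adm[OF w']
    have a: "adm (Suc n) ?\<sigma> ?h"
      unfolding adm_def
    proof (intro ballI conjI)
      fix \<chi> assume \<chi>: "\<chi> \<in> chars d (Suc n)"
      note 1 = admD[OF aw \<chi>]
      note 2 = admD[OF k 1(1)]
      show "?\<sigma> \<chi> \<in> chars d (Suc n)" "Comp d \<xi> (Suc n) (?\<sigma> \<chi>) = Comp d \<xi> (Suc n) \<chi>"
        using 1 2 by simp_all
      show "?h \<chi> \<in> carrier (Hc (Suc n) \<chi>)"
        by (rule HA.m_closed[OF 1(3) 2(3)[unfolded 1(2)]])
    qed
    have ext_root: "\<exists>a\<in>{1..d}. \<psi> n = \<xi> a" if "\<psi> \<in> chars d n" for \<psi>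
      using \<xi>_col[OF that, of n] col_range[OF that, of n] n by (intro bexI[of _ "col \<psi> n"]) simp_all
    \<comment> \<open>The word does not move position n+1. So if the word followed by s_n fixes
      \<chi>, comparing values at n gives \<chi>(n) = \<chi>(n+1); then s_n fixes \<chi>, and the
      word has to fix it as well.\<close>
    have fixed: "?\<sigma> \<chi> = \<chi> \<longleftrightarrow> \<chi> n = \<chi> (Suc n) \<and> wperm w \<chi> = \<chi>" for \<chi>
    proof
      have last: "wperm w \<chi> (Suc n) = \<chi> (Suc n)"
        using wperm_ext[OF word, of \<chi> "\<chi> (Suc n)"] by (metis fun_upd_same fun_upd_triv)
      assume *: "?\<sigma> \<chi> = \<chi>"
      have "?\<sigma> \<chi> n = wperm w \<chi> (Suc n)"
        by simp
      then have e: "\<chi> n = \<chi> (Suc n)"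
        unfolding * last .
      have "wperm w \<chi> = ?\<sigma> \<chi> \<circ> sw n"
        unfolding gperm.simps comp_sw_sw ..
      also have "\<dots> = \<chi>"
        unfolding * by (rule sw_fixed[OF e])
      finally show "\<chi> n = \<chi> (Suc n) \<and> wperm w \<chi> = \<chi>"
        using e by blast
    next
      assume "\<chi> n = \<chi> (Suc n) \<and> wperm w \<chi> = \<chi>"
      then show "?\<sigma> \<chi> = \<chi>"
        using sw_fixed[of \<chi> n] by (simp only: gperm.simps simp_thms)
    qed
    have "combined_trace d \<xi> \<tau> (Suc n) (yh_incl d n (yh_word d n w) \<otimes>\<^bsub>YH d (Suc n)\<^esub> y)
      = form (Suc n) (mono_mat (Suc n) ?\<sigma> ?h)"
      unfolding combined_form yh_incl(2)[OF word] P.hom_mult[OF yh_word_closed[OF w'] y] Psi_word(2)[OF w'] Psi_y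
        mono_mat_mult[OF aw k] ..
    also have "\<dots> = (\<Sum>\<chi>\<in>chars d (Suc n). if ?\<sigma> \<chi> = \<chi> then L (Comp d \<xi> (Suc n) \<chi>) (?h \<chi>) else 0)"
      by (rule form_mono_mat[OF _ a]) simp
    also have "\<dots> = (\<Sum>\<chi>\<in>{\<chi>\<in>chars d (Suc n). \<chi> n = \<chi> (Suc n)}. if wperm w \<chi> = \<chi> then L (Comp d \<xi> (Suc n) \<chi>) (?h \<chi>) else 0)"
      unfolding fixed by (rule sum.mono_neutral_cong_right) (auto simp: finite_chars)
    also have "\<dots> = (\<Sum>\<psi>\<in>chars d n. if wperm w \<psi> = \<psi> then L (Comp d \<xi> n \<psi>) (wval n w \<psi>) else 0)"
    \<comment> \<open>A character for n strands is extended by repeating its last value; the way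
      back resets the value at n+1 to \<open>undefined\<close>, which an extensional function has
      there.\<close>
    proof (rule sum.reindex_bij_witness[of _ ?e "\<lambda>\<chi>. \<chi>(Suc n := undefined)"])
      fix \<psi> assume \<psi>: "\<psi> \<in> chars d n"
      have u: "\<psi> (Suc n) = undefined"
        using PiE_arb[OF \<psi>[unfolded chars_def], of "Suc n"] by simp
      show "(?e \<psi>)(Suc n := undefined) = \<psi>"
        using u by (simp add: fun_upd_idem)
      obtain a where "a \<in> {1..d}" "\<psi> n = \<xi> a"
        using ext_root[OF \<psi>] by blast
      then show "?e \<psi> \<in> {\<chi>\<in>chars d (Suc n). \<chi> n = \<chi> (Suc n)}"
        using chars_ext[OF \<psi>] n by simp
    next
      fix \<chi> assume "\<chi> \<in> {\<chi>\<in>chars d (Suc n). \<chi> n = \<chi> (Suc n)}"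
      then have \<chi>: "\<chi> \<in> chars d (Suc n)" and e: "\<chi> n = \<chi> (Suc n)"
        by simp_all
      let ?\<psi> = "\<chi>(Suc n := undefined)"
      show ch: "?\<psi> \<in> chars d n"
        by (rule chars_restrict[OF \<chi>])
      show e\<psi>: "?e ?\<psi> = \<chi>"
        using e by (simp add: fun_upd_idem)
      obtain a where a: "a \<in> {1..d}" "?\<psi> n = \<xi> a"
        using ext_root[OF ch] by blast
      have \<chi>_ext: "\<chi> = ?\<psi>(Suc n := \<xi> a)"
        using e\<psi> unfolding a(2) by (rule sym)
      have wc: "wperm w ?\<psi> \<in> chars d n"
        by (rule admD(1)[OF wval_adm[OF word] ch])
      \<comment> \<open>The word commutes with the extension. Conversely the extension can be
        undone, because both characters for n strands are \<open>undefined\<close> at n+1.\<close>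
      have w_iff: "wperm w \<chi> = \<chi> \<longleftrightarrow> wperm w ?\<psi> = ?\<psi>"
      proof
        assume "wperm w \<chi> = \<chi>"
        then have "(wperm w ?\<psi>)(Suc n := \<xi> a) = ?\<psi>(Suc n := \<xi> a)"
          using wperm_ext[OF word, of ?\<psi> "\<xi> a"] unfolding \<chi>_ext[symmetric] by simp
        then have "(wperm w ?\<psi>)(Suc n := undefined) = ?\<psi>(Suc n := undefined)"
          by (metis fun_upd_upd)
        moreover have "wperm w ?\<psi> (Suc n) = undefined"
          using PiE_arb[OF wc[unfolded chars_def], of "Suc n"] by simp
        ultimately show "wperm w ?\<psi> = ?\<psi>"
          by (metis fun_upd_triv fun_upd_upd)
      next
        assume "wperm w ?\<psi> = ?\<psi>"
        with wperm_ext[OF word, of ?\<psi> "\<xi> a"] have "wperm w (?\<psi>(Suc n := \<xi> a)) = ?\<psi>(Suc n := \<xi> a)"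
          by (simp only:)
        then show "wperm w \<chi> = \<chi>"
          unfolding \<chi>_ext[symmetric] .
      qed
      let ?\<mu> = "Comp d \<xi> n ?\<psi>"
      let ?\<mu>' = "?\<mu>(a := Suc (?\<mu> a))"
      obtain g where g: "markov_elt (?\<mu> a) g" "k \<chi> = in_factor d ?\<mu>' a g"
        using val[OF ch a] unfolding \<chi>_ext[symmetric] by blast
      have nn: "n \<in> {1..n}"
        using n by simp
      have "col ?\<psi> n = a"
        unfolding colour_def a(2) by (rule inv_\<xi>[OF a(1)])
      \<comment> \<open>Position n itself has colour a. Hence the new strand joins a part that is
        already positive.\<close>
      then have pos: "1 \<le> ?\<mu> a"
        using rank_col_le[OF ch nn] by simp
      obtain \<iota> where \<iota>: "\<iota> \<in> K_algebra_hom (Hmu d ?\<mu>) (Hmu d ?\<mu>')"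
        "\<And>b x. b \<in> {1..d} \<Longrightarrow> x \<in> yh_gens (?\<mu> b) \<Longrightarrow> \<iota> (hg d ?\<mu> b x) = hg d ?\<mu>' b x"
        "\<And>h. h \<in> (\<Pi> i\<in>{1..d}. carrier (hecke (?\<mu> i))) \<Longrightarrow> \<iota> (pure_tensor {1..d} (\<lambda>i. hecke (?\<mu> i)) h)
          = pure_tensor {1..d} (\<lambda>i. hecke (?\<mu>' i)) (\<lambda>i. if i = a then yh_incl 1 (?\<mu> a) (h i) else h i)"
        using lift_exists[OF a(1), of ?\<mu>] by blast
      have C: "Comp d \<xi> (Suc n) \<chi> = ?\<mu>'"
        using Comp_ext[OF ch a(1)] unfolding \<chi>_ext[symmetric] .
      have wv: "wval (Suc n) w \<chi> = \<iota> (wval n w ?\<psi>)"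
        using wval_ext[OF a(1) \<iota>(1,2) ch refl word] unfolding \<chi>_ext[symmetric] .
      have "L ?\<mu>' (\<iota> (wval n w ?\<psi>) \<otimes>\<^bsub>Hmu d ?\<mu>'\<^esub> in_factor d ?\<mu>' a g) = L ?\<mu> (wval n w ?\<psi>)"
        by (rule L_lift[OF Comp_composition[OF ch] n a(1) pos \<iota>(1,3) g(1) admD(3)[OF wval_adm[OF word] ch]])
      then have "L (Comp d \<xi> (Suc n) \<chi>) (?h \<chi>) = L ?\<mu> (wval n w ?\<psi>)" if "wperm w \<chi> = \<chi>"
        unfolding that C wv g(2) .
      then show "(if wperm w ?\<psi> = ?\<psi> then L ?\<mu> (wval n w ?\<psi>) else 0)
        = (if wperm w \<chi> = \<chi> then L (Comp d \<xi> (Suc n) \<chi>) (?h \<chi>) else 0)"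
        unfolding w_iff[symmetric] by (cases "wperm w \<chi> = \<chi>") (simp_all only: if_True if_False simp_thms)
    qed
    also have "\<dots> = form n (mono_mat n (wperm w) (wval n w))"
      by (rule form_mono_mat[OF n wval_adm[OF word], symmetric])
    also have "\<dots> = combined_trace d \<xi> \<tau> n (yh_word d n w)"
      unfolding combined_form Psi_word(2)[OF word] ..
    finally show ?case .
  next
    case (add x x')
    then show ?case
      using lin y unfolding K_linear_def by (simp add: YA.l_distr)
  next
    case (smult c x)
    then show ?case
      using lin y unfolding K_linear_def by (simp add: YA.smult_mult_l)
  qed
qed

text \<open>Position n is the last of its colour among the first n, so its rank is the full part a
  of the old composition. In the factor with one more strand this is the index of the last
  generator.\<close>

lemma Gval_last:
  assumes \<psi>: "\<psi> \<in> chars d n" and a: "a \<in> {1..d}" "\<psi> n = \<xi> a" and n: "1 \<le> n"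
  shows "Gval (Suc n) (\<psi>(Suc n := \<xi> a)) n
    = in_factor d ((Comp d \<xi> n \<psi>)(a := Suc (Comp d \<xi> n \<psi> a))) a (yh_g 1 (Suc (Comp d \<xi> n \<psi> a)) (Comp d \<xi> n \<psi> a))"
proof -
  have nn: "n \<in> {1..n}"
    using n by simp
  have c: "col \<psi> n = a"
    unfolding colour_def a(2) by (rule inv_\<xi>[OF a(1)])
  have "rank (col \<psi>) n = Comp d \<xi> n \<psi> a"
    using Comp_col[OF \<psi> nn] unfolding rank_def c by simp
  then show ?thesis
    unfolding Gval_def Comp_ext[OF \<psi> a(1)] col_ext[OF a(1)] rank_ext[OF nn] hg_def yh_g_def using c by simp
qed

text \<open>The entries of the inverse of the matrix of g_n. As s_n is an involution, the inverse
  permutes the rows in the same way; where the last two values differ, the entry u is replaced by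
  u^-1.\<close>

definition ival :: "nat \<Rightarrow> (nat \<Rightarrow> complex) \<Rightarrow> hmu" where
  "ival n \<chi> = (if \<chi> n = \<chi> (Suc n) then inv\<^bsub>Hc (Suc n) \<chi>\<^esub> Gval (Suc n) \<chi> n
     else u_pow (-1) \<odot>\<^bsub>Hc (Suc n) \<chi>\<^esub> \<one>\<^bsub>Hc (Suc n) \<chi>\<^esub>)"

lemma Gval_Units:
  assumes \<chi>: "\<chi> \<in> chars d (Suc n)" and n: "1 \<le> n" and e: "\<chi> n = \<chi> (Suc n)"
  shows "Gval (Suc n) \<chi> n \<in> Units (Hc (Suc n) \<chi>)"
proof -
  let ?\<mu> = "Comp d \<xi> (Suc n) \<chi>"
  have nn: "n \<in> {1..<Suc n}" "n \<in> {1..Suc n}"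
    using n by simp_all
  interpret H: K_hom "hecke (?\<mu> (col \<chi> n))" "Hmu d ?\<mu>" "in_factor d ?\<mu> (col \<chi> n)"
    by (rule K_hom_in_factor[OF col_range[OF \<chi> nn(2)]])
  show ?thesis
    unfolding Gval_def hg_def yh_g_def[symmetric]
    by (rule H.hom_Units[OF G_Units[OF order_refl rank_col_less[OF \<chi> nn(1) e]]])
qed

lemma Psi_g:
  assumes n: "1 \<le> n"
  shows "Psi d \<xi> (Suc n) (yh_g d (Suc n) n) = mono_mat (Suc n) (gperm (G n)) (gval (Suc n) (G n))"
    and "Psi d \<xi> (Suc n) (inv\<^bsub>YH d (Suc n)\<^esub> yh_g d (Suc n) n) = mono_mat (Suc n) (gperm (G n)) (ival n)"
    and "adm (Suc n) (gperm (G n)) (ival n)"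
proof -
  interpret F: Phi_hom d \<xi> "Suc n" "Psi d \<xi> (Suc n)"
    by (intro Phi_hom.intro Phi_hom_axioms.intro roots_axioms Psi_hom Psi_word(2))
  have nn: "n \<in> {1..<Suc n}"
    using n by simp
  have x: "G n \<in> yh_gens (Suc n)"
    using n by simp
  let ?M = "Mats d \<xi> (Suc n)"
  show g: "Psi d \<xi> (Suc n) (yh_g d (Suc n) n) = mono_mat (Suc n) (gperm (G n)) (gval (Suc n) (G n))"
    unfolding yh_g_def by (rule F.f_gen[OF x])
  note a1 = gval_adm[OF x]
  show a2: "adm (Suc n) (gperm (G n)) (ival n)"
    unfolding adm_def
  proof (intro ballI conjI)
    fix \<chi> assume \<chi>: "\<chi> \<in> chars d (Suc n)"
    show "gperm (G n) \<chi> \<in> chars d (Suc n)" "Comp d \<xi> (Suc n) (gperm (G n) \<chi>) = Comp d \<xi> (Suc n) \<chi>"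
      by (rule admD[OF a1 \<chi>])+
    show "ival n \<chi> \<in> carrier (Hc (Suc n) \<chi>)"
      unfolding ival_def using HA.Units_inv_closed[OF Gval_Units[OF \<chi> n]] by simp
  qed
  have u: "(u_pow i \<odot>\<^bsub>Hc m \<chi>\<^esub> \<one>\<^bsub>Hc m \<chi>\<^esub>) \<otimes>\<^bsub>Hc m \<chi>\<^esub> (u_pow (- i) \<odot>\<^bsub>Hc m \<chi>\<^esub> \<one>\<^bsub>Hc m \<chi>\<^esub>) = \<one>\<^bsub>Hc m \<chi>\<^esub>" for i m \<chi>
    by (simp add: HA.scalar_mult HA.smult_smult u_pow_add)
  have C: "Comp d \<xi> (Suc n) (gperm (G n) \<chi>) = Comp d \<xi> (Suc n) \<chi>" if "\<chi> \<in> chars d (Suc n)" for \<chi>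
    by (rule admD(2)[OF a1 that])
  have 1: "mono_mat (Suc n) (gperm (G n)) (gval (Suc n) (G n)) \<otimes>\<^bsub>?M\<^esub> mono_mat (Suc n) (gperm (G n)) (ival n) = \<one>\<^bsub>?M\<^esub>"
    unfolding mono_mat_mult[OF a1 a2] mono_mat_one[symmetric]
  proof (rule mono_mat_cong, rule disjI1, rule conjI)
    fix \<chi> assume \<chi>: "\<chi> \<in> chars d (Suc n)"
    show "gperm (G n) (gperm (G n) \<chi>) = \<chi>"
      unfolding gperm.simps by (rule comp_sw_sw)
    show "gval (Suc n) (G n) \<chi> \<otimes>\<^bsub>Hc (Suc n) \<chi>\<^esub> ival n (gperm (G n) \<chi>) = \<one>\<^bsub>Hc (Suc n) \<chi>\<^esub>"
    proof (cases "\<chi> n = \<chi> (Suc n)")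
      case True
      have "gperm (G n) \<chi> = \<chi>"
        unfolding gperm.simps by (rule sw_fixed[OF True])
      then show ?thesis
        using HA.Units_r_inv[OF Gval_Units[OF \<chi> n True]] True by (simp add: ival_def)
    next
      case False
      then have "gperm (G n) \<chi> n \<noteq> gperm (G n) \<chi> (Suc n)"
        by simp
      then show ?thesis
        unfolding ival_def C[OF \<chi>] gval.simps if_not_P[OF False] using u[of "Suc n" \<chi> 1] by (simp only: if_False simp_thms)
    qed
  qed
  have 2: "mono_mat (Suc n) (gperm (G n)) (ival n) \<otimes>\<^bsub>?M\<^esub> mono_mat (Suc n) (gperm (G n)) (gval (Suc n) (G n)) = \<one>\<^bsub>?M\<^esub>"
    unfolding mono_mat_mult[OF a2 a1] mono_mat_one[symmetric]
  proof (rule mono_mat_cong, rule disjI1, rule conjI)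
    fix \<chi> assume \<chi>: "\<chi> \<in> chars d (Suc n)"
    show "gperm (G n) (gperm (G n) \<chi>) = \<chi>"
      unfolding gperm.simps by (rule comp_sw_sw)
    show "ival n \<chi> \<otimes>\<^bsub>Hc (Suc n) \<chi>\<^esub> gval (Suc n) (G n) (gperm (G n) \<chi>) = \<one>\<^bsub>Hc (Suc n) \<chi>\<^esub>"
    proof (cases "\<chi> n = \<chi> (Suc n)")
      case True
      have "gperm (G n) \<chi> = \<chi>"
        unfolding gperm.simps by (rule sw_fixed[OF True])
      then show ?thesis
        using HA.Units_l_inv[OF Gval_Units[OF \<chi> n True]] True by (simp add: ival_def)
    next
      case False
      then have "gperm (G n) \<chi> n \<noteq> gperm (G n) \<chi> (Suc n)"
        by simp
      then show ?thesis
        unfolding ival_def gval.simps(1) C[OF \<chi>] if_not_P[OF False] using u[of "Suc n" \<chi> "-1"]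
        by (simp only: if_False simp_thms minus_minus)
    qed
  qed
  have "Psi d \<xi> (Suc n) (inv\<^bsub>YH d (Suc n)\<^esub> yh_g d (Suc n) n) = inv\<^bsub>?M\<^esub> mono_mat (Suc n) (gperm (G n)) (gval (Suc n) (G n))"
    unfolding g[symmetric] by (rule F.hom_inv[OF G_Units[OF d nn]])
  also have "\<dots> = mono_mat (Suc n) (gperm (G n)) (ival n)"
    by (rule F.B.inv_char[OF mono_mat_closed[OF a1] mono_mat_closed[OF a2] 1 2])
  finally show "Psi d \<xi> (Suc n) (inv\<^bsub>YH d (Suc n)\<^esub> yh_g d (Suc n) n) = mono_mat (Suc n) (gperm (G n)) (ival n)" .
qed

lemma combined_markov:
  assumes n: "1 \<le> n" and x: "x \<in> carrier (YH d n)"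
  shows "combined_trace d \<xi> \<tau> (Suc n) (yh_incl d n x \<otimes>\<^bsub>YH d (Suc n)\<^esub> yh_g d (Suc n) n) = combined_trace d \<xi> \<tau> n x"
    and "combined_trace d \<xi> \<tau> (Suc n) (yh_incl d n x \<otimes>\<^bsub>YH d (Suc n)\<^esub> inv\<^bsub>YH d (Suc n)\<^esub> yh_g d (Suc n) n)
      = combined_trace d \<xi> \<tau> n x"
proof -
  have nn: "n \<in> {1..<Suc n}"
    using n by simp
  have pos: "1 \<le> Comp d \<xi> n \<psi> a" if \<psi>: "\<psi> \<in> chars d n" and a: "a \<in> {1..d}" "\<psi> n = \<xi> a" for \<psi> a
  proof -
    have "col \<psi> n = a"
      unfolding colour_def a(2) by (rule inv_\<xi>[OF a(1)])
    then show ?thesis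
      using rank_col_le[OF \<psi>, of n] n by simp
  qed
  have e: "(\<psi>(Suc n := \<xi> a)) n = (\<psi>(Suc n := \<xi> a)) (Suc n)" if "\<psi> n = \<xi> a" for \<psi> :: "nat \<Rightarrow> complex" and a
    using that by simp
  show "combined_trace d \<xi> \<tau> (Suc n) (yh_incl d n x \<otimes>\<^bsub>YH d (Suc n)\<^esub> yh_g d (Suc n) n) = combined_trace d \<xi> \<tau> n x"
  proof (rule markov_step[OF n x g_closed[OF nn] Psi_g(1)[OF n]])
    show "adm (Suc n) (gperm (G n)) (gval (Suc n) (G n))"
      by (rule gval_adm) (use n in simp)
    fix \<psi> a assume \<psi>: "\<psi> \<in> chars d n" "a \<in> {1..d}" "\<psi> n = \<xi> a"
    show "\<exists>g. markov_elt (Comp d \<xi> n \<psi> a) g \<and>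
      gval (Suc n) (G n) (\<psi>(Suc n := \<xi> a)) = in_factor d ((Comp d \<xi> n \<psi>)(a := Suc (Comp d \<xi> n \<psi> a))) a g"
      unfolding gval.simps if_P[OF e[where \<psi> = \<psi> and a = a, OF \<psi>(3)]] Gval_last[OF \<psi> n]
      using markov_elt_g(1)[OF pos[OF \<psi>]] by blast
  qed
  show "combined_trace d \<xi> \<tau> (Suc n) (yh_incl d n x \<otimes>\<^bsub>YH d (Suc n)\<^esub> inv\<^bsub>YH d (Suc n)\<^esub> yh_g d (Suc n) n) = combined_trace d \<xi> \<tau> n x"
  proof (rule markov_step[OF n x YA.Units_inv_closed[OF G_Units[OF d nn]] Psi_g(2,3)[OF n]])
    fix \<psi> a assume \<psi>: "\<psi> \<in> chars d n" "a \<in> {1..d}" "\<psi> n = \<xi> a"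
    let ?\<mu> = "Comp d \<xi> n \<psi>"
    let ?\<mu>' = "?\<mu>(a := Suc (?\<mu> a))"
    interpret H: K_hom "hecke (?\<mu>' a)" "Hmu d ?\<mu>'" "in_factor d ?\<mu>' a"
      by (rule K_hom_in_factor[OF \<psi>(2)])
    have "yh_g 1 (Suc (?\<mu> a)) (?\<mu> a) \<in> Units (hecke (Suc (?\<mu> a)))"
      by (rule G_Units) (use pos[OF \<psi>] in simp_all)
    then have i: "inv\<^bsub>Hmu d ?\<mu>'\<^esub> in_factor d ?\<mu>' a (yh_g 1 (Suc (?\<mu> a)) (?\<mu> a))
      = in_factor d ?\<mu>' a (inv\<^bsub>hecke (Suc (?\<mu> a))\<^esub> yh_g 1 (Suc (?\<mu> a)) (?\<mu> a))"
      using H.hom_inv[of "yh_g 1 (Suc (?\<mu> a)) (?\<mu> a)"] by simp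
    show "\<exists>g. markov_elt (?\<mu> a) g \<and> ival n (\<psi>(Suc n := \<xi> a)) = in_factor d ?\<mu>' a g"
      unfolding ival_def if_P[OF e[where \<psi> = \<psi> and a = a, OF \<psi>(3)]] Gval_last[OF \<psi> n] Comp_ext[OF \<psi>(1,2)] i
      using markov_elt_g(2)[OF pos[OF \<psi>]] by blast
  qed
qed

end

theorem theorem4p1:
  fixes d :: nat
    and \<xi> :: "nat \<Rightarrow> complex"
    and \<tau> :: "(nat \<Rightarrow> nat) \<Rightarrow> nat \<Rightarrow> nat \<Rightarrow> yh \<Rightarrow> laurent"
  assumes "d \<ge> 1"
    and "bij_betw \<xi> {1..d} {z. z ^ d = 1}"
    and "\<And>m a. m \<in> Soc d \<Longrightarrow> a \<in> {1..d} \<Longrightarrow> m a \<noteq> 0 \<Longrightarrow> markov_trace 1 (\<tau> m a)"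
  shows "markov_trace d (combined_trace d \<xi> \<tau>)"
proof -
  interpret markov_family d \<xi> \<tau>
    by (intro markov_family.intro markov_family_axioms.intro roots.intro assms)
  show ?thesis
    unfolding markov_trace_def using combined_linear combined_commute combined_markov by blast
qed

end
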